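(* Let $k\geq 3$ and $d\geq 3$. Every $(k+d-1,7^k,d)_7$ code and every $(k+d-1,5^k,d)_5$ code is equivalent to a linear code.
   Context: An $(n,M,d)_q$ code is a subset of $\mathcal{A}^n$, where $\mathcal{A}$ is an alphabet of size $q$ (here identified with the field $\mathbb{F}_q$), having $M$ elements and minimum Hamming distance $d$. Two codes of length $n$ are equivalent if one can be obtained from the other by a permutation of the coordinates followed by a permutation of the symbols in each coordinate separately (possibly different permutations in different coordinates). A code is linear if it is an $\mathbb{F}_q$-linear subspace of $\mathbb{F}_q^n$. *)

theory Defs
  imports Main
begin

definition hamming :: "'a list \<Rightarrow> 'a list \<Rightarrow> nat" where
  "hamming x y = card {i. i < length x \<and> x ! i \<noteq> y ! i}"

definition min_dist :: "'a list set \<Rightarrow> nat" where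
  "min_dist C = Min {hamming x y | x y. x \<in> C \<and> y \<in> C \<and> x \<noteq> y}"

definition is_code :: "nat \<Rightarrow> nat \<Rightarrow> nat \<Rightarrow> 'a list set \<Rightarrow> bool" where
  "is_code n M d C \<longleftrightarrow> C \<subseteq> {w. length w = n} \<and> card C = M \<and> min_dist C = d"

definition code_equiv :: "nat \<Rightarrow> 'a list set \<Rightarrow> 'a list set \<Rightarrow> bool" where
  "code_equiv n C D \<longleftrightarrow>
     (\<exists>\<sigma> \<pi>. bij_betw \<sigma> {..<n} {..<n} \<and> (\<forall>i<n. bij (\<pi> i)) \<and>
        D = (\<lambda>w. map (\<lambda>i. \<pi> i (w ! \<sigma> i)) [0..<n]) ` C)"

definition linear_code :: "nat \<Rightarrow> 'a::field list set \<Rightarrow> bool" where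
  "linear_code n L \<longleftrightarrow> L \<subseteq> {w. length w = n} \<and> replicate n 0 \<in> L \<and>
     (\<forall>x\<in>L. \<forall>y\<in>L. map2 (+) x y \<in> L) \<and>
     (\<forall>c. \<forall>x\<in>L. map ((*) c) x \<in> L)"

end

(* Fixing all but three information symbols and two check symbols of an MDS code leaves a code of
   dimension 3 and distance 3, so the core is k = d = 3. There a plane (one symbol fixed) is a pair of
   orthogonal Latin squares. For seven symbols a parity count shows that some pair of lines of a plane
   has even relative position; starting from such a pair, all planes are found to be of seven types.
   Two planes crossing in a line restrict each other so much that three parallel lines of a plane of
   one of the five nonlinear types cannot all be extended. Linear planes are described by a cross
   ratio, and they fit together only linearly. Finally, in a longer code the change of one symbol
   acts on each check symbol independently of the other symbols, up to labels. *)
theory Submission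
  imports Defs "HOL-Combinatorics.Permutations"
begin

text \<open>The obstacle is that planes over seven symbols need not be linear (over five symbols
  they are), so linearity can only come from the way planes cross. Two planes that share a line have
  no other word in common. Once the remaining coordinates are labelled along that line, this says
  that two idempotent Latin squares agree on the diagonal only, and for well-chosen squares very few
  relabellings, often none, allow it. The elimination of types runs in three stages, because every
  excluded type shortens the list of squares that a crossing plane can carry. The two linear types
  belong to the two orbits of cross ratios over seven elements: the harmonic values 2, 4, 6 and the
  roots 3, 5 of k^2 - k + 1. A plane of the first kind forces all labels of its crossing planes to
  be linear; planes of the second kind do not, but then the planes of three directions cannot all be
  of that kind. The passage to longer codes uses that the field is prime, so that additive maps are
  multiplications by constants.\<close>

section \<open>Planes and codes with k = d = 3 as relations\<close>

definition net4_ex :: "('a \<Rightarrow> 'a \<Rightarrow> 'a \<Rightarrow> 'a \<Rightarrow> bool) \<Rightarrow> bool" where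
  "net4_ex N \<longleftrightarrow>
    (\<forall>a b. \<exists>c d. N a b c d) \<and> (\<forall>a b. \<exists>c d. N a c b d) \<and> (\<forall>a b. \<exists>c d. N a c d b) \<and>
    (\<forall>a b. \<exists>c d. N c a b d) \<and> (\<forall>a b. \<exists>c d. N c a d b) \<and> (\<forall>a b. \<exists>c d. N c d a b)"

definition net4_eq :: "('a \<Rightarrow> 'a \<Rightarrow> 'a \<Rightarrow> 'a \<Rightarrow> bool) \<Rightarrow> bool" where
  "net4_eq N \<longleftrightarrow> (\<forall>a b c d a' b' c' d'. N a b c d \<longrightarrow> N a' b' c' d' \<longrightarrow>
      a = a' \<and> b = b' \<or> a = a' \<and> c = c' \<or> a = a' \<and> d = d' \<or>
      b = b' \<and> c = c' \<or> b = b' \<and> d = d' \<or> c = c' \<and> d = d' \<longrightarrow>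
      a = a' \<and> b = b' \<and> c = c' \<and> d = d')"

text \<open>A pair of orthogonal Latin squares, kept as the relation of being a word and not as two
  functions: all four coordinates stay on an equal footing, and a transposition of coordinates is a
  reordering of bound variables.\<close>

definition net4 :: "('a \<Rightarrow> 'a \<Rightarrow> 'a \<Rightarrow> 'a \<Rightarrow> bool) \<Rightarrow> bool" where
  "net4 N \<longleftrightarrow> net4_ex N \<and> net4_eq N"

definition mds5_ex :: "('a \<Rightarrow> 'a \<Rightarrow> 'a \<Rightarrow> 'a \<Rightarrow> 'a \<Rightarrow> bool) \<Rightarrow> bool" where
  "mds5_ex R \<longleftrightarrow>
    (\<forall>a b c. \<exists>d e. R a b c d e) \<and> (\<forall>a b c. \<exists>d e. R a b d c e) \<and> (\<forall>a b c. \<exists>d e. R a b d e c) \<and>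
    (\<forall>a b c. \<exists>d e. R a d b c e) \<and> (\<forall>a b c. \<exists>d e. R a d b e c) \<and> (\<forall>a b c. \<exists>d e. R a d e b c) \<and>
    (\<forall>a b c. \<exists>d e. R d a b c e) \<and> (\<forall>a b c. \<exists>d e. R d a b e c) \<and> (\<forall>a b c. \<exists>d e. R d a e b c) \<and>
    (\<forall>a b c. \<exists>d e. R d e a b c)"

definition mds5_eq :: "('a \<Rightarrow> 'a \<Rightarrow> 'a \<Rightarrow> 'a \<Rightarrow> 'a \<Rightarrow> bool) \<Rightarrow> bool" where
  "mds5_eq R \<longleftrightarrow> (\<forall>a b c d e a' b' c' d' e'. R a b c d e \<longrightarrow> R a' b' c' d' e' \<longrightarrow>
      a = a' \<and> b = b' \<and> c = c' \<or> a = a' \<and> b = b' \<and> d = d' \<or> a = a' \<and> b = b' \<and> e = e' \<or>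
      a = a' \<and> c = c' \<and> d = d' \<or> a = a' \<and> c = c' \<and> e = e' \<or> a = a' \<and> d = d' \<and> e = e' \<or>
      b = b' \<and> c = c' \<and> d = d' \<or> b = b' \<and> c = c' \<and> e = e' \<or> b = b' \<and> d = d' \<and> e = e' \<or>
      c = c' \<and> d = d' \<and> e = e' \<longrightarrow>
      a = a' \<and> b = b' \<and> c = c' \<and> d = d' \<and> e = e')"

text \<open>The code with k = d = 3: three coordinates can be prescribed freely and determine the
  word. Fixing one coordinate leaves a plane.\<close>

definition mds5 :: "('a \<Rightarrow> 'a \<Rightarrow> 'a \<Rightarrow> 'a \<Rightarrow> 'a \<Rightarrow> bool) \<Rightarrow> bool" where
  "mds5 R \<longleftrightarrow> mds5_ex R \<and> mds5_eq R"

lemma net4_ex: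
  assumes "net4 N"
  shows "\<exists>c d. N a b c d" and "\<exists>c d. N a c b d" and "\<exists>c d. N a c d b" and "\<exists>c d. N c a b d"
    and "\<exists>c d. N c a d b" and "\<exists>c d. N c d a b"
  using assms by (simp_all add: net4_def net4_ex_def)

lemma net4_eq:
  assumes "net4 N" "N a b c d" "N a' b' c' d'"
    and "a = a' \<and> b = b' \<or> a = a' \<and> c = c' \<or> a = a' \<and> d = d' \<or>
      b = b' \<and> c = c' \<or> b = b' \<and> d = d' \<or> c = c' \<and> d = d'"
  shows "a = a' \<and> b = b' \<and> c = c' \<and> d = d'"
proof -
  have "net4_eq N" using assms(1) by (simp add: net4_def)
  from this[unfolded net4_eq_def, rule_format, OF assms(2-4)] show ?thesis .
qed

lemma mds5_ex:
  assumes "mds5 R"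
  shows "\<exists>d e. R a b c d e" and "\<exists>d e. R a b d c e" and "\<exists>d e. R a b d e c" and "\<exists>d e. R a d b c e"
    and "\<exists>d e. R a d b e c" and "\<exists>d e. R a d e b c" and "\<exists>d e. R d a b c e" and "\<exists>d e. R d a b e c"
    and "\<exists>d e. R d a e b c" and "\<exists>d e. R d e a b c"
  using assms by (simp_all add: mds5_def mds5_ex_def)

lemma mds5_eq:
  assumes "mds5 R" "R a b c d e" "R a' b' c' d' e'"
    and "a = a' \<and> b = b' \<and> c = c' \<or> a = a' \<and> b = b' \<and> d = d' \<or> a = a' \<and> b = b' \<and> e = e' \<or>
      a = a' \<and> c = c' \<and> d = d' \<or> a = a' \<and> c = c' \<and> e = e' \<or> a = a' \<and> d = d' \<and> e = e' \<or>
      b = b' \<and> c = c' \<and> d = d' \<or> b = b' \<and> c = c' \<and> e = e' \<or> b = b' \<and> d = d' \<and> e = e' \<or>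
      c = c' \<and> d = d' \<and> e = e'"
  shows "a = a' \<and> b = b' \<and> c = c' \<and> d = d' \<and> e = e'"
proof -
  have "mds5_eq R" using assms(1) by (simp add: mds5_def)
  from this[unfolded mds5_eq_def, rule_format, OF assms(2-4)] show ?thesis .
qed

text \<open>The adjacent transpositions proved here and below generate all permutations of the
  coordinates.\<close>

lemma net4_swap1: assumes "net4 N" shows "net4 (\<lambda>y z. N z y)"
proof -
  have "net4_ex (\<lambda>y z. N z y)" unfolding net4_ex_def
    by (intro conjI allI; (rule net4_ex[OF assms] | (subst ex_comm, rule net4_ex[OF assms])))
  moreover have "net4_eq (\<lambda>y z. N z y)" unfolding net4_eq_def
    by (intro allI impI, drule (1) net4_eq[OF assms], argo, simp)
  ultimately show ?thesis by (simp add: net4_def)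
qed

lemma net4_swap2: assumes "net4 N" shows "net4 (\<lambda>y z f. N y f z)"
proof -
  have "net4_ex (\<lambda>y z f. N y f z)" unfolding net4_ex_def
    by (intro conjI allI; (rule net4_ex[OF assms] | (subst ex_comm, rule net4_ex[OF assms])))
  moreover have "net4_eq (\<lambda>y z f. N y f z)" unfolding net4_eq_def
    by (intro allI impI, drule (1) net4_eq[OF assms], argo, simp)
  ultimately show ?thesis by (simp add: net4_def)
qed

lemma net4_swap3: assumes "net4 N" shows "net4 (\<lambda>y z f g. N y z g f)"
proof -
  have "net4_ex (\<lambda>y z f g. N y z g f)" unfolding net4_ex_def
    by (intro conjI allI; (rule net4_ex[OF assms] | (subst ex_comm, rule net4_ex[OF assms])))
  moreover have "net4_eq (\<lambda>y z f g. N y z g f)" unfolding net4_eq_def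
    by (intro allI impI, drule (1) net4_eq[OF assms], argo, simp)
  ultimately show ?thesis by (simp add: net4_def)
qed

lemma mds5_swap0: assumes "mds5 R" shows "mds5 (\<lambda>x y. R y x)"
proof -
  have "mds5_ex (\<lambda>x y. R y x)" unfolding mds5_ex_def
    by (intro conjI allI; (rule mds5_ex[OF assms] | (subst ex_comm, rule mds5_ex[OF assms])))
  moreover have "mds5_eq (\<lambda>x y. R y x)" unfolding mds5_eq_def
    by (intro allI impI, drule (1) mds5_eq[OF assms], argo, simp)
  ultimately show ?thesis by (simp add: mds5_def)
qed

lemma mds5_swap1: assumes "mds5 R" shows "mds5 (\<lambda>x y z. R x z y)"
proof -
  have "mds5_ex (\<lambda>x y z. R x z y)" unfolding mds5_ex_def
    by (intro conjI allI; (rule mds5_ex[OF assms] | (subst ex_comm, rule mds5_ex[OF assms])))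
  moreover have "mds5_eq (\<lambda>x y z. R x z y)" unfolding mds5_eq_def
    by (intro allI impI, drule (1) mds5_eq[OF assms], argo, simp)
  ultimately show ?thesis by (simp add: mds5_def)
qed

lemma mds5_swap2: assumes "mds5 R" shows "mds5 (\<lambda>x y z f. R x y f z)"
proof -
  have "mds5_ex (\<lambda>x y z f. R x y f z)" unfolding mds5_ex_def
    by (intro conjI allI; (rule mds5_ex[OF assms] | (subst ex_comm, rule mds5_ex[OF assms])))
  moreover have "mds5_eq (\<lambda>x y z f. R x y f z)" unfolding mds5_eq_def
    by (intro allI impI, drule (1) mds5_eq[OF assms], argo, simp)
  ultimately show ?thesis by (simp add: mds5_def)
qed

lemma mds5_swap3: assumes "mds5 R" shows "mds5 (\<lambda>x y z f g. R x y z g f)"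
proof -
  have "mds5_ex (\<lambda>x y z f g. R x y z g f)" unfolding mds5_ex_def
    by (intro conjI allI; (rule mds5_ex[OF assms] | (subst ex_comm, rule mds5_ex[OF assms])))
  moreover have "mds5_eq (\<lambda>x y z f g. R x y z g f)" unfolding mds5_eq_def
    by (intro allI impI, drule (1) mds5_eq[OF assms], argo, simp)
  ultimately show ?thesis by (simp add: mds5_def)
qed

lemma mds5_plane: assumes "mds5 R" shows "net4 (R x)"
proof -
  have "net4_ex (R x)" unfolding net4_ex_def by (intro conjI allI; rule mds5_ex[OF assms])
  moreover have "net4_eq (R x)" unfolding net4_eq_def
    by (intro allI impI, drule (1) mds5_eq[OF assms], argo, simp)
  ultimately show ?thesis by (simp add: net4_def)
qed

lemma bij_eq: "bij a \<Longrightarrow> (a x = a y) = (x = y)"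
  by (simp add: bij_is_inj inj_eq)

lemma net4_relabel:
  assumes N: "net4 N" and b: "bij a" "bij b" "bij c" "bij d"
  shows "net4 (\<lambda>y z f g. N (a y) (b z) (c f) (d g))"
proof -
  have *: "\<exists>c' d'. P (f c') (g d')" if "\<exists>c d. P c d" "bij f" "bij g" for P :: "'a \<Rightarrow> 'a \<Rightarrow> bool" and f g
    using that by (metis bij_pointE)
  note *[OF net4_ex(1)[OF N] b(3,4)] *[OF net4_ex(2)[OF N] b(2,4)] *[OF net4_ex(3)[OF N] b(2,3)]
    *[OF net4_ex(4)[OF N] b(1,4)] *[OF net4_ex(5)[OF N] b(1,3)] *[OF net4_ex(6)[OF N] b(1,2)]
  then have "net4_ex (\<lambda>y z f g. N (a y) (b z) (c f) (d g))" unfolding net4_ex_def by simp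
  moreover have "net4_eq (\<lambda>y z f g. N (a y) (b z) (c f) (d g))" unfolding net4_eq_def
    by (intro allI impI, drule (1) net4_eq[OF N]) (simp_all add: bij_eq[OF b(1)] bij_eq[OF b(2)] bij_eq[OF b(3)] bij_eq[OF b(4)])
  ultimately show ?thesis by (simp add: net4_def)
qed

lemma mds5_relabel:
  assumes R: "mds5 R" and b: "bij p" "bij a" "bij b" "bij c" "bij d"
  shows "mds5 (\<lambda>x y z f g. R (p x) (a y) (b z) (c f) (d g))"
proof -
  have *: "\<exists>c' d'. P (f c') (g d')" if "\<exists>c d. P c d" "bij f" "bij g" for P :: "'a \<Rightarrow> 'a \<Rightarrow> bool" and f g
    using that by (metis bij_pointE)
  note *[OF mds5_ex(1)[OF R] b(4,5)] *[OF mds5_ex(2)[OF R] b(3,5)] *[OF mds5_ex(3)[OF R] b(3,4)]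
    *[OF mds5_ex(4)[OF R] b(2,5)] *[OF mds5_ex(5)[OF R] b(2,4)] *[OF mds5_ex(6)[OF R] b(2,3)]
    *[OF mds5_ex(7)[OF R] b(1,5)] *[OF mds5_ex(8)[OF R] b(1,4)] *[OF mds5_ex(9)[OF R] b(1,3)]
    *[OF mds5_ex(10)[OF R] b(1,2)]
  then have "mds5_ex (\<lambda>x y z f g. R (p x) (a y) (b z) (c f) (d g))" unfolding mds5_ex_def by simp
  moreover have "mds5_eq (\<lambda>x y z f g. R (p x) (a y) (b z) (c f) (d g))" unfolding mds5_eq_def
    by (intro allI impI, drule (1) mds5_eq[OF R])
      (simp_all add: bij_eq[OF b(1)] bij_eq[OF b(2)] bij_eq[OF b(3)] bij_eq[OF b(4)] bij_eq[OF b(5)])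
  ultimately show ?thesis by (simp add: mds5_def)
qed

section \<open>Equivalence of planes\<close>

text \<open>Generated by single relabellings and adjacent transpositions on the right-hand side, so
  that an invariance proof is an induction with four elementary steps and never handles a general
  permutation of coordinates.\<close>

inductive eqv :: "('a \<Rightarrow> 'a \<Rightarrow> 'a \<Rightarrow> 'a \<Rightarrow> bool) \<Rightarrow> ('a \<Rightarrow> 'a \<Rightarrow> 'a \<Rightarrow> 'a \<Rightarrow> bool) \<Rightarrow> bool" for N where
  eqv_refl: "eqv N N"
| eqv_relabel: "eqv N M \<Longrightarrow> bij a \<Longrightarrow> bij b \<Longrightarrow> bij c \<Longrightarrow> bij d \<Longrightarrow> eqv N (\<lambda>y z f g. M (a y) (b z) (c f) (d g))"
| eqv_swap1: "eqv N M \<Longrightarrow> eqv N (\<lambda>y z. M z y)"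
| eqv_swap2: "eqv N M \<Longrightarrow> eqv N (\<lambda>y z f. M y f z)"
| eqv_swap3: "eqv N M \<Longrightarrow> eqv N (\<lambda>y z f g. M y z g f)"

lemma eqv_trans: assumes "eqv N M" "eqv M K" shows "eqv N K"
  using assms(2,1) by (induction rule: eqv.induct) (auto intro: eqv.intros)

lemma eqv_net4: assumes "eqv N M" "net4 N" shows "net4 M"
  using assms(1)
proof (induction rule: eqv.induct)
  case eqv_refl show ?case by (rule assms(2))
next
  case (eqv_relabel M a b c d) show ?case by (rule net4_relabel[OF eqv_relabel.IH eqv_relabel.hyps(2-5)])
next
  case (eqv_swap1 M) show ?case by (rule net4_swap1[OF eqv_swap1.IH])
next
  case (eqv_swap2 M) show ?case by (rule net4_swap2[OF eqv_swap2.IH])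
next
  case (eqv_swap3 M) show ?case by (rule net4_swap3[OF eqv_swap3.IH])
qed

text \<open>Relabelling or permuting the last four coordinates acts on the whole code and fixes the
  index \<open>x\<close> of the plane. Hence one plane can be put into standard form without losing
  the code around it.\<close>

lemma eqv_plane: assumes "eqv (R x) M" "mds5 R" shows "\<exists>R'. mds5 R' \<and> R' x = M"
  using assms(1)
proof (induction rule: eqv.induct)
  case eqv_refl show ?case using assms(2) by blast
next
  case (eqv_relabel M a b c d)
  then obtain R' where R': "mds5 R'" "R' x = M" by blast
  have "mds5 (\<lambda>x y z f g. R' (id x) (a y) (b z) (c f) (d g))"
    by (rule mds5_relabel[OF R'(1) bij_id eqv_relabel.hyps(2-5)])
  then show ?case by (intro exI conjI, assumption) (simp add: R'(2))
next
  case (eqv_swap1 M)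
  then obtain R' where R': "mds5 R'" "R' x = M" by blast
  from mds5_swap1[OF R'(1)] show ?case by (intro exI conjI, assumption) (simp add: R'(2))
next
  case (eqv_swap2 M)
  then obtain R' where R': "mds5 R'" "R' x = M" by blast
  from mds5_swap2[OF R'(1)] show ?case by (intro exI conjI, assumption) (simp add: R'(2))
next
  case (eqv_swap3 M)
  then obtain R' where R': "mds5 R'" "R' x = M" by blast
  from mds5_swap3[OF R'(1)] show ?case by (intro exI conjI, assumption) (simp add: R'(2))
qed

section \<open>Seven symbols, and searches over their permutations\<close>

datatype s7 = A0 | A1 | A2 | A3 | A4 | A5 | A6
text \<open>Functions on the seven symbols as explicit tuples, so that lookups and equality tests
  are settled by rewriting.\<close>

datatype 'a v7 = V 'a 'a 'a 'a 'a 'a 'a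

fun at :: "'a v7 \<Rightarrow> s7 \<Rightarrow> 'a" (infixl \<open>$\<close> 90) where
  "V a b c d e f g $ A0 = a" | "V a b c d e f g $ A1 = b" | "V a b c d e f g $ A2 = c"
| "V a b c d e f g $ A3 = d" | "V a b c d e f g $ A4 = e" | "V a b c d e f g $ A5 = f"
| "V a b c d e f g $ A6 = g"

definition tab :: "(s7 \<Rightarrow> 'a) \<Rightarrow> 'a v7" where
  "tab f = V (f A0) (f A1) (f A2) (f A3) (f A4) (f A5) (f A6)"

lemma at_tab [simp]: "tab f $ i = f i"
  by (cases i) (simp_all add: tab_def)

lemma UNIV_s7: "(UNIV :: s7 set) = {A0, A1, A2, A3, A4, A5, A6}"
  using s7.exhaust by blast

instance s7 :: finite
  by standard (simp add: UNIV_s7)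

lemma card_s7: "card (UNIV :: s7 set) = 7"
  by (simp add: UNIV_s7)

lemma all_s7: "(\<forall>x::s7. P x) \<longleftrightarrow> P A0 \<and> P A1 \<and> P A2 \<and> P A3 \<and> P A4 \<and> P A5 \<and> P A6"
  by (metis s7.exhaust)

lemma ex_s7: "(\<exists>x::s7. P x) \<longleftrightarrow> P A0 \<or> P A1 \<or> P A2 \<or> P A3 \<or> P A4 \<or> P A5 \<or> P A6"
  by (metis s7.exhaust)

text \<open>
  The evaluator behind \<open>code_simp\<close> reduces both arguments of a conjunction, hence the conditionals
  in executable predicates.
\<close>

definition every :: "(s7 \<Rightarrow> bool) \<Rightarrow> bool" where
  "every P = (if P A0 then if P A1 then if P A2 then if P A3 then if P A4 then if P A5 then P A6
    else False else False else False else False else False else False)"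

definition some :: "(s7 \<Rightarrow> bool) \<Rightarrow> bool" where
  "some P = (if P A0 then True else if P A1 then True else if P A2 then True else if P A3 then True
    else if P A4 then True else if P A5 then True else P A6)"

lemma every_iff [simp]: "every P \<longleftrightarrow> (\<forall>x. P x)"
  by (simp add: every_def all_s7)

lemma everyD: "every P \<Longrightarrow> P x"
  by simp

lemma some_iff [simp]: "some P \<longleftrightarrow> (\<exists>x. P x)"
  by (simp add: some_def ex_s7)

fun elem :: "'a \<Rightarrow> 'a list \<Rightarrow> bool" where
  "elem x [] = False"
| "elem x (y # ys) = (if x = y then True else elem x ys)"

fun any :: "('a \<Rightarrow> bool) \<Rightarrow> 'a list \<Rightarrow> bool" where
  "any P [] = False"
| "any P (x # xs) = (if P x then True else any P xs)"

fun alls :: "('a \<Rightarrow> bool) \<Rightarrow> 'a list \<Rightarrow> bool" where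
  "alls P [] = True"
| "alls P (x # xs) = (if P x then alls P xs else False)"

lemma elem_iff [simp]: "elem x xs \<longleftrightarrow> x \<in> set xs"
  by (induction xs) auto

lemma any_iff [simp]: "any P xs \<longleftrightarrow> (\<exists>x\<in>set xs. P x)"
  by (induction xs) auto

lemma alls_iff [simp]: "alls P xs \<longleftrightarrow> (\<forall>x\<in>set xs. P x)"
  by (induction xs) auto

definition idv :: "s7 v7" where "idv = V A0 A1 A2 A3 A4 A5 A6"

lemma at_idv [simp]: "idv $ i = i"
  by (cases i) (simp_all add: idv_def)

definition isperm :: "s7 v7 \<Rightarrow> bool" where
  "isperm p = every (\<lambda>y. some (\<lambda>x. p $ x = y))"

lemma isperm_iff: "isperm p \<longleftrightarrow> bij (at p)"
proof -
  have "isperm p \<longleftrightarrow> surj (at p)"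
    unfolding isperm_def every_iff some_iff surj_def by metis
  then show ?thesis
    by (metis bij_def finite_UNIV_surj_inj finite)
qed

text \<open>The last branch makes no test: for a permutation, \<open>A6\<close> is the only preimage
  that is left.\<close>

definition inv7 :: "s7 v7 \<Rightarrow> s7 v7" where
  "inv7 p = tab (\<lambda>y. if p $ A0 = y then A0 else if p $ A1 = y then A1 else if p $ A2 = y then A2
    else if p $ A3 = y then A3 else if p $ A4 = y then A4 else if p $ A5 = y then A5 else A6)"

lemma at_inv7: assumes "bij (at p)" shows "p $ (inv7 p $ y) = y"
proof -
  have "\<exists>x. p $ x = y" using assms by (metis bij_pointE)
  then show ?thesis by (auto simp: inv7_def ex_s7)
qed

lemma inv7_at: "bij (at p) \<Longrightarrow> inv7 p $ (p $ x) = x"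
  by (metis at_inv7 bij_is_inj injD)

lemma bij_inv7: "bij (at p) \<Longrightarrow> bij (at (inv7 p))"
  by (metis at_inv7 inv7_at bij_betw_byWitness UNIV_I subset_UNIV o_bij comp_apply eq_id_iff)

text \<open>Backtracking over all permutations of \<^typ>\<open>s7\<close>: \<open>tk\<close> tests a partial
  permutation of which only the first \<open>k + 1\<close> places are meaningful.\<close>

definition enum :: "(s7 v7 \<Rightarrow> bool) \<Rightarrow> (s7 v7 \<Rightarrow> bool) \<Rightarrow> (s7 v7 \<Rightarrow> bool) \<Rightarrow> (s7 v7 \<Rightarrow> bool) \<Rightarrow>
    (s7 v7 \<Rightarrow> bool) \<Rightarrow> (s7 v7 \<Rightarrow> bool) \<Rightarrow> (s7 v7 \<Rightarrow> bool) \<Rightarrow> (s7 v7 \<Rightarrow> bool) \<Rightarrow> bool" where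
  "enum t0 t1 t2 t3 t4 t5 t6 Q = every (\<lambda>a. if t0 (V a A0 A0 A0 A0 A0 A0) then
    every (\<lambda>b. if elem b [a] then True else if t1 (V a b A0 A0 A0 A0 A0) then
    every (\<lambda>c. if elem c [a,b] then True else if t2 (V a b c A0 A0 A0 A0) then
    every (\<lambda>d. if elem d [a,b,c] then True else if t3 (V a b c d A0 A0 A0) then
    every (\<lambda>e. if elem e [a,b,c,d] then True else if t4 (V a b c d e A0 A0) then
    every (\<lambda>f. if elem f [a,b,c,d,e] then True else if t5 (V a b c d e f A0) then
    every (\<lambda>g. if elem g [a,b,c,d,e,f] then True else if t6 (V a b c d e f g) then
      Q (V a b c d e f g) else True) else True) else True) else True) else True) else True) else True)"

lemma enumD:
  assumes "enum t0 t1 t2 t3 t4 t5 t6 Q" "bij (at p)" "p = V a b c d e f g"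
    "t0 (V a A0 A0 A0 A0 A0 A0)" "t1 (V a b A0 A0 A0 A0 A0)" "t2 (V a b c A0 A0 A0 A0)"
    "t3 (V a b c d A0 A0 A0)" "t4 (V a b c d e A0 A0)" "t5 (V a b c d e f A0)"
    "t6 (V a b c d e f g)"
  shows "Q p"
proof -
  have inj: "p $ i \<noteq> p $ j" if "i \<noteq> j" for i j using assms(2) that by (metis bij_is_inj injD)
  have "a \<noteq> b" "a \<noteq> c" "a \<noteq> d" "a \<noteq> e" "a \<noteq> f" "a \<noteq> g" "b \<noteq> c" "b \<noteq> d" "b \<noteq> e" "b \<noteq> f" "b \<noteq> g"
    "c \<noteq> d" "c \<noteq> e" "c \<noteq> f" "c \<noteq> g" "d \<noteq> e" "d \<noteq> f" "d \<noteq> g" "e \<noteq> f" "e \<noteq> g" "f \<noteq> g"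
    using inj[of A0 A1] inj[of A0 A2] inj[of A0 A3] inj[of A0 A4] inj[of A0 A5] inj[of A0 A6]
      inj[of A1 A2] inj[of A1 A3] inj[of A1 A4] inj[of A1 A5] inj[of A1 A6] inj[of A2 A3] inj[of A2 A4]
      inj[of A2 A5] inj[of A2 A6] inj[of A3 A4] inj[of A3 A5] inj[of A3 A6] inj[of A4 A5] inj[of A4 A6]
      inj[of A5 A6] by (simp_all add: assms(3))
  note ne = this this[symmetric]
  from assms(1) show ?thesis
    unfolding enum_def assms(3)
    apply -
    apply (drule everyD[where x = a], simp only: assms(4) if_True)
    apply (drule everyD[where x = b], simp only: assms(5) ne elem.simps if_True if_False)
    apply (drule everyD[where x = c], simp only: assms(6) ne elem.simps if_True if_False)
    apply (drule everyD[where x = d], simp only: assms(7) ne elem.simps if_True if_False)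
    apply (drule everyD[where x = e], simp only: assms(8) ne elem.simps if_True if_False)
    apply (drule everyD[where x = f], simp only: assms(9) ne elem.simps if_True if_False)
    apply (drule everyD[where x = g], simp only: assms(10) ne elem.simps if_True if_False)
    done
qed

subsection \<open>Parity\<close>

definition swapv :: "s7 v7 \<Rightarrow> s7 \<Rightarrow> s7 v7" where
  "swapv p i = map_v7 (\<lambda>x. if x = i then p $ i else if x = p $ i then i else x) p"

text \<open>Parity by sorting: each place that is not yet fixed costs one transposition, and the
  flag flips with it. The result is true when the identity is reached with the flag true, that is,
  after an even number of transpositions from a true flag and after an odd number from a false
  one.\<close>

fun par :: "s7 list \<Rightarrow> s7 v7 \<Rightarrow> bool \<Rightarrow> bool" where
  "par [] p b = (if p = idv then b else False)"
| "par (i # is) p b = (if p $ i = i then par is p b else par is (swapv p i) (\<not> b))"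

lemma at_map [simp]: "map_v7 f p $ i = f (p $ i)"
  by (cases p; cases i) simp_all

lemma permutation_s7: "bij (p :: s7 \<Rightarrow> s7) \<Longrightarrow> permutation p"
  by (simp add: permutation)

lemma at_swapv: "at (swapv p i) = transpose i (p $ i) \<circ> at p"
  by (auto simp: swapv_def transpose_def fun_eq_iff)

lemma par_sign:
  "par is p b \<Longrightarrow> bij (at p) \<Longrightarrow> sign (at p) = (if b then 1 else - 1)"
proof (induction "is" arbitrary: p b)
  case Nil
  then have "p = idv" b by (auto split: if_splits)
  moreover have "at idv = id" by (simp add: fun_eq_iff)
  ultimately show ?case by simp
next
  case (Cons i "is")
  show ?case
  proof (cases "p $ i = i")
    case True
    with Cons show ?thesis by simp
  next
    case False
    let ?q = "swapv p i"
    have q: "bij (at ?q)" unfolding at_swapv by (intro bij_comp Cons.prems bij_transpose)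
    have "sign (at ?q) = (if \<not> b then 1 else - 1)"
      using Cons.IH[OF _ q] Cons.prems False by simp
    moreover have "sign (at ?q) = sign (transpose i (p $ i)) * sign (at p)"
      unfolding at_swapv
      by (rule sign_compose) (use Cons.prems in \<open>simp_all add: permutation_s7\<close>)
    ultimately show ?thesis using False by (auto simp: sign_swap_id split: if_splits)
  qed
qed

definition s7s :: "s7 list" where "s7s = [A0, A1, A2, A3, A4, A5, A6]"

definition is_odd :: "s7 v7 \<Rightarrow> bool" where "is_odd p = par s7s p False"

text \<open>Success of the test proves oddness; therefore a search that skips whatever passes the
  test skips no even permutation.\<close>

lemma is_odd_sign: "is_odd p \<Longrightarrow> bij (at p) \<Longrightarrow> sign (at p) = - 1"
  unfolding is_odd_def using par_sign by fastforce

text \<open>The cycle types on seven points without fixed points are 7, 5+2, 4+3 and 3+2+2. The even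
  ones are 7 and 3+2+2, represented by \<open>R7\<close> and \<open>R223\<close>.\<close>

definition R7 :: "s7 v7" where "R7 = V A1 A2 A3 A4 A5 A6 A0"
definition R223 :: "s7 v7" where "R223 = V A1 A0 A3 A2 A5 A6 A4"

definition conjv :: "s7 v7 \<Rightarrow> s7 v7 \<Rightarrow> s7 v7 \<Rightarrow> bool" where
  "conjv r p e = (if every (\<lambda>i. p $ (e $ i) = e $ (r $ i)) then isperm e else False)"

definition orbit7 :: "s7 v7 \<Rightarrow> s7 v7" where
  "orbit7 p = V A0 (p $ A0) (p $ (p $ A0)) (p $ (p $ (p $ A0))) (p $ (p $ (p $ (p $ A0))))
    (p $ (p $ (p $ (p $ (p $ A0))))) (p $ (p $ (p $ (p $ (p $ (p $ A0))))))"

text \<open>The conjugating permutation is read off the cycles: for a 7-cycle it lists the orbit of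
  \<open>A0\<close>; for type 3+2+2 it is built from points \<open>x\<close> and \<open>y\<close> of
  the two 2-cycles and a point \<open>z\<close> of the 3-cycle.\<close>

definition conj_rep :: "s7 v7 \<Rightarrow> bool" where
  "conj_rep p = (if conjv R7 p (orbit7 p) then True else
    some (\<lambda>x. if p $ (p $ x) = x then some (\<lambda>y. if p $ (p $ y) = y then
      some (\<lambda>z. conjv R223 p (V x (p $ x) y (p $ y) z (p $ z) (p $ (p $ z)))) else False) else False))"

lemma even_derangements: "enum (\<lambda>p. p $ A0 \<noteq> A0) (\<lambda>p. p $ A1 \<noteq> A1) (\<lambda>p. p $ A2 \<noteq> A2) (\<lambda>p. p $ A3 \<noteq> A3)
    (\<lambda>p. p $ A4 \<noteq> A4) (\<lambda>p. p $ A5 \<noteq> A5) (\<lambda>p. p $ A6 \<noteq> A6) (\<lambda>p. if is_odd p then True else conj_rep p)"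
  by code_simp

lemma even_derangement:
  assumes "bij (at p)" "\<And>i. p $ i \<noteq> i" "sign (at p) = 1"
  obtains r e where "r = R7 \<or> r = R223" "bij (at e)" "\<And>i. p $ (e $ i) = e $ (r $ i)"
proof -
  obtain a b c d e f g where p: "p = V a b c d e f g" by (cases p)
  have ne: "a \<noteq> A0" "b \<noteq> A1" "c \<noteq> A2" "d \<noteq> A3" "e \<noteq> A4" "f \<noteq> A5" "g \<noteq> A6"
    using assms(2)[of A0] assms(2)[of A1] assms(2)[of A2] assms(2)[of A3] assms(2)[of A4] assms(2)[of A5]
      assms(2)[of A6] by (simp_all add: p)
  have "if is_odd p then True else conj_rep p"
    by (rule enumD[OF even_derangements assms(1) p]) (simp_all add: ne)
  moreover have "\<not> is_odd p" using is_odd_sign[OF _ assms(1)] assms(3) by auto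
  ultimately have "conj_rep p" by simp
  then have "\<exists>r e. (r = R7 \<or> r = R223) \<and> conjv r p e"
    unfolding conj_rep_def some_iff by (auto split: if_splits)
  with that show thesis unfolding conjv_def every_iff isperm_iff by (auto split: if_splits)
qed

text \<open>The seven types, found by computer search and given as pairs of orthogonal Latin squares;
  \<open>T5\<close> and \<open>T6\<close> are the linear ones.\<close>

definition T0 :: "s7 v7 v7 \<times> s7 v7 v7" where
  "T0 = (V (V A0 A1 A2 A3 A4 A5 A6) (V A1 A0 A5 A4 A6 A2 A3) (V A2 A3 A1 A6 A5 A4 A0) (V A3 A2 A4 A5 A0 A6 A1) (V A4 A5 A6 A0 A3 A1 A2) (V A5 A6 A0 A1 A2 A3 A4) (V A6 A4 A3 A2 A1 A0 A5),
    V (V A0 A2 A6 A1 A3 A4 A5) (V A1 A4 A3 A5 A2 A0 A6) (V A2 A0 A5 A4 A1 A6 A3) (V A3 A5 A2 A0 A6 A1 A4) (V A4 A6 A0 A2 A5 A3 A1) (V A5 A3 A1 A6 A4 A2 A0) (V A6 A1 A4 A3 A0 A5 A2))"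
definition T1 :: "s7 v7 v7 \<times> s7 v7 v7" where
  "T1 = (V (V A0 A1 A2 A3 A4 A5 A6) (V A1 A0 A3 A2 A5 A6 A4) (V A2 A4 A5 A1 A6 A0 A3) (V A3 A5 A6 A0 A1 A4 A2) (V A4 A3 A0 A6 A2 A1 A5) (V A5 A6 A1 A4 A3 A2 A0) (V A6 A2 A4 A5 A0 A3 A1),
    V (V A0 A1 A2 A3 A4 A5 A6) (V A2 A4 A5 A6 A0 A1 A3) (V A1 A6 A4 A5 A2 A3 A0) (V A4 A3 A0 A1 A6 A2 A5) (V A5 A2 A6 A4 A3 A0 A1) (V A6 A5 A3 A0 A1 A4 A2) (V A3 A0 A1 A2 A5 A6 A4))"
definition T2 :: "s7 v7 v7 \<times> s7 v7 v7" where
  "T2 = (V (V A0 A1 A2 A3 A4 A5 A6) (V A1 A0 A3 A2 A5 A6 A4) (V A2 A5 A0 A6 A1 A4 A3) (V A3 A4 A5 A1 A6 A0 A2) (V A4 A2 A6 A5 A3 A1 A0) (V A5 A6 A4 A0 A2 A3 A1) (V A6 A3 A1 A4 A0 A2 A5),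
    V (V A0 A1 A2 A3 A4 A5 A6) (V A2 A4 A1 A5 A6 A0 A3) (V A3 A2 A5 A1 A0 A6 A4) (V A6 A5 A3 A4 A2 A1 A0) (V A1 A6 A4 A0 A5 A3 A2) (V A4 A3 A0 A6 A1 A2 A5) (V A5 A0 A6 A2 A3 A4 A1))"
definition T3 :: "s7 v7 v7 \<times> s7 v7 v7" where
  "T3 = (V (V A0 A1 A2 A3 A4 A5 A6) (V A1 A0 A3 A2 A5 A6 A4) (V A2 A3 A0 A1 A6 A4 A5) (V A3 A4 A5 A6 A1 A2 A0) (V A4 A2 A6 A5 A0 A3 A1) (V A5 A6 A1 A4 A3 A0 A2) (V A6 A5 A4 A0 A2 A1 A3),
    V (V A0 A1 A2 A3 A4 A5 A6) (V A2 A4 A1 A5 A6 A0 A3) (V A3 A0 A5 A4 A2 A6 A1) (V A6 A5 A3 A1 A0 A4 A2) (V A1 A6 A4 A0 A3 A2 A5) (V A4 A3 A6 A2 A5 A1 A0) (V A5 A2 A0 A6 A1 A3 A4))"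
definition T4 :: "s7 v7 v7 \<times> s7 v7 v7" where
  "T4 = (V (V A0 A1 A2 A3 A4 A5 A6) (V A1 A2 A0 A4 A5 A6 A3) (V A2 A6 A3 A5 A1 A0 A4) (V A3 A4 A5 A6 A2 A1 A0) (V A4 A5 A6 A0 A3 A2 A1) (V A5 A0 A4 A1 A6 A3 A2) (V A6 A3 A1 A2 A0 A4 A5),
    V (V A0 A1 A2 A3 A4 A5 A6) (V A2 A3 A4 A5 A6 A0 A1) (V A6 A4 A5 A0 A3 A1 A2) (V A4 A0 A1 A2 A5 A6 A3) (V A1 A2 A3 A6 A0 A4 A5) (V A3 A5 A6 A4 A1 A2 A0) (V A5 A6 A0 A1 A2 A3 A4))"
definition T5 :: "s7 v7 v7 \<times> s7 v7 v7" where
  "T5 = (V (V A0 A1 A2 A3 A4 A5 A6) (V A1 A2 A3 A4 A5 A6 A0) (V A2 A3 A4 A5 A6 A0 A1) (V A3 A4 A5 A6 A0 A1 A2) (V A4 A5 A6 A0 A1 A2 A3) (V A5 A6 A0 A1 A2 A3 A4) (V A6 A0 A1 A2 A3 A4 A5),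
    V (V A0 A2 A4 A6 A1 A3 A5) (V A1 A3 A5 A0 A2 A4 A6) (V A2 A4 A6 A1 A3 A5 A0) (V A3 A5 A0 A2 A4 A6 A1) (V A4 A6 A1 A3 A5 A0 A2) (V A5 A0 A2 A4 A6 A1 A3) (V A6 A1 A3 A5 A0 A2 A4))"
definition T6 :: "s7 v7 v7 \<times> s7 v7 v7" where
  "T6 = (V (V A0 A1 A2 A3 A4 A5 A6) (V A1 A2 A3 A4 A5 A6 A0) (V A2 A3 A4 A5 A6 A0 A1) (V A3 A4 A5 A6 A0 A1 A2) (V A4 A5 A6 A0 A1 A2 A3) (V A5 A6 A0 A1 A2 A3 A4) (V A6 A0 A1 A2 A3 A4 A5),
    V (V A0 A3 A6 A2 A5 A1 A4) (V A1 A4 A0 A3 A6 A2 A5) (V A2 A5 A1 A4 A0 A3 A6) (V A3 A6 A2 A5 A1 A4 A0) (V A4 A0 A3 A6 A2 A5 A1) (V A5 A1 A4 A0 A3 A6 A2) (V A6 A2 A5 A1 A4 A0 A3))"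

definition types :: "(s7 v7 v7 \<times> s7 v7 v7) list" where
  "types = [T0, T1, T2, T3, T4, T5, T6]"

section \<open>Starting pairs of lines, and the reduction of even pairs to them\<close>

text \<open>A pair \<open>(s, t)\<close> encodes two lines of a plane: when the other three
  coordinates are labelled along the first line, the second consists of the triples
  \<open>(i, s i, t i)\<close>. The 18 pairs represent the even ones up to common relabelling,
  permutation of the three coordinates and exchange of the two lines; \<open>even_pairs7\<close> and
  \<open>even_pairs223\<close> confirm that none is missing.\<close>

definition st0 :: "s7 v7 \<times> s7 v7" where "st0 = (R7, V A2 A0 A1 A5 A6 A3 A4)"
definition st1 :: "s7 v7 \<times> s7 v7" where "st1 = (R7, V A2 A0 A4 A1 A6 A3 A5)"
definition st2 :: "s7 v7 \<times> s7 v7" where "st2 = (R7, V A2 A0 A4 A5 A6 A1 A3)"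
definition st3 :: "s7 v7 \<times> s7 v7" where "st3 = (R7, V A2 A0 A5 A1 A6 A4 A3)"
definition st4 :: "s7 v7 \<times> s7 v7" where "st4 = (R7, V A2 A3 A0 A5 A6 A1 A4)"
definition st5 :: "s7 v7 \<times> s7 v7" where "st5 = (R7, V A2 A3 A4 A5 A6 A0 A1)"
definition st6 :: "s7 v7 \<times> s7 v7" where "st6 = (R7, V A2 A3 A5 A6 A0 A1 A4)"
definition st7 :: "s7 v7 \<times> s7 v7" where "st7 = (R7, V A2 A3 A6 A5 A1 A0 A4)"
definition st8 :: "s7 v7 \<times> s7 v7" where "st8 = (R7, V A2 A4 A0 A6 A1 A3 A5)"
definition st9 :: "s7 v7 \<times> s7 v7" where "st9 = (R7, V A2 A4 A5 A0 A6 A1 A3)"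
definition st10 :: "s7 v7 \<times> s7 v7" where "st10 = (R7, V A2 A4 A5 A6 A1 A0 A3)"
definition st11 :: "s7 v7 \<times> s7 v7" where "st11 = (R7, V A2 A5 A0 A6 A1 A4 A3)"
definition st12 :: "s7 v7 \<times> s7 v7" where "st12 = (R7, V A2 A5 A6 A0 A1 A3 A4)"
definition st13 :: "s7 v7 \<times> s7 v7" where "st13 = (R7, V A2 A5 A6 A1 A0 A4 A3)"
definition st14 :: "s7 v7 \<times> s7 v7" where "st14 = (R7, V A3 A4 A5 A6 A0 A1 A2)"
definition st15 :: "s7 v7 \<times> s7 v7" where "st15 = (R7, V A3 A5 A6 A0 A2 A1 A4)"
definition st16 :: "s7 v7 \<times> s7 v7" where "st16 = (R223, V A2 A3 A0 A1 A6 A4 A5)"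
definition st17 :: "s7 v7 \<times> s7 v7" where "st17 = (R223, V A2 A4 A6 A5 A1 A3 A0)"

definition starts :: "(s7 v7 \<times> s7 v7) list" where
  "starts = [st0, st1, st2, st3, st4, st5, st6, st7, st8, st9, st10, st11, st12, st13, st14, st15, st16, st17]"

text \<open>Witnesses that an even pair is equivalent to one of the starts, listed by the first two values
  of its second permutation: the start, an order of the three coordinates, whether the pair is inverted
  first, and the conjugating permutation.\<close>

fun W7 :: "s7 \<Rightarrow> s7 \<Rightarrow> ((s7 v7 \<times> s7 v7) \<times> s7 \<times> bool \<times> s7 v7) list" where
  "W7 A2 A0 = [(st0, A0, False, V A0 A1 A2 A3 A4 A5 A6),
    (st1, A0, False, V A0 A1 A2 A3 A4 A5 A6),
    (st2, A0, False, V A0 A1 A2 A3 A4 A5 A6),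
    (st1, A2, False, V A2 A1 A0 A6 A5 A4 A3),
    (st3, A0, False, V A0 A1 A2 A3 A4 A5 A6),
    (st2, A1, False, V A1 A0 A2 A4 A6 A3 A5),
    (st0, A2, False, V A2 A1 A0 A6 A5 A4 A3),
    (st2, A2, False, V A2 A1 A0 A6 A5 A4 A3),
    (st1, A1, False, V A1 A0 A2 A4 A6 A5 A3),
    (st3, A0, False, V A4 A5 A6 A0 A1 A2 A3)]"
| "W7 A2 A3 = [(st0, A0, False, V A3 A4 A5 A6 A0 A1 A2),
    (st4, A0, False, V A0 A1 A2 A3 A4 A5 A6),
    (st0, A2, False, V A3 A2 A1 A0 A6 A5 A4),
    (st2, A0, True, V A6 A5 A4 A3 A2 A1 A0),
    (st5, A0, False, V A0 A1 A2 A3 A4 A5 A6),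
    (st2, A0, False, V A2 A3 A4 A5 A6 A0 A1),
    (st2, A0, False, V A3 A4 A5 A6 A0 A1 A2),
    (st4, A0, False, V A3 A4 A5 A6 A0 A1 A2),
    (st6, A0, False, V A0 A1 A2 A3 A4 A5 A6),
    (st6, A4, False, V A5 A0 A4 A6 A1 A2 A3),
    (st2, A0, True, V A5 A4 A3 A2 A1 A0 A6),
    (st7, A0, False, V A0 A1 A2 A3 A4 A5 A6)]"
| "W7 A2 A4 = [(st4, A0, False, V A4 A5 A6 A0 A1 A2 A3),
    (st8, A0, False, V A0 A1 A2 A3 A4 A5 A6),
    (st3, A0, True, V A6 A5 A4 A3 A2 A1 A0),
    (st2, A0, True, V A2 A1 A0 A6 A5 A4 A3),
    (st1, A2, False, V A0 A6 A5 A4 A3 A2 A1),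
    (st9, A0, False, V A0 A1 A2 A3 A4 A5 A6),
    (st6, A0, False, V A1 A2 A3 A4 A5 A6 A0),
    (st10, A0, False, V A0 A1 A2 A3 A4 A5 A6),
    (st9, A4, False, V A4 A0 A3 A5 A6 A1 A2),
    (st8, A2, False, V A0 A6 A5 A4 A3 A2 A1),
    (st9, A0, False, V A4 A5 A6 A0 A1 A2 A3),
    (st2, A0, False, V A4 A5 A6 A0 A1 A2 A3)]"
| "W7 A2 A5 = [(st10, A5, False, V A4 A2 A1 A5 A3 A0 A6),
    (st11, A0, False, V A0 A1 A2 A3 A4 A5 A6),
    (st8, A0, True, V A2 A1 A0 A6 A5 A4 A3),
    (st1, A1, False, V A4 A6 A5 A3 A1 A0 A2),
    (st2, A1, True, V A2 A0 A1 A5 A3 A6 A4),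
    (st7, A0, False, V A1 A2 A3 A4 A5 A6 A0),
    (st7, A0, False, V A3 A4 A5 A6 A0 A1 A2),
    (st10, A0, False, V A5 A6 A0 A1 A2 A3 A4),
    (st2, A0, True, V A4 A3 A2 A1 A0 A6 A5),
    (st12, A0, False, V A0 A1 A2 A3 A4 A5 A6),
    (st6, A4, False, V A0 A4 A6 A1 A2 A3 A5),
    (st13, A0, False, V A0 A1 A2 A3 A4 A5 A6),
    (st9, A5, False, V A1 A6 A5 A3 A0 A4 A2)]"
| "W7 A2 A6 = [(st10, A5, False, V A3 A0 A6 A4 A2 A1 A5),
    (st0, A0, False, V A4 A5 A6 A0 A1 A2 A3),
    (st2, A2, True, V A0 A1 A2 A3 A4 A5 A6),
    (st3, A0, True, V A2 A1 A0 A6 A5 A4 A3),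
    (st1, A0, False, V A4 A5 A6 A0 A1 A2 A3),
    (st9, A5, False, V A4 A2 A1 A6 A5 A3 A0),
    (st1, A0, False, V A2 A3 A4 A5 A6 A0 A1),
    (st4, A0, False, V A1 A2 A3 A4 A5 A6 A0),
    (st7, A0, False, V A5 A6 A0 A1 A2 A3 A4),
    (st13, A1, False, V A2 A6 A3 A1 A5 A4 A0),
    (st8, A2, True, V A5 A6 A0 A1 A2 A3 A4),
    (st9, A1, False, V A6 A3 A0 A2 A5 A1 A4)]"
| "W7 A3 A0 = [(st0, A2, False, V A6 A5 A4 A3 A2 A1 A0),
    (st4, A2, False, V A3 A2 A1 A0 A6 A5 A4),
    (st1, A2, False, V A4 A3 A2 A1 A0 A6 A5),
    (st2, A0, True, V A1 A0 A6 A5 A4 A3 A2),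
    (st9, A4, False, V A1 A2 A4 A0 A3 A5 A6),
    (st8, A0, True, V A6 A5 A4 A3 A2 A1 A0),
    (st1, A2, False, V A6 A5 A4 A3 A2 A1 A0),
    (st10, A4, False, V A6 A0 A3 A5 A1 A2 A4),
    (st9, A3, False, V A0 A3 A6 A4 A1 A5 A2),
    (st7, A2, False, V A0 A6 A5 A4 A3 A2 A1),
    (st13, A0, False, V A4 A5 A6 A0 A1 A2 A3),
    (st3, A0, True, V A5 A4 A3 A2 A1 A0 A6)]"
| "W7 A3 A4 = [(st2, A1, True, V A5 A3 A6 A4 A2 A0 A1),
    (st6, A0, False, V A4 A5 A6 A0 A1 A2 A3),
    (st9, A3, False, V A6 A4 A1 A5 A2 A0 A3),
    (st0, A2, False, V A0 A6 A5 A4 A3 A2 A1),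
    (st10, A4, False, V A4 A6 A0 A3 A5 A1 A2),
    (st10, A0, False, V A1 A2 A3 A4 A5 A6 A0),
    (st6, A0, False, V A3 A4 A5 A6 A0 A1 A2),
    (st14, A0, False, V A0 A1 A2 A3 A4 A5 A6),
    (st6, A0, False, V A2 A3 A4 A5 A6 A0 A1),
    (st12, A2, False, V A0 A6 A5 A4 A3 A2 A1),
    (st2, A1, False, V A2 A4 A6 A3 A5 A1 A0),
    (st10, A4, False, V A3 A5 A1 A2 A4 A6 A0),
    (st9, A0, False, V A1 A2 A3 A4 A5 A6 A0),
    (st10, A0, False, V A2 A3 A4 A5 A6 A0 A1)]"
| "W7 A3 A5 = [(st2, A1, False, V A4 A6 A3 A5 A1 A0 A2),
    (st8, A0, False, V A3 A4 A5 A6 A0 A1 A2),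
    (st7, A1, False, V A4 A1 A3 A5 A0 A2 A6),
    (st8, A2, False, V A6 A5 A4 A3 A2 A1 A0),
    (st11, A0, False, V A3 A4 A5 A6 A0 A1 A2),
    (st10, A4, False, V A5 A1 A2 A4 A6 A0 A3),
    (st8, A2, True, V A0 A1 A2 A3 A4 A5 A6),
    (st10, A0, False, V A3 A4 A5 A6 A0 A1 A2),
    (st2, A0, False, V A5 A6 A0 A1 A2 A3 A4),
    (st9, A0, False, V A5 A6 A0 A1 A2 A3 A4),
    (st9, A0, False, V A2 A3 A4 A5 A6 A0 A1),
    (st12, A2, False, V A6 A5 A4 A3 A2 A1 A0),
    (st15, A0, False, V A0 A1 A2 A3 A4 A5 A6),
    (st7, A1, False, V A5 A0 A2 A6 A4 A1 A3),
    (st9, A4, False, V A0 A3 A5 A6 A1 A2 A4),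
    (st13, A1, False, V A3 A1 A5 A4 A0 A2 A6)]"
| "W7 A3 A6 = [(st6, A2, False, V A0 A6 A5 A4 A3 A2 A1),
    (st2, A1, True, V A3 A6 A4 A2 A0 A1 A5),
    (st9, A1, False, V A5 A1 A4 A6 A3 A0 A2),
    (st4, A2, False, V A0 A6 A5 A4 A3 A2 A1),
    (st8, A2, False, V A3 A2 A1 A0 A6 A5 A4),
    (st8, A0, True, V A4 A3 A2 A1 A0 A6 A5),
    (st8, A2, True, V A3 A4 A5 A6 A0 A1 A2),
    (st3, A0, False, V A2 A3 A4 A5 A6 A0 A1),
    (st6, A0, False, V A5 A6 A0 A1 A2 A3 A4),
    (st4, A0, False, V A5 A6 A0 A1 A2 A3 A4),
    (st15, A0, False, V A5 A6 A0 A1 A2 A3 A4),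
    (st8, A0, False, V A1 A2 A3 A4 A5 A6 A0),
    (st9, A3, False, V A4 A1 A5 A2 A0 A3 A6),
    (st9, A1, False, V A0 A2 A5 A1 A4 A6 A3),
    (st9, A3, False, V A5 A2 A0 A3 A6 A4 A1)]"
| "W7 A4 A0 = [(st2, A2, True, V A3 A4 A5 A6 A0 A1 A2),
    (st6, A4, False, V A1 A2 A3 A5 A0 A4 A6),
    (st7, A2, False, V A3 A2 A1 A0 A6 A5 A4),
    (st8, A2, True, V A1 A2 A3 A4 A5 A6 A0),
    (st9, A4, False, V A5 A6 A1 A2 A4 A0 A3),
    (st12, A2, False, V A2 A1 A0 A6 A5 A4 A3),
    (st2, A1, True, V A0 A1 A5 A3 A6 A4 A2),
    (st10, A4, False, V A1 A2 A4 A6 A0 A3 A5),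
    (st10, A2, False, V A0 A6 A5 A4 A3 A2 A1),
    (st7, A2, False, V A5 A4 A3 A2 A1 A0 A6),
    (st11, A0, False, V A4 A5 A6 A0 A1 A2 A3),
    (st13, A1, False, V A5 A4 A0 A2 A6 A3 A1),
    (st1, A1, False, V A6 A5 A3 A1 A0 A2 A4)]"
| "W7 A4 A3 = [(st3, A0, True, V A3 A2 A1 A0 A6 A5 A4),
    (st7, A0, False, V A4 A5 A6 A0 A1 A2 A3),
    (st13, A1, False, V A0 A2 A6 A3 A1 A5 A4),
    (st1, A1, False, V A3 A1 A0 A2 A4 A6 A5),
    (st2, A0, False, V A6 A0 A1 A2 A3 A4 A5),
    (st3, A0, False, V A6 A0 A1 A2 A3 A4 A5),
    (st9, A0, False, V A3 A4 A5 A6 A0 A1 A2),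
    (st2, A0, True, V A3 A2 A1 A0 A6 A5 A4),
    (st10, A0, False, V A6 A0 A1 A2 A3 A4 A5),
    (st9, A0, False, V A6 A0 A1 A2 A3 A4 A5),
    (st13, A0, False, V A6 A0 A1 A2 A3 A4 A5),
    (st11, A0, False, V A6 A0 A1 A2 A3 A4 A5),
    (st1, A1, False, V A2 A4 A6 A5 A3 A1 A0),
    (st10, A0, False, V A4 A5 A6 A0 A1 A2 A3),
    (st7, A0, False, V A2 A3 A4 A5 A6 A0 A1)]"
| "W7 A4 A5 = [(st12, A0, False, V A3 A4 A5 A6 A0 A1 A2),
    (st9, A5, False, V A6 A5 A3 A0 A4 A2 A1),
    (st7, A1, False, V A0 A2 A6 A4 A1 A3 A5),
    (st15, A0, False, V A2 A3 A4 A5 A6 A0 A1),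
    (st13, A0, False, V A1 A2 A3 A4 A5 A6 A0),
    (st13, A1, False, V A1 A5 A4 A0 A2 A6 A3),
    (st6, A4, False, V A6 A1 A2 A3 A5 A0 A4),
    (st12, A2, False, V A3 A2 A1 A0 A6 A5 A4),
    (st9, A4, False, V A3 A5 A6 A1 A2 A4 A0),
    (st5, A1, False, V A0 A2 A4 A6 A1 A3 A5),
    (st12, A0, False, V A1 A2 A3 A4 A5 A6 A0),
    (st12, A2, False, V A5 A4 A3 A2 A1 A0 A6),
    (st15, A0, False, V A1 A2 A3 A4 A5 A6 A0),
    (st12, A0, False, V A2 A3 A4 A5 A6 A0 A1),
    (st12, A2, False, V A4 A3 A2 A1 A0 A6 A5),
    (st6, A4, False, V A4 A6 A1 A2 A3 A5 A0)]"
| "W7 A4 A6 = [(st10, A2, False, V A5 A4 A3 A2 A1 A0 A6),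
    (st9, A2, False, V A4 A3 A2 A1 A0 A6 A5),
    (st12, A0, False, V A4 A5 A6 A0 A1 A2 A3),
    (st10, A5, False, V A2 A1 A5 A3 A0 A6 A4),
    (st2, A1, False, V A6 A3 A5 A1 A0 A2 A4),
    (st9, A2, False, V A0 A6 A5 A4 A3 A2 A1),
    (st2, A2, False, V A0 A6 A5 A4 A3 A2 A1),
    (st8, A0, False, V A4 A5 A6 A0 A1 A2 A3),
    (st9, A5, False, V A5 A3 A0 A4 A2 A1 A6),
    (st7, A1, False, V A1 A3 A5 A0 A2 A6 A4),
    (st7, A1, False, V A2 A6 A4 A1 A3 A5 A0),
    (st11, A0, False, V A1 A2 A3 A4 A5 A6 A0),
    (st15, A0, False, V A3 A4 A5 A6 A0 A1 A2),
    (st8, A2, False, V A5 A4 A3 A2 A1 A0 A6),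
    (st8, A0, True, V A1 A0 A6 A5 A4 A3 A2),
    (st13, A0, False, V A2 A3 A4 A5 A6 A0 A1)]"
| "W7 A5 A0 = [(st2, A2, False, V A6 A5 A4 A3 A2 A1 A0),
    (st6, A2, False, V A3 A2 A1 A0 A6 A5 A4),
    (st4, A2, False, V A6 A5 A4 A3 A2 A1 A0),
    (st9, A5, False, V A3 A0 A4 A2 A1 A6 A5),
    (st1, A0, False, V A5 A6 A0 A1 A2 A3 A4),
    (st8, A2, False, V A2 A1 A0 A6 A5 A4 A3),
    (st8, A0, False, V A5 A6 A0 A1 A2 A3 A4),
    (st3, A0, True, V A1 A0 A6 A5 A4 A3 A2),
    (st9, A2, False, V A6 A5 A4 A3 A2 A1 A0),
    (st9, A2, False, V A2 A1 A0 A6 A5 A4 A3),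
    (st10, A2, False, V A2 A1 A0 A6 A5 A4 A3),
    (st2, A2, True, V A1 A2 A3 A4 A5 A6 A0)]"
| "W7 A5 A3 = [(st10, A5, False, V A5 A3 A0 A6 A4 A2 A1),
    (st1, A0, False, V A3 A4 A5 A6 A0 A1 A2),
    (st8, A2, True, V A4 A5 A6 A0 A1 A2 A3),
    (st9, A1, False, V A4 A6 A3 A0 A2 A5 A1),
    (st3, A0, False, V A3 A4 A5 A6 A0 A1 A2),
    (st0, A0, False, V A6 A0 A1 A2 A3 A4 A5),
    (st2, A1, False, V A5 A1 A0 A2 A4 A6 A3),
    (st7, A0, False, V A6 A0 A1 A2 A3 A4 A5),
    (st4, A0, False, V A6 A0 A1 A2 A3 A4 A5),
    (st6, A0, False, V A6 A0 A1 A2 A3 A4 A5),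
    (st4, A0, False, V A2 A3 A4 A5 A6 A0 A1),
    (st12, A0, False, V A6 A0 A1 A2 A3 A4 A5),
    (st9, A5, False, V A2 A1 A6 A5 A3 A0 A4),
    (st8, A0, True, V A3 A2 A1 A0 A6 A5 A4),
    (st10, A5, False, V A6 A4 A2 A1 A5 A3 A0),
    (st2, A1, True, V A4 A2 A0 A1 A5 A3 A6)]"
| "W7 A5 A4 = [(st9, A1, False, V A2 A5 A1 A4 A6 A3 A0),
    (st8, A2, False, V A4 A3 A2 A1 A0 A6 A5),
    (st15, A0, False, V A4 A5 A6 A0 A1 A2 A3),
    (st9, A1, False, V A3 A0 A2 A5 A1 A4 A6),
    (st9, A3, False, V A1 A5 A2 A0 A3 A6 A4),
    (st13, A0, False, V A3 A4 A5 A6 A0 A1 A2),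
    (st9, A3, False, V A2 A0 A3 A6 A4 A1 A5),
    (st8, A0, True, V A0 A6 A5 A4 A3 A2 A1),
    (st15, A0, False, V A6 A0 A1 A2 A3 A4 A5),
    (st7, A1, False, V A3 A5 A0 A2 A6 A4 A1),
    (st13, A1, False, V A6 A3 A1 A5 A4 A0 A2),
    (st7, A1, False, V A6 A4 A1 A3 A5 A0 A2),
    (st8, A0, False, V A2 A3 A4 A5 A6 A0 A1),
    (st8, A2, True, V A6 A0 A1 A2 A3 A4 A5),
    (st11, A0, False, V A2 A3 A4 A5 A6 A0 A1)]"
| "W7 A5 A6 = [(st14, A1, False, V A0 A3 A6 A2 A5 A1 A4),
    (st6, A2, False, V A6 A5 A4 A3 A2 A1 A0),
    (st10, A2, False, V A4 A3 A2 A1 A0 A6 A5),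
    (st6, A2, False, V A5 A4 A3 A2 A1 A0 A6),
    (st9, A2, False, V A3 A2 A1 A0 A6 A5 A4),
    (st10, A2, False, V A3 A2 A1 A0 A6 A5 A4),
    (st6, A2, False, V A4 A3 A2 A1 A0 A6 A5),
    (st12, A0, False, V A5 A6 A0 A1 A2 A3 A4),
    (st10, A5, False, V A0 A6 A4 A2 A1 A5 A3),
    (st2, A1, True, V A6 A4 A2 A0 A1 A5 A3),
    (st9, A1, False, V A1 A4 A6 A3 A0 A2 A5),
    (st10, A5, False, V A1 A5 A3 A0 A6 A4 A2),
    (st2, A1, False, V A3 A5 A1 A0 A2 A4 A6),
    (st0, A0, False, V A5 A6 A0 A1 A2 A3 A4)]"
| "W7 A6 A0 = [(st5, A2, False, V A0 A6 A5 A4 A3 A2 A1),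
    (st2, A2, True, V A4 A5 A6 A0 A1 A2 A3),
    (st2, A2, False, V A5 A4 A3 A2 A1 A0 A6),
    (st2, A2, True, V A5 A6 A0 A1 A2 A3 A4),
    (st2, A2, False, V A4 A3 A2 A1 A0 A6 A5),
    (st6, A4, False, V A2 A3 A5 A0 A4 A6 A1),
    (st0, A0, False, V A1 A2 A3 A4 A5 A6 A0),
    (st0, A2, False, V A5 A4 A3 A2 A1 A0 A6),
    (st6, A2, False, V A2 A1 A0 A6 A5 A4 A3),
    (st4, A2, False, V A2 A1 A0 A6 A5 A4 A3),
    (st7, A2, False, V A2 A1 A0 A6 A5 A4 A3),
    (st4, A2, False, V A5 A4 A3 A2 A1 A0 A6)]"
| "W7 A6 A3 = [(st2, A2, True, V A6 A0 A1 A2 A3 A4 A5),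
    (st9, A5, False, V A0 A4 A2 A1 A6 A5 A3),
    (st1, A0, False, V A1 A2 A3 A4 A5 A6 A0),
    (st2, A2, False, V A3 A2 A1 A0 A6 A5 A4),
    (st1, A2, False, V A3 A2 A1 A0 A6 A5 A4),
    (st1, A0, False, V A6 A0 A1 A2 A3 A4 A5),
    (st6, A4, False, V A3 A5 A0 A4 A6 A1 A2),
    (st0, A0, False, V A2 A3 A4 A5 A6 A0 A1),
    (st0, A2, False, V A4 A3 A2 A1 A0 A6 A5),
    (st2, A0, False, V A1 A2 A3 A4 A5 A6 A0),
    (st2, A0, True, V A0 A6 A5 A4 A3 A2 A1),
    (st9, A4, False, V A2 A4 A0 A3 A5 A6 A1),
    (st8, A2, False, V A1 A0 A6 A5 A4 A3 A2),
    (st8, A0, False, V A6 A0 A1 A2 A3 A4 A5),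
    (st1, A2, False, V A1 A0 A6 A5 A4 A3 A2),
    (st3, A0, True, V A0 A6 A5 A4 A3 A2 A1)]"
| "W7 A6 A4 = [(st6, A2, False, V A1 A0 A6 A5 A4 A3 A2),
    (st4, A2, False, V A1 A0 A6 A5 A4 A3 A2),
    (st8, A0, True, V A5 A4 A3 A2 A1 A0 A6),
    (st8, A2, True, V A2 A3 A4 A5 A6 A0 A1),
    (st3, A0, False, V A1 A2 A3 A4 A5 A6 A0),
    (st7, A2, False, V A1 A0 A6 A5 A4 A3 A2),
    (st4, A2, False, V A4 A3 A2 A1 A0 A6 A5),
    (st9, A4, False, V A6 A1 A2 A4 A0 A3 A5),
    (st1, A2, False, V A5 A4 A3 A2 A1 A0 A6),
    (st12, A2, False, V A1 A0 A6 A5 A4 A3 A2),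
    (st2, A1, False, V A0 A2 A4 A6 A3 A5 A1),
    (st10, A4, False, V A0 A3 A5 A1 A2 A4 A6),
    (st9, A3, False, V A3 A6 A4 A1 A5 A2 A0),
    (st2, A1, True, V A1 A5 A3 A6 A4 A2 A0),
    (st10, A4, False, V A2 A4 A6 A0 A3 A5 A1),
    (st0, A2, False, V A1 A0 A6 A5 A4 A3 A2)]"
| "W7 A6 A5 = [(st10, A2, False, V A6 A5 A4 A3 A2 A1 A0),
    (st9, A2, False, V A5 A4 A3 A2 A1 A0 A6),
    (st9, A2, False, V A1 A0 A6 A5 A4 A3 A2),
    (st2, A2, False, V A1 A0 A6 A5 A4 A3 A2),
    (st10, A2, False, V A1 A0 A6 A5 A4 A3 A2),
    (st7, A2, False, V A6 A5 A4 A3 A2 A1 A0),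
    (st7, A2, False, V A4 A3 A2 A1 A0 A6 A5),
    (st2, A2, True, V A2 A3 A4 A5 A6 A0 A1),
    (st13, A0, False, V A5 A6 A0 A1 A2 A3 A4),
    (st11, A0, False, V A5 A6 A0 A1 A2 A3 A4),
    (st1, A1, False, V A0 A2 A4 A6 A5 A3 A1),
    (st13, A1, False, V A4 A0 A2 A6 A3 A1 A5),
    (st3, A0, True, V A4 A3 A2 A1 A0 A6 A5),
    (st3, A0, False, V A5 A6 A0 A1 A2 A3 A4),
    (st1, A1, False, V A5 A3 A1 A0 A2 A4 A6)]"
| "W7 _ _ = []"

fun W223 :: "s7 \<Rightarrow> s7 \<Rightarrow> ((s7 v7 \<times> s7 v7) \<times> s7 \<times> bool \<times> s7 v7) list" where
  "W223 A2 A3 = [(st16, A0, False, V A0 A1 A2 A3 A4 A5 A6),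
    (st0, A1, False, V A3 A5 A4 A6 A0 A2 A1),
    (st0, A1, False, V A3 A5 A4 A6 A1 A0 A2),
    (st0, A1, False, V A3 A5 A4 A6 A2 A1 A0),
    (st0, A1, False, V A5 A3 A6 A4 A0 A2 A1),
    (st12, A4, False, V A4 A0 A3 A6 A2 A5 A1),
    (st12, A4, False, V A0 A4 A6 A3 A5 A1 A2),
    (st0, A1, False, V A5 A3 A6 A4 A1 A0 A2),
    (st12, A4, False, V A0 A4 A6 A3 A2 A5 A1),
    (st12, A4, False, V A4 A0 A3 A6 A1 A2 A5),
    (st0, A1, False, V A5 A3 A6 A4 A2 A1 A0),
    (st12, A4, False, V A4 A0 A3 A6 A5 A1 A2),
    (st12, A4, False, V A0 A4 A6 A3 A1 A2 A5)]"
| "W223 A2 A4 = [(st11, A3, False, V A0 A2 A3 A6 A1 A4 A5),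
    (st11, A3, False, V A3 A6 A0 A2 A4 A5 A1),
    (st0, A1, False, V A4 A6 A5 A3 A0 A2 A1),
    (st8, A1, True, V A2 A0 A1 A4 A6 A3 A5),
    (st8, A1, False, V A0 A2 A1 A4 A3 A6 A5),
    (st8, A1, False, V A1 A4 A2 A0 A5 A3 A6),
    (st11, A1, False, V A6 A3 A0 A2 A4 A1 A5),
    (st4, A1, False, V A6 A4 A0 A2 A5 A1 A3),
    (st15, A3, False, V A3 A0 A1 A5 A4 A6 A2),
    (st15, A1, False, V A0 A3 A1 A5 A4 A2 A6),
    (st8, A1, True, V A1 A4 A0 A2 A3 A5 A6),
    (st11, A1, False, V A2 A0 A3 A6 A1 A5 A4),
    (st10, A3, False, V A6 A3 A4 A1 A0 A5 A2),
    (st17, A0, False, V A0 A1 A2 A3 A4 A5 A6),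
    (st10, A1, False, V A3 A6 A4 A1 A0 A2 A5)]"
| "W223 A2 A5 = [(st11, A3, False, V A3 A6 A0 A2 A1 A4 A5),
    (st11, A3, False, V A0 A2 A3 A6 A5 A1 A4),
    (st0, A1, False, V A4 A6 A5 A3 A1 A0 A2),
    (st8, A1, False, V A0 A2 A1 A4 A5 A3 A6),
    (st8, A1, True, V A2 A0 A1 A4 A5 A6 A3),
    (st8, A1, True, V A1 A4 A0 A2 A6 A3 A5),
    (st11, A1, False, V A2 A0 A3 A6 A4 A1 A5),
    (st17, A0, False, V A0 A1 A2 A3 A6 A4 A5),
    (st10, A1, False, V A3 A6 A4 A1 A5 A0 A2),
    (st10, A3, False, V A6 A3 A4 A1 A2 A0 A5),
    (st8, A1, False, V A1 A4 A2 A0 A6 A5 A3),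
    (st11, A1, False, V A6 A3 A0 A2 A5 A4 A1),
    (st15, A1, False, V A0 A3 A1 A5 A6 A4 A2),
    (st4, A1, False, V A6 A4 A0 A2 A3 A5 A1),
    (st15, A3, False, V A3 A0 A1 A5 A2 A4 A6)]"
| "W223 A2 A6 = [(st11, A3, False, V A0 A2 A3 A6 A4 A5 A1),
    (st11, A3, False, V A3 A6 A0 A2 A5 A1 A4),
    (st0, A1, False, V A4 A6 A5 A3 A2 A1 A0),
    (st8, A1, True, V A2 A0 A1 A4 A3 A5 A6),
    (st8, A1, False, V A0 A2 A1 A4 A6 A5 A3),
    (st8, A1, False, V A1 A4 A2 A0 A3 A6 A5),
    (st11, A1, False, V A6 A3 A0 A2 A1 A5 A4),
    (st15, A3, False, V A3 A0 A1 A5 A6 A2 A4),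
    (st15, A1, False, V A0 A3 A1 A5 A2 A6 A4),
    (st4, A1, False, V A6 A4 A0 A2 A1 A3 A5),
    (st8, A1, True, V A1 A4 A0 A2 A5 A6 A3),
    (st11, A1, False, V A2 A0 A3 A6 A5 A4 A1),
    (st10, A1, False, V A3 A6 A4 A1 A2 A5 A0),
    (st10, A3, False, V A6 A3 A4 A1 A5 A2 A0),
    (st17, A0, False, V A0 A1 A2 A3 A5 A6 A4)]"
| "W223 A3 A2 = [(st0, A1, False, V A5 A3 A4 A6 A0 A2 A1),
    (st0, A1, False, V A5 A3 A4 A6 A1 A0 A2),
    (st0, A1, False, V A5 A3 A4 A6 A2 A1 A0),
    (st16, A0, False, V A0 A1 A3 A2 A4 A5 A6),
    (st0, A1, False, V A3 A5 A6 A4 A0 A2 A1),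
    (st12, A4, False, V A0 A4 A3 A6 A2 A5 A1),
    (st12, A4, False, V A4 A0 A6 A3 A5 A1 A2),
    (st0, A1, False, V A3 A5 A6 A4 A1 A0 A2),
    (st12, A4, False, V A4 A0 A6 A3 A2 A5 A1),
    (st12, A4, False, V A0 A4 A3 A6 A1 A2 A5),
    (st0, A1, False, V A3 A5 A6 A4 A2 A1 A0),
    (st12, A4, False, V A0 A4 A3 A6 A5 A1 A2),
    (st12, A4, False, V A4 A0 A6 A3 A1 A2 A5)]"
| "W223 A3 A4 = [(st0, A1, False, V A4 A6 A3 A5 A0 A2 A1),
    (st8, A1, False, V A1 A4 A0 A2 A5 A3 A6),
    (st8, A1, True, V A1 A4 A2 A0 A3 A5 A6),
    (st11, A1, False, V A6 A3 A2 A0 A4 A1 A5),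
    (st11, A1, False, V A2 A0 A6 A3 A1 A5 A4),
    (st11, A3, False, V A0 A2 A6 A3 A1 A4 A5),
    (st8, A1, True, V A2 A0 A4 A1 A6 A3 A5),
    (st10, A3, False, V A6 A3 A1 A4 A0 A5 A2),
    (st17, A0, False, V A0 A1 A3 A2 A4 A5 A6),
    (st10, A1, False, V A3 A6 A1 A4 A0 A2 A5),
    (st11, A3, False, V A3 A6 A2 A0 A4 A5 A1),
    (st8, A1, False, V A0 A2 A4 A1 A3 A6 A5),
    (st4, A1, False, V A6 A4 A2 A0 A5 A1 A3),
    (st15, A3, False, V A3 A0 A5 A1 A4 A6 A2),
    (st15, A1, False, V A0 A3 A5 A1 A4 A2 A6)]"
| "W223 A3 A5 = [(st0, A1, False, V A4 A6 A3 A5 A1 A0 A2),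
    (st8, A1, True, V A1 A4 A2 A0 A6 A3 A5),
    (st8, A1, False, V A1 A4 A0 A2 A6 A5 A3),
    (st11, A1, False, V A2 A0 A6 A3 A4 A1 A5),
    (st11, A1, False, V A6 A3 A2 A0 A5 A4 A1),
    (st11, A3, False, V A3 A6 A2 A0 A1 A4 A5),
    (st8, A1, False, V A0 A2 A4 A1 A5 A3 A6),
    (st15, A1, False, V A0 A3 A5 A1 A6 A4 A2),
    (st4, A1, False, V A6 A4 A2 A0 A3 A5 A1),
    (st15, A3, False, V A3 A0 A5 A1 A2 A4 A6),
    (st11, A3, False, V A0 A2 A6 A3 A5 A1 A4),
    (st8, A1, True, V A2 A0 A4 A1 A5 A6 A3),
    (st17, A0, False, V A0 A1 A3 A2 A6 A4 A5),
    (st10, A1, False, V A3 A6 A1 A4 A5 A0 A2),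
    (st10, A3, False, V A6 A3 A1 A4 A2 A0 A5)]"
| "W223 A3 A6 = [(st0, A1, False, V A4 A6 A3 A5 A2 A1 A0),
    (st8, A1, False, V A1 A4 A0 A2 A3 A6 A5),
    (st8, A1, True, V A1 A4 A2 A0 A5 A6 A3),
    (st11, A1, False, V A6 A3 A2 A0 A1 A5 A4),
    (st11, A1, False, V A2 A0 A6 A3 A5 A4 A1),
    (st11, A3, False, V A0 A2 A6 A3 A4 A5 A1),
    (st8, A1, True, V A2 A0 A4 A1 A3 A5 A6),
    (st10, A1, False, V A3 A6 A1 A4 A2 A5 A0),
    (st10, A3, False, V A6 A3 A1 A4 A5 A2 A0),
    (st17, A0, False, V A0 A1 A3 A2 A5 A6 A4),
    (st11, A3, False, V A3 A6 A2 A0 A5 A1 A4),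
    (st8, A1, False, V A0 A2 A4 A1 A6 A5 A3),
    (st15, A3, False, V A3 A0 A5 A1 A6 A2 A4),
    (st15, A1, False, V A0 A3 A5 A1 A2 A6 A4),
    (st4, A1, False, V A6 A4 A2 A0 A1 A3 A5)]"
| "W223 A4 A2 = [(st0, A1, False, V A6 A4 A5 A3 A0 A2 A1),
    (st8, A1, True, V A0 A2 A1 A4 A6 A3 A5),
    (st8, A1, False, V A2 A0 A1 A4 A3 A6 A5),
    (st11, A3, False, V A2 A0 A3 A6 A1 A4 A5),
    (st11, A3, False, V A6 A3 A0 A2 A4 A5 A1),
    (st11, A1, False, V A3 A6 A0 A2 A4 A1 A5),
    (st8, A1, False, V A4 A1 A2 A0 A5 A3 A6),
    (st15, A3, False, V A0 A3 A1 A5 A4 A6 A2),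
    (st4, A1, False, V A4 A6 A0 A2 A5 A1 A3),
    (st15, A1, False, V A3 A0 A1 A5 A4 A2 A6),
    (st11, A1, False, V A0 A2 A3 A6 A1 A5 A4),
    (st8, A1, True, V A4 A1 A0 A2 A3 A5 A6),
    (st17, A0, False, V A1 A0 A2 A3 A4 A5 A6),
    (st10, A3, False, V A3 A6 A4 A1 A0 A5 A2),
    (st10, A1, False, V A6 A3 A4 A1 A0 A2 A5)]"
| "W223 A4 A3 = [(st11, A1, False, V A3 A6 A2 A0 A4 A1 A5),
    (st11, A1, False, V A0 A2 A6 A3 A1 A5 A4),
    (st0, A1, False, V A6 A4 A3 A5 A0 A2 A1),
    (st8, A1, False, V A4 A1 A0 A2 A5 A3 A6),
    (st8, A1, True, V A4 A1 A2 A0 A3 A5 A6),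
    (st8, A1, True, V A0 A2 A4 A1 A6 A3 A5),
    (st11, A3, False, V A2 A0 A6 A3 A1 A4 A5),
    (st17, A0, False, V A1 A0 A3 A2 A4 A5 A6),
    (st10, A3, False, V A3 A6 A1 A4 A0 A5 A2),
    (st10, A1, False, V A6 A3 A1 A4 A0 A2 A5),
    (st8, A1, False, V A2 A0 A4 A1 A3 A6 A5),
    (st11, A3, False, V A6 A3 A2 A0 A4 A5 A1),
    (st15, A3, False, V A0 A3 A5 A1 A4 A6 A2),
    (st4, A1, False, V A4 A6 A2 A0 A5 A1 A3),
    (st15, A1, False, V A3 A0 A5 A1 A4 A2 A6)]"
| "W223 A4 A5 = [(st12, A4, False, V A3 A6 A4 A0 A2 A5 A1),
    (st4, A1, False, V A0 A2 A6 A4 A1 A3 A5),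
    (st15, A3, False, V A1 A5 A3 A0 A6 A2 A4),
    (st15, A1, False, V A1 A5 A0 A3 A2 A6 A4),
    (st12, A4, False, V A3 A6 A0 A4 A2 A5 A1),
    (st17, A0, False, V A3 A2 A0 A1 A5 A6 A4),
    (st10, A1, False, V A1 A4 A3 A6 A2 A5 A0),
    (st10, A3, False, V A1 A4 A6 A3 A5 A2 A0),
    (st4, A1, False, V A0 A2 A4 A6 A1 A3 A5),
    (st15, A1, False, V A1 A5 A3 A0 A2 A6 A4),
    (st15, A3, False, V A1 A5 A0 A3 A6 A2 A4),
    (st17, A0, False, V A3 A2 A1 A0 A5 A6 A4),
    (st10, A3, False, V A1 A4 A3 A6 A5 A2 A0),
    (st10, A1, False, V A1 A4 A6 A3 A2 A5 A0)]"
| "W223 A4 A6 = [(st12, A4, False, V A6 A3 A0 A4 A5 A1 A2),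
    (st10, A3, False, V A4 A1 A6 A3 A2 A0 A5),
    (st17, A0, False, V A2 A3 A0 A1 A6 A4 A5),
    (st10, A1, False, V A4 A1 A3 A6 A5 A0 A2),
    (st12, A4, False, V A6 A3 A4 A0 A5 A1 A2),
    (st15, A3, False, V A5 A1 A3 A0 A2 A4 A6),
    (st15, A1, False, V A5 A1 A0 A3 A6 A4 A2),
    (st4, A1, False, V A2 A0 A6 A4 A3 A5 A1),
    (st10, A3, False, V A4 A1 A3 A6 A2 A0 A5),
    (st10, A1, False, V A4 A1 A6 A3 A5 A0 A2),
    (st17, A0, False, V A2 A3 A1 A0 A6 A4 A5),
    (st15, A3, False, V A5 A1 A0 A3 A2 A4 A6),
    (st4, A1, False, V A2 A0 A4 A6 A3 A5 A1),
    (st15, A1, False, V A5 A1 A3 A0 A6 A4 A2)]"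
| "W223 A5 A2 = [(st0, A1, False, V A6 A4 A5 A3 A1 A0 A2),
    (st8, A1, False, V A2 A0 A1 A4 A5 A3 A6),
    (st8, A1, True, V A0 A2 A1 A4 A5 A6 A3),
    (st11, A3, False, V A6 A3 A0 A2 A1 A4 A5),
    (st11, A3, False, V A2 A0 A3 A6 A5 A1 A4),
    (st11, A1, False, V A0 A2 A3 A6 A4 A1 A5),
    (st8, A1, True, V A4 A1 A0 A2 A6 A3 A5),
    (st10, A1, False, V A6 A3 A4 A1 A5 A0 A2),
    (st17, A0, False, V A1 A0 A2 A3 A6 A4 A5),
    (st10, A3, False, V A3 A6 A4 A1 A2 A0 A5),
    (st11, A1, False, V A3 A6 A0 A2 A5 A4 A1),
    (st8, A1, False, V A4 A1 A2 A0 A6 A5 A3),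
    (st4, A1, False, V A4 A6 A0 A2 A3 A5 A1),
    (st15, A1, False, V A3 A0 A1 A5 A6 A4 A2),
    (st15, A3, False, V A0 A3 A1 A5 A2 A4 A6)]"
| "W223 A5 A3 = [(st11, A1, False, V A0 A2 A6 A3 A4 A1 A5),
    (st11, A1, False, V A3 A6 A2 A0 A5 A4 A1),
    (st0, A1, False, V A6 A4 A3 A5 A1 A0 A2),
    (st8, A1, True, V A4 A1 A2 A0 A6 A3 A5),
    (st8, A1, False, V A4 A1 A0 A2 A6 A5 A3),
    (st8, A1, False, V A2 A0 A4 A1 A5 A3 A6),
    (st11, A3, False, V A6 A3 A2 A0 A1 A4 A5),
    (st4, A1, False, V A4 A6 A2 A0 A3 A5 A1),
    (st15, A1, False, V A3 A0 A5 A1 A6 A4 A2),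
    (st15, A3, False, V A0 A3 A5 A1 A2 A4 A6),
    (st8, A1, True, V A0 A2 A4 A1 A5 A6 A3),
    (st11, A3, False, V A2 A0 A6 A3 A5 A1 A4),
    (st10, A1, False, V A6 A3 A1 A4 A5 A0 A2),
    (st17, A0, False, V A1 A0 A3 A2 A6 A4 A5),
    (st10, A3, False, V A3 A6 A1 A4 A2 A0 A5)]"
| "W223 A5 A4 = [(st12, A4, False, V A6 A3 A0 A4 A2 A5 A1),
    (st17, A0, False, V A2 A3 A0 A1 A5 A6 A4),
    (st10, A1, False, V A4 A1 A3 A6 A2 A5 A0),
    (st10, A3, False, V A4 A1 A6 A3 A5 A2 A0),
    (st12, A4, False, V A6 A3 A4 A0 A2 A5 A1),
    (st4, A1, False, V A2 A0 A6 A4 A1 A3 A5),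
    (st15, A3, False, V A5 A1 A3 A0 A6 A2 A4),
    (st15, A1, False, V A5 A1 A0 A3 A2 A6 A4),
    (st17, A0, False, V A2 A3 A1 A0 A5 A6 A4),
    (st10, A3, False, V A4 A1 A3 A6 A5 A2 A0),
    (st10, A1, False, V A4 A1 A6 A3 A2 A5 A0),
    (st4, A1, False, V A2 A0 A4 A6 A1 A3 A5),
    (st15, A1, False, V A5 A1 A3 A0 A2 A6 A4),
    (st15, A3, False, V A5 A1 A0 A3 A6 A2 A4)]"
| "W223 A5 A6 = [(st12, A4, False, V A3 A6 A4 A0 A1 A2 A5),
    (st15, A1, False, V A1 A5 A0 A3 A4 A2 A6),
    (st4, A1, False, V A0 A2 A6 A4 A5 A1 A3),
    (st15, A3, False, V A1 A5 A3 A0 A4 A6 A2),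
    (st12, A4, False, V A3 A6 A0 A4 A1 A2 A5),
    (st10, A1, False, V A1 A4 A3 A6 A0 A2 A5),
    (st10, A3, False, V A1 A4 A6 A3 A0 A5 A2),
    (st17, A0, False, V A3 A2 A0 A1 A4 A5 A6),
    (st15, A1, False, V A1 A5 A3 A0 A4 A2 A6),
    (st15, A3, False, V A1 A5 A0 A3 A4 A6 A2),
    (st4, A1, False, V A0 A2 A4 A6 A5 A1 A3),
    (st10, A1, False, V A1 A4 A6 A3 A0 A2 A5),
    (st17, A0, False, V A3 A2 A1 A0 A4 A5 A6),
    (st10, A3, False, V A1 A4 A3 A6 A0 A5 A2)]"
| "W223 A6 A2 = [(st0, A1, False, V A6 A4 A5 A3 A2 A1 A0),
    (st8, A1, True, V A0 A2 A1 A4 A3 A5 A6),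
    (st8, A1, False, V A2 A0 A1 A4 A6 A5 A3),
    (st11, A3, False, V A2 A0 A3 A6 A4 A5 A1),
    (st11, A3, False, V A6 A3 A0 A2 A5 A1 A4),
    (st11, A1, False, V A3 A6 A0 A2 A1 A5 A4),
    (st8, A1, False, V A4 A1 A2 A0 A3 A6 A5),
    (st15, A1, False, V A3 A0 A1 A5 A2 A6 A4),
    (st15, A3, False, V A0 A3 A1 A5 A6 A2 A4),
    (st4, A1, False, V A4 A6 A0 A2 A1 A3 A5),
    (st11, A1, False, V A0 A2 A3 A6 A5 A4 A1),
    (st8, A1, True, V A4 A1 A0 A2 A5 A6 A3),
    (st10, A3, False, V A3 A6 A4 A1 A5 A2 A0),
    (st10, A1, False, V A6 A3 A4 A1 A2 A5 A0),
    (st17, A0, False, V A1 A0 A2 A3 A5 A6 A4)]"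
| "W223 A6 A3 = [(st11, A1, False, V A3 A6 A2 A0 A1 A5 A4),
    (st11, A1, False, V A0 A2 A6 A3 A5 A4 A1),
    (st0, A1, False, V A6 A4 A3 A5 A2 A1 A0),
    (st8, A1, False, V A4 A1 A0 A2 A3 A6 A5),
    (st8, A1, True, V A4 A1 A2 A0 A5 A6 A3),
    (st8, A1, True, V A0 A2 A4 A1 A3 A5 A6),
    (st11, A3, False, V A2 A0 A6 A3 A4 A5 A1),
    (st10, A3, False, V A3 A6 A1 A4 A5 A2 A0),
    (st10, A1, False, V A6 A3 A1 A4 A2 A5 A0),
    (st17, A0, False, V A1 A0 A3 A2 A5 A6 A4),
    (st8, A1, False, V A2 A0 A4 A1 A6 A5 A3),
    (st11, A3, False, V A6 A3 A2 A0 A5 A1 A4),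
    (st15, A1, False, V A3 A0 A5 A1 A2 A6 A4),
    (st15, A3, False, V A0 A3 A5 A1 A6 A2 A4),
    (st4, A1, False, V A4 A6 A2 A0 A1 A3 A5)]"
| "W223 A6 A4 = [(st12, A4, False, V A3 A6 A4 A0 A5 A1 A2),
    (st15, A3, False, V A1 A5 A3 A0 A2 A4 A6),
    (st15, A1, False, V A1 A5 A0 A3 A6 A4 A2),
    (st4, A1, False, V A0 A2 A6 A4 A3 A5 A1),
    (st12, A4, False, V A3 A6 A0 A4 A5 A1 A2),
    (st10, A3, False, V A1 A4 A6 A3 A2 A0 A5),
    (st17, A0, False, V A3 A2 A0 A1 A6 A4 A5),
    (st10, A1, False, V A1 A4 A3 A6 A5 A0 A2),
    (st15, A3, False, V A1 A5 A0 A3 A2 A4 A6),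
    (st4, A1, False, V A0 A2 A4 A6 A3 A5 A1),
    (st15, A1, False, V A1 A5 A3 A0 A6 A4 A2),
    (st10, A3, False, V A1 A4 A3 A6 A2 A0 A5),
    (st10, A1, False, V A1 A4 A6 A3 A5 A0 A2),
    (st17, A0, False, V A3 A2 A1 A0 A6 A4 A5)]"
| "W223 A6 A5 = [(st12, A4, False, V A6 A3 A0 A4 A1 A2 A5),
    (st10, A1, False, V A4 A1 A3 A6 A0 A2 A5),
    (st10, A3, False, V A4 A1 A6 A3 A0 A5 A2),
    (st17, A0, False, V A2 A3 A0 A1 A4 A5 A6),
    (st12, A4, False, V A6 A3 A4 A0 A1 A2 A5),
    (st15, A1, False, V A5 A1 A0 A3 A4 A2 A6),
    (st4, A1, False, V A2 A0 A6 A4 A5 A1 A3),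
    (st15, A3, False, V A5 A1 A3 A0 A4 A6 A2),
    (st10, A1, False, V A4 A1 A6 A3 A0 A2 A5),
    (st17, A0, False, V A2 A3 A1 A0 A4 A5 A6),
    (st10, A3, False, V A4 A1 A3 A6 A0 A5 A2),
    (st15, A1, False, V A5 A1 A3 A0 A4 A2 A6),
    (st15, A3, False, V A5 A1 A0 A3 A4 A6 A2),
    (st4, A1, False, V A2 A0 A4 A6 A5 A1 A3)]"
| "W223 _ _ = []"

section \<open>Every plane contains a starting pair\<close>

definition tn :: "s7 v7 v7 \<times> s7 v7 v7 \<Rightarrow> s7 \<Rightarrow> s7 \<Rightarrow> s7 \<Rightarrow> s7 \<Rightarrow> bool" where
  "tn T y z f g \<longleftrightarrow> f = fst T $ y $ z \<and> g = snd T $ y $ z"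

definition classified :: "(s7 \<Rightarrow> s7 \<Rightarrow> s7 \<Rightarrow> s7 \<Rightarrow> bool) \<Rightarrow> bool" where
  "classified N \<longleftrightarrow> (\<exists>T\<in>set types. eqv N (tn T))"

lemma classified_eqv: "eqv N M \<Longrightarrow> classified M \<Longrightarrow> classified N"
  unfolding classified_def by (blast intro: eqv_trans)

text \<open>Says that a relative position of two lines is settled. Three permutations in place of
  two keep the notion symmetric in the three coordinates; the normal form has
  \<open>u = id\<close>.\<close>

definition good :: "(s7 \<Rightarrow> s7) \<Rightarrow> (s7 \<Rightarrow> s7) \<Rightarrow> (s7 \<Rightarrow> s7) \<Rightarrow> bool" where
  "good u v w \<longleftrightarrow> (\<forall>N y0 y1. net4 N \<longrightarrow> y0 \<noteq> y1 \<longrightarrow> (\<forall>i. N y0 i i i) \<longrightarrow> (\<forall>i. N y1 (u i) (v i) (w i)) \<longrightarrow> classified N)"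

lemma good_swap12: assumes "good v u w" shows "good u v w"
  unfolding good_def
proof (intro allI impI)
  fix N :: "s7 \<Rightarrow> s7 \<Rightarrow> s7 \<Rightarrow> s7 \<Rightarrow> bool" and y0 y1
  assume N: "net4 N" "y0 \<noteq> y1" "\<forall>i. N y0 i i i" "\<forall>i. N y1 (u i) (v i) (w i)"
  have "classified (\<lambda>y z f. N y f z)"
    using assms[unfolded good_def, rule_format, of "\<lambda>y z f. N y f z" y0 y1] net4_swap2[OF N(1)] N(2-4) by simp
  then show "classified N" by (rule classified_eqv[OF eqv_swap2[OF eqv_refl]])
qed

lemma good_swap23: assumes "good u w v" shows "good u v w"
  unfolding good_def
proof (intro allI impI)
  fix N :: "s7 \<Rightarrow> s7 \<Rightarrow> s7 \<Rightarrow> s7 \<Rightarrow> bool" and y0 y1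
  assume N: "net4 N" "y0 \<noteq> y1" "\<forall>i. N y0 i i i" "\<forall>i. N y1 (u i) (v i) (w i)"
  have "classified (\<lambda>y z f g. N y z g f)"
    using assms[unfolded good_def, rule_format, of "\<lambda>y z f g. N y z g f" y0 y1] net4_swap3[OF N(1)] N(2-4) by simp
  then show "classified N" by (rule classified_eqv[OF eqv_swap3[OF eqv_refl]])
qed

text \<open>Relabelling all three coordinates by the same permutation keeps the first line diagonal
  and conjugates the second. Running through the second line in the order given by \<open>u\<close>
  makes its first permutation the identity.\<close>

lemma good_conj:
  assumes "good id s t" "bij e" "\<And>i. s (e (u i)) = e (v i)" "\<And>i. t (e (u i)) = e (w i)" "bij u"
  shows "good u v w"
  unfolding good_def
proof (intro allI impI)
  fix N :: "s7 \<Rightarrow> s7 \<Rightarrow> s7 \<Rightarrow> s7 \<Rightarrow> bool" and y0 y1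
  assume N: "net4 N" "y0 \<noteq> y1" "\<forall>i. N y0 i i i" "\<forall>i. N y1 (u i) (v i) (w i)"
  define c where "c = inv e"
  have c: "bij c" "\<And>i. c (e i) = i" "\<And>i. e (c i) = i"
    using assms(2) by (simp_all add: c_def bij_imp_bij_inv bij_is_inj bij_is_surj inv_f_f surj_f_inv_f)
  let ?M = "\<lambda>y z f g. N (id y) (c z) (c f) (c g)"
  have "?M y1 j (s j) (t j)" for j
  proof -
    obtain i where "j = e (u i)" using assms(2,5) by (metis bij_pointE)
    then show ?thesis using N(4) by (simp add: assms(3,4) c(2))
  qed
  then have "classified ?M"
    using assms(1)[unfolded good_def, rule_format, of ?M y0 y1] net4_relabel[OF N(1) bij_id c(1) c(1) c(1)] N(2,3) by simp
  then show "classified N" by (rule classified_eqv[OF eqv_relabel[OF eqv_refl bij_id c(1) c(1) c(1)]])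
qed

text \<open>The two lines change roles: relabelling by \<open>s\<close> and \<open>t\<close> makes
  the second line the diagonal, and the first line then carries the inverse permutations.\<close>

lemma good_inv:
  assumes "good id s' t'" "bij s" "bij t" "\<And>i. s (s' i) = i" "\<And>i. t (t' i) = i"
  shows "good id s t"
  unfolding good_def
proof (intro allI impI)
  fix N :: "s7 \<Rightarrow> s7 \<Rightarrow> s7 \<Rightarrow> s7 \<Rightarrow> bool" and y0 y1
  assume N: "net4 N" "y0 \<noteq> y1" "\<forall>i. N y0 i i i" "\<forall>i. N y1 (id i) (s i) (t i)"
  let ?M = "\<lambda>y z f g. N (id y) (id z) (s f) (t g)"
  have "classified ?M"
    using assms(1)[unfolded good_def, rule_format, of ?M y1 y0] net4_relabel[OF N(1) bij_id bij_id assms(2,3)] N(2-4)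
    by (simp add: assms(4,5))
  then show "classified N" by (rule classified_eqv[OF eqv_relabel[OF eqv_refl bij_id bij_id assms(2,3)]])
qed

text \<open>The six orders of three coordinates, indexed by \<open>s7\<close> so that a witness
  needs no further type; \<open>A6\<close> repeats \<open>A0\<close> to make the function
  total.\<close>

fun pick :: "s7 \<Rightarrow> 'a \<Rightarrow> 'a \<Rightarrow> 'a \<Rightarrow> 'a \<times> 'a \<times> 'a" where
  "pick A0 x y z = (x, y, z)" | "pick A1 x y z = (x, z, y)" | "pick A2 x y z = (y, x, z)"
| "pick A3 x y z = (y, z, x)" | "pick A4 x y z = (z, x, y)" | "pick A5 x y z = (z, y, x)"
| "pick A6 x y z = (x, y, z)"

lemma good_pick:
  assumes "pick k (x :: s7 v7) y z = (u, v, w)" "good (at u) (at v) (at w)"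
  shows "good (at x) (at y) (at z)"
  using assms by (cases k) (auto intro: good_swap12 good_swap23)

definition witness :: "s7 v7 \<Rightarrow> s7 v7 \<Rightarrow> (s7 v7 \<times> s7 v7) \<times> s7 \<times> bool \<times> s7 v7 \<Rightarrow> bool" where
  "witness s t = (\<lambda>(st, k, fl, e). case (if fl then pick k idv (inv7 s) (inv7 t) else pick k idv s t) of
    (u, v, w) \<Rightarrow> if every (\<lambda>i. if fst st $ (e $ (u $ i)) = e $ (v $ i) then snd st $ (e $ (u $ i)) = e $ (w $ i) else False)
      then isperm e else False)"

lemma witness_good:
  assumes w: "witness s t (st, k, fl, e)" and "good id (at (fst st)) (at (snd st))" and b: "bij (at s)" "bij (at t)"
  shows "good id (at s) (at t)"
proof -
  have idv: "at idv = id" by (simp add: fun_eq_iff)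
  have *: "good id (at s') (at t')" if "pick k idv s' t' = (u, v, w)" "bij (at s')" "bij (at t')"
    "\<And>i. fst st $ (e $ (u $ i)) = e $ (v $ i)" "\<And>i. snd st $ (e $ (u $ i)) = e $ (w $ i)" "bij (at e)" for s' t' u v w
  proof -
    have "bij (at u)" using that(1-3) by (cases k) (auto simp: idv)
    from good_conj[OF assms(2) that(6,4,5) this] have "good (at u) (at v) (at w)" .
    from good_pick[OF that(1) this] show ?thesis by (simp add: idv)
  qed
  show ?thesis
  proof (cases fl)
    case False
    obtain u v x where p: "pick k idv s t = (u, v, x)" by (metis prod_cases3)
    show ?thesis using w False p by (intro *[OF p b]) (auto simp: witness_def isperm_iff split: if_splits)
  next
    case True
    obtain u v x where p: "pick k idv (inv7 s) (inv7 t) = (u, v, x)" by (metis prod_cases3)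
    have "good id (at (inv7 s)) (at (inv7 t))" using w True p
      by (intro *[OF p bij_inv7[OF b(1)] bij_inv7[OF b(2)]]) (auto simp: witness_def isperm_iff split: if_splits)
    then show ?thesis by (rule good_inv[OF _ b]) (simp_all add: at_inv7 b)
  qed
qed

text \<open>One place of the condition that \<open>p\<close> agrees nowhere with the identity or
  with \<open>r\<close>. The second permutation of a pair of lines satisfies it because distinct
  words of a plane share at most one coordinate; stated place by place, it prunes the
  enumeration.\<close>

definition disc :: "s7 v7 \<Rightarrow> s7 \<Rightarrow> s7 v7 \<Rightarrow> bool" where
  "disc r k p = (if p $ k = k then False else p $ k \<noteq> r $ k)"

text \<open>Each even permutation is handled by a witness from the short list filed under its first
  two values, so the computation only checks conjugations and never looks for them.\<close>

lemma even_pairs7: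
  "enum (disc R7 A0) (disc R7 A1) (disc R7 A2) (disc R7 A3) (disc R7 A4) (disc R7 A5) (disc R7 A6) (\<lambda>p. if is_odd p then True else any (witness R7 p) (W7 (p $ A0) (p $ A1)))"
  by code_simp

lemma even_pairs223:
  "enum (disc R223 A0) (disc R223 A1) (disc R223 A2) (disc R223 A3) (disc R223 A4) (disc R223 A5) (disc R223 A6) (\<lambda>p. if is_odd p then True else any (witness R223 p) (W223 (p $ A0) (p $ A1)))"
  by code_simp

lemma W_starts: "x \<in> set (W7 a b) \<Longrightarrow> fst x \<in> set starts" "x \<in> set (W223 a b) \<Longrightarrow> fst x \<in> set starts"
  by (cases a; cases b; auto simp: starts_def)+

lemma good_even_pair_rep:
  assumes starts: "\<And>s t. (s, t) \<in> set starts \<Longrightarrow> good id (at s) (at t)"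
    and r: "r = R7 \<or> r = R223" and t: "bij (at t)" "\<And>i. t $ i \<noteq> i" "\<And>i. t $ i \<noteq> r $ i" "sign (at t) = 1"
  shows "good id (at r) (at t)"
proof -
  obtain a b c d e f g where p: "t = V a b c d e f g" by (cases t)
  have "bij (at R7)" "bij (at R223)" unfolding isperm_iff[symmetric] by code_simp+
  then have br: "bij (at r)" using r by blast
  have ne: "a \<noteq> A0" "b \<noteq> A1" "c \<noteq> A2" "d \<noteq> A3" "e \<noteq> A4" "f \<noteq> A5" "g \<noteq> A6"
    "a \<noteq> r $ A0" "b \<noteq> r $ A1" "c \<noteq> r $ A2" "d \<noteq> r $ A3" "e \<noteq> r $ A4" "f \<noteq> r $ A5" "g \<noteq> r $ A6"
    using t(2)[of A0] t(2)[of A1] t(2)[of A2] t(2)[of A3] t(2)[of A4] t(2)[of A5] t(2)[of A6]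
      t(3)[of A0] t(3)[of A1] t(3)[of A2] t(3)[of A3] t(3)[of A4] t(3)[of A5] t(3)[of A6] by (simp_all add: p)
  have no: "\<not> is_odd t" using is_odd_sign[OF _ t(1)] t(4) by auto
  have "\<exists>x. fst x \<in> set starts \<and> witness r t x"
  proof (cases "r = R7")
    case True
    have "if is_odd t then True else any (witness R7 t) (W7 (t $ A0) (t $ A1))"
      by (rule enumD[OF even_pairs7 t(1) p]) (use ne True in \<open>simp_all add: disc_def\<close>)
    then have "any (witness R7 t) (W7 (t $ A0) (t $ A1))" using no by simp
    then show ?thesis unfolding True any_iff using W_starts(1) by blast
  next
    case False
    then have rr: "r = R223" using r by simp
    have "if is_odd t then True else any (witness R223 t) (W223 (t $ A0) (t $ A1))"
      by (rule enumD[OF even_pairs223 t(1) p]) (use ne rr in \<open>simp_all add: disc_def\<close>)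
    then have "any (witness R223 t) (W223 (t $ A0) (t $ A1))" using no by simp
    then show ?thesis unfolding rr any_iff using W_starts(2) by blast
  qed
  then obtain s' t' k fl e where x: "(s', t') \<in> set starts" "witness r t ((s', t'), k, fl, e)"
    by (metis fst_conv surj_pair)
  then show ?thesis using witness_good[OF x(2) _ br t(1)] starts by simp
qed

text \<open>Conjugation turns the first permutation into \<open>R7\<close> or \<open>R223\<close>.
  The sign of the second is unchanged by conjugation, and so is its disagreement with the identity
  and with the first.\<close>

lemma good_even_pair:
  assumes starts: "\<And>s t. (s, t) \<in> set starts \<Longrightarrow> good id (at s) (at t)"
    and s: "bij s" "\<And>i. s i \<noteq> i" "sign s = 1"
    and t: "bij t" "\<And>i. t i \<noteq> i" "sign t = 1" and st: "\<And>i. s i \<noteq> t i"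
  shows "good id s t"
proof -
  have tab: "at (tab f) = f" for f :: "s7 \<Rightarrow> s7" by (simp add: fun_eq_iff)
  obtain r e where re: "r = R7 \<or> r = R223" "bij (at e)" "\<And>i. tab s $ (e $ i) = e $ (r $ i)"
    by (rule even_derangement[of "tab s"]) (use s tab[of s] in auto)
  define c where "c = inv (at e)"
  have c: "bij c" "\<And>i. c (e $ i) = i" "\<And>i. e $ (c i) = i"
    using re(2) by (simp_all add: c_def bij_imp_bij_inv bij_is_inj bij_is_surj inv_f_f surj_f_inv_f)
  define t' where "t' = tab (\<lambda>i. c (t (e $ i)))"
  have t'eq: "at t' = c \<circ> (t \<circ> at e)" by (simp add: t'_def fun_eq_iff)
  have bt': "bij (at t')" unfolding t'eq by (intro bij_comp re(2) t(1) c(1))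
  have sc: "sign c = sign (at e)" unfolding c_def by (rule sign_inverse) (rule permutation_s7[OF re(2)])
  have "sign (at t') = sign c * (sign t * sign (at e))"
    unfolding t'eq by (simp add: sign_compose permutation_s7 permutation_compose c(1) t(1) re(2))
  then have sgn: "sign (at t') = 1" using t(3) sc by (simp add: sign_def split: if_splits)
  have "good id (at r) (at t')"
  proof (rule good_even_pair_rep[OF starts re(1) bt' _ _ sgn])
    show "t' $ i \<noteq> i" for i using t(2)[of "e $ i"] c(3)[of "t (e $ i)"] by (auto simp: t'_def)
    show "t' $ i \<noteq> r $ i" for i
      using st[of "e $ i"] re(3)[of i] c(3)[of "t (e $ i)"] by (auto simp: t'_def)
  qed
  then show ?thesis
  proof (rule good_conj[OF _ c(1) _ _ bij_id])
    show "r $ (c (id i)) = c (s i)" for i using re(3)[of "c i"] c(2,3) by simp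
    show "t' $ (c (id i)) = c (t i)" for i using c(3) by (simp add: t'_def)
  qed
qed

theorem classification:
  assumes starts: "\<And>s t. (s, t) \<in> set starts \<Longrightarrow> good id (at s) (at t)" and N: "net4 N"
  shows "classified N"
proof -
  have "\<forall>y z. \<exists>f g. N y z f g" using net4_ex(1)[OF N] by blast
  then obtain P Q where PQ: "\<And>y z. N y z (P y z) (Q y z)" by metis
  have bP: "bij (P y)" and bQ: "bij (Q y)" for y
  proof -
    have "inj (P y)" "inj (Q y)" using net4_eq[OF N PQ PQ] by (auto intro!: injI)
    then show "bij (P y)" "bij (Q y)" by (simp_all add: bij_def finite_UNIV_inj_surj)
  qed
  \<comment> \<open>There are seven lines but only four pairs of signs, so two lines have both signs
    in common.\<close>
  define h where "h y = (sign (P y), sign (Q y))" for y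
  have sgn1: "sign p \<in> {1, - 1}" for p :: "s7 \<Rightarrow> s7" by (simp add: sign_def)
  have "range h \<subseteq> {1, - 1} \<times> {1, - 1}" unfolding h_def using sgn1 by blast
  then have "card (range h) \<le> 4" using card_mono[of "{1, - 1::int} \<times> {1, - 1::int}" "range h"] by simp
  then have "\<not> inj h" using card_image[of h UNIV] card_s7 by auto
  then obtain y0 y1 where y: "y0 \<noteq> y1" "h y0 = h y1" by (auto simp: inj_def)
  let ?M = "\<lambda>y z f g. N (id y) (id z) (P y0 f) (Q y0 g)"
  have M: "net4 ?M" by (rule net4_relabel[OF N bij_id bij_id bP bQ])
  \<comment> \<open>The position of line \<open>y1\<close> after \<open>f\<close> and
    \<open>g\<close> are labelled along line \<open>y0\<close>. Equal signs make \<open>s\<close>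
    and \<open>t\<close> even.\<close>
  define s where "s = inv (P y0) \<circ> P y1"
  define t where "t = inv (Q y0) \<circ> Q y1"
  have s: "bij s" "bij t" unfolding s_def t_def by (intro bij_comp bij_imp_bij_inv bP bQ)+
  have M0: "?M y0 i i i" for i using PQ by simp
  have M1: "?M y1 i (s i) (t i)" for i
    using PQ[of y1 i] by (simp add: s_def t_def bij_is_surj[OF bP] bij_is_surj[OF bQ] surj_f_inv_f)
  have sgn: "sign s = 1" "sign t = 1"
  proof -
    have "sign s = sign (P y0) * sign (P y1)" "sign t = sign (Q y0) * sign (Q y1)"
      unfolding s_def t_def
      by (simp_all add: sign_compose permutation_s7 bij_imp_bij_inv bP bQ sign_inverse)
    then show "sign s = 1" "sign t = 1" using y(2) by (auto simp: h_def sign_def split: if_splits)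
  qed
  have "good id s t"
  proof (rule good_even_pair[OF starts s(1) _ sgn(1) s(2) _ sgn(2)])
    show "s i \<noteq> i" for i using net4_eq[OF M M0[of i] M1[of i]] y(1) by auto
    show "t i \<noteq> i" for i using net4_eq[OF M M0[of i] M1[of i]] y(1) by auto
    show "s i \<noteq> t i" for i using net4_eq[OF M M0[of "s i"] M1[of i]] y(1) by auto
  qed
  note spec[OF spec[OF spec[OF this[unfolded good_def], of ?M], of y0], of y1]
  with M y(1) M0 M1 have "classified ?M" by auto
  then show ?thesis by (rule classified_eqv[OF eqv_relabel[OF eqv_refl bij_id bij_id bP bQ]])
qed

section \<open>Completions of a starting pair as a satisfiability problem\<close>

lemma ex1_clauses:
  assumes "\<exists>!x::s7. P x"
  shows "(P A0 \<or> P A1 \<or> P A2 \<or> P A3 \<or> P A4 \<or> P A5 \<or> P A6) \<and> (\<not> P A0 \<or> \<not> P A1) \<and> (\<not> P A0 \<or> \<not> P A2) \<and> (\<not> P A0 \<or> \<not> P A3) \<and> (\<not> P A0 \<or> \<not> P A4) \<and> (\<not> P A0 \<or> \<not> P A5) \<and> (\<not> P A0 \<or> \<not> P A6) \<and> (\<not> P A1 \<or> \<not> P A2) \<and> (\<not> P A1 \<or> \<not> P A3) \<and> (\<not> P A1 \<or> \<not> P A4) \<and> (\<not> P A1 \<or> \<not> P A5) \<and> (\<not> P A1 \<or> \<not> P A6) \<and> (\<not> P A2 \<or> \<not> P A3) \<and> (\<not> P A2 \<or> \<not> P A4) \<and> (\<not> P A2 \<or> \<not> P A5) \<and> (\<not>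 P A2 \<or> \<not> P A6) \<and> (\<not> P A3 \<or> \<not> P A4) \<and> (\<not> P A3 \<or> \<not> P A5) \<and> (\<not> P A3 \<or> \<not> P A6) \<and> (\<not> P A4 \<or> \<not> P A5) \<and> (\<not> P A4 \<or> \<not> P A6) \<and> (\<not> P A5 \<or> \<not> P A6)"
proof -
  have "P A0 \<or> P A1 \<or> P A2 \<or> P A3 \<or> P A4 \<or> P A5 \<or> P A6" using assms by (metis s7.exhaust)
  moreover have ne: "\<not> P x \<or> \<not> P y" if "x \<noteq> y" for x y using assms that by blast
  ultimately show ?thesis by (intro conjI ne) simp_all
qed

text \<open>A plane is described by three of its ternary projections, onto \<open>(y, z, f)\<close>,
  \<open>(y, z, g)\<close> and \<open>(z, f, g)\<close>. With the triples as propositional variables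
  this takes 1029 variables, against 2401 for the words. Each projection is a Latin square, and the
  last three assumptions say that two projections of a word force the third.\<close>

locale net7 =
  fixes a b d :: "s7 \<Rightarrow> s7 \<Rightarrow> s7 \<Rightarrow> bool"
  assumes a1: "\<And>y z. \<exists>!f. a y z f" and a2: "\<And>y f. \<exists>!z. a y z f" and a3: "\<And>z f. \<exists>!y. a y z f"
    and b1: "\<And>y z. \<exists>!g. b y z g" and b2: "\<And>y g. \<exists>!z. b y z g" and b3: "\<And>z g. \<exists>!y. b y z g"
    and d1: "\<And>z f. \<exists>!g. d z f g" and d2: "\<And>z g. \<exists>!f. d z f g" and d3: "\<And>f g. \<exists>!z. d z f g"
    and abd: "\<And>y z f g. a y z f \<Longrightarrow> b y z g \<Longrightarrow> d z f g"
    and adb: "\<And>y z f g. a y z f \<Longrightarrow> d z f g \<Longrightarrow> b y z g"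
    and bda: "\<And>y z f g. b y z g \<Longrightarrow> d z f g \<Longrightarrow> a y z f"
begin

lemma word_clauses: "(\<not> a y z f \<or> \<not> b y z g \<or> d z f g) \<and> (\<not> a y z f \<or> \<not> d z f g \<or> b y z g) \<and>
    (\<not> b y z g \<or> \<not> d z f g \<or> a y z f)"
  using abd adb bda by blast

lemma row_clauses: "\<forall>f g. (\<not> a y z f \<or> \<not> b y z g \<or> d z f g) \<and> (\<not> a y z f \<or> \<not> d z f g \<or> b y z g) \<and>
    (\<not> b y z g \<or> \<not> d z f g \<or> a y z f)"
  by (intro allI word_clauses)

lemmas a1_clauses =
  ex1_clauses[OF a1[of A0 A0]] ex1_clauses[OF a1[of A0 A1]] ex1_clauses[OF a1[of A0 A2]] ex1_clauses[OF a1[of A0 A3]] ex1_clauses[OF a1[of A0 A4]] ex1_clauses[OF a1[of A0 A5]] ex1_clauses[OF a1[of A0 A6]]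
  ex1_clauses[OF a1[of A1 A0]] ex1_clauses[OF a1[of A1 A1]] ex1_clauses[OF a1[of A1 A2]] ex1_clauses[OF a1[of A1 A3]] ex1_clauses[OF a1[of A1 A4]] ex1_clauses[OF a1[of A1 A5]] ex1_clauses[OF a1[of A1 A6]]
  ex1_clauses[OF a1[of A2 A0]] ex1_clauses[OF a1[of A2 A1]] ex1_clauses[OF a1[of A2 A2]] ex1_clauses[OF a1[of A2 A3]] ex1_clauses[OF a1[of A2 A4]] ex1_clauses[OF a1[of A2 A5]] ex1_clauses[OF a1[of A2 A6]]
  ex1_clauses[OF a1[of A3 A0]] ex1_clauses[OF a1[of A3 A1]] ex1_clauses[OF a1[of A3 A2]] ex1_clauses[OF a1[of A3 A3]] ex1_clauses[OF a1[of A3 A4]] ex1_clauses[OF a1[of A3 A5]] ex1_clauses[OF a1[of A3 A6]]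
  ex1_clauses[OF a1[of A4 A0]] ex1_clauses[OF a1[of A4 A1]] ex1_clauses[OF a1[of A4 A2]] ex1_clauses[OF a1[of A4 A3]] ex1_clauses[OF a1[of A4 A4]] ex1_clauses[OF a1[of A4 A5]] ex1_clauses[OF a1[of A4 A6]]
  ex1_clauses[OF a1[of A5 A0]] ex1_clauses[OF a1[of A5 A1]] ex1_clauses[OF a1[of A5 A2]] ex1_clauses[OF a1[of A5 A3]] ex1_clauses[OF a1[of A5 A4]] ex1_clauses[OF a1[of A5 A5]] ex1_clauses[OF a1[of A5 A6]]
  ex1_clauses[OF a1[of A6 A0]] ex1_clauses[OF a1[of A6 A1]] ex1_clauses[OF a1[of A6 A2]] ex1_clauses[OF a1[of A6 A3]] ex1_clauses[OF a1[of A6 A4]] ex1_clauses[OF a1[of A6 A5]] ex1_clauses[OF a1[of A6 A6]]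

lemmas a2_clauses =
  ex1_clauses[OF a2[of A0 A0]] ex1_clauses[OF a2[of A0 A1]] ex1_clauses[OF a2[of A0 A2]] ex1_clauses[OF a2[of A0 A3]] ex1_clauses[OF a2[of A0 A4]] ex1_clauses[OF a2[of A0 A5]] ex1_clauses[OF a2[of A0 A6]]
  ex1_clauses[OF a2[of A1 A0]] ex1_clauses[OF a2[of A1 A1]] ex1_clauses[OF a2[of A1 A2]] ex1_clauses[OF a2[of A1 A3]] ex1_clauses[OF a2[of A1 A4]] ex1_clauses[OF a2[of A1 A5]] ex1_clauses[OF a2[of A1 A6]]
  ex1_clauses[OF a2[of A2 A0]] ex1_clauses[OF a2[of A2 A1]] ex1_clauses[OF a2[of A2 A2]] ex1_clauses[OF a2[of A2 A3]] ex1_clauses[OF a2[of A2 A4]] ex1_clauses[OF a2[of A2 A5]] ex1_clauses[OF a2[of A2 A6]]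
  ex1_clauses[OF a2[of A3 A0]] ex1_clauses[OF a2[of A3 A1]] ex1_clauses[OF a2[of A3 A2]] ex1_clauses[OF a2[of A3 A3]] ex1_clauses[OF a2[of A3 A4]] ex1_clauses[OF a2[of A3 A5]] ex1_clauses[OF a2[of A3 A6]]
  ex1_clauses[OF a2[of A4 A0]] ex1_clauses[OF a2[of A4 A1]] ex1_clauses[OF a2[of A4 A2]] ex1_clauses[OF a2[of A4 A3]] ex1_clauses[OF a2[of A4 A4]] ex1_clauses[OF a2[of A4 A5]] ex1_clauses[OF a2[of A4 A6]]
  ex1_clauses[OF a2[of A5 A0]] ex1_clauses[OF a2[of A5 A1]] ex1_clauses[OF a2[of A5 A2]] ex1_clauses[OF a2[of A5 A3]] ex1_clauses[OF a2[of A5 A4]] ex1_clauses[OF a2[of A5 A5]] ex1_clauses[OF a2[of A5 A6]]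
  ex1_clauses[OF a2[of A6 A0]] ex1_clauses[OF a2[of A6 A1]] ex1_clauses[OF a2[of A6 A2]] ex1_clauses[OF a2[of A6 A3]] ex1_clauses[OF a2[of A6 A4]] ex1_clauses[OF a2[of A6 A5]] ex1_clauses[OF a2[of A6 A6]]

lemmas a3_clauses =
  ex1_clauses[OF a3[of A0 A0]] ex1_clauses[OF a3[of A0 A1]] ex1_clauses[OF a3[of A0 A2]] ex1_clauses[OF a3[of A0 A3]] ex1_clauses[OF a3[of A0 A4]] ex1_clauses[OF a3[of A0 A5]] ex1_clauses[OF a3[of A0 A6]]
  ex1_clauses[OF a3[of A1 A0]] ex1_clauses[OF a3[of A1 A1]] ex1_clauses[OF a3[of A1 A2]] ex1_clauses[OF a3[of A1 A3]] ex1_clauses[OF a3[of A1 A4]] ex1_clauses[OF a3[of A1 A5]] ex1_clauses[OF a3[of A1 A6]]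
  ex1_clauses[OF a3[of A2 A0]] ex1_clauses[OF a3[of A2 A1]] ex1_clauses[OF a3[of A2 A2]] ex1_clauses[OF a3[of A2 A3]] ex1_clauses[OF a3[of A2 A4]] ex1_clauses[OF a3[of A2 A5]] ex1_clauses[OF a3[of A2 A6]]
  ex1_clauses[OF a3[of A3 A0]] ex1_clauses[OF a3[of A3 A1]] ex1_clauses[OF a3[of A3 A2]] ex1_clauses[OF a3[of A3 A3]] ex1_clauses[OF a3[of A3 A4]] ex1_clauses[OF a3[of A3 A5]] ex1_clauses[OF a3[of A3 A6]]
  ex1_clauses[OF a3[of A4 A0]] ex1_clauses[OF a3[of A4 A1]] ex1_clauses[OF a3[of A4 A2]] ex1_clauses[OF a3[of A4 A3]] ex1_clauses[OF a3[of A4 A4]] ex1_clauses[OF a3[of A4 A5]] ex1_clauses[OF a3[of A4 A6]]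
  ex1_clauses[OF a3[of A5 A0]] ex1_clauses[OF a3[of A5 A1]] ex1_clauses[OF a3[of A5 A2]] ex1_clauses[OF a3[of A5 A3]] ex1_clauses[OF a3[of A5 A4]] ex1_clauses[OF a3[of A5 A5]] ex1_clauses[OF a3[of A5 A6]]
  ex1_clauses[OF a3[of A6 A0]] ex1_clauses[OF a3[of A6 A1]] ex1_clauses[OF a3[of A6 A2]] ex1_clauses[OF a3[of A6 A3]] ex1_clauses[OF a3[of A6 A4]] ex1_clauses[OF a3[of A6 A5]] ex1_clauses[OF a3[of A6 A6]]

lemmas b1_clauses =
  ex1_clauses[OF b1[of A0 A0]] ex1_clauses[OF b1[of A0 A1]] ex1_clauses[OF b1[of A0 A2]] ex1_clauses[OF b1[of A0 A3]] ex1_clauses[OF b1[of A0 A4]] ex1_clauses[OF b1[of A0 A5]] ex1_clauses[OF b1[of A0 A6]]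
  ex1_clauses[OF b1[of A1 A0]] ex1_clauses[OF b1[of A1 A1]] ex1_clauses[OF b1[of A1 A2]] ex1_clauses[OF b1[of A1 A3]] ex1_clauses[OF b1[of A1 A4]] ex1_clauses[OF b1[of A1 A5]] ex1_clauses[OF b1[of A1 A6]]
  ex1_clauses[OF b1[of A2 A0]] ex1_clauses[OF b1[of A2 A1]] ex1_clauses[OF b1[of A2 A2]] ex1_clauses[OF b1[of A2 A3]] ex1_clauses[OF b1[of A2 A4]] ex1_clauses[OF b1[of A2 A5]] ex1_clauses[OF b1[of A2 A6]]
  ex1_clauses[OF b1[of A3 A0]] ex1_clauses[OF b1[of A3 A1]] ex1_clauses[OF b1[of A3 A2]] ex1_clauses[OF b1[of A3 A3]] ex1_clauses[OF b1[of A3 A4]] ex1_clauses[OF b1[of A3 A5]] ex1_clauses[OF b1[of A3 A6]]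
  ex1_clauses[OF b1[of A4 A0]] ex1_clauses[OF b1[of A4 A1]] ex1_clauses[OF b1[of A4 A2]] ex1_clauses[OF b1[of A4 A3]] ex1_clauses[OF b1[of A4 A4]] ex1_clauses[OF b1[of A4 A5]] ex1_clauses[OF b1[of A4 A6]]
  ex1_clauses[OF b1[of A5 A0]] ex1_clauses[OF b1[of A5 A1]] ex1_clauses[OF b1[of A5 A2]] ex1_clauses[OF b1[of A5 A3]] ex1_clauses[OF b1[of A5 A4]] ex1_clauses[OF b1[of A5 A5]] ex1_clauses[OF b1[of A5 A6]]
  ex1_clauses[OF b1[of A6 A0]] ex1_clauses[OF b1[of A6 A1]] ex1_clauses[OF b1[of A6 A2]] ex1_clauses[OF b1[of A6 A3]] ex1_clauses[OF b1[of A6 A4]] ex1_clauses[OF b1[of A6 A5]] ex1_clauses[OF b1[of A6 A6]]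

lemmas b2_clauses =
  ex1_clauses[OF b2[of A0 A0]] ex1_clauses[OF b2[of A0 A1]] ex1_clauses[OF b2[of A0 A2]] ex1_clauses[OF b2[of A0 A3]] ex1_clauses[OF b2[of A0 A4]] ex1_clauses[OF b2[of A0 A5]] ex1_clauses[OF b2[of A0 A6]]
  ex1_clauses[OF b2[of A1 A0]] ex1_clauses[OF b2[of A1 A1]] ex1_clauses[OF b2[of A1 A2]] ex1_clauses[OF b2[of A1 A3]] ex1_clauses[OF b2[of A1 A4]] ex1_clauses[OF b2[of A1 A5]] ex1_clauses[OF b2[of A1 A6]]
  ex1_clauses[OF b2[of A2 A0]] ex1_clauses[OF b2[of A2 A1]] ex1_clauses[OF b2[of A2 A2]] ex1_clauses[OF b2[of A2 A3]] ex1_clauses[OF b2[of A2 A4]] ex1_clauses[OF b2[of A2 A5]] ex1_clauses[OF b2[of A2 A6]]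
  ex1_clauses[OF b2[of A3 A0]] ex1_clauses[OF b2[of A3 A1]] ex1_clauses[OF b2[of A3 A2]] ex1_clauses[OF b2[of A3 A3]] ex1_clauses[OF b2[of A3 A4]] ex1_clauses[OF b2[of A3 A5]] ex1_clauses[OF b2[of A3 A6]]
  ex1_clauses[OF b2[of A4 A0]] ex1_clauses[OF b2[of A4 A1]] ex1_clauses[OF b2[of A4 A2]] ex1_clauses[OF b2[of A4 A3]] ex1_clauses[OF b2[of A4 A4]] ex1_clauses[OF b2[of A4 A5]] ex1_clauses[OF b2[of A4 A6]]
  ex1_clauses[OF b2[of A5 A0]] ex1_clauses[OF b2[of A5 A1]] ex1_clauses[OF b2[of A5 A2]] ex1_clauses[OF b2[of A5 A3]] ex1_clauses[OF b2[of A5 A4]] ex1_clauses[OF b2[of A5 A5]] ex1_clauses[OF b2[of A5 A6]]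
  ex1_clauses[OF b2[of A6 A0]] ex1_clauses[OF b2[of A6 A1]] ex1_clauses[OF b2[of A6 A2]] ex1_clauses[OF b2[of A6 A3]] ex1_clauses[OF b2[of A6 A4]] ex1_clauses[OF b2[of A6 A5]] ex1_clauses[OF b2[of A6 A6]]

lemmas b3_clauses =
  ex1_clauses[OF b3[of A0 A0]] ex1_clauses[OF b3[of A0 A1]] ex1_clauses[OF b3[of A0 A2]] ex1_clauses[OF b3[of A0 A3]] ex1_clauses[OF b3[of A0 A4]] ex1_clauses[OF b3[of A0 A5]] ex1_clauses[OF b3[of A0 A6]]
  ex1_clauses[OF b3[of A1 A0]] ex1_clauses[OF b3[of A1 A1]] ex1_clauses[OF b3[of A1 A2]] ex1_clauses[OF b3[of A1 A3]] ex1_clauses[OF b3[of A1 A4]] ex1_clauses[OF b3[of A1 A5]] ex1_clauses[OF b3[of A1 A6]]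
  ex1_clauses[OF b3[of A2 A0]] ex1_clauses[OF b3[of A2 A1]] ex1_clauses[OF b3[of A2 A2]] ex1_clauses[OF b3[of A2 A3]] ex1_clauses[OF b3[of A2 A4]] ex1_clauses[OF b3[of A2 A5]] ex1_clauses[OF b3[of A2 A6]]
  ex1_clauses[OF b3[of A3 A0]] ex1_clauses[OF b3[of A3 A1]] ex1_clauses[OF b3[of A3 A2]] ex1_clauses[OF b3[of A3 A3]] ex1_clauses[OF b3[of A3 A4]] ex1_clauses[OF b3[of A3 A5]] ex1_clauses[OF b3[of A3 A6]]
  ex1_clauses[OF b3[of A4 A0]] ex1_clauses[OF b3[of A4 A1]] ex1_clauses[OF b3[of A4 A2]] ex1_clauses[OF b3[of A4 A3]] ex1_clauses[OF b3[of A4 A4]] ex1_clauses[OF b3[of A4 A5]] ex1_clauses[OF b3[of A4 A6]]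
  ex1_clauses[OF b3[of A5 A0]] ex1_clauses[OF b3[of A5 A1]] ex1_clauses[OF b3[of A5 A2]] ex1_clauses[OF b3[of A5 A3]] ex1_clauses[OF b3[of A5 A4]] ex1_clauses[OF b3[of A5 A5]] ex1_clauses[OF b3[of A5 A6]]
  ex1_clauses[OF b3[of A6 A0]] ex1_clauses[OF b3[of A6 A1]] ex1_clauses[OF b3[of A6 A2]] ex1_clauses[OF b3[of A6 A3]] ex1_clauses[OF b3[of A6 A4]] ex1_clauses[OF b3[of A6 A5]] ex1_clauses[OF b3[of A6 A6]]

lemmas d1_clauses =
  ex1_clauses[OF d1[of A0 A0]] ex1_clauses[OF d1[of A0 A1]] ex1_clauses[OF d1[of A0 A2]] ex1_clauses[OF d1[of A0 A3]] ex1_clauses[OF d1[of A0 A4]] ex1_clauses[OF d1[of A0 A5]] ex1_clauses[OF d1[of A0 A6]]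
  ex1_clauses[OF d1[of A1 A0]] ex1_clauses[OF d1[of A1 A1]] ex1_clauses[OF d1[of A1 A2]] ex1_clauses[OF d1[of A1 A3]] ex1_clauses[OF d1[of A1 A4]] ex1_clauses[OF d1[of A1 A5]] ex1_clauses[OF d1[of A1 A6]]
  ex1_clauses[OF d1[of A2 A0]] ex1_clauses[OF d1[of A2 A1]] ex1_clauses[OF d1[of A2 A2]] ex1_clauses[OF d1[of A2 A3]] ex1_clauses[OF d1[of A2 A4]] ex1_clauses[OF d1[of A2 A5]] ex1_clauses[OF d1[of A2 A6]]
  ex1_clauses[OF d1[of A3 A0]] ex1_clauses[OF d1[of A3 A1]] ex1_clauses[OF d1[of A3 A2]] ex1_clauses[OF d1[of A3 A3]] ex1_clauses[OF d1[of A3 A4]] ex1_clauses[OF d1[of A3 A5]] ex1_clauses[OF d1[of A3 A6]]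
  ex1_clauses[OF d1[of A4 A0]] ex1_clauses[OF d1[of A4 A1]] ex1_clauses[OF d1[of A4 A2]] ex1_clauses[OF d1[of A4 A3]] ex1_clauses[OF d1[of A4 A4]] ex1_clauses[OF d1[of A4 A5]] ex1_clauses[OF d1[of A4 A6]]
  ex1_clauses[OF d1[of A5 A0]] ex1_clauses[OF d1[of A5 A1]] ex1_clauses[OF d1[of A5 A2]] ex1_clauses[OF d1[of A5 A3]] ex1_clauses[OF d1[of A5 A4]] ex1_clauses[OF d1[of A5 A5]] ex1_clauses[OF d1[of A5 A6]]
  ex1_clauses[OF d1[of A6 A0]] ex1_clauses[OF d1[of A6 A1]] ex1_clauses[OF d1[of A6 A2]] ex1_clauses[OF d1[of A6 A3]] ex1_clauses[OF d1[of A6 A4]] ex1_clauses[OF d1[of A6 A5]] ex1_clauses[OF d1[of A6 A6]]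

lemmas d2_clauses =
  ex1_clauses[OF d2[of A0 A0]] ex1_clauses[OF d2[of A0 A1]] ex1_clauses[OF d2[of A0 A2]] ex1_clauses[OF d2[of A0 A3]] ex1_clauses[OF d2[of A0 A4]] ex1_clauses[OF d2[of A0 A5]] ex1_clauses[OF d2[of A0 A6]]
  ex1_clauses[OF d2[of A1 A0]] ex1_clauses[OF d2[of A1 A1]] ex1_clauses[OF d2[of A1 A2]] ex1_clauses[OF d2[of A1 A3]] ex1_clauses[OF d2[of A1 A4]] ex1_clauses[OF d2[of A1 A5]] ex1_clauses[OF d2[of A1 A6]]
  ex1_clauses[OF d2[of A2 A0]] ex1_clauses[OF d2[of A2 A1]] ex1_clauses[OF d2[of A2 A2]] ex1_clauses[OF d2[of A2 A3]] ex1_clauses[OF d2[of A2 A4]] ex1_clauses[OF d2[of A2 A5]] ex1_clauses[OF d2[of A2 A6]]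
  ex1_clauses[OF d2[of A3 A0]] ex1_clauses[OF d2[of A3 A1]] ex1_clauses[OF d2[of A3 A2]] ex1_clauses[OF d2[of A3 A3]] ex1_clauses[OF d2[of A3 A4]] ex1_clauses[OF d2[of A3 A5]] ex1_clauses[OF d2[of A3 A6]]
  ex1_clauses[OF d2[of A4 A0]] ex1_clauses[OF d2[of A4 A1]] ex1_clauses[OF d2[of A4 A2]] ex1_clauses[OF d2[of A4 A3]] ex1_clauses[OF d2[of A4 A4]] ex1_clauses[OF d2[of A4 A5]] ex1_clauses[OF d2[of A4 A6]]
  ex1_clauses[OF d2[of A5 A0]] ex1_clauses[OF d2[of A5 A1]] ex1_clauses[OF d2[of A5 A2]] ex1_clauses[OF d2[of A5 A3]] ex1_clauses[OF d2[of A5 A4]] ex1_clauses[OF d2[of A5 A5]] ex1_clauses[OF d2[of A5 A6]]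
  ex1_clauses[OF d2[of A6 A0]] ex1_clauses[OF d2[of A6 A1]] ex1_clauses[OF d2[of A6 A2]] ex1_clauses[OF d2[of A6 A3]] ex1_clauses[OF d2[of A6 A4]] ex1_clauses[OF d2[of A6 A5]] ex1_clauses[OF d2[of A6 A6]]

lemmas d3_clauses =
  ex1_clauses[OF d3[of A0 A0]] ex1_clauses[OF d3[of A0 A1]] ex1_clauses[OF d3[of A0 A2]] ex1_clauses[OF d3[of A0 A3]] ex1_clauses[OF d3[of A0 A4]] ex1_clauses[OF d3[of A0 A5]] ex1_clauses[OF d3[of A0 A6]]
  ex1_clauses[OF d3[of A1 A0]] ex1_clauses[OF d3[of A1 A1]] ex1_clauses[OF d3[of A1 A2]] ex1_clauses[OF d3[of A1 A3]] ex1_clauses[OF d3[of A1 A4]] ex1_clauses[OF d3[of A1 A5]] ex1_clauses[OF d3[of A1 A6]]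
  ex1_clauses[OF d3[of A2 A0]] ex1_clauses[OF d3[of A2 A1]] ex1_clauses[OF d3[of A2 A2]] ex1_clauses[OF d3[of A2 A3]] ex1_clauses[OF d3[of A2 A4]] ex1_clauses[OF d3[of A2 A5]] ex1_clauses[OF d3[of A2 A6]]
  ex1_clauses[OF d3[of A3 A0]] ex1_clauses[OF d3[of A3 A1]] ex1_clauses[OF d3[of A3 A2]] ex1_clauses[OF d3[of A3 A3]] ex1_clauses[OF d3[of A3 A4]] ex1_clauses[OF d3[of A3 A5]] ex1_clauses[OF d3[of A3 A6]]
  ex1_clauses[OF d3[of A4 A0]] ex1_clauses[OF d3[of A4 A1]] ex1_clauses[OF d3[of A4 A2]] ex1_clauses[OF d3[of A4 A3]] ex1_clauses[OF d3[of A4 A4]] ex1_clauses[OF d3[of A4 A5]] ex1_clauses[OF d3[of A4 A6]]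
  ex1_clauses[OF d3[of A5 A0]] ex1_clauses[OF d3[of A5 A1]] ex1_clauses[OF d3[of A5 A2]] ex1_clauses[OF d3[of A5 A3]] ex1_clauses[OF d3[of A5 A4]] ex1_clauses[OF d3[of A5 A5]] ex1_clauses[OF d3[of A5 A6]]
  ex1_clauses[OF d3[of A6 A0]] ex1_clauses[OF d3[of A6 A1]] ex1_clauses[OF d3[of A6 A2]] ex1_clauses[OF d3[of A6 A3]] ex1_clauses[OF d3[of A6 A4]] ex1_clauses[OF d3[of A6 A5]] ex1_clauses[OF d3[of A6 A6]]

lemmas words_clauses =
  row_clauses[of A0 A0, unfolded all_s7] row_clauses[of A0 A1, unfolded all_s7] row_clauses[of A0 A2, unfolded all_s7] row_clauses[of A0 A3, unfolded all_s7] row_clauses[of A0 A4, unfolded all_s7] row_clauses[of A0 A5, unfolded all_s7] row_clauses[of A0 A6, unfolded all_s7]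
  row_clauses[of A1 A0, unfolded all_s7] row_clauses[of A1 A1, unfolded all_s7] row_clauses[of A1 A2, unfolded all_s7] row_clauses[of A1 A3, unfolded all_s7] row_clauses[of A1 A4, unfolded all_s7] row_clauses[of A1 A5, unfolded all_s7] row_clauses[of A1 A6, unfolded all_s7]
  row_clauses[of A2 A0, unfolded all_s7] row_clauses[of A2 A1, unfolded all_s7] row_clauses[of A2 A2, unfolded all_s7] row_clauses[of A2 A3, unfolded all_s7] row_clauses[of A2 A4, unfolded all_s7] row_clauses[of A2 A5, unfolded all_s7] row_clauses[of A2 A6, unfolded all_s7]
  row_clauses[of A3 A0, unfolded all_s7] row_clauses[of A3 A1, unfolded all_s7] row_clauses[of A3 A2, unfolded all_s7] row_clauses[of A3 A3, unfolded all_s7] row_clauses[of A3 A4, unfolded all_s7] row_clauses[of A3 A5, unfolded all_s7] row_clauses[of A3 A6, unfolded all_s7]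
  row_clauses[of A4 A0, unfolded all_s7] row_clauses[of A4 A1, unfolded all_s7] row_clauses[of A4 A2, unfolded all_s7] row_clauses[of A4 A3, unfolded all_s7] row_clauses[of A4 A4, unfolded all_s7] row_clauses[of A4 A5, unfolded all_s7] row_clauses[of A4 A6, unfolded all_s7]
  row_clauses[of A5 A0, unfolded all_s7] row_clauses[of A5 A1, unfolded all_s7] row_clauses[of A5 A2, unfolded all_s7] row_clauses[of A5 A3, unfolded all_s7] row_clauses[of A5 A4, unfolded all_s7] row_clauses[of A5 A5, unfolded all_s7] row_clauses[of A5 A6, unfolded all_s7]
  row_clauses[of A6 A0, unfolded all_s7] row_clauses[of A6 A1, unfolded all_s7] row_clauses[of A6 A2, unfolded all_s7] row_clauses[of A6 A3, unfolded all_s7] row_clauses[of A6 A4, unfolded all_s7] row_clauses[of A6 A5, unfolded all_s7] row_clauses[of A6 A6, unfolded all_s7]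

lemmas net_clauses = a1_clauses a2_clauses a3_clauses b1_clauses b2_clauses b3_clauses d1_clauses d2_clauses d3_clauses words_clauses

end

text \<open>The normal form of a plane with a marked pair of lines: line \<open>A0\<close> is the
  diagonal, line \<open>A1\<close> carries \<open>st\<close>, and \<open>a i A0 i\<close> names each
  line by its symbol \<open>f\<close> in column \<open>A0\<close>, which removes the freedom to
  permute the lines.\<close>

definition start :: "(s7 \<Rightarrow> s7 \<Rightarrow> s7 \<Rightarrow> bool) \<Rightarrow> (s7 \<Rightarrow> s7 \<Rightarrow> s7 \<Rightarrow> bool) \<Rightarrow> (s7 \<Rightarrow> s7 \<Rightarrow> s7 \<Rightarrow> bool) \<Rightarrow>
    s7 v7 \<times> s7 v7 \<Rightarrow> bool" where
  "start a b d st \<longleftrightarrow> (\<forall>i. a A0 i i \<and> b A0 i i \<and> d i i i \<and> a i A0 i \<and>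
    a A1 i (fst st $ i) \<and> b A1 i (snd st $ i) \<and> d i (fst st $ i) (snd st $ i))"

fun swp :: "s7 \<Rightarrow> s7 \<times> s7 \<times> s7 \<times> s7 \<Rightarrow> s7 \<times> s7 \<times> s7 \<times> s7" where
  "swp A1 (y, z, f, g) = (z, y, f, g)"
| "swp A2 (y, z, f, g) = (y, f, z, g)"
| "swp A3 (y, z, f, g) = (y, z, g, f)"
| "swp _ w = w"

fun swps :: "s7 list \<Rightarrow> s7 \<times> s7 \<times> s7 \<times> s7 \<Rightarrow> s7 \<times> s7 \<times> s7 \<times> s7" where
  "swps [] w = w"
| "swps (k # ks) w = swp k (swps ks w)"

text \<open>A type, a sequence of coordinate transpositions, and a relabelling of each coordinate.\<close>

type_synonym iso = "(s7 v7 v7 \<times> s7 v7 v7) \<times> s7 list \<times> s7 v7 \<times> s7 v7 \<times> s7 v7 \<times> s7 v7"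

fun iso_word :: "iso \<Rightarrow> s7 \<Rightarrow> s7 \<Rightarrow> s7 \<times> s7 \<times> s7 \<times> s7" where
  "iso_word (T, ks, p, q, r, s) y z = swps ks (p $ y, q $ z, r $ (fst T $ y $ z), s $ (snd T $ y $ z))"

fun on_word :: "(s7 \<Rightarrow> s7 \<Rightarrow> s7 \<Rightarrow> bool) \<Rightarrow> (s7 \<Rightarrow> s7 \<Rightarrow> s7 \<Rightarrow> bool) \<Rightarrow> s7 \<times> s7 \<times> s7 \<times> s7 \<Rightarrow> bool" where
  "on_word a b (y, z, f, g) \<longleftrightarrow> a y z f \<and> b y z g"

definition holds :: "(s7 \<Rightarrow> s7 \<Rightarrow> s7 \<Rightarrow> bool) \<Rightarrow> (s7 \<Rightarrow> s7 \<Rightarrow> s7 \<Rightarrow> bool) \<Rightarrow> iso \<Rightarrow> bool" where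
  "holds a b w \<longleftrightarrow> (\<forall>y z. on_word a b (iso_word w y z))"

lemmas word_simps = holds_def all_s7 iso_word.simps at.simps swps.simps swp.simps on_word.simps fst_conv snd_conv
  T0_def T1_def T2_def T3_def T4_def T5_def T6_def

lemmas start_simps = start_def all_s7 at.simps fst_conv snd_conv R7_def R223_def
  st0_def st1_def st2_def st3_def st4_def st5_def st6_def st7_def st8_def st9_def st10_def st11_def st12_def st13_def st14_def st15_def st16_def st17_def

text \<open>The possible completions of \<open>st2\<close>. Each is written as an isomorphism from
  one of the types, so the same entry describes all 49 words of the completion and proves its type.
  The starts without such a list have no completion.\<close>

definition sols2 :: "iso list" where
  "sols2 = [(T0, [A2, A1], V A2 A6 A0 A1 A4 A3 A5, V A5 A3 A4 A0 A6 A1 A2, V A4 A3 A5 A2 A6 A1 A0, V A1 A2 A4 A5 A0 A6 A3),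
    (T4, [], V A6 A0 A1 A2 A5 A3 A4, V A1 A2 A4 A6 A0 A3 A5, V A4 A1 A2 A5 A6 A0 A3, V A3 A5 A1 A2 A4 A6 A0),
    (T0, [A2, A1, A3, A2, A1], V A1 A3 A0 A2 A4 A5 A6, V A5 A4 A3 A2 A0 A1 A6, V A3 A5 A6 A2 A4 A0 A1, V A2 A0 A6 A3 A1 A5 A4),
    (T0, [A1, A2], V A2 A6 A0 A1 A5 A4 A3, V A4 A5 A6 A1 A0 A2 A3, V A3 A6 A4 A5 A2 A0 A1, V A1 A0 A3 A6 A2 A4 A5)]"

definition sols3 :: "iso list" where
  "sols3 = [(T4, [], V A2 A0 A4 A3 A1 A6 A5, V A5 A2 A0 A6 A3 A1 A4, V A0 A5 A2 A4 A6 A3 A1, V A1 A4 A5 A2 A0 A6 A3),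
    (T2, [A2], V A1 A5 A3 A2 A0 A4 A6, V A3 A0 A1 A5 A4 A6 A2, V A2 A6 A0 A4 A3 A5 A1, V A5 A3 A2 A6 A1 A4 A0),
    (T2, [A2], V A3 A2 A5 A4 A0 A6 A1, V A0 A4 A6 A1 A3 A5 A2, V A2 A5 A4 A3 A0 A1 A6, V A1 A0 A2 A5 A6 A3 A4),
    (T2, [A2], V A3 A1 A5 A6 A0 A2 A4, V A5 A0 A3 A1 A2 A4 A6, V A6 A4 A0 A2 A5 A1 A3, V A1 A5 A6 A4 A3 A2 A0),
    (T2, [], V A3 A1 A4 A6 A0 A2 A5, V A1 A6 A3 A5 A4 A2 A0, V A0 A2 A6 A4 A1 A5 A3, V A5 A1 A0 A2 A3 A4 A6),
    (T2, [], V A2 A3 A4 A5 A0 A6 A1, V A6 A2 A0 A5 A3 A1 A4, V A4 A1 A2 A3 A6 A5 A0, V A5 A6 A4 A1 A0 A3 A2),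
    (T2, [], V A1 A5 A3 A4 A0 A2 A6, V A3 A6 A5 A1 A2 A0 A4, V A4 A0 A6 A2 A3 A1 A5, V A1 A3 A4 A0 A5 A2 A6),
    (T4, [A2], V A3 A0 A2 A4 A1 A6 A5, V A1 A4 A6 A0 A3 A5 A2, V A6 A1 A4 A2 A0 A3 A5, V A5 A2 A1 A4 A6 A0 A3),
    (T4, [A1], V A4 A0 A6 A1 A3 A5 A2, V A3 A5 A1 A6 A2 A4 A0, V A1 A3 A5 A0 A6 A2 A4, V A5 A0 A6 A1 A2 A3 A4)]"

definition sols4 :: "iso list" where
  "sols4 = [(T0, [A1, A3, A2, A1], V A0 A4 A2 A6 A3 A5 A1, V A3 A1 A6 A4 A0 A2 A5, V A2 A5 A3 A4 A0 A1 A6, V A5 A1 A6 A0 A3 A4 A2),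
    (T0, [A1, A3, A2], V A0 A6 A2 A4 A1 A5 A3, V A1 A3 A4 A6 A0 A2 A5, V A5 A4 A2 A3 A0 A1 A6, V A5 A3 A4 A0 A1 A6 A2),
    (T0, [A1, A3, A2], V A0 A3 A4 A1 A2 A5 A6, V A4 A1 A0 A6 A5 A3 A2, V A3 A4 A0 A2 A6 A5 A1, V A3 A2 A4 A6 A5 A1 A0),
    (T0, [A1, A3, A2, A1], V A0 A1 A6 A3 A2 A5 A4, V A6 A3 A0 A4 A5 A1 A2, V A2 A3 A0 A5 A6 A4 A1, V A1 A2 A6 A4 A5 A3 A0),
    (T2, [A1], V A1 A6 A5 A0 A3 A2 A4, V A1 A4 A3 A0 A5 A2 A6, V A2 A0 A6 A1 A4 A3 A5, V A3 A5 A4 A1 A0 A6 A2),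
    (T2, [A1, A3, A2, A1], V A0 A2 A4 A6 A1 A3 A5, V A6 A5 A2 A0 A1 A3 A4, V A6 A4 A1 A0 A3 A5 A2, V A5 A2 A3 A0 A4 A1 A6)]"

definition sols5 :: "iso list" where
  "sols5 = [(T0, [A2], V A0 A4 A3 A1 A5 A2 A6, V A2 A5 A4 A1 A3 A0 A6, V A2 A5 A4 A1 A3 A0 A6, V A2 A1 A5 A3 A0 A6 A4),
    (T0, [A2], V A1 A5 A3 A0 A6 A2 A4, V A3 A0 A1 A4 A2 A5 A6, V A2 A6 A0 A3 A1 A4 A5, V A4 A5 A1 A3 A6 A0 A2),
    (T3, [A1, A2, A3], V A0 A3 A1 A5 A6 A2 A4, V A3 A4 A0 A2 A1 A6 A5, V A5 A3 A0 A6 A2 A4 A1, V A3 A4 A0 A2 A1 A6 A5),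
    (T0, [A2], V A1 A4 A6 A0 A3 A2 A5, V A5 A2 A3 A6 A4 A0 A1, V A4 A1 A2 A5 A3 A6 A0, V A6 A0 A3 A5 A1 A2 A4),
    (T0, [A2], V A0 A4 A6 A1 A2 A3 A5, V A4 A0 A6 A3 A5 A2 A1, V A4 A0 A6 A3 A5 A2 A1, V A4 A3 A0 A5 A2 A1 A6),
    (T4, [], V A2 A0 A3 A6 A4 A5 A1, V A5 A1 A4 A0 A3 A6 A2, V A4 A5 A1 A2 A0 A3 A6, V A6 A2 A5 A1 A4 A0 A3),
    (T5, [A1], V A0 A1 A2 A3 A4 A5 A6, V A0 A1 A2 A3 A4 A5 A6, V A0 A1 A2 A3 A4 A5 A6, V A0 A1 A2 A3 A4 A5 A6),
    (T4, [], V A4 A0 A5 A6 A2 A3 A1, V A4 A0 A3 A6 A2 A5 A1, V A3 A4 A0 A1 A6 A2 A5, V A5 A1 A4 A0 A3 A6 A2),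
    (T4, [], V A4 A0 A5 A6 A2 A3 A1, V A1 A4 A0 A3 A6 A2 A5, V A0 A1 A4 A5 A3 A6 A2, V A2 A5 A1 A4 A0 A3 A6),
    (T4, [], V A6 A0 A3 A4 A2 A5 A1, V A0 A3 A6 A2 A5 A1 A4, V A6 A0 A3 A4 A2 A5 A1, V A1 A4 A0 A3 A6 A2 A5),
    (T4, [], V A4 A0 A5 A6 A2 A3 A1, V A6 A2 A5 A1 A4 A0 A3, V A5 A6 A2 A3 A1 A4 A0, V A0 A3 A6 A2 A5 A1 A4),
    (T0, [A2], V A0 A5 A4 A1 A2 A6 A3, V A1 A4 A3 A0 A2 A6 A5, V A1 A4 A3 A0 A2 A6 A5, V A1 A0 A4 A2 A6 A5 A3),
    (T0, [A2], V A1 A3 A4 A0 A2 A5 A6, V A2 A6 A0 A3 A1 A4 A5, V A1 A5 A6 A2 A0 A3 A4, V A3 A4 A0 A2 A5 A6 A1),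
    (T0, [A2], V A1 A3 A4 A0 A6 A2 A5, V A0 A4 A5 A1 A6 A2 A3, V A6 A3 A4 A0 A5 A1 A2, V A1 A2 A5 A0 A3 A4 A6),
    (T0, [A2], V A0 A5 A4 A1 A6 A3 A2, V A6 A2 A1 A5 A0 A4 A3, V A6 A2 A1 A5 A0 A4 A3, V A6 A5 A2 A0 A4 A3 A1),
    (T0, [A2], V A1 A4 A2 A0 A6 A5 A3, V A4 A1 A2 A5 A3 A6 A0, V A3 A0 A1 A4 A2 A5 A6, V A5 A6 A2 A4 A0 A1 A3),
    (T0, [A2], V A0 A4 A2 A1 A5 A6 A3, V A3 A6 A5 A2 A4 A1 A0, V A3 A6 A5 A2 A4 A1 A0, V A3 A2 A6 A4 A1 A0 A5),
    (T4, [], V A4 A0 A5 A2 A3 A6 A1, V A3 A6 A2 A5 A1 A4 A0, V A2 A3 A6 A0 A5 A1 A4, V A4 A0 A3 A6 A2 A5 A1),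
    (T0, [A2], V A1 A4 A5 A0 A3 A6 A2, V A6 A3 A4 A0 A5 A1 A2, V A5 A2 A3 A6 A4 A0 A1, V A0 A1 A4 A6 A2 A3 A5),
    (T0, [A2], V A0 A3 A5 A1 A2 A6 A4, V A5 A1 A0 A4 A6 A3 A2, V A5 A1 A0 A4 A6 A3 A2, V A5 A4 A1 A6 A3 A2 A0),
    (T3, [A1, A2, A3], V A0 A1 A5 A4 A2 A3 A6, V A0 A5 A6 A2 A4 A1 A3, V A0 A4 A3 A5 A6 A2 A1, V A0 A5 A6 A2 A4 A1 A3),
    (T4, [], V A4 A0 A2 A5 A6 A3 A1, V A2 A5 A1 A4 A0 A3 A6, V A1 A2 A5 A6 A4 A0 A3, V A3 A6 A2 A5 A1 A4 A0),
    (T0, [A2], V A0 A3 A4 A1 A6 A2 A5, V A0 A3 A2 A6 A1 A5 A4, V A0 A3 A2 A6 A1 A5 A4, V A0 A6 A3 A1 A5 A4 A2),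
    (T0, [A2], V A1 A5 A4 A0 A2 A6 A3, V A1 A5 A6 A2 A0 A3 A4, V A0 A4 A5 A1 A6 A2 A3, V A2 A3 A6 A1 A4 A5 A0)]"

definition sols6 :: "iso list" where
  "sols6 = [(T2, [A1, A2, A1], V A2 A3 A6 A4 A5 A0 A1, V A0 A6 A4 A5 A3 A2 A1, V A2 A3 A6 A4 A5 A0 A1, V A5 A1 A6 A4 A0 A2 A3),
    (T2, [A1, A3, A2, A1], V A4 A6 A5 A3 A1 A2 A0, V A0 A2 A1 A5 A3 A6 A4, V A6 A3 A2 A4 A5 A1 A0, V A6 A5 A3 A2 A1 A0 A4),
    (T0, [A1, A2, A1], V A1 A4 A0 A3 A6 A5 A2, V A1 A4 A5 A6 A3 A2 A0, V A0 A3 A6 A4 A5 A2 A1, V A1 A5 A6 A0 A4 A2 A3),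
    (T0, [A1, A3, A2, A1], V A0 A3 A2 A6 A5 A1 A4, V A4 A1 A5 A2 A3 A6 A0, V A1 A2 A6 A4 A5 A3 A0, V A5 A6 A3 A1 A2 A0 A4),
    (T0, [A1, A3, A2, A1], V A2 A4 A3 A5 A0 A1 A6, V A0 A6 A5 A4 A2 A3 A1, V A1 A6 A5 A2 A0 A4 A3, V A1 A6 A5 A2 A0 A4 A3),
    (T0, [A1, A2, A1], V A0 A2 A4 A6 A1 A5 A3, V A0 A2 A5 A1 A6 A3 A4, V A0 A2 A4 A6 A1 A5 A3, V A0 A5 A1 A4 A2 A3 A6),
    (T2, [A1, A3, A2, A1], V A1 A2 A4 A0 A5 A6 A3, V A5 A0 A6 A3 A1 A4 A2, V A1 A5 A4 A6 A0 A3 A2, V A6 A5 A3 A2 A1 A0 A4),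
    (T2, [A2, A1], V A1 A4 A3 A0 A2 A5 A6, V A3 A2 A1 A4 A5 A6 A0, V A2 A5 A0 A3 A4 A6 A1, V A0 A6 A2 A4 A3 A5 A1),
    (T2, [A1, A2, A1], V A2 A1 A5 A0 A6 A4 A3, V A3 A4 A6 A5 A0 A1 A2, V A3 A5 A4 A6 A2 A1 A0, V A1 A5 A0 A4 A6 A3 A2),
    (T2, [A3, A2, A1], V A0 A3 A6 A2 A4 A1 A5, V A2 A5 A0 A6 A3 A4 A1, V A6 A5 A0 A3 A1 A2 A4, V A1 A3 A0 A2 A4 A6 A5)]"

definition sols8 :: "iso list" where
  "sols8 = [(T0, [A3, A2], V A0 A5 A4 A6 A2 A3 A1, V A5 A4 A0 A2 A1 A3 A6, V A5 A4 A0 A2 A1 A3 A6, V A5 A2 A4 A1 A3 A6 A0),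
    (T2, [A2], V A0 A3 A4 A5 A6 A2 A1, V A0 A3 A4 A2 A1 A5 A6, V A0 A3 A4 A2 A1 A5 A6, V A0 A3 A4 A2 A1 A5 A6),
    (T0, [], V A2 A4 A3 A5 A0 A1 A6, V A2 A3 A4 A5 A0 A6 A1, V A5 A6 A1 A0 A2 A3 A4, V A4 A1 A5 A6 A2 A0 A3),
    (T3, [A3], V A0 A3 A1 A5 A6 A2 A4, V A1 A0 A4 A2 A3 A5 A6, V A1 A0 A4 A2 A3 A5 A6, V A1 A0 A4 A2 A3 A5 A6),
    (T2, [], V A2 A3 A4 A1 A6 A0 A5, V A0 A5 A6 A2 A4 A1 A3, V A2 A3 A4 A1 A6 A0 A5, V A6 A4 A1 A5 A0 A3 A2)]"

definition sols9 :: "iso list" where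
  "sols9 = [(T2, [A1, A2, A1], V A0 A5 A6 A2 A1 A4 A3, V A4 A6 A2 A1 A5 A0 A3, V A2 A1 A3 A4 A6 A0 A5, V A1 A3 A6 A2 A4 A0 A5),
    (T2, [A1, A2, A1], V A0 A2 A1 A5 A6 A3 A4, V A2 A0 A4 A5 A1 A6 A3, V A2 A0 A6 A4 A5 A1 A3, V A1 A0 A2 A6 A5 A3 A4)]"

definition sols10 :: "iso list" where
  "sols10 = [(T2, [A1, A2], V A0 A4 A5 A6 A2 A1 A3, V A1 A5 A6 A2 A4 A0 A3, V A1 A5 A6 A2 A4 A0 A3, V A2 A3 A5 A6 A1 A0 A4),
    (T0, [A1, A3, A2], V A0 A4 A6 A5 A3 A2 A1, V A5 A6 A1 A0 A3 A2 A4, V A6 A2 A4 A0 A5 A1 A3, V A6 A0 A2 A5 A1 A3 A4),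
    (T2, [A1, A3, A2, A1], V A4 A1 A6 A2 A5 A0 A3, V A4 A1 A6 A0 A3 A2 A5, V A0 A1 A6 A3 A5 A4 A2, V A4 A2 A5 A3 A1 A6 A0),
    (T0, [], V A1 A4 A2 A5 A3 A0 A6, V A3 A0 A4 A1 A5 A2 A6, V A4 A1 A5 A2 A6 A3 A0, V A6 A4 A2 A0 A5 A3 A1),
    (T0, [], V A0 A4 A6 A3 A5 A1 A2, V A4 A0 A3 A6 A2 A5 A1, V A4 A0 A3 A6 A2 A5 A1, V A4 A6 A0 A2 A5 A1 A3),
    (T2, [A2], V A3 A2 A5 A6 A4 A1 A0, V A2 A3 A0 A6 A5 A4 A1, V A5 A0 A4 A3 A6 A1 A2, V A3 A1 A6 A5 A4 A2 A0),
    (T2, [], V A0 A3 A6 A1 A5 A2 A4, V A4 A6 A2 A5 A0 A3 A1, V A4 A6 A2 A5 A0 A3 A1, V A4 A6 A2 A5 A0 A3 A1),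
    (T2, [], V A1 A5 A2 A0 A3 A6 A4, V A3 A1 A5 A2 A0 A4 A6, V A4 A2 A6 A3 A1 A5 A0, V A6 A4 A0 A5 A2 A1 A3),
    (T2, [A1, A3, A2, A1], V A4 A0 A6 A3 A5 A1 A2, V A0 A4 A2 A3 A6 A5 A1, V A6 A0 A5 A2 A4 A3 A1, V A6 A4 A0 A5 A3 A1 A2),
    (T2, [A1, A2], V A0 A3 A2 A1 A5 A6 A4, V A0 A3 A2 A6 A4 A1 A5, V A0 A3 A2 A6 A4 A1 A5, V A0 A1 A5 A4 A3 A2 A6),
    (T0, [A1, A3, A2], V A0 A3 A1 A2 A4 A5 A6, V A5 A4 A3 A2 A1 A0 A6, V A2 A6 A4 A1 A3 A0 A5, V A2 A1 A6 A3 A0 A5 A4)]"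

definition sols11 :: "iso list" where
  "sols11 = [(T0, [A3, A2, A1], V A0 A2 A3 A6 A5 A4 A1, V A1 A0 A6 A5 A3 A4 A2, V A2 A0 A6 A3 A1 A5 A4, V A3 A1 A0 A4 A2 A6 A5),
    (T0, [A3, A2, A1], V A0 A2 A3 A6 A1 A4 A5, V A0 A1 A2 A3 A5 A4 A6, V A0 A2 A3 A6 A1 A4 A5, V A0 A2 A3 A6 A1 A4 A5)]"

definition sols13 :: "iso list" where
  "sols13 = [(T0, [A1, A2, A1], V A0 A4 A3 A6 A2 A1 A5, V A2 A5 A6 A4 A0 A3 A1, V A6 A5 A1 A2 A0 A3 A4, V A1 A5 A6 A0 A2 A4 A3),
    (T0, [A2, A1, A3, A2], V A0 A3 A5 A1 A6 A2 A4, V A1 A5 A4 A0 A6 A2 A3, V A2 A3 A6 A0 A4 A5 A1, V A5 A0 A2 A1 A4 A6 A3),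
    (T0, [A1, A3, A2], V A0 A3 A1 A2 A5 A4 A6, V A5 A6 A2 A3 A0 A1 A4, V A4 A2 A1 A6 A0 A5 A3, V A4 A6 A2 A0 A5 A3 A1),
    (T0, [A1, A3, A2, A1], V A0 A4 A2 A3 A5 A6 A1, V A3 A2 A1 A0 A5 A6 A4, V A6 A4 A3 A0 A5 A2 A1, V A2 A0 A6 A3 A1 A5 A4),
    (T0, [A1, A2], V A0 A1 A6 A4 A2 A5 A3, V A4 A6 A3 A0 A2 A5 A1, V A4 A6 A3 A0 A2 A5 A1, V A6 A0 A5 A4 A3 A2 A1),
    (T0, [A2, A1, A3, A2, A1], V A0 A1 A4 A5 A6 A3 A2, V A6 A2 A5 A1 A0 A4 A3, V A3 A4 A1 A6 A0 A5 A2, V A3 A2 A5 A0 A6 A1 A4)]"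

definition sols14 :: "iso list" where
  "sols14 = [(T1, [A1], V A4 A3 A2 A5 A6 A0 A1, V A4 A3 A6 A5 A1 A0 A2, V A2 A6 A0 A1 A5 A4 A3, V A6 A3 A5 A2 A0 A4 A1),
    (T1, [A1], V A4 A0 A5 A1 A3 A6 A2, V A0 A4 A1 A5 A6 A2 A3, V A4 A0 A5 A1 A3 A6 A2, V A4 A5 A0 A2 A1 A3 A6),
    (T2, [A1, A2], V A4 A1 A6 A2 A5 A0 A3, V A4 A1 A6 A0 A3 A2 A5, V A0 A5 A3 A2 A6 A4 A1, V A4 A2 A5 A3 A1 A6 A0),
    (T3, [A1, A2, A3], V A0 A3 A1 A5 A6 A2 A4, V A4 A5 A1 A3 A2 A0 A6, V A1 A6 A3 A2 A5 A0 A4, V A4 A5 A1 A3 A2 A0 A6),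
    (T2, [A1, A2], V A2 A6 A4 A0 A3 A5 A1, V A2 A6 A4 A5 A1 A0 A3, V A0 A5 A3 A2 A6 A4 A1, V A2 A0 A3 A1 A6 A4 A5),
    (T1, [A1], V A2 A0 A6 A4 A5 A1 A3, V A3 A1 A6 A4 A5 A2 A0, V A1 A3 A4 A6 A0 A5 A2, V A6 A5 A1 A0 A3 A4 A2),
    (T2, [A2, A1], V A4 A6 A5 A3 A1 A2 A0, V A3 A0 A6 A4 A1 A2 A5, V A6 A4 A1 A0 A3 A5 A2, V A0 A4 A5 A2 A6 A3 A1),
    (T2, [A1, A3, A2, A1], V A0 A2 A1 A6 A4 A5 A3, V A0 A2 A1 A5 A3 A6 A4, V A0 A4 A3 A5 A6 A2 A1, V A0 A6 A4 A3 A2 A1 A5),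
    (T1, [A1], V A6 A2 A0 A3 A5 A1 A4, V A0 A5 A1 A2 A4 A6 A3, V A6 A2 A0 A3 A5 A1 A4, V A6 A0 A2 A4 A3 A5 A1),
    (T2, [A2, A1], V A1 A3 A2 A0 A5 A6 A4, V A5 A0 A6 A4 A1 A2 A3, V A3 A1 A5 A4 A0 A2 A6, V A4 A1 A2 A6 A3 A0 A5),
    (T1, [A1], V A6 A1 A2 A4 A3 A0 A5, V A4 A0 A6 A2 A3 A5 A1, V A1 A6 A5 A3 A2 A4 A0, V A5 A6 A3 A4 A1 A0 A2),
    (T2, [A1, A3, A2, A1], V A0 A5 A6 A1 A3 A2 A4, V A4 A2 A3 A6 A1 A5 A0, V A1 A4 A5 A3 A2 A6 A0, V A5 A6 A1 A2 A3 A4 A0),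
    (T1, [A1], V A2 A1 A0 A3 A4 A5 A6, V A5 A3 A2 A4 A1 A0 A6, V A0 A4 A5 A6 A3 A2 A1, V A4 A1 A3 A0 A5 A2 A6),
    (T3, [A1, A2, A3], V A0 A1 A5 A4 A2 A3 A6, V A5 A3 A4 A0 A2 A6 A1, V A2 A6 A5 A0 A1 A4 A3, V A5 A3 A4 A0 A2 A6 A1),
    (T2, [A1, A2], V A0 A4 A2 A5 A1 A3 A6, V A0 A4 A2 A3 A6 A5 A1, V A0 A4 A2 A3 A6 A5 A1, V A0 A5 A1 A6 A4 A2 A3),
    (T2, [A1, A3, A2, A1], V A1 A3 A2 A0 A5 A6 A4, V A1 A3 A2 A6 A4 A0 A5, V A0 A4 A3 A5 A6 A2 A1, V A1 A0 A5 A4 A3 A2 A6),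
    (T2, [A2, A1], V A0 A2 A1 A6 A4 A5 A3, V A2 A0 A3 A6 A1 A4 A5, V A2 A0 A4 A3 A6 A1 A5, V A3 A0 A1 A5 A2 A6 A4),
    (T1, [A1], V A3 A1 A0 A5 A6 A2 A4, V A5 A1 A6 A4 A3 A2 A0, V A2 A4 A5 A0 A1 A6 A3, V A0 A6 A2 A1 A4 A5 A3),
    (T1, [A1], V A2 A5 A3 A6 A1 A4 A0, V A0 A3 A1 A4 A2 A6 A5, V A2 A5 A3 A6 A1 A4 A0, V A2 A3 A5 A0 A6 A1 A4),
    (T1, [A1], V A0 A1 A2 A6 A5 A4 A3, V A3 A6 A5 A4 A0 A1 A2, V A3 A6 A5 A4 A0 A1 A2, V A1 A4 A2 A5 A0 A3 A6),
    (T1, [A1], V A0 A3 A1 A4 A6 A2 A5, V A0 A3 A1 A4 A6 A2 A5, V A0 A3 A1 A4 A6 A2 A5, V A0 A1 A3 A5 A4 A6 A2),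
    (T2, [A1, A2], V A0 A3 A5 A2 A6 A4 A1, V A1 A4 A6 A5 A2 A3 A0, V A1 A4 A6 A5 A2 A3 A0, V A3 A5 A2 A4 A6 A1 A0),
    (T3, [A1, A2, A3], V A0 A3 A1 A5 A6 A2 A4, V A5 A6 A2 A4 A3 A1 A0, V A4 A2 A6 A5 A1 A3 A0, V A5 A6 A2 A4 A3 A1 A0),
    (T1, [A1], V A5 A1 A6 A2 A4 A0 A3, V A0 A3 A1 A4 A2 A6 A5, V A5 A1 A6 A2 A4 A0 A3, V A5 A6 A1 A3 A2 A4 A0),
    (T1, [A1], V A4 A2 A1 A6 A0 A3 A5, V A2 A1 A3 A4 A6 A5 A0, V A3 A5 A6 A1 A2 A0 A4, V A1 A0 A3 A2 A5 A6 A4),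
    (T1, [A1], V A0 A2 A3 A5 A4 A1 A6, V A2 A0 A6 A4 A3 A5 A1, V A2 A0 A6 A4 A3 A5 A1, V A6 A0 A4 A5 A2 A1 A3),
    (T2, [A1, A3, A2, A1], V A4 A6 A5 A3 A1 A2 A0, V A4 A6 A5 A2 A0 A3 A1, V A0 A4 A3 A5 A6 A2 A1, V A4 A3 A1 A0 A6 A5 A2),
    (T6, [A1], V A0 A1 A2 A3 A4 A5 A6, V A0 A1 A2 A3 A4 A5 A6, V A0 A1 A2 A3 A4 A5 A6, V A0 A1 A2 A3 A4 A5 A6),
    (T2, [A2, A1], V A5 A0 A6 A4 A2 A3 A1, V A5 A0 A6 A3 A1 A4 A2, V A0 A5 A2 A1 A4 A6 A3, V A1 A5 A6 A3 A0 A4 A2),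
    (T2, [A1, A2], V A1 A4 A6 A3 A0 A5 A2, V A2 A5 A0 A6 A3 A4 A1, V A1 A4 A5 A3 A2 A6 A0, V A4 A6 A3 A5 A0 A2 A1),
    (T1, [A1], V A6 A0 A1 A5 A4 A3 A2, V A5 A2 A3 A4 A0 A1 A6, V A2 A5 A4 A3 A6 A0 A1, V A0 A3 A1 A4 A6 A2 A5),
    (T2, [A2, A1], V A2 A4 A3 A1 A6 A0 A5, V A5 A0 A6 A3 A1 A4 A2, V A4 A2 A6 A5 A1 A3 A0, V A5 A2 A3 A0 A4 A1 A6),
    (T1, [A1], V A1 A0 A6 A2 A3 A4 A5, V A3 A6 A5 A4 A1 A0 A2, V A6 A3 A4 A5 A2 A1 A0, V A3 A0 A2 A6 A4 A1 A5),
    (T2, [A1, A3, A2, A1], V A5 A0 A6 A4 A2 A3 A1, V A5 A0 A6 A3 A1 A4 A2, V A0 A4 A3 A5 A6 A2 A1, V A5 A4 A2 A1 A0 A6 A3),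
    (T1, [A1], V A5 A4 A3 A6 A0 A1 A2, V A6 A2 A3 A4 A1 A0 A5, V A3 A0 A1 A2 A6 A5 A4, V A0 A4 A6 A3 A1 A5 A2),
    (T1, [A1], V A1 A4 A2 A5 A0 A3 A6, V A0 A5 A1 A6 A2 A4 A3, V A1 A4 A2 A5 A0 A3 A6, V A1 A2 A4 A6 A5 A0 A3),
    (T2, [A1, A3, A2, A1], V A3 A5 A4 A2 A0 A1 A6, V A3 A5 A4 A1 A6 A2 A0, V A0 A4 A3 A5 A6 A2 A1, V A3 A2 A0 A6 A5 A4 A1),
    (T2, [A2, A1], V A0 A5 A6 A1 A3 A2 A4, V A3 A1 A2 A4 A0 A6 A5, V A4 A6 A2 A3 A0 A5 A1, V A6 A2 A1 A4 A0 A3 A5),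
    (T1, [A1], V A1 A3 A4 A6 A5 A2 A0, V A2 A0 A4 A6 A3 A5 A1, V A3 A1 A0 A5 A4 A6 A2, V A0 A1 A5 A6 A3 A2 A4),
    (T2, [A1, A3, A2, A1], V A2 A4 A3 A1 A6 A0 A5, V A2 A4 A3 A0 A5 A1 A6, V A0 A4 A3 A5 A6 A2 A1, V A2 A1 A6 A5 A4 A3 A0),
    (T2, [A2, A1], V A3 A5 A4 A2 A0 A1 A6, V A4 A0 A3 A5 A1 A6 A2, V A5 A3 A0 A6 A2 A4 A1, V A6 A3 A4 A1 A5 A2 A0),
    (T1, [A1], V A5 A0 A1 A3 A2 A6 A4, V A5 A0 A2 A4 A3 A6 A1, V A0 A5 A4 A2 A1 A3 A6, V A4 A5 A2 A3 A0 A6 A1),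
    (T2, [A1, A2], V A1 A5 A3 A6 A2 A4 A0, V A1 A5 A3 A4 A0 A6 A2, V A0 A3 A6 A5 A4 A2 A1, V A1 A6 A2 A0 A5 A3 A4),
    (T1, [A1], V A3 A0 A2 A6 A4 A1 A5, V A1 A4 A0 A3 A2 A6 A5, V A4 A1 A3 A0 A5 A2 A6, V A6 A5 A3 A1 A2 A0 A4),
    (T2, [A1, A2], V A3 A0 A5 A1 A4 A6 A2, V A3 A0 A5 A6 A2 A1 A4, V A0 A3 A6 A5 A4 A2 A1, V A3 A1 A4 A2 A0 A5 A6),
    (T3, [A1, A2, A3], V A0 A1 A5 A4 A2 A3 A6, V A6 A4 A5 A1 A3 A0 A2, V A5 A2 A1 A3 A4 A0 A6, V A6 A4 A5 A1 A3 A0 A2),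
    (T1, [A1], V A3 A2 A1 A4 A5 A6 A0, V A2 A6 A4 A3 A1 A0 A5, V A1 A5 A6 A0 A4 A3 A2, V A5 A2 A4 A1 A6 A3 A0)]"

definition sols15 :: "iso list" where
  "sols15 = [(T0, [A3, A2, A1], V A0 A1 A6 A5 A2 A4 A3, V A5 A6 A0 A1 A3 A2 A4, V A4 A6 A0 A3 A5 A1 A2, V A2 A4 A5 A1 A3 A6 A0),
    (T0, [A3, A2, A1], V A1 A5 A6 A4 A2 A0 A3, V A2 A5 A1 A4 A3 A0 A6, V A3 A2 A5 A0 A6 A1 A4, V A5 A4 A0 A2 A1 A3 A6)]"

declare [[argo_timeout = 1000]]

context net7 begin

lemma no_sols0: "\<not> start a b d st0"
proof
  assume st: "start a b d st0"
  show False using net_clauses st[unfolded start_simps] by argo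
qed

lemma no_sols1: "\<not> start a b d st1"
proof
  assume st: "start a b d st1"
  show False using net_clauses st[unfolded start_simps] by argo
qed

text \<open>Completeness by refutation: every listed completion is blocked by negating the
  conjunction of its 98 entries in \<open>a\<close> and \<open>b\<close>, and with all of them
  blocked the clauses of the plane are contradictory.\<close>

lemma sols2: assumes st: "start a b d st2" shows "\<exists>w\<in>set sols2. holds a b w"
proof (rule ccontr)
  assume "\<not> ?thesis"
  then have "\<forall>w\<in>set sols2. \<not> holds a b w" by blast
  note neg = this[unfolded sols2_def list.set ball_simps]
  show False using net_clauses st[unfolded start_simps] neg[unfolded word_simps] by argo
qed

lemma sols3: assumes st: "start a b d st3" shows "\<exists>w\<in>set sols3. holds a b w"
proof (rule ccontr)
  assume "\<not> ?thesis"
  then have "\<forall>w\<in>set sols3. \<not> holds a b w" by blast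
  note neg = this[unfolded sols3_def list.set ball_simps]
  show False using net_clauses st[unfolded start_simps] neg[unfolded word_simps] by argo
qed

lemma sols4: assumes st: "start a b d st4" shows "\<exists>w\<in>set sols4. holds a b w"
proof (rule ccontr)
  assume "\<not> ?thesis"
  then have "\<forall>w\<in>set sols4. \<not> holds a b w" by blast
  note neg = this[unfolded sols4_def list.set ball_simps]
  show False using net_clauses st[unfolded start_simps] neg[unfolded word_simps] by argo
qed

lemma sols5: assumes st: "start a b d st5" shows "\<exists>w\<in>set sols5. holds a b w"
proof (rule ccontr)
  assume "\<not> ?thesis"
  then have "\<forall>w\<in>set sols5. \<not> holds a b w" by blast
  note neg = this[unfolded sols5_def list.set ball_simps]
  show False using net_clauses st[unfolded start_simps] neg[unfolded word_simps] by argo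
qed

lemma sols6: assumes st: "start a b d st6" shows "\<exists>w\<in>set sols6. holds a b w"
proof (rule ccontr)
  assume "\<not> ?thesis"
  then have "\<forall>w\<in>set sols6. \<not> holds a b w" by blast
  note neg = this[unfolded sols6_def list.set ball_simps]
  show False using net_clauses st[unfolded start_simps] neg[unfolded word_simps] by argo
qed

lemma no_sols7: "\<not> start a b d st7"
proof
  assume st: "start a b d st7"
  show False using net_clauses st[unfolded start_simps] by argo
qed

lemma sols8: assumes st: "start a b d st8" shows "\<exists>w\<in>set sols8. holds a b w"
proof (rule ccontr)
  assume "\<not> ?thesis"
  then have "\<forall>w\<in>set sols8. \<not> holds a b w" by blast
  note neg = this[unfolded sols8_def list.set ball_simps]
  show False using net_clauses st[unfolded start_simps] neg[unfolded word_simps] by argo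
qed

lemma sols9: assumes st: "start a b d st9" shows "\<exists>w\<in>set sols9. holds a b w"
proof (rule ccontr)
  assume "\<not> ?thesis"
  then have "\<forall>w\<in>set sols9. \<not> holds a b w" by blast
  note neg = this[unfolded sols9_def list.set ball_simps]
  show False using net_clauses st[unfolded start_simps] neg[unfolded word_simps] by argo
qed

lemma sols10: assumes st: "start a b d st10" shows "\<exists>w\<in>set sols10. holds a b w"
proof (rule ccontr)
  assume "\<not> ?thesis"
  then have "\<forall>w\<in>set sols10. \<not> holds a b w" by blast
  note neg = this[unfolded sols10_def list.set ball_simps]
  show False using net_clauses st[unfolded start_simps] neg[unfolded word_simps] by argo
qed

lemma sols11: assumes st: "start a b d st11" shows "\<exists>w\<in>set sols11. holds a b w"
proof (rule ccontr)
  assume "\<not> ?thesis"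
  then have "\<forall>w\<in>set sols11. \<not> holds a b w" by blast
  note neg = this[unfolded sols11_def list.set ball_simps]
  show False using net_clauses st[unfolded start_simps] neg[unfolded word_simps] by argo
qed

lemma no_sols12: "\<not> start a b d st12"
proof
  assume st: "start a b d st12"
  show False using net_clauses st[unfolded start_simps] by argo
qed

lemma sols13: assumes st: "start a b d st13" shows "\<exists>w\<in>set sols13. holds a b w"
proof (rule ccontr)
  assume "\<not> ?thesis"
  then have "\<forall>w\<in>set sols13. \<not> holds a b w" by blast
  note neg = this[unfolded sols13_def list.set ball_simps]
  show False using net_clauses st[unfolded start_simps] neg[unfolded word_simps] by argo
qed

lemma sols14: assumes st: "start a b d st14" shows "\<exists>w\<in>set sols14. holds a b w"
proof (rule ccontr)
  assume "\<not> ?thesis"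
  then have "\<forall>w\<in>set sols14. \<not> holds a b w" by blast
  note neg = this[unfolded sols14_def list.set ball_simps]
  show False using net_clauses st[unfolded start_simps] neg[unfolded word_simps] by argo
qed

lemma sols15: assumes st: "start a b d st15" shows "\<exists>w\<in>set sols15. holds a b w"
proof (rule ccontr)
  assume "\<not> ?thesis"
  then have "\<forall>w\<in>set sols15. \<not> holds a b w" by blast
  note neg = this[unfolded sols15_def list.set ball_simps]
  show False using net_clauses st[unfolded start_simps] neg[unfolded word_simps] by argo
qed

lemma no_sols16: "\<not> start a b d st16"
proof
  assume st: "start a b d st16"
  show False using net_clauses st[unfolded start_simps] by argo
qed

lemma no_sols17: "\<not> start a b d st17"
proof
  assume st: "start a b d st17"
  show False using net_clauses st[unfolded start_simps] by argo
qed

end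

section \<open>From completed starts to the classification\<close>

definition ok_iso :: "iso \<Rightarrow> bool" where
  "ok_iso w = (case w of (T, ks, p, q, r, s) \<Rightarrow>
    if elem T types then if isperm p then if isperm q then if isperm r then isperm s
    else False else False else False else False)"

fun on_net :: "(s7 \<Rightarrow> s7 \<Rightarrow> s7 \<Rightarrow> s7 \<Rightarrow> bool) \<Rightarrow> s7 \<times> s7 \<times> s7 \<times> s7 \<Rightarrow> bool" where
  "on_net N (y, z, f, g) = N y z f g"

lemma eqv_swp: "eqv N (\<lambda>y z f g. on_net N (swp k (y, z, f, g)))"
  by (cases k) (auto intro: eqv.intros)

lemma on_net_swp: "on_net (\<lambda>y z f g. on_net N (swp k (y, z, f, g))) w = on_net N (swp k w)"
  by (cases w) simp

lemma eqv_swps: "eqv N (\<lambda>y z f g. on_net N (swps ks (y, z, f, g)))"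
proof (induction ks arbitrary: N)
  case Nil
  show ?case by (simp add: eqv_refl)
next
  case (Cons k ks)
  from eqv_trans[OF eqv_swp[of N k] Cons.IH] show ?case by (simp add: on_net_swp)
qed

lemma tn_unique:
  assumes "net4 N" "\<And>y z. N y z (fst T $ y $ z) (snd T $ y $ z)"
  shows "N = tn T"
proof (intro ext)
  fix y z f g
  show "N y z f g = tn T y z f g"
    using net4_eq[OF assms(1) assms(2)[of y z], of y z f g] assms(2)[of y z] by (auto simp: tn_def)
qed

lemma net7_net4:
  assumes N: "net4 N"
  shows "net7 (\<lambda>y z f. \<exists>g. N y z f g) (\<lambda>y z g. \<exists>f. N y z f g) (\<lambda>z f g. \<exists>y. N y z f g)"
proof -
  note ex = net4_ex[OF N]
  note eq = net4_eq[OF N]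
  show ?thesis
  proof
    show "\<exists>!f. \<exists>g. N y z f g" for y z
      by (rule ex_ex1I; (use ex(1)[of y z] in blast)?; (elim exE, drule (1) eq, simp, simp)?)
    show "\<exists>!z. \<exists>g. N y z f g" for y f
      by (rule ex_ex1I; (use ex(2)[of y f] in blast)?; (elim exE, drule (1) eq, simp, simp)?)
    show "\<exists>!y. \<exists>g. N y z f g" for z f
      by (rule ex_ex1I; (use ex(4)[of z f] in blast)?; (elim exE, drule (1) eq, simp, simp)?)
    show "\<exists>!g. \<exists>f. N y z f g" for y z
      by (rule ex_ex1I; (use ex(1)[of y z] in blast)?; (elim exE, drule (1) eq, simp, simp)?)
    show "\<exists>!z. \<exists>f. N y z f g" for y g
      by (rule ex_ex1I; (use ex(3)[of y g] in blast)?; (elim exE, drule (1) eq, simp, simp)?)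
    show "\<exists>!y. \<exists>f. N y z f g" for z g
      by (rule ex_ex1I; (use ex(5)[of z g] in blast)?; (elim exE, drule (1) eq, simp, simp)?)
    show "\<exists>!g. \<exists>y. N y z f g" for z f
      by (rule ex_ex1I; (use ex(4)[of z f] in blast)?; (elim exE, drule (1) eq, simp, simp)?)
    show "\<exists>!f. \<exists>y. N y z f g" for z g
      by (rule ex_ex1I; (use ex(5)[of z g] in blast)?; (elim exE, drule (1) eq, simp, simp)?)
    show "\<exists>!z. \<exists>y. N y z f g" for f g
      by (rule ex_ex1I; (use ex(6)[of f g] in blast)?; (elim exE, drule (1) eq, simp, simp)?)
    show "\<exists>y. N y z f g" if h: "\<exists>g. N y z f g" "\<exists>f. N y z f g" for y z f g
    proof -
      from h obtain g' f' where n: "N y z f g'" "N y z f' g" by blast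
      from eq[OF n] n show ?thesis by auto
    qed
    show "\<exists>f. N y z f g" if h: "\<exists>g. N y z f g" "\<exists>y. N y z f g" for y z f g
    proof -
      from h obtain g' y' where n: "N y z f g'" "N y' z f g" by blast
      from eq[OF n] n show ?thesis by auto
    qed
    show "\<exists>g. N y z f g" if h: "\<exists>f. N y z f g" "\<exists>y. N y z f g" for y z f g
    proof -
      from h obtain f' y' where n: "N y z f' g" "N y' z f g" by blast
      from eq[OF n] n show ?thesis by auto
    qed
  qed
qed

text \<open>Read through the transpositions and the four relabellings, the plane contains every word
  of \<open>T\<close>. A plane has exactly one word for each \<open>(y, z)\<close>, so it is then
  equal to \<open>tn T\<close>.\<close>

lemma holds_classified:
  assumes N: "net4 N" and h: "holds (\<lambda>y z f. \<exists>g. N y z f g) (\<lambda>y z g. \<exists>f. N y z f g) w" and ok: "ok_iso w"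
  shows "classified N"
proof -
  obtain T ks p q r s where w: "w = (T, ks, p, q, r, s)" by (metis prod_cases6)
  have b: "T \<in> set types" "bij (at p)" "bij (at q)" "bij (at r)" "bij (at s)"
    using ok by (auto simp: w ok_iso_def isperm_iff split: if_splits)
  have on: "on_net N u" if "on_word (\<lambda>y z f. \<exists>g. N y z f g) (\<lambda>y z g. \<exists>f. N y z f g) u" for u
  proof -
    obtain y z f g where u: "u = (y, z, f, g)" by (metis prod_cases4)
    from that obtain g' f' where n: "N y z f g'" "N y z f' g" by (auto simp: u)
    from net4_eq[OF N n] n show ?thesis by (simp add: u)
  qed
  let ?M = "\<lambda>y z f g. on_net N (swps ks (at p y, at q z, at r f, at s g))"
  have e: "eqv N ?M" by (rule eqv_relabel[OF eqv_swps b(2-5)])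
  have "?M y z (fst T $ y $ z) (snd T $ y $ z)" for y z
    using h on unfolding holds_def w iso_word.simps by blast
  from tn_unique[OF eqv_net4[OF e N] this] e have "eqv N (tn T)" by simp
  with b(1) show ?thesis unfolding classified_def by blast
qed

text \<open>Only the names of the lines are missing from the normal form. The map \<open>h\<close>
  names a line by its symbol \<open>f\<close> in column \<open>A0\<close>; the condition
  \<open>fst st $ A0 = A1\<close> is what gives the second line the name \<open>A1\<close>.\<close>

lemma good_startI:
  assumes sol: "\<And>a b d. net7 a b d \<Longrightarrow> start a b d st \<Longrightarrow> \<exists>w\<in>set ws. holds a b w"
    and ok: "alls ok_iso ws" and st0: "fst st $ A0 = A1"
  shows "good id (at (fst st)) (at (snd st))"
  unfolding good_def
proof (intro allI impI)
  fix N :: "s7 \<Rightarrow> s7 \<Rightarrow> s7 \<Rightarrow> s7 \<Rightarrow> bool" and y0 y1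
  assume N: "net4 N" "y0 \<noteq> y1" "\<forall>i. N y0 i i i" "\<forall>i. N y1 (id i) (fst st $ i) (snd st $ i)"
  note eq = net4_eq[OF N(1)]
  have "\<forall>f. \<exists>y g. N y A0 f g" using net4_ex(4)[OF N(1)] by blast
  then obtain h G where h: "\<And>f. N (h f) A0 f (G f)" by metis
  have "inj h" using eq[OF h h] by (auto intro!: injI)
  then have bh: "bij h" by (simp add: bij_def finite_UNIV_inj_surj)
  have h0: "h A0 = y0" using eq[OF h[of A0], of y0 A0 A0 A0] N(3) by auto
  have h1: "h A1 = y1" using eq[OF h[of A1], of y1 A0 A1 "snd st $ A0"] N(4)[rule_format, of A0] st0 by auto
  let ?M = "\<lambda>y z f g. N (h y) (id z) (id f) (id g)"
  have M: "net4 ?M" by (rule net4_relabel[OF N(1) bh bij_id bij_id bij_id])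
  have "start (\<lambda>y z f. \<exists>g. ?M y z f g) (\<lambda>y z g. \<exists>f. ?M y z f g) (\<lambda>z f g. \<exists>y. ?M y z f g) st"
    unfolding start_def
  proof (intro allI conjI)
    fix i
    have "?M A0 i i i" using N(3) h0 by simp
    then show "\<exists>g. ?M A0 i i g" "\<exists>f. ?M A0 i f i" "\<exists>y. ?M y i i i" by blast+
    have "?M i A0 i (G i)" using h by simp
    then show "\<exists>g. ?M i A0 i g" by blast
    have "?M A1 i (fst st $ i) (snd st $ i)" using N(4) h1 by simp
    then show "\<exists>g. ?M A1 i (fst st $ i) g" "\<exists>f. ?M A1 i f (snd st $ i)"
      "\<exists>y. ?M y i (fst st $ i) (snd st $ i)" by blast+
  qed
  from sol[OF net7_net4[OF M] this] obtain w where
    "w \<in> set ws" "holds (\<lambda>y z f. \<exists>g. ?M y z f g) (\<lambda>y z g. \<exists>f. ?M y z f g) w" by blast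
  with ok have "classified ?M" by (intro holds_classified[OF M]) auto
  then show "classified N" by (rule classified_eqv[OF eqv_relabel[OF eqv_refl bh bij_id bij_id bij_id]])
qed

lemma ok_sols:
  "alls ok_iso sols2"
  "alls ok_iso sols3"
  "alls ok_iso sols4"
  "alls ok_iso sols5"
  "alls ok_iso sols6"
  "alls ok_iso sols8"
  "alls ok_iso sols9"
  "alls ok_iso sols10"
  "alls ok_iso sols11"
  "alls ok_iso sols13"
  "alls ok_iso sols14"
  "alls ok_iso sols15"
  by code_simp+

lemma starts_fst:
  "fst st0 $ A0 = A1"
  "fst st1 $ A0 = A1"
  "fst st2 $ A0 = A1"
  "fst st3 $ A0 = A1"
  "fst st4 $ A0 = A1"
  "fst st5 $ A0 = A1"
  "fst st6 $ A0 = A1"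
  "fst st7 $ A0 = A1"
  "fst st8 $ A0 = A1"
  "fst st9 $ A0 = A1"
  "fst st10 $ A0 = A1"
  "fst st11 $ A0 = A1"
  "fst st12 $ A0 = A1"
  "fst st13 $ A0 = A1"
  "fst st14 $ A0 = A1"
  "fst st15 $ A0 = A1"
  "fst st16 $ A0 = A1"
  "fst st17 $ A0 = A1"
  by code_simp+

lemma good0: "good id (at (fst st0)) (at (snd st0))"
  by (rule good_startI[where ws = "[]", OF _ _ starts_fst(1)]) (use net7.no_sols0 in auto)

lemma good1: "good id (at (fst st1)) (at (snd st1))"
  by (rule good_startI[where ws = "[]", OF _ _ starts_fst(2)]) (use net7.no_sols1 in auto)

lemma good2: "good id (at (fst st2)) (at (snd st2))"
  by (rule good_startI[OF net7.sols2 ok_sols(1) starts_fst(3)])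

lemma good3: "good id (at (fst st3)) (at (snd st3))"
  by (rule good_startI[OF net7.sols3 ok_sols(2) starts_fst(4)])

lemma good4: "good id (at (fst st4)) (at (snd st4))"
  by (rule good_startI[OF net7.sols4 ok_sols(3) starts_fst(5)])

lemma good5: "good id (at (fst st5)) (at (snd st5))"
  by (rule good_startI[OF net7.sols5 ok_sols(4) starts_fst(6)])

lemma good6: "good id (at (fst st6)) (at (snd st6))"
  by (rule good_startI[OF net7.sols6 ok_sols(5) starts_fst(7)])

lemma good7: "good id (at (fst st7)) (at (snd st7))"
  by (rule good_startI[where ws = "[]", OF _ _ starts_fst(8)]) (use net7.no_sols7 in auto)

lemma good8: "good id (at (fst st8)) (at (snd st8))"
  by (rule good_startI[OF net7.sols8 ok_sols(6) starts_fst(9)])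

lemma good9: "good id (at (fst st9)) (at (snd st9))"
  by (rule good_startI[OF net7.sols9 ok_sols(7) starts_fst(10)])

lemma good10: "good id (at (fst st10)) (at (snd st10))"
  by (rule good_startI[OF net7.sols10 ok_sols(8) starts_fst(11)])

lemma good11: "good id (at (fst st11)) (at (snd st11))"
  by (rule good_startI[OF net7.sols11 ok_sols(9) starts_fst(12)])

lemma good12: "good id (at (fst st12)) (at (snd st12))"
  by (rule good_startI[where ws = "[]", OF _ _ starts_fst(13)]) (use net7.no_sols12 in auto)

lemma good13: "good id (at (fst st13)) (at (snd st13))"
  by (rule good_startI[OF net7.sols13 ok_sols(10) starts_fst(14)])

lemma good14: "good id (at (fst st14)) (at (snd st14))"
  by (rule good_startI[OF net7.sols14 ok_sols(11) starts_fst(15)])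

lemma good15: "good id (at (fst st15)) (at (snd st15))"
  by (rule good_startI[OF net7.sols15 ok_sols(12) starts_fst(16)])

lemma good16: "good id (at (fst st16)) (at (snd st16))"
  by (rule good_startI[where ws = "[]", OF _ _ starts_fst(17)]) (use net7.no_sols16 in auto)

lemma good17: "good id (at (fst st17)) (at (snd st17))"
  by (rule good_startI[where ws = "[]", OF _ _ starts_fst(18)]) (use net7.no_sols17 in auto)

theorem net4_classified: assumes "net4 N" shows "classified N"
proof (rule classification[OF _ assms])
  have "\<forall>st\<in>set starts. good id (at (fst st)) (at (snd st))"
    unfolding starts_def by (simp add: good0 good1 good2 good3 good4 good5 good6 good7 good8 good9 good10 good11 good12 good13 good14 good15 good16 good17)
  then show "good id (at s) (at t)" if "(s, t) \<in> set starts" for s t using that by auto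
qed

lemma if_conj: "(if a then b else False) \<longleftrightarrow> a \<and> b"
  by simp

subsection \<open>A plane with a marked line\<close>

text \<open>A plane that contains a marked line turns into an idempotent Latin square once the three
  remaining coordinates are labelled along that line.\<close>

definition mk :: "s7 v7 v7 \<Rightarrow> (s7 \<Rightarrow> s7 \<Rightarrow> s7 \<Rightarrow> s7 \<Rightarrow> bool) \<Rightarrow> s7 \<Rightarrow> bool" where
  "mk A N x0 \<longleftrightarrow> (\<exists>p q r. bij p \<and> bij q \<and> bij r \<and> (\<forall>i. N x0 (p i) (q i) (r i)) \<and>
    (\<forall>i j. \<exists>x. N x (p i) (q j) (r (A $ i $ j))))"

definition Mk :: "s7 v7 v7 set \<Rightarrow> (s7 \<Rightarrow> s7 \<Rightarrow> s7 \<Rightarrow> s7 \<Rightarrow> bool) \<Rightarrow> bool" where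
  "Mk fs N \<longleftrightarrow> (\<forall>x0. \<exists>A\<in>fs. mk A N x0)"

definition swap12 :: "s7 v7 v7 \<Rightarrow> s7 v7 v7 \<Rightarrow> s7 v7 \<Rightarrow> bool" where
  "swap12 A B e = (if isperm e then every (\<lambda>i. every (\<lambda>j. B $ (e $ j) $ (e $ i) = e $ (A $ i $ j))) else False)"

definition swap23 :: "s7 v7 v7 \<Rightarrow> s7 v7 v7 \<Rightarrow> s7 v7 \<Rightarrow> bool" where
  "swap23 A B e = (if isperm e then every (\<lambda>i. if isperm (A $ i) then
    every (\<lambda>j. B $ (e $ i) $ (e $ (A $ i $ j)) = e $ j) else False) else False)"

text \<open>Transposing a square and exchanging its columns with its entries generate all six
  conjugates. A list closed under both, up to relabelling, describes marked lines independently of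
  the order of the three coordinates.\<close>

definition closed :: "s7 v7 v7 set \<Rightarrow> bool" where
  "closed fs \<longleftrightarrow> (\<forall>A\<in>fs. (\<exists>B\<in>fs. \<exists>e. swap12 A B e) \<and> (\<exists>B\<in>fs. \<exists>e. swap23 A B e))"

lemma Mk_swap12:
  assumes "closed fs" "Mk fs N"
  shows "Mk fs (\<lambda>x z f. N x f z)"
  unfolding Mk_def
proof
  fix x0
  obtain A where A: "A \<in> fs" "mk A N x0" using assms(2) by (auto simp: Mk_def)
  then obtain p q r where m: "bij p" "bij q" "bij r" "\<And>i. N x0 (p i) (q i) (r i)"
    "\<And>i j. \<exists>x. N x (p i) (q j) (r (A $ i $ j))" unfolding mk_def by blast
  obtain B e where B: "B \<in> fs" "bij (at e)" "\<And>i j. B $ (e $ j) $ (e $ i) = e $ (A $ i $ j)"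
    using assms(1) A(1) unfolding closed_def swap12_def if_conj every_iff isperm_iff by blast
  define c where "c = at (inv7 e)"
  have c: "bij c" "\<And>i. c (e $ i) = i" "\<And>i. e $ (c i) = i"
    using B(2) by (simp_all add: c_def bij_inv7 inv7_at at_inv7)
  have "mk B (\<lambda>x z f. N x f z) x0" unfolding mk_def
  proof (rule exI[of _ "q \<circ> c"], rule exI[of _ "p \<circ> c"], rule exI[of _ "r \<circ> c"], intro conjI allI)
    show "bij (q \<circ> c)" "bij (p \<circ> c)" "bij (r \<circ> c)" using m(1-3) c(1) by (auto intro: bij_comp)
    show "N x0 ((p \<circ> c) i) ((q \<circ> c) i) ((r \<circ> c) i)" for i using m(4) by simp
    show "\<exists>x. N x ((p \<circ> c) j) ((q \<circ> c) i) ((r \<circ> c) (B $ i $ j))" for i j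
      using m(5)[of "c j" "c i"] B(3)[of "c i" "c j"] c by simp
  qed
  with B(1) show "\<exists>B\<in>fs. mk B (\<lambda>x z f. N x f z) x0" by blast
qed

lemma Mk_swap23:
  assumes "closed fs" "Mk fs N"
  shows "Mk fs (\<lambda>x z f g. N x z g f)"
  unfolding Mk_def
proof
  fix x0
  obtain A where A: "A \<in> fs" "mk A N x0" using assms(2) by (auto simp: Mk_def)
  then obtain p q r where m: "bij p" "bij q" "bij r" "\<And>i. N x0 (p i) (q i) (r i)"
    "\<And>i j. \<exists>x. N x (p i) (q j) (r (A $ i $ j))" unfolding mk_def by blast
  \<comment> \<open>The equation is solved for the column: row \<open>i\<close> of \<open>A\<close>
    is a permutation, so each \<open>k\<close> is an entry \<open>A $ i $ j\<close>.\<close>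
  obtain B e where B: "B \<in> fs" "bij (at e)" "\<And>i k. \<exists>j. A $ i $ j = k \<and> B $ (e $ i) $ (e $ k) = e $ j"
  proof -
    from assms(1) A(1) obtain B e where B: "B \<in> fs" "bij (at e)" "\<And>i. bij (at (A $ i))"
      "\<And>i j. B $ (e $ i) $ (e $ (A $ i $ j)) = e $ j"
      unfolding closed_def swap23_def if_conj every_iff isperm_iff by blast
    show thesis
    proof (rule that[OF B(1,2)])
      fix i k
      obtain j where "k = A $ i $ j" using B(3)[of i] by (metis bij_pointE)
      then show "\<exists>j. A $ i $ j = k \<and> B $ (e $ i) $ (e $ k) = e $ j" using B(4)[of i j] by blast
    qed
  qed
  define c where "c = at (inv7 e)"
  have c: "bij c" "\<And>i. c (e $ i) = i" "\<And>i. e $ (c i) = i"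
    using B(2) by (simp_all add: c_def bij_inv7 inv7_at at_inv7)
  have "mk B (\<lambda>x z f g. N x z g f) x0" unfolding mk_def
  proof (rule exI[of _ "p \<circ> c"], rule exI[of _ "r \<circ> c"], rule exI[of _ "q \<circ> c"], intro conjI allI)
    show "bij (p \<circ> c)" "bij (r \<circ> c)" "bij (q \<circ> c)" using m(1-3) c(1) by (auto intro: bij_comp)
    show "N x0 ((p \<circ> c) i) ((q \<circ> c) i) ((r \<circ> c) i)" for i using m(4) by simp
    show "\<exists>x. N x ((p \<circ> c) i) ((q \<circ> c) (B $ i $ k)) ((r \<circ> c) k)" for i k
    proof -
      obtain j where "A $ (c i) $ j = c k" "B $ i $ k = e $ j" using B(3)[of "c i" "c k"] c by auto
      then show ?thesis using m(5)[of "c i" j] c by simp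
    qed
  qed
  with B(1) show "\<exists>B\<in>fs. mk B (\<lambda>x z f g. N x z g f) x0" by blast
qed

definition Full :: "s7 v7 v7 set \<Rightarrow> (s7 \<Rightarrow> s7 \<Rightarrow> s7 \<Rightarrow> s7 \<Rightarrow> bool) \<Rightarrow> bool" where
  "Full fs N \<longleftrightarrow> Mk fs N \<and> Mk fs (\<lambda>x z. N z x) \<and> Mk fs (\<lambda>x y z. N y z x) \<and> Mk fs (\<lambda>x y z f. N y z f x)"

lemma Mk_relabel:
  assumes "Mk fs (\<lambda>y z f g. N (a y) (b z) (c f) (d g))" "bij a" "bij b" "bij c" "bij d"
  shows "Mk fs N"
  unfolding Mk_def
proof
  fix x0
  obtain y where y: "x0 = a y" using assms(2) by (metis bij_pointE)
  obtain A where A: "A \<in> fs" "mk A (\<lambda>y z f g. N (a y) (b z) (c f) (d g)) y"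
    using assms(1) unfolding Mk_def by blast
  then obtain p q r where m: "bij p" "bij q" "bij r" "\<And>i. N (a y) (b (p i)) (c (q i)) (d (r i))"
    "\<And>i j. \<exists>x. N (a x) (b (p i)) (c (q j)) (d (r (A $ i $ j)))" unfolding mk_def by blast
  have "mk A N (a y)" unfolding mk_def
  proof (rule exI[of _ "b \<circ> p"], rule exI[of _ "c \<circ> q"], rule exI[of _ "d \<circ> r"], intro conjI allI)
    show "bij (b \<circ> p)" "bij (c \<circ> q)" "bij (d \<circ> r)" using m(1-3) assms(3-5) by (auto intro: bij_comp)
    show "N (a y) ((b \<circ> p) i) ((c \<circ> q) i) ((d \<circ> r) i)" for i using m(4) by simp
    show "\<exists>x. N x ((b \<circ> p) i) ((c \<circ> q) j) ((d \<circ> r) (A $ i $ j))" for i j using m(5)[of i j] by auto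
  qed
  with A(1) y show "\<exists>A\<in>fs. mk A N x0" by blast
qed

text \<open>A transposition of coordinates permutes the four directions of lines and reorders the
  three remaining coordinates within each. The former is absorbed because \<open>Full\<close> treats
  all directions, the latter by closure of \<open>fs\<close>.\<close>

lemma Full_eqv: assumes "eqv N M" "closed fs" shows "Full fs M \<Longrightarrow> Full fs N"
  using assms(1)
proof (induction rule: eqv.induct)
  case (eqv_relabel M a b c d)
  have "Full fs M" unfolding Full_def
  proof (intro conjI)
    note F = eqv_relabel.prems[unfolded Full_def]
    note b = eqv_relabel.hyps(2-5)
    show "Mk fs M" by (rule Mk_relabel[of fs M a b c d]) (use F b in simp_all)
    show "Mk fs (\<lambda>x z. M z x)" by (rule Mk_relabel[of fs "\<lambda>x z. M z x" b a c d]) (use F b in simp_all)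
    show "Mk fs (\<lambda>x y z. M y z x)" by (rule Mk_relabel[of fs "\<lambda>x y z. M y z x" c a b d]) (use F b in simp_all)
    show "Mk fs (\<lambda>x y z f. M y z f x)" by (rule Mk_relabel[of fs "\<lambda>x y z f. M y z f x" d a b c]) (use F b in simp_all)
  qed
  then show ?case by (rule eqv_relabel.IH)
next
  case (eqv_swap1 M)
  have "Full fs M" unfolding Full_def
  proof (intro conjI)
    note F = eqv_swap1.prems[unfolded Full_def]
    show "Mk fs M" "Mk fs (\<lambda>x z. M z x)" using F by simp_all
    show "Mk fs (\<lambda>x y z. M y z x)" using Mk_swap12[OF assms(2), of "\<lambda>x y z. M z y x"] F by simp
    show "Mk fs (\<lambda>x y z f. M y z f x)" using Mk_swap12[OF assms(2), of "\<lambda>x y z f. M z y f x"] F by simp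
  qed
  then show ?case by (rule eqv_swap1.IH)
next
  case (eqv_swap2 M)
  have "Full fs M" unfolding Full_def
  proof (intro conjI)
    note F = eqv_swap2.prems[unfolded Full_def]
    show "Mk fs M" using Mk_swap12[OF assms(2), of "\<lambda>x y z. M x z y"] F by simp
    show "Mk fs (\<lambda>x z. M z x)" "Mk fs (\<lambda>x y z. M y z x)" using F by simp_all
    show "Mk fs (\<lambda>x y z f. M y z f x)" using Mk_swap23[OF assms(2), of "\<lambda>x y z f. M y f z x"] F by simp
  qed
  then show ?case by (rule eqv_swap2.IH)
next
  case (eqv_swap3 M)
  have "Full fs M" unfolding Full_def
  proof (intro conjI)
    note F = eqv_swap3.prems[unfolded Full_def]
    show "Mk fs M" using Mk_swap23[OF assms(2), of "\<lambda>x y z f. M x y f z"] F by simp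
    show "Mk fs (\<lambda>x z. M z x)" using Mk_swap23[OF assms(2), of "\<lambda>x y z f. M y x f z"] F by simp
    show "Mk fs (\<lambda>x y z. M y z x)" "Mk fs (\<lambda>x y z f. M y z f x)" using F by simp_all
  qed
  then show ?case by (rule eqv_swap3.IH)
qed

text \<open>The squares that arise from the seven types, up to relabelling: those in \<open>forms_BEF\<close> from
  \<open>T1\<close>, \<open>T4\<close>, \<open>T5\<close>, \<open>T6\<close> and those in \<open>forms_BF\<close> from \<open>T1\<close>, \<open>T5\<close>, \<open>T6\<close>.\<close>

definition L0 :: "s7 v7 v7" where
  "L0 = V (V A0 A3 A1 A4 A5 A6 A2) (V A5 A1 A6 A0 A3 A2 A4) (V A3 A6 A2 A5 A1 A4 A0) (V A1 A2 A4 A3 A6 A0 A5) (V A2 A0 A5 A6 A4 A3 A1) (V A6 A4 A0 A1 A2 A5 A3) (V A4 A5 A3 A2 A0 A1 A6)"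
definition L1 :: "s7 v7 v7" where
  "L1 = V (V A0 A6 A4 A5 A2 A3 A1) (V A2 A1 A0 A6 A5 A4 A3) (V A5 A3 A2 A1 A6 A0 A4) (V A6 A4 A5 A3 A1 A2 A0) (V A3 A2 A1 A0 A4 A6 A5) (V A1 A0 A6 A4 A3 A5 A2) (V A4 A5 A3 A2 A0 A1 A6)"
definition L2 :: "s7 v7 v7" where
  "L2 = V (V A0 A2 A5 A6 A3 A1 A4) (V A6 A1 A3 A4 A2 A0 A5) (V A4 A0 A2 A5 A1 A6 A3) (V A5 A6 A1 A3 A0 A4 A2) (V A2 A5 A6 A1 A4 A3 A0) (V A3 A4 A0 A2 A6 A5 A1) (V A1 A3 A4 A0 A5 A2 A6)"
definition L3 :: "s7 v7 v7" where
  "L3 = V (V A0 A5 A1 A4 A6 A2 A3) (V A5 A1 A4 A2 A3 A6 A0) (V A1 A4 A2 A6 A0 A3 A5) (V A4 A2 A6 A3 A5 A0 A1) (V A6 A3 A0 A5 A4 A1 A2) (V A2 A6 A3 A0 A1 A5 A4) (V A3 A0 A5 A1 A2 A4 A6)"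
definition L4 :: "s7 v7 v7" where
  "L4 = V (V A0 A2 A6 A1 A3 A4 A5) (V A4 A1 A0 A6 A5 A3 A2) (V A3 A5 A2 A0 A6 A1 A4) (V A6 A4 A5 A3 A2 A0 A1) (V A2 A3 A1 A5 A4 A6 A0) (V A1 A6 A4 A2 A0 A5 A3) (V A5 A0 A3 A4 A1 A2 A6)"
definition L5 :: "s7 v7 v7" where
  "L5 = V (V A0 A4 A3 A6 A2 A1 A5) (V A2 A1 A5 A4 A3 A6 A0) (V A6 A0 A2 A5 A1 A4 A3) (V A1 A6 A0 A3 A5 A2 A4) (V A3 A5 A6 A2 A4 A0 A1) (V A4 A3 A1 A0 A6 A5 A2) (V A5 A2 A4 A1 A0 A3 A6)"
definition L6 :: "s7 v7 v7" where
  "L6 = V (V A0 A5 A4 A2 A1 A6 A3) (V A6 A1 A0 A4 A3 A2 A5) (V A1 A4 A2 A6 A5 A3 A0) (V A2 A0 A5 A3 A6 A4 A1) (V A5 A6 A3 A0 A4 A1 A2) (V A3 A2 A6 A1 A0 A5 A4) (V A4 A3 A1 A5 A2 A0 A6)"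
definition L7 :: "s7 v7 v7" where
  "L7 = V (V A0 A6 A3 A1 A2 A4 A5) (V A4 A1 A5 A2 A3 A6 A0) (V A3 A5 A2 A0 A6 A1 A4) (V A2 A4 A6 A3 A5 A0 A1) (V A5 A0 A1 A6 A4 A3 A2) (V A6 A2 A0 A4 A1 A5 A3) (V A1 A3 A4 A5 A0 A2 A6)"
definition L8 :: "s7 v7 v7" where
  "L8 = V (V A0 A4 A3 A2 A5 A6 A1) (V A6 A1 A5 A4 A0 A2 A3) (V A3 A5 A2 A6 A1 A0 A4) (V A1 A2 A0 A3 A6 A4 A5) (V A2 A3 A6 A5 A4 A1 A0) (V A4 A6 A1 A0 A3 A5 A2) (V A5 A0 A4 A1 A2 A3 A6)"
definition L9 :: "s7 v7 v7" where
  "L9 = V (V A0 A6 A3 A2 A1 A4 A5) (V A4 A1 A5 A6 A3 A2 A0) (V A5 A4 A2 A0 A6 A1 A3) (V A2 A0 A1 A3 A5 A6 A4) (V A6 A5 A0 A1 A4 A3 A2) (V A3 A2 A6 A4 A0 A5 A1) (V A1 A3 A4 A5 A2 A0 A6)"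
definition L10 :: "s7 v7 v7" where
  "L10 = V (V A0 A6 A1 A2 A3 A4 A5) (V A5 A1 A4 A6 A2 A0 A3) (V A3 A5 A2 A0 A6 A1 A4) (V A6 A4 A0 A3 A5 A2 A1) (V A1 A2 A3 A5 A4 A6 A0) (V A4 A3 A6 A1 A0 A5 A2) (V A2 A0 A5 A4 A1 A3 A6)"
definition L11 :: "s7 v7 v7" where
  "L11 = V (V A0 A5 A3 A6 A1 A4 A2) (V A6 A1 A5 A4 A2 A3 A0) (V A1 A4 A2 A0 A3 A6 A5) (V A2 A6 A0 A3 A5 A1 A4) (V A3 A2 A6 A5 A4 A0 A1) (V A4 A0 A1 A2 A6 A5 A3) (V A5 A3 A4 A1 A0 A2 A6)"
definition L12 :: "s7 v7 v7" where
  "L12 = V (V A0 A4 A6 A2 A5 A1 A3) (V A6 A1 A4 A5 A3 A2 A0) (V A3 A0 A2 A4 A1 A6 A5) (V A2 A5 A0 A3 A6 A4 A1) (V A5 A6 A1 A0 A4 A3 A2) (V A1 A2 A3 A6 A0 A5 A4) (V A4 A3 A5 A1 A2 A0 A6)"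
definition L13 :: "s7 v7 v7" where
  "L13 = V (V A0 A4 A6 A2 A5 A3 A1) (V A5 A1 A3 A4 A6 A2 A0) (V A4 A0 A2 A5 A1 A6 A3) (V A2 A6 A1 A3 A0 A4 A5) (V A1 A3 A5 A6 A4 A0 A2) (V A6 A2 A0 A1 A3 A5 A4) (V A3 A5 A4 A0 A2 A1 A6)"
definition L14 :: "s7 v7 v7" where
  "L14 = V (V A0 A6 A3 A5 A1 A4 A2) (V A6 A1 A5 A2 A3 A0 A4) (V A1 A4 A2 A6 A0 A3 A5) (V A4 A2 A0 A3 A5 A6 A1) (V A5 A0 A6 A1 A4 A2 A3) (V A2 A3 A1 A4 A6 A5 A0) (V A3 A5 A4 A0 A2 A1 A6)"
definition L15 :: "s7 v7 v7" where
  "L15 = V (V A0 A5 A4 A2 A1 A6 A3) (V A4 A1 A0 A6 A3 A2 A5) (V A6 A3 A2 A1 A5 A0 A4) (V A2 A4 A5 A3 A6 A1 A0) (V A5 A6 A1 A0 A4 A3 A2) (V A3 A2 A6 A4 A0 A5 A1) (V A1 A0 A3 A5 A2 A4 A6)"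
definition L16 :: "s7 v7 v7" where
  "L16 = V (V A0 A6 A5 A2 A3 A1 A4) (V A3 A1 A4 A5 A6 A2 A0) (V A6 A0 A2 A4 A5 A3 A1) (V A2 A4 A0 A3 A1 A6 A5) (V A5 A3 A6 A1 A4 A0 A2) (V A4 A2 A1 A6 A0 A5 A3) (V A1 A5 A3 A0 A2 A4 A6)"
definition L17 :: "s7 v7 v7" where
  "L17 = V (V A0 A5 A3 A4 A6 A2 A1) (V A6 A1 A5 A0 A2 A3 A4) (V A1 A6 A2 A5 A3 A4 A0) (V A2 A4 A0 A3 A1 A6 A5) (V A5 A3 A6 A1 A4 A0 A2) (V A4 A2 A1 A6 A0 A5 A3) (V A3 A0 A4 A2 A5 A1 A6)"
definition L18 :: "s7 v7 v7" where
  "L18 = V (V A0 A3 A6 A2 A5 A4 A1) (V A6 A1 A0 A4 A3 A2 A5) (V A5 A4 A2 A0 A6 A1 A3) (V A2 A5 A4 A3 A1 A6 A0) (V A3 A6 A5 A1 A4 A0 A2) (V A1 A2 A3 A6 A0 A5 A4) (V A4 A0 A1 A5 A2 A3 A6)"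
definition L19 :: "s7 v7 v7" where
  "L19 = V (V A0 A6 A3 A1 A5 A4 A2) (V A2 A1 A5 A4 A3 A6 A0) (V A3 A5 A2 A6 A1 A0 A4) (V A6 A4 A0 A3 A2 A1 A5) (V A5 A3 A6 A0 A4 A2 A1) (V A4 A0 A1 A2 A6 A5 A3) (V A1 A2 A4 A5 A0 A3 A6)"
definition L20 :: "s7 v7 v7" where
  "L20 = V (V A0 A6 A1 A2 A5 A4 A3) (V A5 A1 A6 A4 A3 A2 A0) (V A3 A5 A2 A0 A6 A1 A4) (V A4 A0 A5 A3 A1 A6 A2) (V A6 A2 A3 A1 A4 A0 A5) (V A2 A3 A4 A6 A0 A5 A1) (V A1 A4 A0 A5 A2 A3 A6)"
definition L21 :: "s7 v7 v7" where
  "L21 = V (V A0 A2 A3 A6 A5 A4 A1) (V A6 A1 A5 A4 A3 A0 A2) (V A3 A5 A2 A0 A6 A1 A4) (V A1 A4 A6 A3 A0 A2 A5) (V A5 A3 A1 A2 A4 A6 A0) (V A4 A6 A0 A1 A2 A5 A3) (V A2 A0 A4 A5 A1 A3 A6)"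
definition L22 :: "s7 v7 v7" where
  "L22 = V (V A0 A5 A1 A2 A3 A6 A4) (V A6 A1 A4 A5 A0 A2 A3) (V A3 A0 A2 A1 A6 A4 A5) (V A2 A4 A6 A3 A5 A0 A1) (V A1 A6 A5 A0 A4 A3 A2) (V A4 A2 A3 A6 A1 A5 A0) (V A5 A3 A0 A4 A2 A1 A6)"
definition L23 :: "s7 v7 v7" where
  "L23 = V (V A0 A2 A3 A4 A6 A1 A5) (V A4 A1 A5 A6 A2 A3 A0) (V A1 A3 A2 A0 A5 A6 A4) (V A5 A6 A0 A3 A1 A4 A2) (V A3 A0 A6 A5 A4 A2 A1) (V A6 A4 A1 A2 A0 A5 A3) (V A2 A5 A4 A1 A3 A0 A6)"
definition L24 :: "s7 v7 v7" where
  "L24 = V (V A0 A6 A3 A2 A1 A4 A5) (V A5 A1 A0 A4 A6 A2 A3) (V A1 A4 A2 A6 A5 A3 A0) (V A2 A5 A1 A3 A0 A6 A4) (V A3 A0 A6 A5 A4 A1 A2) (V A6 A2 A4 A0 A3 A5 A1) (V A4 A3 A5 A1 A2 A0 A6)"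
definition L25 :: "s7 v7 v7" where
  "L25 = V (V A0 A4 A3 A2 A5 A6 A1) (V A2 A1 A5 A6 A3 A0 A4) (V A6 A0 A2 A5 A1 A4 A3) (V A4 A2 A0 A3 A6 A1 A5) (V A1 A5 A6 A0 A4 A3 A2) (V A3 A6 A1 A4 A2 A5 A0) (V A5 A3 A4 A1 A0 A2 A6)"
definition L26 :: "s7 v7 v7" where
  "L26 = V (V A0 A4 A1 A5 A3 A6 A2) (V A2 A1 A3 A6 A0 A4 A5) (V A3 A5 A2 A0 A6 A1 A4) (V A4 A6 A0 A3 A5 A2 A1) (V A6 A2 A5 A1 A4 A0 A3) (V A1 A3 A6 A4 A2 A5 A0) (V A5 A0 A4 A2 A1 A3 A6)"
definition L27 :: "s7 v7 v7" where
  "L27 = V (V A0 A2 A6 A4 A1 A3 A5) (V A4 A1 A0 A2 A5 A6 A3) (V A3 A5 A2 A0 A6 A1 A4) (V A2 A6 A5 A3 A0 A4 A1) (V A5 A3 A1 A6 A4 A2 A0) (V A6 A0 A4 A1 A3 A5 A2) (V A1 A4 A3 A5 A2 A0 A6)"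
definition L28 :: "s7 v7 v7" where
  "L28 = V (V A0 A2 A1 A4 A5 A6 A3) (V A4 A1 A0 A2 A6 A3 A5) (V A6 A3 A2 A5 A1 A4 A0) (V A1 A5 A6 A3 A0 A2 A4) (V A5 A6 A3 A1 A4 A0 A2) (V A3 A0 A4 A6 A2 A5 A1) (V A2 A4 A5 A0 A3 A1 A6)"
definition L29 :: "s7 v7 v7" where
  "L29 = V (V A0 A2 A1 A6 A3 A4 A5) (V A2 A1 A3 A5 A0 A6 A4) (V A6 A4 A2 A1 A5 A3 A0) (V A4 A0 A5 A3 A6 A1 A2) (V A5 A3 A6 A2 A4 A0 A1) (V A1 A6 A4 A0 A2 A5 A3) (V A3 A5 A0 A4 A1 A2 A6)"
definition L30 :: "s7 v7 v7" where
  "L30 = V (V A0 A4 A1 A5 A3 A6 A2) (V A5 A1 A0 A4 A6 A2 A3) (V A6 A3 A2 A0 A1 A4 A5) (V A2 A5 A6 A3 A0 A1 A4) (V A3 A2 A5 A6 A4 A0 A1) (V A4 A6 A3 A1 A2 A5 A0) (V A1 A0 A4 A2 A5 A3 A6)"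
definition L31 :: "s7 v7 v7" where
  "L31 = V (V A0 A2 A6 A4 A1 A3 A5) (V A2 A1 A5 A6 A3 A0 A4) (V A3 A4 A2 A1 A5 A6 A0) (V A4 A5 A0 A3 A6 A1 A2) (V A5 A6 A1 A0 A4 A2 A3) (V A6 A3 A4 A2 A0 A5 A1) (V A1 A0 A3 A5 A2 A4 A6)"
definition L32 :: "s7 v7 v7" where
  "L32 = V (V A0 A5 A6 A2 A3 A4 A1) (V A4 A1 A3 A5 A2 A6 A0) (V A1 A0 A2 A6 A5 A3 A4) (V A5 A4 A0 A3 A6 A1 A2) (V A3 A6 A1 A0 A4 A2 A5) (V A6 A2 A4 A1 A0 A5 A3) (V A2 A3 A5 A4 A1 A0 A6)"
definition L33 :: "s7 v7 v7" where
  "L33 = V (V A0 A6 A3 A4 A5 A1 A2) (V A6 A1 A4 A2 A0 A3 A5) (V A1 A0 A2 A5 A6 A4 A3) (V A2 A5 A6 A3 A1 A0 A4) (V A3 A2 A5 A0 A4 A6 A1) (V A4 A3 A1 A6 A2 A5 A0) (V A5 A4 A0 A1 A3 A2 A6)"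
definition L34 :: "s7 v7 v7" where
  "L34 = V (V A0 A2 A3 A4 A5 A6 A1) (V A2 A1 A4 A5 A6 A3 A0) (V A6 A5 A2 A0 A1 A4 A3) (V A4 A6 A1 A3 A0 A2 A5) (V A1 A3 A5 A6 A4 A0 A2) (V A3 A0 A6 A1 A2 A5 A4) (V A5 A4 A0 A2 A3 A1 A6)"
definition L35 :: "s7 v7 v7" where
  "L35 = V (V A0 A6 A1 A2 A3 A4 A5) (V A6 A1 A0 A5 A2 A3 A4) (V A3 A4 A2 A6 A5 A1 A0) (V A4 A2 A5 A3 A0 A6 A1) (V A5 A0 A6 A1 A4 A2 A3) (V A1 A3 A4 A0 A6 A5 A2) (V A2 A5 A3 A4 A1 A0 A6)"
definition L36 :: "s7 v7 v7" where
  "L36 = V (V A0 A5 A4 A2 A1 A6 A3) (V A4 A1 A5 A6 A3 A0 A2) (V A3 A6 A2 A5 A0 A1 A4) (V A6 A4 A0 A3 A5 A2 A1) (V A2 A0 A6 A1 A4 A3 A5) (V A1 A2 A3 A4 A6 A5 A0) (V A5 A3 A1 A0 A2 A4 A6)"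
definition L37 :: "s7 v7 v7" where
  "L37 = V (V A0 A4 A3 A6 A2 A1 A5) (V A5 A1 A6 A4 A0 A2 A3) (V A4 A5 A2 A0 A6 A3 A1) (V A2 A6 A5 A3 A1 A4 A0) (V A1 A3 A0 A5 A4 A6 A2) (V A6 A0 A1 A2 A3 A5 A4) (V A3 A2 A4 A1 A5 A0 A6)"
definition L38 :: "s7 v7 v7" where
  "L38 = V (V A0 A4 A1 A2 A5 A6 A3) (V A5 A1 A6 A4 A2 A3 A0) (V A6 A0 A2 A5 A3 A1 A4) (V A4 A5 A0 A3 A6 A2 A1) (V A1 A2 A3 A6 A4 A0 A5) (V A3 A6 A4 A1 A0 A5 A2) (V A2 A3 A5 A0 A1 A4 A6)"
definition L39 :: "s7 v7 v7" where
  "L39 = V (V A0 A2 A3 A6 A1 A4 A5) (V A6 A1 A4 A5 A3 A0 A2) (V A1 A5 A2 A4 A6 A3 A0) (V A2 A6 A5 A3 A0 A1 A4) (V A5 A0 A1 A2 A4 A6 A3) (V A4 A3 A6 A0 A2 A5 A1) (V A3 A4 A0 A1 A5 A2 A6)"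
definition L40 :: "s7 v7 v7" where
  "L40 = V (V A0 A5 A6 A4 A1 A3 A2) (V A4 A1 A0 A5 A2 A6 A3) (V A1 A6 A2 A0 A3 A4 A5) (V A2 A4 A5 A3 A6 A1 A0) (V A5 A2 A3 A6 A4 A0 A1) (V A6 A3 A1 A2 A0 A5 A4) (V A3 A0 A4 A1 A5 A2 A6)"
definition L41 :: "s7 v7 v7" where
  "L41 = V (V A0 A4 A6 A5 A3 A1 A2) (V A2 A1 A4 A6 A0 A3 A5) (V A3 A0 A2 A4 A5 A6 A1) (V A6 A5 A0 A3 A1 A2 A4) (V A5 A6 A1 A2 A4 A0 A3) (V A4 A2 A3 A1 A6 A5 A0) (V A1 A3 A5 A0 A2 A4 A6)"
definition L42 :: "s7 v7 v7" where
  "L42 = V (V A0 A6 A1 A2 A5 A4 A3) (V A2 A1 A5 A6 A0 A3 A4) (V A3 A4 A2 A5 A1 A6 A0) (V A6 A5 A4 A3 A2 A0 A1) (V A1 A3 A6 A0 A4 A2 A5) (V A4 A0 A3 A1 A6 A5 A2) (V A5 A2 A0 A4 A3 A1 A6)"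
definition L43 :: "s7 v7 v7" where
  "L43 = V (V A0 A2 A3 A6 A5 A4 A1) (V A4 A1 A0 A5 A6 A2 A3) (V A6 A4 A2 A0 A1 A3 A5) (V A5 A6 A4 A3 A2 A1 A0) (V A3 A0 A5 A1 A4 A6 A2) (V A1 A3 A6 A2 A0 A5 A4) (V A2 A5 A1 A4 A3 A0 A6)"
definition L44 :: "s7 v7 v7" where
  "L44 = V (V A0 A6 A3 A1 A2 A4 A5) (V A2 A1 A4 A5 A3 A6 A0) (V A6 A3 A2 A4 A5 A0 A1) (V A1 A0 A5 A3 A6 A2 A4) (V A5 A2 A6 A0 A4 A1 A3) (V A3 A4 A1 A6 A0 A5 A2) (V A4 A5 A0 A2 A1 A3 A6)"
definition L45 :: "s7 v7 v7" where
  "L45 = V (V A0 A3 A4 A2 A5 A6 A1) (V A6 A1 A0 A4 A2 A3 A5) (V A5 A6 A2 A1 A3 A4 A0) (V A1 A0 A5 A3 A6 A2 A4) (V A3 A5 A1 A6 A4 A0 A2) (V A4 A2 A6 A0 A1 A5 A3) (V A2 A4 A3 A5 A0 A1 A6)"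
definition L46 :: "s7 v7 v7" where
  "L46 = V (V A0 A2 A6 A1 A5 A3 A4) (V A6 A1 A3 A0 A2 A4 A5) (V A3 A4 A2 A5 A6 A1 A0) (V A1 A5 A4 A3 A0 A6 A2) (V A2 A3 A5 A6 A4 A0 A1) (V A4 A6 A0 A2 A1 A5 A3) (V A5 A0 A1 A4 A3 A2 A6)"
definition L47 :: "s7 v7 v7" where
  "L47 = V (V A0 A3 A1 A5 A6 A4 A2) (V A3 A1 A4 A2 A5 A6 A0) (V A6 A5 A2 A0 A1 A3 A4) (V A4 A0 A6 A3 A2 A1 A5) (V A5 A6 A0 A1 A4 A2 A3) (V A2 A4 A3 A6 A0 A5 A1) (V A1 A2 A5 A4 A3 A0 A6)"
definition L48 :: "s7 v7 v7" where
  "L48 = V (V A0 A6 A5 A1 A3 A4 A2) (V A3 A1 A6 A0 A5 A2 A4) (V A4 A0 A2 A5 A1 A6 A3) (V A2 A4 A1 A3 A6 A0 A5) (V A5 A2 A3 A6 A4 A1 A0) (V A6 A3 A4 A2 A0 A5 A1) (V A1 A5 A0 A4 A2 A3 A6)"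
definition L49 :: "s7 v7 v7" where
  "L49 = V (V A0 A3 A6 A4 A5 A2 A1) (V A3 A1 A5 A0 A6 A4 A2) (V A1 A4 A2 A6 A0 A3 A5) (V A5 A2 A0 A3 A1 A6 A4) (V A6 A5 A1 A2 A4 A0 A3) (V A4 A6 A3 A1 A2 A5 A0) (V A2 A0 A4 A5 A3 A1 A6)"
definition L50 :: "s7 v7 v7" where
  "L50 = V (V A0 A3 A5 A2 A6 A4 A1) (V A2 A1 A4 A6 A5 A3 A0) (V A3 A4 A2 A0 A1 A6 A5) (V A5 A6 A1 A3 A0 A2 A4) (V A6 A2 A0 A5 A4 A1 A3) (V A1 A0 A6 A4 A3 A5 A2) (V A4 A5 A3 A1 A2 A0 A6)"
definition L51 :: "s7 v7 v7" where
  "L51 = V (V A0 A6 A3 A1 A5 A2 A4) (V A6 A1 A0 A5 A2 A4 A3) (V A3 A4 A2 A0 A1 A6 A5) (V A4 A2 A5 A3 A6 A0 A1) (V A2 A5 A1 A6 A4 A3 A0) (V A1 A0 A6 A4 A3 A5 A2) (V A5 A3 A4 A2 A0 A1 A6)"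
definition L52 :: "s7 v7 v7" where
  "L52 = V (V A0 A2 A3 A5 A6 A1 A4) (V A3 A1 A4 A6 A2 A0 A5) (V A5 A4 A2 A1 A0 A6 A3) (V A2 A6 A0 A3 A5 A4 A1) (V A6 A5 A1 A0 A4 A3 A2) (V A4 A3 A6 A2 A1 A5 A0) (V A1 A0 A5 A4 A3 A2 A6)"
definition L53 :: "s7 v7 v7" where
  "L53 = V (V A0 A5 A1 A2 A6 A3 A4) (V A5 A1 A4 A0 A2 A6 A3) (V A4 A3 A2 A6 A1 A0 A5) (V A2 A6 A0 A3 A5 A4 A1) (V A3 A2 A6 A5 A4 A1 A0) (V A6 A4 A3 A1 A0 A5 A2) (V A1 A0 A5 A4 A3 A2 A6)"
definition L54 :: "s7 v7 v7" where
  "L54 = V (V A0 A6 A3 A4 A2 A1 A5) (V A6 A1 A4 A2 A5 A0 A3) (V A3 A0 A2 A5 A1 A6 A4) (V A1 A5 A0 A3 A6 A4 A2) (V A5 A2 A1 A6 A4 A3 A0) (V A2 A4 A6 A0 A3 A5 A1) (V A4 A3 A5 A1 A0 A2 A6)"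
definition L55 :: "s7 v7 v7" where
  "L55 = V (V A0 A5 A4 A2 A3 A6 A1) (V A5 A1 A3 A6 A2 A4 A0) (V A1 A4 A2 A0 A6 A3 A5) (V A2 A0 A6 A3 A5 A1 A4) (V A6 A2 A1 A5 A4 A0 A3) (V A3 A6 A0 A4 A1 A5 A2) (V A4 A3 A5 A1 A0 A2 A6)"
definition L56 :: "s7 v7 v7" where
  "L56 = V (V A0 A2 A6 A1 A3 A4 A5) (V A2 A1 A4 A6 A5 A3 A0) (V A5 A3 A2 A0 A1 A6 A4) (V A4 A5 A0 A3 A6 A2 A1) (V A1 A6 A3 A5 A4 A0 A2) (V A6 A4 A1 A2 A0 A5 A3) (V A3 A0 A5 A4 A2 A1 A6)"
definition L57 :: "s7 v7 v7" where
  "L57 = V (V A0 A3 A1 A4 A5 A6 A2) (V A6 A1 A0 A5 A2 A4 A3) (V A3 A4 A2 A1 A6 A0 A5) (V A2 A6 A5 A3 A0 A1 A4) (V A5 A0 A6 A2 A4 A3 A1) (V A4 A2 A3 A6 A1 A5 A0) (V A1 A5 A4 A0 A3 A2 A6)"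
definition L58 :: "s7 v7 v7" where
  "L58 = V (V A0 A2 A5 A4 A1 A6 A3) (V A2 A1 A3 A5 A6 A4 A0) (V A6 A4 A2 A0 A3 A1 A5) (V A1 A6 A0 A3 A5 A2 A4) (V A3 A5 A1 A6 A4 A0 A2) (V A4 A3 A6 A2 A0 A5 A1) (V A5 A0 A4 A1 A2 A3 A6)"
definition L59 :: "s7 v7 v7" where
  "L59 = V (V A0 A4 A1 A6 A3 A2 A5) (V A6 A1 A0 A2 A5 A3 A4) (V A3 A5 A2 A4 A1 A6 A0) (V A2 A0 A5 A3 A6 A4 A1) (V A5 A2 A6 A0 A4 A1 A3) (V A4 A6 A3 A1 A0 A5 A2) (V A1 A3 A4 A5 A2 A0 A6)"
definition L60 :: "s7 v7 v7" where
  "L60 = V (V A0 A6 A3 A2 A5 A4 A1) (V A3 A1 A4 A6 A0 A2 A5) (V A1 A0 A2 A5 A6 A3 A4) (V A4 A5 A1 A3 A2 A6 A0) (V A5 A2 A6 A0 A4 A1 A3) (V A6 A4 A0 A1 A3 A5 A2) (V A2 A3 A5 A4 A1 A0 A6)"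
definition L61 :: "s7 v7 v7" where
  "L61 = V (V A0 A6 A3 A2 A5 A4 A1) (V A4 A1 A5 A0 A2 A6 A3) (V A1 A0 A2 A5 A6 A3 A4) (V A6 A2 A4 A3 A0 A1 A5) (V A3 A5 A1 A6 A4 A0 A2) (V A2 A3 A6 A4 A1 A5 A0) (V A5 A4 A0 A1 A3 A2 A6)"
definition L62 :: "s7 v7 v7" where
  "L62 = V (V A0 A4 A3 A6 A2 A1 A5) (V A3 A1 A0 A4 A5 A6 A2) (V A5 A6 A2 A1 A3 A4 A0) (V A2 A5 A6 A3 A1 A0 A4) (V A6 A2 A5 A0 A4 A3 A1) (V A4 A0 A1 A2 A6 A5 A3) (V A1 A3 A4 A5 A0 A2 A6)"
definition L63 :: "s7 v7 v7" where
  "L63 = V (V A0 A5 A4 A2 A1 A6 A3) (V A2 A1 A6 A0 A3 A4 A5) (V A6 A3 A2 A4 A5 A0 A1) (V A5 A4 A0 A3 A6 A1 A2) (V A3 A6 A1 A5 A4 A2 A0) (V A1 A2 A3 A6 A0 A5 A4) (V A4 A0 A5 A1 A2 A3 A6)"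
definition L64 :: "s7 v7 v7" where
  "L64 = V (V A0 A2 A1 A6 A5 A4 A3) (V A2 A1 A0 A5 A6 A3 A4) (V A1 A0 A2 A4 A3 A6 A5) (V A6 A5 A4 A3 A2 A1 A0) (V A5 A6 A3 A2 A4 A0 A1) (V A4 A3 A6 A1 A0 A5 A2) (V A3 A4 A5 A0 A1 A2 A6)"
definition L65 :: "s7 v7 v7" where
  "L65 = V (V A0 A2 A6 A4 A1 A3 A5) (V A5 A1 A3 A6 A0 A2 A4) (V A4 A0 A2 A5 A6 A1 A3) (V A6 A4 A1 A3 A5 A0 A2) (V A2 A3 A5 A0 A4 A6 A1) (V A1 A6 A4 A2 A3 A5 A0) (V A3 A5 A0 A1 A2 A4 A6)"
definition L66 :: "s7 v7 v7" where
  "L66 = V (V A0 A4 A1 A5 A3 A6 A2) (V A4 A1 A5 A2 A6 A0 A3) (V A1 A5 A2 A6 A0 A3 A4) (V A5 A2 A6 A3 A1 A4 A0) (V A3 A6 A0 A1 A4 A2 A5) (V A6 A0 A3 A4 A2 A5 A1) (V A2 A3 A4 A0 A5 A1 A6)"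
definition L67 :: "s7 v7 v7" where
  "L67 = V (V A0 A5 A4 A6 A2 A1 A3) (V A2 A1 A0 A4 A3 A6 A5) (V A6 A3 A2 A1 A5 A4 A0) (V A4 A6 A5 A3 A0 A2 A1) (V A1 A0 A6 A5 A4 A3 A2) (V A3 A2 A1 A0 A6 A5 A4) (V A5 A4 A3 A2 A1 A0 A6)"

section \<open>Closure of the lists of squares, and marks on the seven types\<close>

definition forms_all :: "s7 v7 v7 list" where
  "forms_all = [L0, L1, L2, L3, L4, L5, L6, L7, L8, L9, L10, L11, L12, L13, L14, L15, L16, L17, L18, L19, L20, L21, L22, L23, L24, L25, L26, L27, L28, L29, L30, L31, L32, L33, L34, L35, L36, L37, L38, L39, L40, L41, L42, L43, L44, L45, L46, L47, L48, L49, L50, L51, L52, L53, L54, L55, L56, L57, L58, L59, L60, L61, L62, L63, L64, L65, L66, L67]"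

definition forms_BEF :: "s7 v7 v7 list" where
  "forms_BEF = [L1, L2, L3, L10, L11, L12, L28, L29, L30, L31, L32, L33, L34, L35, L36, L37, L65, L66, L67]"

definition forms_BF :: "s7 v7 v7 list" where
  "forms_BF = [L1, L2, L3, L28, L29, L30, L31, L32, L33, L34, L35, L36, L37]"

lemma swap12_forms:
  "swap12 L0 L0 (V A2 A4 A3 A5 A0 A1 A6)"
  "swap12 L1 L2 (V A0 A1 A2 A3 A4 A5 A6)"
  "swap12 L2 L1 (V A0 A1 A2 A3 A4 A5 A6)"
  "swap12 L3 L3 (V A0 A1 A2 A3 A4 A5 A6)"
  "swap12 L4 L5 (V A0 A1 A2 A3 A4 A5 A6)"
  "swap12 L5 L4 (V A0 A1 A2 A3 A4 A5 A6)"
  "swap12 L6 L6 (V A3 A5 A2 A0 A6 A1 A4)"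
  "swap12 L7 L8 (V A0 A1 A2 A3 A4 A5 A6)"
  "swap12 L8 L7 (V A0 A1 A2 A3 A4 A5 A6)"
  "swap12 L9 L9 (V A3 A5 A2 A0 A6 A1 A4)"
  "swap12 L10 L11 (V A0 A1 A2 A3 A4 A5 A6)"
  "swap12 L11 L10 (V A0 A1 A2 A3 A4 A5 A6)"
  "swap12 L12 L12 (V A3 A5 A2 A0 A6 A1 A4)"
  "swap12 L13 L15 (V A0 A1 A2 A3 A4 A5 A6)"
  "swap12 L14 L14 (V A3 A1 A6 A0 A4 A5 A2)"
  "swap12 L15 L13 (V A0 A1 A2 A3 A4 A5 A6)"
  "swap12 L16 L18 (V A0 A1 A2 A3 A4 A5 A6)"
  "swap12 L17 L20 (V A0 A1 A2 A3 A4 A5 A6)"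
  "swap12 L18 L16 (V A0 A1 A2 A3 A4 A5 A6)"
  "swap12 L19 L21 (V A0 A1 A2 A3 A4 A5 A6)"
  "swap12 L20 L17 (V A0 A1 A2 A3 A4 A5 A6)"
  "swap12 L21 L19 (V A0 A1 A2 A3 A4 A5 A6)"
  "swap12 L22 L24 (V A0 A1 A2 A3 A4 A5 A6)"
  "swap12 L23 L26 (V A0 A1 A2 A3 A4 A5 A6)"
  "swap12 L24 L22 (V A0 A1 A2 A3 A4 A5 A6)"
  "swap12 L25 L27 (V A0 A1 A2 A3 A4 A5 A6)"
  "swap12 L26 L23 (V A0 A1 A2 A3 A4 A5 A6)"
  "swap12 L27 L25 (V A0 A1 A2 A3 A4 A5 A6)"
  "swap12 L28 L29 (V A4 A2 A5 A3 A6 A1 A0)"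
  "swap12 L29 L28 (V A1 A4 A6 A3 A2 A0 A5)"
  "swap12 L30 L32 (V A0 A1 A2 A3 A4 A5 A6)"
  "swap12 L31 L34 (V A0 A1 A2 A3 A4 A5 A6)"
  "swap12 L32 L30 (V A0 A1 A2 A3 A4 A5 A6)"
  "swap12 L33 L35 (V A0 A1 A2 A3 A4 A5 A6)"
  "swap12 L34 L31 (V A0 A1 A2 A3 A4 A5 A6)"
  "swap12 L35 L33 (V A0 A1 A2 A3 A4 A5 A6)"
  "swap12 L36 L37 (V A0 A1 A2 A3 A4 A5 A6)"
  "swap12 L37 L36 (V A0 A1 A2 A3 A4 A5 A6)"
  "swap12 L38 L40 (V A0 A1 A2 A3 A4 A5 A6)"
  "swap12 L39 L42 (V A0 A1 A2 A3 A4 A5 A6)"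
  "swap12 L40 L38 (V A0 A1 A2 A3 A4 A5 A6)"
  "swap12 L41 L43 (V A0 A1 A2 A3 A4 A5 A6)"
  "swap12 L42 L39 (V A0 A1 A2 A3 A4 A5 A6)"
  "swap12 L43 L41 (V A0 A1 A2 A3 A4 A5 A6)"
  "swap12 L44 L46 (V A0 A1 A2 A3 A4 A5 A6)"
  "swap12 L45 L48 (V A0 A1 A2 A3 A4 A5 A6)"
  "swap12 L46 L44 (V A0 A1 A2 A3 A4 A5 A6)"
  "swap12 L47 L49 (V A0 A1 A2 A3 A4 A5 A6)"
  "swap12 L48 L45 (V A0 A1 A2 A3 A4 A5 A6)"
  "swap12 L49 L47 (V A0 A1 A2 A3 A4 A5 A6)"
  "swap12 L50 L52 (V A0 A1 A2 A3 A4 A5 A6)"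
  "swap12 L51 L54 (V A0 A1 A2 A3 A4 A5 A6)"
  "swap12 L52 L50 (V A0 A1 A2 A3 A4 A5 A6)"
  "swap12 L53 L55 (V A0 A1 A2 A3 A4 A5 A6)"
  "swap12 L54 L51 (V A0 A1 A2 A3 A4 A5 A6)"
  "swap12 L55 L53 (V A0 A1 A2 A3 A4 A5 A6)"
  "swap12 L56 L58 (V A0 A1 A2 A3 A4 A5 A6)"
  "swap12 L57 L60 (V A0 A1 A2 A3 A4 A5 A6)"
  "swap12 L58 L56 (V A0 A1 A2 A3 A4 A5 A6)"
  "swap12 L59 L61 (V A0 A1 A2 A3 A4 A5 A6)"
  "swap12 L60 L57 (V A0 A1 A2 A3 A4 A5 A6)"
  "swap12 L61 L59 (V A0 A1 A2 A3 A4 A5 A6)"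
  "swap12 L62 L63 (V A0 A4 A5 A1 A3 A6 A2)"
  "swap12 L63 L62 (V A0 A3 A6 A4 A1 A2 A5)"
  "swap12 L64 L64 (V A0 A1 A2 A3 A4 A5 A6)"
  "swap12 L65 L67 (V A0 A1 A2 A3 A4 A5 A6)"
  "swap12 L66 L66 (V A0 A1 A2 A3 A4 A5 A6)"
  "swap12 L67 L65 (V A0 A1 A2 A3 A4 A5 A6)"
  by code_simp+

lemma swap23_forms:
  "swap23 L0 L0 (V A2 A4 A1 A5 A3 A0 A6)"
  "swap23 L1 L1 (V A0 A1 A2 A3 A4 A5 A6)"
  "swap23 L2 L3 (V A0 A1 A2 A3 A4 A5 A6)"
  "swap23 L3 L2 (V A0 A1 A2 A3 A4 A5 A6)"
  "swap23 L4 L4 (V A3 A5 A2 A0 A6 A1 A4)"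
  "swap23 L5 L6 (V A0 A1 A2 A3 A4 A5 A6)"
  "swap23 L6 L5 (V A0 A1 A2 A3 A4 A5 A6)"
  "swap23 L7 L7 (V A3 A5 A2 A0 A6 A1 A4)"
  "swap23 L8 L9 (V A0 A1 A2 A3 A4 A5 A6)"
  "swap23 L9 L8 (V A0 A1 A2 A3 A4 A5 A6)"
  "swap23 L10 L10 (V A3 A5 A2 A0 A6 A1 A4)"
  "swap23 L11 L12 (V A0 A1 A2 A3 A4 A5 A6)"
  "swap23 L12 L11 (V A0 A1 A2 A3 A4 A5 A6)"
  "swap23 L13 L14 (V A0 A1 A2 A3 A4 A5 A6)"
  "swap23 L14 L13 (V A0 A1 A2 A3 A4 A5 A6)"
  "swap23 L15 L15 (V A3 A1 A6 A0 A4 A5 A2)"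
  "swap23 L16 L17 (V A0 A1 A2 A3 A4 A5 A6)"
  "swap23 L17 L16 (V A0 A1 A2 A3 A4 A5 A6)"
  "swap23 L18 L19 (V A0 A1 A2 A3 A4 A5 A6)"
  "swap23 L19 L18 (V A0 A1 A2 A3 A4 A5 A6)"
  "swap23 L20 L21 (V A0 A1 A2 A3 A4 A5 A6)"
  "swap23 L21 L20 (V A0 A1 A2 A3 A4 A5 A6)"
  "swap23 L22 L23 (V A0 A1 A2 A3 A4 A5 A6)"
  "swap23 L23 L22 (V A0 A1 A2 A3 A4 A5 A6)"
  "swap23 L24 L25 (V A0 A1 A2 A3 A4 A5 A6)"
  "swap23 L25 L24 (V A0 A1 A2 A3 A4 A5 A6)"
  "swap23 L26 L27 (V A0 A1 A2 A3 A4 A5 A6)"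
  "swap23 L27 L26 (V A0 A1 A2 A3 A4 A5 A6)"
  "swap23 L28 L29 (V A0 A1 A2 A3 A4 A5 A6)"
  "swap23 L29 L28 (V A0 A1 A2 A3 A4 A5 A6)"
  "swap23 L30 L31 (V A0 A1 A2 A3 A4 A5 A6)"
  "swap23 L31 L30 (V A0 A1 A2 A3 A4 A5 A6)"
  "swap23 L32 L33 (V A0 A1 A2 A3 A4 A5 A6)"
  "swap23 L33 L32 (V A0 A1 A2 A3 A4 A5 A6)"
  "swap23 L34 L35 (V A0 A1 A2 A3 A4 A5 A6)"
  "swap23 L35 L34 (V A0 A1 A2 A3 A4 A5 A6)"
  "swap23 L36 L37 (V A0 A1 A2 A3 A4 A5 A6)"
  "swap23 L37 L36 (V A0 A1 A2 A3 A4 A5 A6)"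
  "swap23 L38 L39 (V A0 A1 A2 A3 A4 A5 A6)"
  "swap23 L39 L38 (V A0 A1 A2 A3 A4 A5 A6)"
  "swap23 L40 L41 (V A0 A1 A2 A3 A4 A5 A6)"
  "swap23 L41 L40 (V A0 A1 A2 A3 A4 A5 A6)"
  "swap23 L42 L43 (V A0 A1 A2 A3 A4 A5 A6)"
  "swap23 L43 L42 (V A0 A1 A2 A3 A4 A5 A6)"
  "swap23 L44 L45 (V A0 A1 A2 A3 A4 A5 A6)"
  "swap23 L45 L44 (V A0 A1 A2 A3 A4 A5 A6)"
  "swap23 L46 L47 (V A0 A1 A2 A3 A4 A5 A6)"
  "swap23 L47 L46 (V A0 A1 A2 A3 A4 A5 A6)"
  "swap23 L48 L49 (V A0 A1 A2 A3 A4 A5 A6)"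
  "swap23 L49 L48 (V A0 A1 A2 A3 A4 A5 A6)"
  "swap23 L50 L51 (V A0 A1 A2 A3 A4 A5 A6)"
  "swap23 L51 L50 (V A0 A1 A2 A3 A4 A5 A6)"
  "swap23 L52 L53 (V A0 A1 A2 A3 A4 A5 A6)"
  "swap23 L53 L52 (V A0 A1 A2 A3 A4 A5 A6)"
  "swap23 L54 L55 (V A0 A1 A2 A3 A4 A5 A6)"
  "swap23 L55 L54 (V A0 A1 A2 A3 A4 A5 A6)"
  "swap23 L56 L57 (V A0 A1 A2 A3 A4 A5 A6)"
  "swap23 L57 L56 (V A0 A1 A2 A3 A4 A5 A6)"
  "swap23 L58 L59 (V A0 A1 A2 A3 A4 A5 A6)"
  "swap23 L59 L58 (V A0 A1 A2 A3 A4 A5 A6)"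
  "swap23 L60 L61 (V A0 A1 A2 A3 A4 A5 A6)"
  "swap23 L61 L60 (V A0 A1 A2 A3 A4 A5 A6)"
  "swap23 L62 L63 (V A0 A1 A2 A3 A4 A5 A6)"
  "swap23 L63 L62 (V A0 A1 A2 A3 A4 A5 A6)"
  "swap23 L64 L64 (V A0 A1 A2 A3 A4 A5 A6)"
  "swap23 L65 L66 (V A0 A1 A2 A3 A4 A5 A6)"
  "swap23 L66 L65 (V A0 A1 A2 A3 A4 A5 A6)"
  "swap23 L67 L67 (V A0 A1 A2 A3 A4 A5 A6)"
  by code_simp+

lemma swap12I: "swap12 A B e \<Longrightarrow> \<exists>e. swap12 A B e" and swap23I: "swap23 A B e \<Longrightarrow> \<exists>e. swap23 A B e"
  by blast+

lemma closedI:
  assumes "list_all (\<lambda>A. list_ex (\<lambda>B. \<exists>e. swap12 A B e) fs \<and> list_ex (\<lambda>B. \<exists>e. swap23 A B e) fs) fs"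
  shows "closed (set fs)"
  using assms unfolding closed_def by (simp add: list_all_iff list_ex_iff)

lemma closed_forms: "closed (set forms_all)" "closed (set forms_BEF)" "closed (set forms_BF)"
  by (rule closedI, simp add: forms_all_def forms_BEF_def forms_BF_def swap12_forms[THEN swap12I] swap23_forms[THEN swap23I])+

text \<open>A decidable form of \<open>mk\<close> for line \<open>v\<close>. The cells of row
  \<open>i\<close> are reached through the first coordinate \<open>x\<close> of a word: for the
  fixed second coordinate \<open>p $ i\<close>, the third is a permutation of \<open>x\<close>, so
  each cell occurs once.\<close>

definition chkmark :: "s7 v7 v7 \<times> s7 v7 v7 \<Rightarrow> s7 \<Rightarrow> s7 v7 v7 \<Rightarrow> s7 v7 \<Rightarrow> s7 v7 \<Rightarrow> s7 v7 \<Rightarrow> bool" where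
  "chkmark T v A p q r = (if isperm p then if isperm q then if isperm r then
    if every (\<lambda>i. if fst T $ v $ (p $ i) = q $ i then snd T $ v $ (p $ i) = r $ i else False) then
    every (\<lambda>i. if isperm (tab (\<lambda>x. fst T $ x $ (p $ i))) then
      every (\<lambda>x. r $ (A $ i $ (inv7 q $ (fst T $ x $ (p $ i)))) = snd T $ x $ (p $ i)) else False)
    else False else False else False else False)"

text \<open>Once \<open>p\<close> is chosen the other two labellings are forced; they list the
  symbols of line \<open>v\<close> at the places \<open>p $ i\<close>.\<close>

definition line :: "s7 v7 v7 \<Rightarrow> s7 \<Rightarrow> s7 v7 \<Rightarrow> s7 v7" where
  "line F v p = tab (\<lambda>i. F $ v $ (p $ i))"

lemma chkmarkD:
  assumes "chkmark T v A p q r"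
  shows "bij (at p)" "bij (at q)" "bij (at r)"
    "\<And>i. fst T $ v $ (p $ i) = q $ i \<and> snd T $ v $ (p $ i) = r $ i"
    "\<And>i j. \<exists>x. fst T $ x $ (p $ i) = q $ j \<and> snd T $ x $ (p $ i) = r $ (A $ i $ j)"
proof -
  from assms show b: "bij (at p)" "bij (at q)" "bij (at r)"
    and "\<And>i. fst T $ v $ (p $ i) = q $ i \<and> snd T $ v $ (p $ i) = r $ i"
    unfolding chkmark_def if_conj every_iff isperm_iff by blast+
  from assms have c: "\<And>i. bij (at (tab (\<lambda>x. fst T $ x $ (p $ i))))"
    "\<And>i x. r $ (A $ i $ (inv7 q $ (fst T $ x $ (p $ i)))) = snd T $ x $ (p $ i)"
    unfolding chkmark_def if_conj every_iff isperm_iff by blast+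
  show "\<exists>x. fst T $ x $ (p $ i) = q $ j \<and> snd T $ x $ (p $ i) = r $ (A $ i $ j)" for i j
  proof -
    obtain x where "q $ j = tab (\<lambda>x. fst T $ x $ (p $ i)) $ x" using c(1)[of i] by (metis bij_pointE)
    then have "fst T $ x $ (p $ i) = q $ j" by simp
    then show ?thesis using c(2)[of i x] inv7_at[OF b(2)] by metis
  qed
qed

lemma chkmark_mk:
  assumes "chkmark T v A p q r" "\<And>y z. N y z (fst T $ y $ z) (snd T $ y $ z)"
  shows "mk A N v"
proof -
  note c = chkmarkD[OF assms(1)]
  show ?thesis unfolding mk_def
  proof (rule exI[of _ "at p"], rule exI[of _ "at q"], rule exI[of _ "at r"], intro conjI allI)
    show "N v (p $ i) (q $ i) (r $ i)" for i using assms(2)[of v "p $ i"] c(4) by simp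
    show "\<exists>x. N x (p $ i) (q $ j) (r $ (A $ i $ j))" for i j using c(5)[of i j] assms(2) by metis
  qed (use c in auto)
qed

definition marks :: "s7 v7 v7 \<times> s7 v7 v7 \<Rightarrow> s7 v7 v7 list \<Rightarrow> (s7 v7 v7 \<times> s7 v7) v7 \<Rightarrow> bool" where
  "marks T fs m = every (\<lambda>v. if elem (fst (m $ v)) fs then
     chkmark T v (fst (m $ v)) (snd (m $ v)) (line (fst T) v (snd (m $ v))) (line (snd T) v (snd (m $ v))) else False)"

lemma marks_Mk:
  assumes "marks T fs m" "\<And>y z. N y z (fst T $ y $ z) (snd T $ y $ z)"
  shows "Mk (set fs) N"
  unfolding Mk_def
proof
  fix v
  from assms(1) have "fst (m $ v) \<in> set fs"
    "chkmark T v (fst (m $ v)) (snd (m $ v)) (line (fst T) v (snd (m $ v))) (line (snd T) v (snd (m $ v)))"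
    unfolding marks_def if_conj every_iff elem_iff by blast+
  moreover from this(2) have "mk (fst (m $ v)) N v" by (rule chkmark_mk) (rule assms(2))
  ultimately show "\<exists>A\<in>set fs. mk A N v" by blast
qed

text \<open>\<open>U\<close> is the plane of \<open>T\<close> with the second coordinate moved to
  the front; \<open>turn2\<close> and \<open>turn3\<close> do this for the third and fourth. The
  latter amount to solving for a coordinate, so the solved table is supplied and only
  verified.\<close>

definition turn1 :: "s7 v7 v7 \<times> s7 v7 v7 \<Rightarrow> s7 v7 v7 \<times> s7 v7 v7 \<Rightarrow> bool" where
  "turn1 T U = every (\<lambda>x. every (\<lambda>y. if fst U $ x $ y = fst T $ y $ x then snd U $ x $ y = snd T $ y $ x else False))"

definition turn2 :: "s7 v7 v7 \<times> s7 v7 v7 \<Rightarrow> s7 v7 v7 \<times> s7 v7 v7 \<Rightarrow> bool" where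
  "turn2 T U = every (\<lambda>x. every (\<lambda>y. if fst T $ y $ (fst U $ x $ y) = x then snd U $ x $ y = snd T $ y $ (fst U $ x $ y) else False))"

definition turn3 :: "s7 v7 v7 \<times> s7 v7 v7 \<Rightarrow> s7 v7 v7 \<times> s7 v7 v7 \<Rightarrow> bool" where
  "turn3 T U = every (\<lambda>x. every (\<lambda>y. if snd T $ y $ (fst U $ x $ y) = x then snd U $ x $ y = fst T $ y $ (fst U $ x $ y) else False))"

lemma FullI:
  assumes "turn1 T U1" "turn2 T U2" "turn3 T U3" "marks T fs m0" "marks U1 fs m1" "marks U2 fs m2" "marks U3 fs m3"
  shows "Full (set fs) (tn T)"
  unfolding Full_def
proof (intro conjI)
  show "Mk (set fs) (tn T)" by (rule marks_Mk[OF assms(4)]) (simp add: tn_def)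
  show "Mk (set fs) (\<lambda>x z. tn T z x)"
    by (rule marks_Mk[OF assms(5)]) (use assms(1) in \<open>simp add: turn1_def tn_def if_conj\<close>)
  show "Mk (set fs) (\<lambda>x y z. tn T y z x)"
    by (rule marks_Mk[OF assms(6)]) (use assms(2) in \<open>simp add: turn2_def tn_def if_conj\<close>)
  show "Mk (set fs) (\<lambda>x y z f. tn T y z f x)"
    by (rule marks_Mk[OF assms(7)]) (use assms(3) in \<open>simp add: turn3_def tn_def if_conj\<close>)
qed

definition T0_1 :: "s7 v7 v7 \<times> s7 v7 v7" where
  "T0_1 = (V (V A0 A1 A2 A3 A4 A5 A6) (V A1 A0 A3 A2 A5 A6 A4) (V A2 A5 A1 A4 A6 A0 A3) (V A3 A4 A6 A5 A0 A1 A2) (V A4 A6 A5 A0 A3 A2 A1) (V A5 A2 A4 A6 A1 A3 A0) (V A6 A3 A0 A1 A2 A4 A5),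
    V (V A0 A1 A2 A3 A4 A5 A6) (V A2 A4 A0 A5 A6 A3 A1) (V A6 A3 A5 A2 A0 A1 A4) (V A1 A5 A4 A0 A2 A6 A3) (V A3 A2 A1 A6 A5 A4 A0) (V A4 A0 A6 A1 A3 A2 A5) (V A5 A6 A3 A4 A1 A0 A2))"
definition T0_2 :: "s7 v7 v7 \<times> s7 v7 v7" where
  "T0_2 = (V (V A0 A1 A6 A4 A3 A2 A5) (V A1 A0 A2 A6 A5 A3 A4) (V A2 A5 A0 A1 A6 A4 A3) (V A3 A6 A1 A0 A4 A5 A2) (V A4 A3 A5 A2 A0 A6 A1) (V A5 A2 A4 A3 A1 A0 A6) (V A6 A4 A3 A5 A2 A1 A0),
    V (V A0 A4 A3 A6 A2 A1 A5) (V A2 A1 A5 A4 A3 A6 A0) (V A6 A0 A2 A5 A1 A4 A3) (V A1 A6 A0 A3 A5 A2 A4) (V A3 A5 A6 A2 A4 A0 A1) (V A4 A3 A1 A0 A6 A5 A2) (V A5 A2 A4 A1 A0 A3 A6))"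
definition T0_3 :: "s7 v7 v7 \<times> s7 v7 v7" where
  "T0_3 = (V (V A0 A5 A1 A3 A2 A6 A4) (V A3 A0 A4 A5 A6 A2 A1) (V A1 A4 A0 A2 A3 A5 A6) (V A4 A2 A6 A0 A5 A1 A3) (V A5 A1 A3 A6 A0 A4 A2) (V A6 A3 A2 A1 A4 A0 A5) (V A2 A6 A5 A4 A1 A3 A0),
    V (V A0 A2 A3 A5 A6 A4 A1) (V A3 A1 A5 A6 A2 A0 A4) (V A1 A6 A2 A4 A0 A3 A5) (V A4 A5 A0 A3 A1 A6 A2) (V A5 A0 A6 A1 A4 A2 A3) (V A6 A4 A1 A2 A3 A5 A0) (V A2 A3 A4 A0 A5 A1 A6))"
definition T1_1 :: "s7 v7 v7 \<times> s7 v7 v7" where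
  "T1_1 = (V (V A0 A1 A2 A3 A4 A5 A6) (V A1 A0 A4 A5 A3 A6 A2) (V A2 A3 A5 A6 A0 A1 A4) (V A3 A2 A1 A0 A6 A4 A5) (V A4 A5 A6 A1 A2 A3 A0) (V A5 A6 A0 A4 A1 A2 A3) (V A6 A4 A3 A2 A5 A0 A1),
    V (V A0 A2 A1 A4 A5 A6 A3) (V A1 A4 A6 A3 A2 A5 A0) (V A2 A5 A4 A0 A6 A3 A1) (V A3 A6 A5 A1 A4 A0 A2) (V A4 A0 A2 A6 A3 A1 A5) (V A5 A1 A3 A2 A0 A4 A6) (V A6 A3 A0 A5 A1 A2 A4))"
definition T1_2 :: "s7 v7 v7 \<times> s7 v7 v7" where
  "T1_2 = (V (V A0 A1 A5 A3 A2 A6 A4) (V A1 A0 A3 A4 A5 A2 A6) (V A2 A3 A0 A6 A4 A5 A1) (V A3 A2 A6 A0 A1 A4 A5) (V A4 A6 A1 A5 A0 A3 A2) (V A5 A4 A2 A1 A6 A0 A3) (V A6 A5 A4 A2 A3 A1 A0),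
    V (V A0 A4 A3 A1 A6 A2 A5) (V A1 A2 A5 A6 A0 A3 A4) (V A2 A6 A1 A5 A3 A4 A0) (V A3 A5 A0 A4 A2 A1 A6) (V A4 A3 A6 A2 A5 A0 A1) (V A5 A0 A4 A3 A1 A6 A2) (V A6 A1 A2 A0 A4 A5 A3))"
definition T1_3 :: "s7 v7 v7 \<times> s7 v7 v7" where
  "T1_3 = (V (V A0 A4 A6 A2 A5 A3 A1) (V A1 A5 A0 A3 A6 A4 A2) (V A2 A0 A4 A5 A1 A6 A3) (V A3 A6 A5 A1 A4 A2 A0) (V A4 A1 A2 A0 A3 A5 A6) (V A5 A2 A3 A6 A0 A1 A4) (V A6 A3 A1 A4 A2 A0 A5),
    V (V A0 A5 A3 A6 A1 A4 A2) (V A1 A6 A2 A0 A5 A3 A4) (V A2 A1 A6 A4 A3 A0 A5) (V A3 A4 A0 A5 A2 A1 A6) (V A4 A0 A5 A3 A6 A2 A1) (V A5 A3 A1 A2 A4 A6 A0) (V A6 A2 A4 A1 A0 A5 A3))"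
definition T2_1 :: "s7 v7 v7 \<times> s7 v7 v7" where
  "T2_1 = (V (V A0 A1 A2 A3 A4 A5 A6) (V A1 A0 A5 A4 A2 A6 A3) (V A2 A3 A0 A5 A6 A4 A1) (V A3 A2 A6 A1 A5 A0 A4) (V A4 A5 A1 A6 A3 A2 A0) (V A5 A6 A4 A0 A1 A3 A2) (V A6 A4 A3 A2 A0 A1 A5),
    V (V A0 A2 A3 A6 A1 A4 A5) (V A1 A4 A2 A5 A6 A3 A0) (V A2 A1 A5 A3 A4 A0 A6) (V A3 A5 A1 A4 A0 A6 A2) (V A4 A6 A0 A2 A5 A1 A3) (V A5 A0 A6 A1 A3 A2 A4) (V A6 A3 A4 A0 A2 A5 A1))"
definition T2_2 :: "s7 v7 v7 \<times> s7 v7 v7" where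
  "T2_2 = (V (V A0 A1 A2 A5 A6 A3 A4) (V A1 A0 A4 A3 A5 A6 A2) (V A2 A3 A0 A6 A1 A4 A5) (V A3 A2 A6 A0 A4 A5 A1) (V A4 A6 A5 A1 A0 A2 A3) (V A5 A4 A1 A2 A3 A0 A6) (V A6 A5 A3 A4 A2 A1 A0),
    V (V A0 A4 A5 A1 A2 A6 A3) (V A1 A2 A0 A4 A3 A5 A6) (V A2 A5 A3 A0 A6 A1 A4) (V A3 A1 A4 A6 A5 A2 A0) (V A4 A3 A6 A5 A1 A0 A2) (V A5 A6 A2 A3 A0 A4 A1) (V A6 A0 A1 A2 A4 A3 A5))"
definition T2_3 :: "s7 v7 v7 \<times> s7 v7 v7" where
  "T2_3 = (V (V A0 A5 A4 A6 A3 A2 A1) (V A1 A2 A3 A5 A0 A4 A6) (V A2 A0 A1 A4 A6 A5 A3) (V A3 A6 A0 A2 A5 A1 A4) (V A4 A1 A6 A3 A2 A0 A5) (V A5 A3 A2 A1 A4 A6 A0) (V A6 A4 A5 A0 A1 A3 A2),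
    V (V A0 A6 A1 A2 A5 A4 A3) (V A1 A3 A6 A0 A4 A2 A5) (V A2 A1 A5 A6 A0 A3 A4) (V A3 A4 A2 A5 A1 A6 A0) (V A4 A0 A3 A1 A6 A5 A2) (V A5 A2 A0 A4 A3 A1 A6) (V A6 A5 A4 A3 A2 A0 A1))"
definition T3_1 :: "s7 v7 v7 \<times> s7 v7 v7" where
  "T3_1 = (V (V A0 A1 A2 A3 A4 A5 A6) (V A1 A0 A3 A4 A2 A6 A5) (V A2 A3 A0 A5 A6 A1 A4) (V A3 A2 A1 A6 A5 A4 A0) (V A4 A5 A6 A1 A0 A3 A2) (V A5 A6 A4 A2 A3 A0 A1) (V A6 A4 A5 A0 A1 A2 A3),
    V (V A0 A2 A3 A6 A1 A4 A5) (V A1 A4 A0 A5 A6 A3 A2) (V A2 A1 A5 A3 A4 A6 A0) (V A3 A5 A4 A1 A0 A2 A6) (V A4 A6 A2 A0 A3 A5 A1) (V A5 A0 A6 A4 A2 A1 A3) (V A6 A3 A1 A2 A5 A0 A4))"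
definition T3_2 :: "s7 v7 v7 \<times> s7 v7 v7" where
  "T3_2 = (V (V A0 A1 A2 A6 A4 A5 A3) (V A1 A0 A3 A4 A6 A2 A5) (V A2 A3 A0 A5 A1 A6 A4) (V A3 A2 A1 A0 A5 A4 A6) (V A4 A6 A5 A1 A0 A3 A2) (V A5 A4 A6 A2 A3 A0 A1) (V A6 A5 A4 A3 A2 A1 A0),
    V (V A0 A4 A5 A2 A3 A1 A6) (V A1 A2 A4 A0 A5 A6 A3) (V A2 A5 A3 A4 A6 A0 A1) (V A3 A1 A0 A6 A2 A5 A4) (V A4 A3 A6 A5 A1 A2 A0) (V A5 A6 A1 A3 A0 A4 A2) (V A6 A0 A2 A1 A4 A3 A5))"
definition T3_3 :: "s7 v7 v7 \<times> s7 v7 v7" where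
  "T3_3 = (V (V A0 A5 A1 A4 A3 A6 A2) (V A1 A2 A6 A3 A0 A5 A4) (V A2 A0 A4 A6 A5 A3 A1) (V A3 A6 A0 A2 A4 A1 A5) (V A4 A1 A3 A5 A2 A0 A6) (V A5 A3 A2 A1 A6 A4 A0) (V A6 A4 A5 A0 A1 A2 A3),
    V (V A0 A6 A3 A1 A5 A2 A4) (V A1 A3 A5 A6 A4 A0 A2) (V A2 A1 A6 A0 A3 A4 A5) (V A3 A4 A2 A5 A0 A6 A1) (V A4 A0 A1 A2 A6 A5 A3) (V A5 A2 A0 A4 A1 A3 A6) (V A6 A5 A4 A3 A2 A1 A0))"
definition T4_1 :: "s7 v7 v7 \<times> s7 v7 v7" where
  "T4_1 = (V (V A0 A1 A2 A3 A4 A5 A6) (V A1 A2 A6 A4 A5 A0 A3) (V A2 A0 A3 A5 A6 A4 A1) (V A3 A4 A5 A6 A0 A1 A2) (V A4 A5 A1 A2 A3 A6 A0) (V A5 A6 A0 A1 A2 A3 A4) (V A6 A3 A4 A0 A1 A2 A5),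
    V (V A0 A2 A6 A4 A1 A3 A5) (V A1 A3 A4 A0 A2 A5 A6) (V A2 A4 A5 A1 A3 A6 A0) (V A3 A5 A0 A2 A6 A4 A1) (V A4 A6 A3 A5 A0 A1 A2) (V A5 A0 A1 A6 A4 A2 A3) (V A6 A1 A2 A3 A5 A0 A4))"
definition T4_2 :: "s7 v7 v7 \<times> s7 v7 v7" where
  "T4_2 = (V (V A0 A2 A5 A6 A3 A1 A4) (V A1 A0 A4 A5 A6 A3 A2) (V A2 A1 A0 A4 A5 A6 A3) (V A3 A6 A2 A0 A4 A5 A1) (V A4 A3 A6 A1 A0 A2 A5) (V A5 A4 A3 A2 A1 A0 A6) (V A6 A5 A1 A3 A2 A4 A0),
    V (V A0 A4 A1 A3 A6 A5 A2) (V A1 A2 A3 A6 A5 A4 A0) (V A2 A3 A6 A5 A4 A0 A1) (V A3 A1 A5 A4 A0 A2 A6) (V A4 A5 A2 A0 A1 A6 A3) (V A5 A6 A0 A1 A2 A3 A4) (V A6 A0 A4 A2 A3 A1 A5))"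
definition T4_3 :: "s7 v7 v7 \<times> s7 v7 v7" where
  "T4_3 = (V (V A0 A5 A3 A1 A4 A6 A2) (V A1 A6 A5 A2 A0 A4 A3) (V A2 A0 A6 A3 A1 A5 A4) (V A3 A1 A4 A6 A2 A0 A5) (V A4 A2 A1 A0 A5 A3 A6) (V A5 A3 A2 A4 A6 A1 A0) (V A6 A4 A0 A5 A3 A2 A1),
    V (V A0 A6 A5 A4 A3 A2 A1) (V A1 A3 A0 A5 A4 A6 A2) (V A2 A1 A4 A6 A5 A3 A0) (V A3 A2 A1 A0 A6 A5 A4) (V A4 A0 A6 A3 A2 A1 A5) (V A5 A4 A3 A2 A1 A0 A6) (V A6 A5 A2 A1 A0 A4 A3))"
definition T5_1 :: "s7 v7 v7 \<times> s7 v7 v7" where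
  "T5_1 = (V (V A0 A1 A2 A3 A4 A5 A6) (V A1 A2 A3 A4 A5 A6 A0) (V A2 A3 A4 A5 A6 A0 A1) (V A3 A4 A5 A6 A0 A1 A2) (V A4 A5 A6 A0 A1 A2 A3) (V A5 A6 A0 A1 A2 A3 A4) (V A6 A0 A1 A2 A3 A4 A5),
    V (V A0 A1 A2 A3 A4 A5 A6) (V A2 A3 A4 A5 A6 A0 A1) (V A4 A5 A6 A0 A1 A2 A3) (V A6 A0 A1 A2 A3 A4 A5) (V A1 A2 A3 A4 A5 A6 A0) (V A3 A4 A5 A6 A0 A1 A2) (V A5 A6 A0 A1 A2 A3 A4))"
definition T5_2 :: "s7 v7 v7 \<times> s7 v7 v7" where
  "T5_2 = (V (V A0 A6 A5 A4 A3 A2 A1) (V A1 A0 A6 A5 A4 A3 A2) (V A2 A1 A0 A6 A5 A4 A3) (V A3 A2 A1 A0 A6 A5 A4) (V A4 A3 A2 A1 A0 A6 A5) (V A5 A4 A3 A2 A1 A0 A6) (V A6 A5 A4 A3 A2 A1 A0),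
    V (V A0 A6 A5 A4 A3 A2 A1) (V A2 A1 A0 A6 A5 A4 A3) (V A4 A3 A2 A1 A0 A6 A5) (V A6 A5 A4 A3 A2 A1 A0) (V A1 A0 A6 A5 A4 A3 A2) (V A3 A2 A1 A0 A6 A5 A4) (V A5 A4 A3 A2 A1 A0 A6))"
definition T5_3 :: "s7 v7 v7 \<times> s7 v7 v7" where
  "T5_3 = (V (V A0 A3 A6 A2 A5 A1 A4) (V A4 A0 A3 A6 A2 A5 A1) (V A1 A4 A0 A3 A6 A2 A5) (V A5 A1 A4 A0 A3 A6 A2) (V A2 A5 A1 A4 A0 A3 A6) (V A6 A2 A5 A1 A4 A0 A3) (V A3 A6 A2 A5 A1 A4 A0),
    V (V A0 A4 A1 A5 A2 A6 A3) (V A4 A1 A5 A2 A6 A3 A0) (V A1 A5 A2 A6 A3 A0 A4) (V A5 A2 A6 A3 A0 A4 A1) (V A2 A6 A3 A0 A4 A1 A5) (V A6 A3 A0 A4 A1 A5 A2) (V A3 A0 A4 A1 A5 A2 A6))"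
definition T6_1 :: "s7 v7 v7 \<times> s7 v7 v7" where
  "T6_1 = (V (V A0 A1 A2 A3 A4 A5 A6) (V A1 A2 A3 A4 A5 A6 A0) (V A2 A3 A4 A5 A6 A0 A1) (V A3 A4 A5 A6 A0 A1 A2) (V A4 A5 A6 A0 A1 A2 A3) (V A5 A6 A0 A1 A2 A3 A4) (V A6 A0 A1 A2 A3 A4 A5),
    V (V A0 A1 A2 A3 A4 A5 A6) (V A3 A4 A5 A6 A0 A1 A2) (V A6 A0 A1 A2 A3 A4 A5) (V A2 A3 A4 A5 A6 A0 A1) (V A5 A6 A0 A1 A2 A3 A4) (V A1 A2 A3 A4 A5 A6 A0) (V A4 A5 A6 A0 A1 A2 A3))"
definition T6_2 :: "s7 v7 v7 \<times> s7 v7 v7" where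
  "T6_2 = (V (V A0 A6 A5 A4 A3 A2 A1) (V A1 A0 A6 A5 A4 A3 A2) (V A2 A1 A0 A6 A5 A4 A3) (V A3 A2 A1 A0 A6 A5 A4) (V A4 A3 A2 A1 A0 A6 A5) (V A5 A4 A3 A2 A1 A0 A6) (V A6 A5 A4 A3 A2 A1 A0),
    V (V A0 A5 A3 A1 A6 A4 A2) (V A3 A1 A6 A4 A2 A0 A5) (V A6 A4 A2 A0 A5 A3 A1) (V A2 A0 A5 A3 A1 A6 A4) (V A5 A3 A1 A6 A4 A2 A0) (V A1 A6 A4 A2 A0 A5 A3) (V A4 A2 A0 A5 A3 A1 A6))"
definition T6_3 :: "s7 v7 v7 \<times> s7 v7 v7" where
  "T6_3 = (V (V A0 A2 A4 A6 A1 A3 A5) (V A5 A0 A2 A4 A6 A1 A3) (V A3 A5 A0 A2 A4 A6 A1) (V A1 A3 A5 A0 A2 A4 A6) (V A6 A1 A3 A5 A0 A2 A4) (V A4 A6 A1 A3 A5 A0 A2) (V A2 A4 A6 A1 A3 A5 A0),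
    V (V A0 A3 A6 A2 A5 A1 A4) (V A5 A1 A4 A0 A3 A6 A2) (V A3 A6 A2 A5 A1 A4 A0) (V A1 A4 A0 A3 A6 A2 A5) (V A6 A2 A5 A1 A4 A0 A3) (V A4 A0 A3 A6 A2 A5 A1) (V A2 A5 A1 A4 A0 A3 A6))"

text \<open>The three extra tables are the turned forms of \<open>T0\<close>. The four vectors give,
  for each of the seven lines of one direction, its square and the labelling \<open>p\<close> that
  exhibits it. Such certificates need only be checked.\<close>

lemma Full_T0: "Full (set forms_all) (tn T0)"
  by (rule FullI[where ?U1.0 = T0_1 and ?U2.0 = T0_2 and ?U3.0 = T0_3 and
    ?m0.0 = "(V (L0, V A0 A1 A2 A3 A4 A5 A6) (L0, V A0 A5 A1 A4 A6 A2 A3) (L1, V A0 A1 A2 A3 A4 A5 A6) (L0, V A2 A4 A1 A5 A3 A0 A6) (L0, V A0 A3 A6 A2 A1 A4 A5) (L0, V A1 A6 A5 A2 A4 A0 A3) (L0, V A1 A4 A2 A6 A0 A3 A5))" and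
    ?m1.0 = "(V (L4, V A0 A1 A2 A3 A4 A5 A6) (L4, V A6 A0 A2 A4 A5 A3 A1) (L7, V A0 A1 A2 A3 A4 A5 A6) (L10, V A0 A1 A2 A3 A4 A5 A6) (L4, V A1 A6 A2 A5 A3 A4 A0) (L10, V A1 A6 A2 A5 A3 A4 A0) (L10, V A6 A0 A2 A4 A5 A3 A1))" and
    ?m2.0 = "(V (L13, V A0 A1 A2 A3 A4 A5 A6) (L16, V A0 A1 A2 A3 A4 A5 A6) (L22, V A0 A1 A2 A3 A4 A5 A6) (L22, V A6 A0 A2 A4 A5 A3 A1) (L13, V A6 A0 A2 A4 A5 A3 A1) (L22, V A1 A6 A2 A5 A3 A4 A0) (L13, V A1 A6 A2 A5 A3 A4 A0))" and
    ?m3.0 = "(V (L22, V A4 A3 A2 A6 A1 A0 A5) (L22, V A5 A4 A2 A1 A0 A6 A3) (L22, V A3 A5 A2 A0 A6 A1 A4) (L13, V A3 A5 A2 A0 A6 A1 A4) (L13, V A5 A4 A2 A1 A0 A6 A3) (L16, V A3 A5 A2 A0 A6 A1 A4) (L13, V A4 A3 A2 A6 A1 A0 A5))"])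
    code_simp+

lemma Full_T1: "Full (set forms_BF) (tn T1)"
  by (rule FullI[where ?U1.0 = T1_1 and ?U2.0 = T1_2 and ?U3.0 = T1_3 and
    ?m0.0 = "(V (L28, V A0 A1 A2 A3 A4 A5 A6) (L30, V A0 A1 A2 A3 A4 A5 A6) (L33, V A2 A4 A3 A5 A1 A0 A6) (L30, V A2 A6 A0 A3 A5 A4 A1) (L33, V A0 A5 A3 A4 A6 A2 A1) (L34, V A1 A0 A2 A4 A6 A5 A3) (L34, V A6 A2 A0 A5 A1 A4 A3))" and
    ?m1.0 = "(V (L32, V A2 A1 A0 A3 A5 A4 A6) (L35, V A6 A2 A4 A3 A5 A1 A0) (L32, V A4 A3 A0 A1 A6 A2 A5) (L29, V A2 A6 A4 A0 A3 A1 A5) (L31, V A2 A6 A4 A0 A3 A1 A5) (L31, V A4 A5 A2 A0 A1 A3 A6) (L35, V A5 A4 A2 A1 A6 A3 A0))" and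
    ?m2.0 = "(V (L30, V A1 A4 A3 A0 A6 A5 A2) (L33, V A3 A6 A0 A5 A4 A1 A2) (L30, V A3 A2 A1 A0 A5 A6 A4) (L28, V A1 A4 A3 A0 A6 A5 A2) (L34, V A2 A3 A1 A5 A4 A6 A0) (L34, V A4 A1 A3 A6 A2 A5 A0) (L33, V A1 A5 A0 A6 A2 A3 A4))" and
    ?m3.0 = "(V (L35, V A1 A6 A5 A2 A3 A4 A0) (L31, V A6 A1 A5 A0 A2 A4 A3) (L35, V A3 A5 A6 A4 A1 A2 A0) (L29, V A5 A3 A6 A0 A4 A2 A1) (L32, V A5 A2 A0 A4 A1 A6 A3) (L32, V A6 A4 A0 A2 A3 A5 A1) (L31, V A5 A3 A6 A0 A4 A2 A1))"])
    code_simp+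

lemma Full_T2: "Full (set forms_all) (tn T2)"
  by (rule FullI[where ?U1.0 = T2_1 and ?U2.0 = T2_2 and ?U3.0 = T2_3 and
    ?m0.0 = "(V (L0, V A0 A4 A5 A1 A2 A3 A6) (L0, V A1 A2 A0 A5 A6 A3 A4) (L0, V A1 A4 A6 A3 A0 A5 A2) (L0, V A4 A6 A3 A5 A2 A0 A1) (L36, V A0 A1 A2 A3 A4 A5 A6) (L0, V A1 A4 A6 A3 A0 A5 A2) (L0, V A0 A4 A5 A1 A2 A3 A6))" and
    ?m1.0 = "(V (L38, V A0 A1 A2 A3 A4 A5 A6) (L44, V A0 A1 A2 A3 A4 A5 A6) (L50, V A0 A1 A2 A3 A4 A5 A6) (L38, V A2 A3 A0 A1 A4 A6 A5) (L44, V A2 A3 A0 A1 A4 A6 A5) (L56, V A0 A1 A2 A3 A4 A5 A6) (L50, V A2 A3 A0 A1 A4 A6 A5))" and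
    ?m2.0 = "(V (L45, V A6 A0 A5 A2 A4 A3 A1) (L57, V A5 A2 A6 A0 A4 A1 A3) (L39, V A5 A2 A6 A0 A4 A1 A3) (L39, V A6 A0 A5 A2 A4 A3 A1) (L51, V A6 A0 A5 A2 A4 A3 A1) (L51, V A5 A2 A6 A0 A4 A1 A3) (L45, V A5 A2 A6 A0 A4 A1 A3))" and
    ?m3.0 = "(V (L44, V A1 A6 A3 A5 A4 A2 A0) (L44, V A3 A5 A1 A6 A4 A0 A2) (L38, V A3 A5 A1 A6 A4 A0 A2) (L56, V A1 A6 A3 A5 A4 A2 A0) (L38, V A1 A6 A3 A5 A4 A2 A0) (L50, V A1 A6 A3 A5 A4 A2 A0) (L50, V A3 A5 A1 A6 A4 A0 A2))"])
    code_simp+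

lemma Full_T3: "Full (set forms_all) (tn T3)"
  by (rule FullI[where ?U1.0 = T3_1 and ?U2.0 = T3_2 and ?U3.0 = T3_3 and
    ?m0.0 = "(V (L0, V A0 A4 A5 A1 A2 A3 A6) (L0, V A1 A2 A0 A5 A6 A3 A4) (L0, V A1 A3 A2 A6 A4 A0 A5) (L0, V A3 A4 A2 A5 A1 A6 A0) (L0, V A0 A3 A4 A2 A6 A5 A1) (L0, V A0 A5 A3 A6 A1 A4 A2) (L0, V A2 A6 A0 A4 A1 A5 A3))" and
    ?m1.0 = "(V (L0, V A1 A2 A4 A6 A0 A5 A3) (L0, V A3 A6 A1 A5 A0 A2 A4) (L0, V A0 A3 A1 A2 A6 A4 A5) (L0, V A0 A1 A4 A5 A2 A3 A6) (L0, V A2 A4 A6 A5 A3 A0 A1) (L0, V A0 A4 A3 A6 A5 A1 A2) (L0, V A1 A4 A5 A3 A6 A2 A0))" and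
    ?m2.0 = "(V (L0, V A0 A1 A4 A5 A2 A3 A6) (L0, V A0 A3 A1 A2 A6 A4 A5) (L0, V A3 A6 A1 A5 A0 A2 A4) (L0, V A1 A2 A4 A6 A0 A5 A3) (L0, V A0 A4 A3 A6 A5 A1 A2) (L0, V A2 A4 A6 A5 A3 A0 A1) (L0, V A1 A4 A5 A3 A6 A2 A0))" and
    ?m3.0 = "(V (L62, V A0 A1 A2 A3 A4 A5 A6) (L62, V A0 A3 A6 A4 A1 A2 A5) (L63, V A0 A3 A6 A4 A1 A2 A5) (L63, V A0 A1 A2 A3 A4 A5 A6) (L62, V A0 A4 A5 A1 A3 A6 A2) (L63, V A0 A4 A5 A1 A3 A6 A2) (L64, V A0 A1 A2 A3 A4 A5 A6))"])
    code_simp+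

lemma Full_T4: "Full (set forms_BEF) (tn T4)"
  by (rule FullI[where ?U1.0 = T4_1 and ?U2.0 = T4_2 and ?U3.0 = T4_3 and
    ?m0.0 = "(V (L65, V A0 A1 A2 A3 A4 A5 A6) (L11, V A1 A3 A4 A0 A2 A5 A6) (L11, V A6 A2 A3 A1 A4 A5 A0) (L11, V A0 A4 A2 A6 A3 A5 A1) (L11, V A3 A6 A1 A4 A0 A5 A2) (L11, V A4 A1 A0 A2 A6 A5 A3) (L11, V A2 A0 A6 A3 A1 A5 A4))" and
    ?m1.0 = "(V (L12, V A3 A5 A6 A2 A4 A0 A1) (L12, V A1 A4 A5 A3 A6 A0 A2) (L12, V A6 A3 A2 A4 A1 A0 A5) (L12, V A4 A2 A1 A5 A3 A0 A6) (L12, V A5 A1 A3 A6 A2 A0 A4) (L66, V A1 A2 A5 A6 A4 A0 A3) (L12, V A2 A6 A4 A1 A5 A0 A3))" and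
    ?m2.0 = "(V (L10, V A6 A5 A0 A1 A3 A2 A4) (L10, V A5 A4 A0 A2 A1 A3 A6) (L10, V A2 A3 A0 A5 A6 A4 A1) (L10, V A1 A2 A0 A6 A4 A5 A3) (L10, V A3 A1 A0 A4 A5 A6 A2) (L67, V A1 A2 A5 A6 A4 A0 A3) (L10, V A4 A6 A0 A3 A2 A1 A5))" and
    ?m3.0 = "(V (L11, V A4 A2 A1 A5 A3 A0 A6) (L11, V A6 A3 A2 A4 A1 A0 A5) (L11, V A1 A4 A5 A3 A6 A0 A2) (L11, V A3 A5 A6 A2 A4 A0 A1) (L11, V A2 A6 A4 A1 A5 A0 A3) (L65, V A1 A2 A5 A6 A4 A0 A3) (L11, V A5 A1 A3 A6 A2 A0 A4))"])
    code_simp+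

lemma Full_T5: "Full (set forms_BF) (tn T5)"
  by (rule FullI[where ?U1.0 = T5_1 and ?U2.0 = T5_2 and ?U3.0 = T5_3 and
    ?m0.0 = "(V (L3, V A0 A1 A2 A3 A5 A4 A6) (L3, V A0 A1 A2 A3 A5 A4 A6) (L3, V A0 A1 A2 A3 A5 A4 A6) (L3, V A0 A1 A2 A3 A5 A4 A6) (L3, V A0 A1 A2 A3 A5 A4 A6) (L3, V A0 A1 A2 A3 A5 A4 A6) (L3, V A0 A1 A2 A3 A5 A4 A6))" and
    ?m1.0 = "(V (L2, V A0 A1 A2 A3 A5 A4 A6) (L2, V A0 A1 A2 A3 A5 A4 A6) (L2, V A0 A1 A2 A3 A5 A4 A6) (L2, V A0 A1 A2 A3 A5 A4 A6) (L2, V A0 A1 A2 A3 A5 A4 A6) (L2, V A0 A1 A2 A3 A5 A4 A6) (L2, V A0 A1 A2 A3 A5 A4 A6))" and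
    ?m2.0 = "(V (L2, V A0 A1 A2 A3 A5 A4 A6) (L2, V A0 A1 A2 A3 A5 A4 A6) (L2, V A0 A1 A2 A3 A5 A4 A6) (L2, V A0 A1 A2 A3 A5 A4 A6) (L2, V A0 A1 A2 A3 A5 A4 A6) (L2, V A0 A1 A2 A3 A5 A4 A6) (L2, V A0 A1 A2 A3 A5 A4 A6))" and
    ?m3.0 = "(V (L1, V A0 A1 A2 A3 A5 A4 A6) (L1, V A0 A1 A2 A3 A5 A4 A6) (L1, V A0 A1 A2 A3 A5 A4 A6) (L1, V A0 A1 A2 A3 A5 A4 A6) (L1, V A0 A1 A2 A3 A5 A4 A6) (L1, V A0 A1 A2 A3 A5 A4 A6) (L1, V A0 A1 A2 A3 A5 A4 A6))"])
    code_simp+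

lemma Full_T6: "Full (set forms_BF) (tn T6)"
  by (rule FullI[where ?U1.0 = T6_1 and ?U2.0 = T6_2 and ?U3.0 = T6_3 and
    ?m0.0 = "(V (L37, V A0 A1 A4 A6 A5 A3 A2) (L37, V A0 A1 A4 A6 A5 A3 A2) (L37, V A0 A1 A4 A6 A5 A3 A2) (L37, V A0 A1 A4 A6 A5 A3 A2) (L37, V A0 A1 A4 A6 A5 A3 A2) (L37, V A0 A1 A4 A6 A5 A3 A2) (L37, V A0 A1 A4 A6 A5 A3 A2))" and
    ?m1.0 = "(V (L36, V A0 A1 A4 A6 A5 A3 A2) (L36, V A0 A1 A4 A6 A5 A3 A2) (L36, V A0 A1 A4 A6 A5 A3 A2) (L36, V A0 A1 A4 A6 A5 A3 A2) (L36, V A0 A1 A4 A6 A5 A3 A2) (L36, V A0 A1 A4 A6 A5 A3 A2) (L36, V A0 A1 A4 A6 A5 A3 A2))" and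
    ?m2.0 = "(V (L37, V A0 A1 A4 A6 A5 A3 A2) (L37, V A0 A1 A4 A6 A5 A3 A2) (L37, V A0 A1 A4 A6 A5 A3 A2) (L37, V A0 A1 A4 A6 A5 A3 A2) (L37, V A0 A1 A4 A6 A5 A3 A2) (L37, V A0 A1 A4 A6 A5 A3 A2) (L37, V A0 A1 A4 A6 A5 A3 A2))" and
    ?m3.0 = "(V (L36, V A0 A1 A4 A6 A5 A3 A2) (L36, V A0 A1 A4 A6 A5 A3 A2) (L36, V A0 A1 A4 A6 A5 A3 A2) (L36, V A0 A1 A4 A6 A5 A3 A2) (L36, V A0 A1 A4 A6 A5 A3 A2) (L36, V A0 A1 A4 A6 A5 A3 A2) (L36, V A0 A1 A4 A6 A5 A3 A2))"])
    code_simp+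

lemma Full_mono: "Full fs N \<Longrightarrow> fs \<subseteq> fs' \<Longrightarrow> Full fs' N"
  unfolding Full_def Mk_def by blast

subsection \<open>Gluing two planes along a line\<close>

text \<open>Up to automorphisms of \<open>B\<close>, the inverses of \<open>ths\<close> are the only relabellings of \<open>B\<close> that meet
  \<open>A\<close> on the diagonal only.\<close>

definition glue :: "s7 v7 v7 \<Rightarrow> s7 v7 v7 \<Rightarrow> s7 v7 list \<Rightarrow> bool" where
  "glue A B ths \<longleftrightarrow> (\<forall>p. bij (at p) \<longrightarrow> (\<forall>i j. i \<noteq> j \<longrightarrow> A $ (p $ i) $ (p $ j) \<noteq> p $ (B $ i $ j)) \<longrightarrow>
    (\<exists>th\<in>set ths. \<forall>i j. B $ (th $ (p $ i)) $ (th $ (p $ j)) = th $ (p $ (B $ i $ j))))"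

definition leaf :: "s7 v7 v7 \<Rightarrow> s7 v7 list \<Rightarrow> s7 v7 \<Rightarrow> bool" where
  "leaf B ths q = any (\<lambda>th. every (\<lambda>i. every (\<lambda>j.
    B $ (th $ (inv7 q $ i)) $ (th $ (inv7 q $ j)) = th $ (inv7 q $ (B $ i $ j))))) ths"

text \<open>Turns the definition of a square into 49 ground rewrite rules, so that a search never
  unfolds the whole table.\<close>

lemma at2: "B = V (V x00 x01 x02 x03 x04 x05 x06) (V x10 x11 x12 x13 x14 x15 x16) (V x20 x21 x22 x23 x24 x25 x26) (V x30 x31 x32 x33 x34 x35 x36) (V x40 x41 x42 x43 x44 x45 x46) (V x50 x51 x52 x53 x54 x55 x56) (V x60 x61 x62 x63 x64 x65 x66) \<Longrightarrow>
  B $ A0 $ A0 = x00 \<and> B $ A0 $ A1 = x01 \<and> B $ A0 $ A2 = x02 \<and> B $ A0 $ A3 = x03 \<and> B $ A0 $ A4 = x04 \<and> B $ A0 $ A5 = x05 \<and> B $ A0 $ A6 = x06 \<and> B $ A1 $ A0 = x10 \<and> B $ A1 $ A1 = x11 \<and> B $ A1 $ A2 = x12 \<and> B $ A1 $ A3 = x13 \<and> B $ A1 $ A4 = x14 \<and> B $ A1 $ A5 = x15 \<and> B $ A1 $ A6 = x16 \<and> B $ A2 $ A0 = x20 \<and> B $ A2 $ A1 = x21 \<and> B $ A2 $ A2 = x22 \<and> B $ A2 $ A3 = x23 \<and> B $ A2 $ A4 = x24 \<and> B $ A2 $ A5 = x25 \<and> B $ A2 $ A6 = x26 \<and> B $ A3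 $ A0 = x30 \<and> B $ A3 $ A1 = x31 \<and> B $ A3 $ A2 = x32 \<and> B $ A3 $ A3 = x33 \<and> B $ A3 $ A4 = x34 \<and> B $ A3 $ A5 = x35 \<and> B $ A3 $ A6 = x36 \<and> B $ A4 $ A0 = x40 \<and> B $ A4 $ A1 = x41 \<and> B $ A4 $ A2 = x42 \<and> B $ A4 $ A3 = x43 \<and> B $ A4 $ A4 = x44 \<and> B $ A4 $ A5 = x45 \<and> B $ A4 $ A6 = x46 \<and> B $ A5 $ A0 = x50 \<and> B $ A5 $ A1 = x51 \<and> B $ A5 $ A2 = x52 \<and> B $ A5 $ A3 = x53 \<and> B $ A5 $ A4 = x54 \<and> B $ A5 $ A5 = x55 \<and> B $ A5 $ A6 = x56 \<and> B $ A6 $ A0 = x60 \<and> B $ A6 $ A1 = x61 \<and> B $ A6 $ A2 = x62 \<and> B $ A6 $ A3 = x63 \<and> B $ A6 $ A4 = x64 \<and> B $ A6 $ A5 = x65 \<and> B $ A6 $ A6 = x66"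
  by simp

text \<open>The search runs over the inverse \<open>q\<close> of \<open>p\<close>. The condition
  becomes \<open>B $ (q $ i) $ (q $ j) \<noteq> q $ (A $ i $ j)\<close>, whose indices come from the
  fixed table \<open>A\<close>; it can be tested as soon as the three values of \<open>q\<close>
  involved are chosen.\<close>

lemma glueI:
  assumes "\<And>q. bij (at q) \<Longrightarrow> (\<And>i j. i \<noteq> j \<Longrightarrow> B $ (q $ i) $ (q $ j) \<noteq> q $ (A $ i $ j)) \<Longrightarrow> leaf B ths q"
  shows "glue A B ths"
  unfolding glue_def
proof (intro allI impI)
  fix p assume p: "bij (at p)" and a: "\<forall>i j. i \<noteq> j \<longrightarrow> A $ (p $ i) $ (p $ j) \<noteq> p $ (B $ i $ j)"
  note b = bij_inv7[OF p]
  have inv: "inv7 (inv7 p) $ x = p $ x" for x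
    using at_inv7[OF b, of "p $ (inv7 (inv7 p) $ x)"] at_inv7[OF b] at_inv7[OF p] inv7_at[OF p] by metis
  have "B $ (inv7 p $ i) $ (inv7 p $ j) \<noteq> inv7 p $ (A $ i $ j)" if "i \<noteq> j" for i j
  proof
    assume e: "B $ (inv7 p $ i) $ (inv7 p $ j) = inv7 p $ (A $ i $ j)"
    have "inv7 p $ i \<noteq> inv7 p $ j" using that by (metis at_inv7[OF p])
    with a have "A $ (p $ (inv7 p $ i)) $ (p $ (inv7 p $ j)) \<noteq> p $ (B $ (inv7 p $ i) $ (inv7 p $ j))" by blast
    with e show False by (simp add: at_inv7[OF p])
  qed
  from assms[OF b this] show "\<exists>th\<in>set ths. \<forall>i j. B $ (th $ (p $ i)) $ (th $ (p $ j)) = th $ (p $ (B $ i $ j))"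
    by (simp add: leaf_def inv)
qed

text \<open>The list of leaves is kept behind a variable \<open>xs\<close>, so that rewriting does not traverse it at each step.\<close>

lemma numeral_Cons:
  "drop (numeral v) (x # xs) = drop (pred_numeral v) xs" "take (numeral v) (x # xs) = x # take (pred_numeral v) xs"
  by (simp_all add: numeral_eq_Suc)

lemmas chunk = numeral_Cons pred_numeral_simps BitM.simps drop_0 take_0 drop_Nil take_Nil
  list.pred_inject prod.case simp_thms

subsubsection \<open>Squares against \<open>L0\<close>\<close>

text \<open>The values are chosen in the order \<open>a\<close>, \<open>b\<close>, \<open>d\<close>,
  \<open>c\<close>, \<open>e\<close>, \<open>f\<close>, \<open>g\<close>, because in
  \<open>L0\<close> the indices \<open>A0\<close>, \<open>A1\<close>, \<open>A3\<close> already
  yield three conditions among themselves. A test stands at the level of its last value, and keeping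
  the levels as separate constants lets rewriting drop a branch before anything deeper is
  unfolded.\<close>

definition s0_7 :: "s7 v7 v7 \<Rightarrow> (s7 v7 \<Rightarrow> bool) \<Rightarrow> s7 \<Rightarrow> s7 \<Rightarrow> s7 \<Rightarrow> s7 \<Rightarrow> s7 \<Rightarrow> s7 \<Rightarrow> s7 \<Rightarrow> bool" where
  "s0_7 B Q a b d c e f g = (if a = g then True else if b = g then True else if d = g then True else if c = g then True else if e = g then True else if f = g then True else if B $ a $ f = g then True else if B $ a $ g = c then True else if B $ b $ c = g then True else if B $ b $ g = e then True else if B $ d $ e = g then True else if B $ d $ g = f then True else if B $ c $ b = g then True else if B $ c $ g = a then True else if B $ e $ d = g then True else if B $ e $ g = b then True else if B $ f $ a = g then True else if B $ f $ g = d then True else if B $ g $ a = e then True else if B $ g $ b = f then True else if B $ g $ d = c then True else if B $ g $ c = d then True else if B $ g $ e = a then True else if B $ g $ f = b then True else Q (V a b c d e f g))"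

definition s0_6 :: "s7 v7 v7 \<Rightarrow> (s7 v7 \<Rightarrow> bool) \<Rightarrow> s7 \<Rightarrow> s7 \<Rightarrow> s7 \<Rightarrow> s7 \<Rightarrow> s7 \<Rightarrow> s7 \<Rightarrow> bool" where
  "s0_6 B Q a b d c e f = (if a = f then True else if b = f then True else if d = f then True else if c = f then True else if e = f then True else if B $ a $ e = f then True else if B $ b $ a = f then True else if B $ b $ f = c then True else if B $ d $ f = a then True else if B $ c $ d = f then True else if B $ c $ f = e then True else if B $ e $ c = f then True else if B $ e $ f = d then True else if B $ f $ b = e then True else if B $ f $ d = b then True else if B $ f $ c = a then True else if B $ f $ e = c then True else every (s0_7 B Q a b d c e f))"

definition s0_5 :: "s7 v7 v7 \<Rightarrow> (s7 v7 \<Rightarrow> bool) \<Rightarrow> s7 \<Rightarrow> s7 \<Rightarrow> s7 \<Rightarrow> s7 \<Rightarrow> s7 \<Rightarrow> bool" where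
  "s0_5 B Q a b d c e = (if a = e then True else if b = e then True else if d = e then True else if c = e then True else if B $ a $ d = e then True else if B $ b $ e = d then True else if B $ d $ c = e then True else if B $ c $ e = b then True else if B $ e $ a = c then True else if B $ e $ b = a then True else every (s0_6 B Q a b d c e))"

definition s0_4 :: "s7 v7 v7 \<Rightarrow> (s7 v7 \<Rightarrow> bool) \<Rightarrow> s7 \<Rightarrow> s7 \<Rightarrow> s7 \<Rightarrow> s7 \<Rightarrow> bool" where
  "s0_4 B Q a b d c = (if a = c then True else if b = c then True else if d = c then True else if B $ a $ c = b then True else if B $ d $ b = c then True else if B $ c $ a = d then True else every (s0_5 B Q a b d c))"

definition s0_3 :: "s7 v7 v7 \<Rightarrow> (s7 v7 \<Rightarrow> bool) \<Rightarrow> s7 \<Rightarrow> s7 \<Rightarrow> s7 \<Rightarrow> bool" where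
  "s0_3 B Q a b d = (if a = d then True else if b = d then True else if B $ a $ b = d then True else if B $ b $ d = a then True else if B $ d $ a = b then True else every (s0_4 B Q a b d))"

definition s0_2 :: "s7 v7 v7 \<Rightarrow> (s7 v7 \<Rightarrow> bool) \<Rightarrow> s7 \<Rightarrow> s7 \<Rightarrow> bool" where
  "s0_2 B Q a b = (if a = b then True else every (s0_3 B Q a b))"

definition s0_1 :: "s7 v7 v7 \<Rightarrow> (s7 v7 \<Rightarrow> bool) \<Rightarrow> s7 \<Rightarrow> bool" where
  "s0_1 B Q a = (every (s0_2 B Q a))"

lemma search0:
  assumes "\<And>xs. (\<And>P. any P xs = any P ths) \<Longrightarrow> every (s0_1 B (leaf B xs))" shows "glue L0 B ths"
proof (rule glueI)
  fix q assume q: "bij (at q)" and t: "\<And>i j. i \<noteq> j \<Longrightarrow> B $ (q $ i) $ (q $ j) \<noteq> q $ (L0 $ i $ j)"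
  obtain a b c d e f g where V: "q = V a b c d e f g" by (cases q)
  have "q $ i \<noteq> q $ j" if "i \<noteq> j" for i j using q that by (metis bij_is_inj injD)
  then have "\<forall>i j. i \<noteq> j \<longrightarrow> q $ i \<noteq> q $ j" by blast
  note ne = this[unfolded all_s7 V, simplified at.simps s7.distinct simp_thms]
  have "\<forall>i j. i \<noteq> j \<longrightarrow> B $ (q $ i) $ (q $ j) \<noteq> q $ (L0 $ i $ j)" using t by blast
  note ts = this[unfolded all_s7 V, simplified at2[OF L0_def] at.simps s7.distinct simp_thms]
  have "s0_1 B (leaf B ths) a" by (rule everyD[OF assms[OF refl]])
  then have h1: "every (s0_2 B (leaf B ths) a)" by (simp only: s0_1_def ne ts if_False)
  have "s0_2 B (leaf B ths) a b" by (rule everyD[OF h1])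
  then have h2: "every (s0_3 B (leaf B ths) a b)" by (simp only: s0_2_def ne ts if_False)
  have "s0_3 B (leaf B ths) a b d" by (rule everyD[OF h2])
  then have h3: "every (s0_4 B (leaf B ths) a b d)" by (simp only: s0_3_def ne ts if_False)
  have "s0_4 B (leaf B ths) a b d c" by (rule everyD[OF h3])
  then have h4: "every (s0_5 B (leaf B ths) a b d c)" by (simp only: s0_4_def ne ts if_False)
  have "s0_5 B (leaf B ths) a b d c e" by (rule everyD[OF h4])
  then have h5: "every (s0_6 B (leaf B ths) a b d c e)" by (simp only: s0_5_def ne ts if_False)
  have "s0_6 B (leaf B ths) a b d c e f" by (rule everyD[OF h5])
  then have h6: "every (s0_7 B (leaf B ths) a b d c e f)" by (simp only: s0_6_def ne ts if_False)
  have "s0_7 B (leaf B ths) a b d c e f g" by (rule everyD[OF h6])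
  then show "leaf B ths q" by (simp only: s0_7_def V ne ts if_False)
qed

text \<open>What the search leaves for each square, as inverses of relabellings and up to
  automorphisms. An empty list means that a line marked \<open>L0\<close> in one plane is never
  marked by that square in a crossing plane; in particular it is never marked \<open>L0\<close>
  twice.\<close>

definition G0 :: "(s7 v7 v7 \<times> s7 v7 list) list" where
  "G0 = [(L0, []),
    (L1, [V A0 A1 A3 A4 A6 A5 A2, V A0 A1 A5 A4 A3 A6 A2]),
    (L2, [V A0 A1 A3 A4 A6 A5 A2, V A0 A1 A6 A4 A5 A3 A2]),
    (L3, [V A0 A1 A5 A4 A3 A6 A2, V A0 A1 A6 A4 A5 A3 A2]),
    (L4, []),
    (L5, []),
    (L6, []),
    (L7, []),
    (L8, []),
    (L9, []),
    (L10, []),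
    (L11, []),
    (L12, []),
    (L13, []),
    (L14, []),
    (L15, []),
    (L16, [V A0 A3 A1 A5 A4 A6 A2, V A5 A0 A6 A3 A1 A4 A2, V A3 A5 A4 A0 A6 A1 A2]),
    (L17, [V A0 A6 A1 A3 A5 A4 A2, V A0 A5 A4 A1 A3 A6 A2, V A3 A0 A4 A6 A1 A5 A2]),
    (L18, [V A0 A5 A3 A1 A6 A4 A2, V A0 A6 A5 A3 A4 A1 A2, V A3 A0 A1 A6 A5 A4 A2]),
    (L19, [V A0 A3 A6 A5 A1 A4 A2, V A5 A0 A4 A3 A6 A1 A2, V A4 A3 A0 A6 A5 A1 A2]),
    (L20, [V A0 A3 A4 A5 A6 A1 A2, V A5 A0 A1 A3 A4 A6 A2, V A5 A4 A0 A1 A6 A3 A2]),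
    (L21, [V A0 A5 A6 A1 A4 A3 A2, V A0 A6 A4 A3 A1 A5 A2, V A3 A0 A5 A6 A4 A1 A2]),
    (L22, []),
    (L23, []),
    (L24, []),
    (L25, []),
    (L26, []),
    (L27, []),
    (L28, [V A0 A4 A1 A6 A5 A2 A3, V A6 A0 A2 A4 A1 A5 A3, V A4 A6 A5 A0 A2 A1 A3]),
    (L29, [V A0 A6 A2 A4 A5 A1 A3, V A4 A0 A1 A6 A2 A5 A3, V A6 A4 A5 A0 A1 A2 A3]),
    (L30, [V A1 A2 A0 A6 A4 A5 A3, V A6 A2 A0 A5 A1 A4 A3, V A6 A1 A5 A2 A0 A4 A3, V A5 A6 A4 A2 A0 A1 A3, V A2 A5 A1 A6 A4 A0 A3, V A2 A6 A4 A1 A5 A0 A3]),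
    (L31, [V A0 A1 A2 A4 A5 A6 A3, V A0 A4 A2 A5 A6 A1 A3, V A5 A0 A1 A4 A2 A6 A3, V A4 A0 A6 A1 A2 A5 A3, V A1 A4 A5 A0 A6 A2 A3, V A4 A5 A6 A0 A1 A2 A3]),
    (L32, [V A0 A1 A5 A4 A6 A2 A3, V A0 A4 A6 A5 A1 A2 A3, V A4 A0 A2 A1 A5 A6 A3, V A5 A0 A2 A4 A6 A1 A3, V A1 A4 A6 A0 A2 A5 A3, V A4 A5 A1 A0 A2 A6 A3]),
    (L33, [V A2 A6 A0 A1 A4 A5 A3, V A2 A5 A0 A6 A1 A4 A3, V A1 A2 A5 A6 A0 A4 A3, V A6 A2 A4 A5 A0 A1 A3, V A6 A1 A4 A2 A5 A0 A3, V A5 A6 A1 A2 A4 A0 A3]),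
    (L34, [V A6 A1 A0 A2 A4 A5 A3, V A5 A6 A0 A2 A1 A4 A3, V A2 A6 A5 A1 A0 A4 A3, V A2 A5 A4 A6 A0 A1 A3, V A1 A2 A4 A6 A5 A0 A3, V A6 A2 A1 A5 A4 A0 A3]),
    (L35, [V A0 A1 A6 A4 A2 A5 A3, V A0 A4 A1 A5 A2 A6 A3, V A4 A0 A5 A1 A6 A2 A3, V A5 A0 A6 A4 A1 A2 A3, V A1 A4 A2 A0 A5 A6 A3, V A4 A5 A2 A0 A6 A1 A3]),
    (L36, []),
    (L37, []),
    (L38, [V A1 A3 A0 A2 A4 A6 A5, V A4 A5 A0 A3 A1 A6 A2, V A2 A1 A6 A3 A0 A4 A5, V A3 A4 A6 A5 A0 A1 A2, V A5 A3 A1 A4 A6 A0 A2, V A3 A2 A4 A1 A6 A0 A5]),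
    (L39, [V A0 A1 A5 A6 A3 A4 A2, V A0 A4 A3 A6 A2 A1 A5, V A6 A0 A1 A4 A3 A2 A5, V A6 A0 A4 A1 A5 A3 A2, V A1 A6 A3 A0 A4 A5 A2, V A4 A6 A2 A0 A1 A3 A5]),
    (L40, [V A0 A1 A3 A6 A4 A5 A2, V A0 A4 A2 A6 A1 A3 A5, V A6 A0 A5 A1 A3 A4 A2, V A6 A0 A3 A4 A2 A1 A5, V A1 A6 A4 A0 A5 A3 A2, V A4 A6 A1 A0 A3 A2 A5]),
    (L41, [V A3 A2 A0 A1 A4 A6 A5, V A5 A3 A0 A4 A1 A6 A2, V A1 A3 A6 A2 A0 A4 A5, V A4 A5 A6 A3 A0 A1 A2, V A2 A1 A4 A3 A6 A0 A5, V A3 A4 A1 A5 A6 A0 A2]),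
    (L42, [V A2 A1 A0 A3 A4 A6 A5, V A3 A4 A0 A5 A1 A6 A2, V A3 A2 A6 A1 A0 A4 A5, V A5 A3 A6 A4 A0 A1 A2, V A1 A3 A4 A2 A6 A0 A5, V A4 A5 A1 A3 A6 A0 A2]),
    (L43, [V A0 A1 A4 A6 A5 A3 A2, V A0 A4 A1 A6 A3 A2 A5, V A6 A0 A3 A1 A4 A5 A2, V A6 A0 A2 A4 A1 A3 A5, V A1 A6 A5 A0 A3 A4 A2, V A4 A6 A3 A0 A2 A1 A5]),
    (L44, [V A0 A5 A2 A1 A3 A4 A6, V A1 A0 A4 A5 A2 A3 A6, V A5 A1 A3 A0 A4 A2 A6]),
    (L45, [V A4 A2 A0 A3 A5 A1 A6, V A3 A4 A1 A2 A0 A5 A6, V A2 A3 A5 A4 A1 A0 A6]),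
    (L46, [V A3 A4 A0 A2 A5 A1 A6, V A2 A3 A1 A4 A0 A5 A6, V A4 A2 A5 A3 A1 A0 A6]),
    (L47, [V A0 A5 A4 A1 A2 A3 A6, V A1 A0 A3 A5 A4 A2 A6, V A5 A1 A2 A0 A3 A4 A6]),
    (L48, [V A0 A5 A3 A1 A4 A2 A6, V A1 A0 A2 A5 A3 A4 A6, V A5 A1 A4 A0 A2 A3 A6]),
    (L49, [V A2 A3 A0 A4 A5 A1 A6, V A4 A2 A1 A3 A0 A5 A6, V A3 A4 A5 A2 A1 A0 A6]),
    (L50, [V A3 A2 A1 A5 A4 A6 A0, V A5 A3 A6 A2 A1 A4 A0, V A2 A5 A4 A3 A6 A1 A0]),
    (L51, [V A1 A4 A2 A6 A5 A3 A0, V A6 A1 A3 A4 A2 A5 A0, V A4 A6 A5 A1 A3 A2 A0]),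
    (L52, [V A1 A4 A5 A6 A3 A2 A0, V A6 A1 A2 A4 A5 A3 A0, V A4 A6 A3 A1 A2 A5 A0]),
    (L53, [V A2 A5 A1 A3 A4 A6 A0, V A3 A2 A6 A5 A1 A4 A0, V A5 A3 A4 A2 A6 A1 A0]),
    (L54, [V A5 A3 A1 A2 A4 A6 A0, V A2 A5 A6 A3 A1 A4 A0, V A3 A2 A4 A5 A6 A1 A0]),
    (L55, [V A1 A4 A3 A6 A2 A5 A0, V A6 A1 A5 A4 A3 A2 A0, V A4 A6 A2 A1 A5 A3 A0]),
    (L56, []),
    (L57, []),
    (L58, []),
    (L59, []),
    (L60, []),
    (L61, []),
    (L62, [V A0 A1 A4 A5 A3 A2 A6, V A0 A2 A3 A1 A5 A6 A4, V A0 A5 A2 A4 A1 A6 A3, V A0 A3 A4 A2 A6 A1 A5, V A0 A4 A5 A6 A3 A1 A2, V A0 A6 A2 A3 A5 A4 A1]),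
    (L63, [V A0 A1 A6 A2 A5 A3 A4, V A0 A2 A1 A3 A6 A4 A5, V A0 A6 A1 A4 A3 A5 A2, V A0 A5 A2 A1 A3 A4 A6, V A0 A4 A6 A5 A1 A2 A3, V A0 A3 A4 A6 A5 A2 A1]),
    (L64, []),
    (L65, []),
    (L66, []),
    (L67, [])]"

lemma G0_forms: "set forms_all \<subseteq> fst ` set G0"
  by (simp add: forms_all_def G0_def)

lemma G0_perm: "(B, ths) \<in> set G0 \<Longrightarrow> th \<in> set ths \<Longrightarrow> bij (at th)"
proof -
  have "\<forall>(B, ths)\<in>set G0. \<forall>th\<in>set ths. isperm th"
    by (simp only: G0_def list.set ball_simps prod.case isperm_def every_def some_def at.simps s7.distinct
      if_True if_False simp_thms cong: if_weak_cong)
  then show "(B, ths) \<in> set G0 \<Longrightarrow> th \<in> set ths \<Longrightarrow> bij (at th)" by (auto simp: isperm_iff)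
qed

lemmas search0_simps = s0_1_def s0_2_def s0_3_def s0_4_def s0_5_def s0_6_def s0_7_def every_def leaf_def any.simps inv7_def tab_def at.simps
  s7.distinct if_True if_False simp_thms(6)

text \<open>The list is verified in slices of seven, so that each rewriting carries the lookup rules
  of seven squares only.\<close>

lemma glue0_0: "list_all (\<lambda>(B, ths). glue L0 B ths) (take 7 (drop 0 G0))"
  by (simp only: G0_def chunk, (intro conjI)?; (rule search0,
    simp only: search0_simps at2[OF L0_def] at2[OF L1_def] at2[OF L2_def] at2[OF L3_def] at2[OF L4_def] at2[OF L5_def] at2[OF L6_def] cong: if_weak_cong))

lemma glue0_7: "list_all (\<lambda>(B, ths). glue L0 B ths) (take 7 (drop 7 G0))"
  by (simp only: G0_def chunk, (intro conjI)?; (rule search0,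
    simp only: search0_simps at2[OF L7_def] at2[OF L8_def] at2[OF L9_def] at2[OF L10_def] at2[OF L11_def] at2[OF L12_def] at2[OF L13_def] cong: if_weak_cong))

lemma glue0_14: "list_all (\<lambda>(B, ths). glue L0 B ths) (take 7 (drop 14 G0))"
  by (simp only: G0_def chunk, (intro conjI)?; (rule search0,
    simp only: search0_simps at2[OF L14_def] at2[OF L15_def] at2[OF L16_def] at2[OF L17_def] at2[OF L18_def] at2[OF L19_def] at2[OF L20_def] cong: if_weak_cong))

lemma glue0_21: "list_all (\<lambda>(B, ths). glue L0 B ths) (take 7 (drop 21 G0))"
  by (simp only: G0_def chunk, (intro conjI)?; (rule search0,
    simp only: search0_simps at2[OF L21_def] at2[OF L22_def] at2[OF L23_def] at2[OF L24_def] at2[OF L25_def] at2[OF L26_def] at2[OF L27_def] cong: if_weak_cong))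

lemma glue0_28: "list_all (\<lambda>(B, ths). glue L0 B ths) (take 7 (drop 28 G0))"
  by (simp only: G0_def chunk, (intro conjI)?; (rule search0,
    simp only: search0_simps at2[OF L28_def] at2[OF L29_def] at2[OF L30_def] at2[OF L31_def] at2[OF L32_def] at2[OF L33_def] at2[OF L34_def] cong: if_weak_cong))

lemma glue0_35: "list_all (\<lambda>(B, ths). glue L0 B ths) (take 7 (drop 35 G0))"
  by (simp only: G0_def chunk, (intro conjI)?; (rule search0,
    simp only: search0_simps at2[OF L35_def] at2[OF L36_def] at2[OF L37_def] at2[OF L38_def] at2[OF L39_def] at2[OF L40_def] at2[OF L41_def] cong: if_weak_cong))

lemma glue0_42: "list_all (\<lambda>(B, ths). glue L0 B ths) (take 7 (drop 42 G0))"
  by (simp only: G0_def chunk, (intro conjI)?; (rule search0,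
    simp only: search0_simps at2[OF L42_def] at2[OF L43_def] at2[OF L44_def] at2[OF L45_def] at2[OF L46_def] at2[OF L47_def] at2[OF L48_def] cong: if_weak_cong))

lemma glue0_49: "list_all (\<lambda>(B, ths). glue L0 B ths) (take 7 (drop 49 G0))"
  by (simp only: G0_def chunk, (intro conjI)?; (rule search0,
    simp only: search0_simps at2[OF L49_def] at2[OF L50_def] at2[OF L51_def] at2[OF L52_def] at2[OF L53_def] at2[OF L54_def] at2[OF L55_def] cong: if_weak_cong))

lemma glue0_56: "list_all (\<lambda>(B, ths). glue L0 B ths) (take 7 (drop 56 G0))"
  by (simp only: G0_def chunk, (intro conjI)?; (rule search0,
    simp only: search0_simps at2[OF L56_def] at2[OF L57_def] at2[OF L58_def] at2[OF L59_def] at2[OF L60_def] at2[OF L61_def] at2[OF L62_def] cong: if_weak_cong))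

lemma glue0_63: "list_all (\<lambda>(B, ths). glue L0 B ths) (take 7 (drop 63 G0))"
  by (simp only: G0_def chunk, (intro conjI)?; (rule search0,
    simp only: search0_simps at2[OF L63_def] at2[OF L64_def] at2[OF L65_def] at2[OF L66_def] at2[OF L67_def] cong: if_weak_cong))

lemma glue0: "\<forall>(B, ths)\<in>set G0. glue L0 B ths"
proof -
  have eq: "G0 = take 7 (drop 0 G0) @ take 7 (drop 7 G0) @ take 7 (drop 14 G0) @ take 7 (drop 21 G0) @ take 7 (drop 28 G0) @ take 7 (drop 35 G0) @ take 7 (drop 42 G0) @ take 7 (drop 49 G0) @ take 7 (drop 56 G0) @ take 7 (drop 63 G0)"
    by (simp only: G0_def chunk append.simps)
  show ?thesis
    unfolding list_all_iff[symmetric] by (subst eq) (simp only: list_all_append glue0_0 glue0_7 glue0_14 glue0_21 glue0_28 glue0_35 glue0_42 glue0_49 glue0_56 glue0_63 simp_thms)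
qed

subsubsection \<open>Squares against \<open>L11\<close>\<close>

text \<open>In \<open>L11\<close> the indices \<open>A0\<close>, \<open>A2\<close>,
  \<open>A3\<close> give four conditions among themselves, hence the order that begins with
  \<open>a\<close>, \<open>c\<close>, \<open>d\<close>.\<close>

definition s11_7 :: "s7 v7 v7 \<Rightarrow> (s7 v7 \<Rightarrow> bool) \<Rightarrow> s7 \<Rightarrow> s7 \<Rightarrow> s7 \<Rightarrow> s7 \<Rightarrow> s7 \<Rightarrow> s7 \<Rightarrow> s7 \<Rightarrow> bool" where
  "s11_7 B Q a c d e b f g = (if a = g then True else if c = g then True else if d = g then True else if e = g then True else if b = g then True else if f = g then True else if B $ a $ d = g then True else if B $ a $ g = c then True else if B $ c $ f = g then True else if B $ c $ g = f then True else if B $ d $ b = g then True else if B $ d $ g = e then True else if B $ e $ c = g then True else if B $ e $ g = b then True else if B $ b $ a = g then True else if B $ b $ g = a then True else if B $ f $ e = g then True else if B $ f $ g = d then True else if B $ g $ a = f then True else if B $ g $ c = e then True else if B $ g $ d = b then True else if B $ g $ e = a then True else if B $ g $ b = d then True else if B $ g $ f = c then True else Q (V a b c d e f g))"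

definition s11_6 :: "s7 v7 v7 \<Rightarrow> (s7 v7 \<Rightarrow> bool) \<Rightarrow> s7 \<Rightarrow> s7 \<Rightarrow> s7 \<Rightarrow> s7 \<Rightarrow> s7 \<Rightarrow> s7 \<Rightarrow> bool" where
  "s11_6 B Q a c d e b f = (if a = f then True else if c = f then True else if d = f then True else if e = f then True else if b = f then True else if B $ a $ b = f then True else if B $ a $ f = e then True else if B $ d $ e = f then True else if B $ d $ f = b then True else if B $ e $ d = f then True else if B $ e $ f = a then True else if B $ b $ c = f then True else if B $ b $ f = d then True else if B $ f $ a = e then True else if B $ f $ c = b then True else if B $ f $ d = c then True else if B $ f $ b = a then True else every (s11_7 B Q a c d e b f))"

definition s11_5 :: "s7 v7 v7 \<Rightarrow> (s7 v7 \<Rightarrow> bool) \<Rightarrow> s7 \<Rightarrow> s7 \<Rightarrow> s7 \<Rightarrow> s7 \<Rightarrow> s7 \<Rightarrow> bool" where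
  "s11_5 B Q a c d e b = (if a = b then True else if c = b then True else if d = b then True else if e = b then True else if B $ a $ e = b then True else if B $ c $ a = b then True else if B $ c $ b = e then True else if B $ e $ b = c then True else if B $ b $ d = e then True else if B $ b $ e = c then True else every (s11_6 B Q a c d e b))"

definition s11_4 :: "s7 v7 v7 \<Rightarrow> (s7 v7 \<Rightarrow> bool) \<Rightarrow> s7 \<Rightarrow> s7 \<Rightarrow> s7 \<Rightarrow> s7 \<Rightarrow> bool" where
  "s11_4 B Q a c d e = (if a = e then True else if c = e then True else if d = e then True else if B $ c $ e = d then True else if B $ e $ a = d then True else every (s11_5 B Q a c d e))"

definition s11_3 :: "s7 v7 v7 \<Rightarrow> (s7 v7 \<Rightarrow> bool) \<Rightarrow> s7 \<Rightarrow> s7 \<Rightarrow> s7 \<Rightarrow> bool" where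
  "s11_3 B Q a c d = (if a = d then True else if c = d then True else if B $ a $ c = d then True else if B $ c $ d = a then True else if B $ d $ a = c then True else if B $ d $ c = a then True else every (s11_4 B Q a c d))"

definition s11_2 :: "s7 v7 v7 \<Rightarrow> (s7 v7 \<Rightarrow> bool) \<Rightarrow> s7 \<Rightarrow> s7 \<Rightarrow> bool" where
  "s11_2 B Q a c = (if a = c then True else every (s11_3 B Q a c))"

definition s11_1 :: "s7 v7 v7 \<Rightarrow> (s7 v7 \<Rightarrow> bool) \<Rightarrow> s7 \<Rightarrow> bool" where
  "s11_1 B Q a = (every (s11_2 B Q a))"

lemma search11:
  assumes "\<And>xs. (\<And>P. any P xs = any P ths) \<Longrightarrow> every (s11_1 B (leaf B xs))" shows "glue L11 B ths"
proof (rule glueI)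
  fix q assume q: "bij (at q)" and t: "\<And>i j. i \<noteq> j \<Longrightarrow> B $ (q $ i) $ (q $ j) \<noteq> q $ (L11 $ i $ j)"
  obtain a b c d e f g where V: "q = V a b c d e f g" by (cases q)
  have "q $ i \<noteq> q $ j" if "i \<noteq> j" for i j using q that by (metis bij_is_inj injD)
  then have "\<forall>i j. i \<noteq> j \<longrightarrow> q $ i \<noteq> q $ j" by blast
  note ne = this[unfolded all_s7 V, simplified at.simps s7.distinct simp_thms]
  have "\<forall>i j. i \<noteq> j \<longrightarrow> B $ (q $ i) $ (q $ j) \<noteq> q $ (L11 $ i $ j)" using t by blast
  note ts = this[unfolded all_s7 V, simplified at2[OF L11_def] at.simps s7.distinct simp_thms]
  have "s11_1 B (leaf B ths) a" by (rule everyD[OF assms[OF refl]])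
  then have h1: "every (s11_2 B (leaf B ths) a)" by (simp only: s11_1_def ne ts if_False)
  have "s11_2 B (leaf B ths) a c" by (rule everyD[OF h1])
  then have h2: "every (s11_3 B (leaf B ths) a c)" by (simp only: s11_2_def ne ts if_False)
  have "s11_3 B (leaf B ths) a c d" by (rule everyD[OF h2])
  then have h3: "every (s11_4 B (leaf B ths) a c d)" by (simp only: s11_3_def ne ts if_False)
  have "s11_4 B (leaf B ths) a c d e" by (rule everyD[OF h3])
  then have h4: "every (s11_5 B (leaf B ths) a c d e)" by (simp only: s11_4_def ne ts if_False)
  have "s11_5 B (leaf B ths) a c d e b" by (rule everyD[OF h4])
  then have h5: "every (s11_6 B (leaf B ths) a c d e b)" by (simp only: s11_5_def ne ts if_False)
  have "s11_6 B (leaf B ths) a c d e b f" by (rule everyD[OF h5])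
  then have h6: "every (s11_7 B (leaf B ths) a c d e b f)" by (simp only: s11_6_def ne ts if_False)
  have "s11_7 B (leaf B ths) a c d e b f g" by (rule everyD[OF h6])
  then show "leaf B ths q" by (simp only: s11_7_def V ne ts if_False)
qed

definition G11 :: "(s7 v7 v7 \<times> s7 v7 list) list" where
  "G11 = [(L1, []),
    (L2, []),
    (L3, []),
    (L10, [V A3 A6 A0 A5 A2 A4 A1, V A2 A6 A4 A0 A5 A3 A1, V A5 A2 A1 A4 A3 A0 A6]),
    (L11, [V A0 A6 A2 A5 A4 A3 A1, V A1 A0 A2 A3 A5 A4 A6, V A1 A0 A2 A6 A4 A5 A3, V A6 A0 A5 A1 A3 A2 A4, V A2 A5 A0 A4 A3 A1 A6, V A5 A3 A0 A2 A4 A1 A6, V A4 A1 A2 A5 A0 A3 A6, V A6 A2 A1 A5 A3 A0 A4, V A2 A5 A3 A1 A4 A0 A6, V A1 A3 A5 A4 A6 A2 A0, V A5 A2 A1 A4 A6 A3 A0, V A6 A5 A3 A2 A4 A1 A0]),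
    (L12, [V A3 A0 A6 A2 A5 A4 A1, V A1 A6 A3 A0 A5 A4 A2, V A6 A3 A5 A1 A4 A2 A0]),
    (L28, []),
    (L29, []),
    (L30, [V A1 A3 A5 A0 A4 A2 A6]),
    (L31, [V A0 A1 A2 A5 A6 A3 A4, V A5 A1 A2 A0 A3 A6 A4]),
    (L32, [V A0 A3 A2 A4 A5 A6 A1, V A1 A6 A0 A5 A3 A4 A2]),
    (L33, [V A0 A6 A2 A5 A4 A1 A3, V A5 A3 A2 A0 A4 A1 A6]),
    (L34, [V A5 A4 A0 A1 A2 A6 A3, V A4 A6 A2 A0 A1 A3 A5]),
    (L35, [V A0 A2 A5 A1 A6 A3 A4]),
    (L36, []),
    (L37, []),
    (L65, []),
    (L66, []),
    (L67, [])]"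

lemma G11_forms: "set forms_BEF \<subseteq> fst ` set G11"
  by (simp add: forms_BEF_def G11_def)

lemma G11_perm: "(B, ths) \<in> set G11 \<Longrightarrow> th \<in> set ths \<Longrightarrow> bij (at th)"
proof -
  have "\<forall>(B, ths)\<in>set G11. \<forall>th\<in>set ths. isperm th"
    by (simp only: G11_def list.set ball_simps prod.case isperm_def every_def some_def at.simps s7.distinct
      if_True if_False simp_thms cong: if_weak_cong)
  then show "(B, ths) \<in> set G11 \<Longrightarrow> th \<in> set ths \<Longrightarrow> bij (at th)" by (auto simp: isperm_iff)
qed

lemmas search11_simps = s11_1_def s11_2_def s11_3_def s11_4_def s11_5_def s11_6_def s11_7_def every_def leaf_def any.simps inv7_def tab_def at.simps
  s7.distinct if_True if_False simp_thms(6)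

lemma glue11_0: "list_all (\<lambda>(B, ths). glue L11 B ths) (take 7 (drop 0 G11))"
  by (simp only: G11_def chunk, (intro conjI)?; (rule search11,
    simp only: search11_simps at2[OF L1_def] at2[OF L2_def] at2[OF L3_def] at2[OF L10_def] at2[OF L11_def] at2[OF L12_def] at2[OF L28_def] cong: if_weak_cong))

lemma glue11_7: "list_all (\<lambda>(B, ths). glue L11 B ths) (take 7 (drop 7 G11))"
  by (simp only: G11_def chunk, (intro conjI)?; (rule search11,
    simp only: search11_simps at2[OF L29_def] at2[OF L30_def] at2[OF L31_def] at2[OF L32_def] at2[OF L33_def] at2[OF L34_def] at2[OF L35_def] cong: if_weak_cong))

lemma glue11_14: "list_all (\<lambda>(B, ths). glue L11 B ths) (take 7 (drop 14 G11))"
  by (simp only: G11_def chunk, (intro conjI)?; (rule search11,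
    simp only: search11_simps at2[OF L36_def] at2[OF L37_def] at2[OF L65_def] at2[OF L66_def] at2[OF L67_def] cong: if_weak_cong))

lemma glue11: "\<forall>(B, ths)\<in>set G11. glue L11 B ths"
proof -
  have eq: "G11 = take 7 (drop 0 G11) @ take 7 (drop 7 G11) @ take 7 (drop 14 G11)"
    by (simp only: G11_def chunk append.simps)
  show ?thesis
    unfolding list_all_iff[symmetric] by (subst eq) (simp only: list_all_append glue11_0 glue11_7 glue11_14 simp_thms)
qed

subsubsection \<open>Squares against \<open>L30\<close>\<close>

definition s30_7 :: "s7 v7 v7 \<Rightarrow> (s7 v7 \<Rightarrow> bool) \<Rightarrow> s7 \<Rightarrow> s7 \<Rightarrow> s7 \<Rightarrow> s7 \<Rightarrow> s7 \<Rightarrow> s7 \<Rightarrow> s7 \<Rightarrow> bool" where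
  "s30_7 B Q a d e b c f g = (if a = g then True else if d = g then True else if e = g then True else if b = g then True else if c = g then True else if f = g then True else if B $ a $ f = g then True else if B $ a $ g = c then True else if B $ d $ c = g then True else if B $ d $ g = e then True else if B $ e $ d = g then True else if B $ e $ g = b then True else if B $ b $ e = g then True else if B $ b $ g = d then True else if B $ c $ a = g then True else if B $ c $ g = f then True else if B $ f $ b = g then True else if B $ f $ g = a then True else if B $ g $ a = b then True else if B $ g $ d = c then True else if B $ g $ e = f then True else if B $ g $ b = a then True else if B $ g $ c = e then True else if B $ g $ f = d then True else Q (V a b c d e f g))"

definition s30_6 :: "s7 v7 v7 \<Rightarrow> (s7 v7 \<Rightarrow> bool) \<Rightarrow> s7 \<Rightarrow> s7 \<Rightarrow> s7 \<Rightarrow> s7 \<Rightarrow> s7 \<Rightarrow> s7 \<Rightarrow> bool" where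
  "s30_6 B Q a d e b c f = (if a = f then True else if d = f then True else if e = f then True else if b = f then True else if c = f then True else if B $ a $ d = f then True else if B $ d $ b = f then True else if B $ d $ f = b then True else if B $ e $ c = f then True else if B $ e $ f = a then True else if B $ b $ a = f then True else if B $ b $ f = c then True else if B $ c $ f = e then True else if B $ f $ a = e then True else if B $ f $ d = b then True else if B $ f $ e = c then True else if B $ f $ c = d then True else every (s30_7 B Q a d e b c f))"

definition s30_5 :: "s7 v7 v7 \<Rightarrow> (s7 v7 \<Rightarrow> bool) \<Rightarrow> s7 \<Rightarrow> s7 \<Rightarrow> s7 \<Rightarrow> s7 \<Rightarrow> s7 \<Rightarrow> bool" where
  "s30_5 B Q a d e b c = (if a = c then True else if d = c then True else if e = c then True else if b = c then True else if B $ a $ c = b then True else if B $ d $ a = c then True else if B $ e $ b = c then True else if B $ b $ c = a then True else if B $ c $ d = a then True else if B $ c $ e = b then True else if B $ c $ b = d then True else every (s30_6 B Q a d e b c))"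

definition s30_4 :: "s7 v7 v7 \<Rightarrow> (s7 v7 \<Rightarrow> bool) \<Rightarrow> s7 \<Rightarrow> s7 \<Rightarrow> s7 \<Rightarrow> s7 \<Rightarrow> bool" where
  "s30_4 B Q a d e b = (if a = b then True else if d = b then True else if e = b then True else if B $ a $ b = e then True else if B $ b $ d = e then True else every (s30_5 B Q a d e b))"

definition s30_3 :: "s7 v7 v7 \<Rightarrow> (s7 v7 \<Rightarrow> bool) \<Rightarrow> s7 \<Rightarrow> s7 \<Rightarrow> s7 \<Rightarrow> bool" where
  "s30_3 B Q a d e = (if a = e then True else if d = e then True else if B $ a $ e = d then True else if B $ d $ e = a then True else if B $ e $ a = d then True else every (s30_4 B Q a d e))"

definition s30_2 :: "s7 v7 v7 \<Rightarrow> (s7 v7 \<Rightarrow> bool) \<Rightarrow> s7 \<Rightarrow> s7 \<Rightarrow> bool" where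
  "s30_2 B Q a d = (if a = d then True else every (s30_3 B Q a d))"

definition s30_1 :: "s7 v7 v7 \<Rightarrow> (s7 v7 \<Rightarrow> bool) \<Rightarrow> s7 \<Rightarrow> bool" where
  "s30_1 B Q a = (every (s30_2 B Q a))"

lemma search30:
  assumes "\<And>xs. (\<And>P. any P xs = any P ths) \<Longrightarrow> every (s30_1 B (leaf B xs))" shows "glue L30 B ths"
proof (rule glueI)
  fix q assume q: "bij (at q)" and t: "\<And>i j. i \<noteq> j \<Longrightarrow> B $ (q $ i) $ (q $ j) \<noteq> q $ (L30 $ i $ j)"
  obtain a b c d e f g where V: "q = V a b c d e f g" by (cases q)
  have "q $ i \<noteq> q $ j" if "i \<noteq> j" for i j using q that by (metis bij_is_inj injD)
  then have "\<forall>i j. i \<noteq> j \<longrightarrow> q $ i \<noteq> q $ j" by blast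
  note ne = this[unfolded all_s7 V, simplified at.simps s7.distinct simp_thms]
  have "\<forall>i j. i \<noteq> j \<longrightarrow> B $ (q $ i) $ (q $ j) \<noteq> q $ (L30 $ i $ j)" using t by blast
  note ts = this[unfolded all_s7 V, simplified at2[OF L30_def] at.simps s7.distinct simp_thms]
  have "s30_1 B (leaf B ths) a" by (rule everyD[OF assms[OF refl]])
  then have h1: "every (s30_2 B (leaf B ths) a)" by (simp only: s30_1_def ne ts if_False)
  have "s30_2 B (leaf B ths) a d" by (rule everyD[OF h1])
  then have h2: "every (s30_3 B (leaf B ths) a d)" by (simp only: s30_2_def ne ts if_False)
  have "s30_3 B (leaf B ths) a d e" by (rule everyD[OF h2])
  then have h3: "every (s30_4 B (leaf B ths) a d e)" by (simp only: s30_3_def ne ts if_False)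
  have "s30_4 B (leaf B ths) a d e b" by (rule everyD[OF h3])
  then have h4: "every (s30_5 B (leaf B ths) a d e b)" by (simp only: s30_4_def ne ts if_False)
  have "s30_5 B (leaf B ths) a d e b c" by (rule everyD[OF h4])
  then have h5: "every (s30_6 B (leaf B ths) a d e b c)" by (simp only: s30_5_def ne ts if_False)
  have "s30_6 B (leaf B ths) a d e b c f" by (rule everyD[OF h5])
  then have h6: "every (s30_7 B (leaf B ths) a d e b c f)" by (simp only: s30_6_def ne ts if_False)
  have "s30_7 B (leaf B ths) a d e b c f g" by (rule everyD[OF h6])
  then show "leaf B ths q" by (simp only: s30_7_def V ne ts if_False)
qed

definition G30 :: "(s7 v7 v7 \<times> s7 v7 list) list" where
  "G30 = [(L1, []),
    (L2, []),
    (L3, []),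
    (L28, []),
    (L29, [V A0 A4 A6 A5 A1 A3 A2, V A3 A5 A1 A0 A6 A2 A4]),
    (L30, [V A0 A5 A2 A6 A4 A1 A3, V A0 A6 A2 A4 A3 A5 A1, V A2 A0 A4 A5 A1 A3 A6, V A1 A4 A0 A5 A2 A3 A6, V A6 A5 A3 A0 A2 A4 A1, V A5 A1 A2 A4 A3 A0 A6, V A6 A2 A1 A5 A3 A0 A4, V A5 A6 A2 A3 A4 A0 A1, V A5 A6 A2 A4 A3 A0 A1, V A5 A2 A1 A4 A6 A3 A0, V A3 A6 A4 A2 A5 A1 A0]),
    (L31, []),
    (L32, [V A5 A1 A0 A3 A4 A2 A6, V A3 A1 A6 A0 A5 A4 A2, V A5 A1 A6 A0 A3 A4 A2, V A4 A2 A1 A5 A0 A3 A6, V A2 A1 A5 A3 A4 A0 A6, V A3 A1 A6 A4 A5 A0 A2, V A5 A3 A2 A1 A6 A0 A4]),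
    (L33, [V A5 A2 A0 A1 A4 A6 A3, V A2 A1 A4 A0 A5 A3 A6, V A6 A2 A3 A0 A4 A1 A5, V A3 A5 A6 A1 A2 A0 A4]),
    (L34, [V A3 A1 A0 A5 A2 A4 A6, V A5 A3 A4 A0 A6 A1 A2, V A2 A3 A1 A6 A4 A0 A5, V A3 A5 A1 A2 A4 A6 A0]),
    (L35, [V A3 A5 A4 A0 A2 A1 A6, V A4 A5 A6 A1 A0 A2 A3, V A4 A3 A5 A6 A0 A1 A2]),
    (L36, [V A0 A1 A2 A5 A4 A3 A6]),
    (L37, [V A0 A1 A3 A2 A5 A4 A6])]"

lemma G30_forms: "set forms_BF \<subseteq> fst ` set G30"
  by (simp add: forms_BF_def G30_def)

lemma G30_perm: "(B, ths) \<in> set G30 \<Longrightarrow> th \<in> set ths \<Longrightarrow> bij (at th)"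
proof -
  have "\<forall>(B, ths)\<in>set G30. \<forall>th\<in>set ths. isperm th"
    by (simp only: G30_def list.set ball_simps prod.case isperm_def every_def some_def at.simps s7.distinct
      if_True if_False simp_thms cong: if_weak_cong)
  then show "(B, ths) \<in> set G30 \<Longrightarrow> th \<in> set ths \<Longrightarrow> bij (at th)" by (auto simp: isperm_iff)
qed

lemmas search30_simps = s30_1_def s30_2_def s30_3_def s30_4_def s30_5_def s30_6_def s30_7_def every_def leaf_def any.simps inv7_def tab_def at.simps
  s7.distinct if_True if_False simp_thms(6)

lemma glue30_0: "list_all (\<lambda>(B, ths). glue L30 B ths) (take 7 (drop 0 G30))"
  by (simp only: G30_def chunk, (intro conjI)?; (rule search30,
    simp only: search30_simps at2[OF L1_def] at2[OF L2_def] at2[OF L3_def] at2[OF L28_def] at2[OF L29_def] at2[OF L30_def] at2[OF L31_def] cong: if_weak_cong))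

lemma glue30_7: "list_all (\<lambda>(B, ths). glue L30 B ths) (take 7 (drop 7 G30))"
  by (simp only: G30_def chunk, (intro conjI)?; (rule search30,
    simp only: search30_simps at2[OF L32_def] at2[OF L33_def] at2[OF L34_def] at2[OF L35_def] at2[OF L36_def] at2[OF L37_def] cong: if_weak_cong))

lemma glue30: "\<forall>(B, ths)\<in>set G30. glue L30 B ths"
proof -
  have eq: "G30 = take 7 (drop 0 G30) @ take 7 (drop 7 G30)"
    by (simp only: G30_def chunk append.simps)
  show ?thesis
    unfolding list_all_iff[symmetric] by (subst eq) (simp only: list_all_append glue30_0 glue30_7 simp_thms)
qed

subsubsection \<open>Squares against \<open>L33\<close>\<close>

definition s33_7 :: "s7 v7 v7 \<Rightarrow> (s7 v7 \<Rightarrow> bool) \<Rightarrow> s7 \<Rightarrow> s7 \<Rightarrow> s7 \<Rightarrow> s7 \<Rightarrow> s7 \<Rightarrow> s7 \<Rightarrow> s7 \<Rightarrow> bool" where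
  "s33_7 B Q a d e f b c g = (if a = g then True else if d = g then True else if e = g then True else if f = g then True else if b = g then True else if c = g then True else if B $ a $ b = g then True else if B $ a $ g = c then True else if B $ d $ c = g then True else if B $ d $ g = e then True else if B $ e $ f = g then True else if B $ e $ g = b then True else if B $ f $ d = g then True else if B $ f $ g = a then True else if B $ b $ a = g then True else if B $ b $ g = f then True else if B $ c $ e = g then True else if B $ c $ g = d then True else if B $ g $ a = f then True else if B $ g $ d = b then True else if B $ g $ e = d then True else if B $ g $ f = c then True else if B $ g $ b = e then True else if B $ g $ c = a then True else Q (V a b c d e f g))"

definition s33_6 :: "s7 v7 v7 \<Rightarrow> (s7 v7 \<Rightarrow> bool) \<Rightarrow> s7 \<Rightarrow> s7 \<Rightarrow> s7 \<Rightarrow> s7 \<Rightarrow> s7 \<Rightarrow> s7 \<Rightarrow> bool" where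
  "s33_6 B Q a d e f b c = (if a = c then True else if d = c then True else if e = c then True else if f = c then True else if b = c then True else if B $ a $ c = d then True else if B $ d $ a = c then True else if B $ e $ b = c then True else if B $ e $ c = f then True else if B $ f $ e = c then True else if B $ f $ c = b then True else if B $ b $ d = c then True else if B $ b $ c = e then True else if B $ c $ a = b then True else if B $ c $ d = f then True else if B $ c $ f = e then True else if B $ c $ b = a then True else every (s33_7 B Q a d e f b c))"

definition s33_5 :: "s7 v7 v7 \<Rightarrow> (s7 v7 \<Rightarrow> bool) \<Rightarrow> s7 \<Rightarrow> s7 \<Rightarrow> s7 \<Rightarrow> s7 \<Rightarrow> s7 \<Rightarrow> bool" where
  "s33_5 B Q a d e f b = (if a = b then True else if d = b then True else if e = b then True else if f = b then True else if B $ a $ f = b then True else if B $ d $ e = b then True else if B $ d $ b = f then True else if B $ f $ b = d then True else if B $ b $ e = a then True else if B $ b $ f = d then True else every (s33_6 B Q a d e f b))"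

definition s33_4 :: "s7 v7 v7 \<Rightarrow> (s7 v7 \<Rightarrow> bool) \<Rightarrow> s7 \<Rightarrow> s7 \<Rightarrow> s7 \<Rightarrow> s7 \<Rightarrow> bool" where
  "s33_4 B Q a d e f = (if a = f then True else if d = f then True else if e = f then True else if B $ a $ e = f then True else if B $ d $ f = a then True else if B $ f $ a = e then True else every (s33_5 B Q a d e f))"

definition s33_3 :: "s7 v7 v7 \<Rightarrow> (s7 v7 \<Rightarrow> bool) \<Rightarrow> s7 \<Rightarrow> s7 \<Rightarrow> s7 \<Rightarrow> bool" where
  "s33_3 B Q a d e = (if a = e then True else if d = e then True else if B $ a $ d = e then True else if B $ e $ a = d then True else if B $ e $ d = a then True else every (s33_4 B Q a d e))"

definition s33_2 :: "s7 v7 v7 \<Rightarrow> (s7 v7 \<Rightarrow> bool) \<Rightarrow> s7 \<Rightarrow> s7 \<Rightarrow> bool" where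
  "s33_2 B Q a d = (if a = d then True else every (s33_3 B Q a d))"

definition s33_1 :: "s7 v7 v7 \<Rightarrow> (s7 v7 \<Rightarrow> bool) \<Rightarrow> s7 \<Rightarrow> bool" where
  "s33_1 B Q a = (every (s33_2 B Q a))"

lemma search33:
  assumes "\<And>xs. (\<And>P. any P xs = any P ths) \<Longrightarrow> every (s33_1 B (leaf B xs))" shows "glue L33 B ths"
proof (rule glueI)
  fix q assume q: "bij (at q)" and t: "\<And>i j. i \<noteq> j \<Longrightarrow> B $ (q $ i) $ (q $ j) \<noteq> q $ (L33 $ i $ j)"
  obtain a b c d e f g where V: "q = V a b c d e f g" by (cases q)
  have "q $ i \<noteq> q $ j" if "i \<noteq> j" for i j using q that by (metis bij_is_inj injD)
  then have "\<forall>i j. i \<noteq> j \<longrightarrow> q $ i \<noteq> q $ j" by blast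
  note ne = this[unfolded all_s7 V, simplified at.simps s7.distinct simp_thms]
  have "\<forall>i j. i \<noteq> j \<longrightarrow> B $ (q $ i) $ (q $ j) \<noteq> q $ (L33 $ i $ j)" using t by blast
  note ts = this[unfolded all_s7 V, simplified at2[OF L33_def] at.simps s7.distinct simp_thms]
  have "s33_1 B (leaf B ths) a" by (rule everyD[OF assms[OF refl]])
  then have h1: "every (s33_2 B (leaf B ths) a)" by (simp only: s33_1_def ne ts if_False)
  have "s33_2 B (leaf B ths) a d" by (rule everyD[OF h1])
  then have h2: "every (s33_3 B (leaf B ths) a d)" by (simp only: s33_2_def ne ts if_False)
  have "s33_3 B (leaf B ths) a d e" by (rule everyD[OF h2])
  then have h3: "every (s33_4 B (leaf B ths) a d e)" by (simp only: s33_3_def ne ts if_False)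
  have "s33_4 B (leaf B ths) a d e f" by (rule everyD[OF h3])
  then have h4: "every (s33_5 B (leaf B ths) a d e f)" by (simp only: s33_4_def ne ts if_False)
  have "s33_5 B (leaf B ths) a d e f b" by (rule everyD[OF h4])
  then have h5: "every (s33_6 B (leaf B ths) a d e f b)" by (simp only: s33_5_def ne ts if_False)
  have "s33_6 B (leaf B ths) a d e f b c" by (rule everyD[OF h5])
  then have h6: "every (s33_7 B (leaf B ths) a d e f b c)" by (simp only: s33_6_def ne ts if_False)
  have "s33_7 B (leaf B ths) a d e f b c g" by (rule everyD[OF h6])
  then show "leaf B ths q" by (simp only: s33_7_def V ne ts if_False)
qed

definition G33 :: "(s7 v7 v7 \<times> s7 v7 list) list" where
  "G33 = [(L1, []),
    (L2, []),
    (L3, []),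
    (L28, []),
    (L29, [V A3 A0 A4 A1 A5 A6 A2, V A6 A0 A4 A2 A5 A3 A1]),
    (L30, [V A3 A1 A0 A5 A2 A4 A6, V A5 A3 A4 A0 A6 A1 A2, V A2 A3 A1 A6 A4 A0 A5, V A3 A5 A1 A2 A4 A6 A0]),
    (L31, [V A5 A1 A0 A3 A4 A2 A6, V A3 A1 A6 A0 A5 A4 A2, V A5 A1 A6 A0 A3 A4 A2, V A4 A2 A1 A5 A0 A3 A6, V A2 A1 A5 A3 A4 A0 A6, V A3 A1 A6 A4 A5 A0 A2, V A5 A3 A2 A1 A6 A0 A4]),
    (L32, [V A3 A5 A4 A0 A2 A1 A6, V A4 A5 A6 A1 A0 A2 A3, V A4 A3 A5 A6 A0 A1 A2]),
    (L33, [V A0 A5 A2 A6 A4 A1 A3, V A0 A6 A2 A4 A3 A5 A1, V A2 A0 A4 A5 A1 A3 A6, V A1 A4 A0 A5 A2 A3 A6, V A6 A5 A3 A0 A2 A4 A1, V A5 A1 A2 A4 A3 A0 A6, V A6 A2 A1 A5 A3 A0 A4, V A5 A6 A2 A3 A4 A0 A1, V A5 A6 A2 A4 A3 A0 A1, V A5 A2 A1 A4 A6 A3 A0, V A3 A6 A4 A2 A5 A1 A0]),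
    (L34, [V A5 A2 A0 A1 A4 A6 A3, V A2 A1 A4 A0 A5 A3 A6, V A6 A2 A3 A0 A4 A1 A5, V A3 A5 A6 A1 A2 A0 A4]),
    (L35, []),
    (L36, [V A0 A1 A2 A5 A4 A3 A6]),
    (L37, [V A0 A1 A3 A2 A5 A4 A6])]"

lemma G33_forms: "set forms_BF \<subseteq> fst ` set G33"
  by (simp add: forms_BF_def G33_def)

lemma G33_perm: "(B, ths) \<in> set G33 \<Longrightarrow> th \<in> set ths \<Longrightarrow> bij (at th)"
proof -
  have "\<forall>(B, ths)\<in>set G33. \<forall>th\<in>set ths. isperm th"
    by (simp only: G33_def list.set ball_simps prod.case isperm_def every_def some_def at.simps s7.distinct
      if_True if_False simp_thms cong: if_weak_cong)
  then show "(B, ths) \<in> set G33 \<Longrightarrow> th \<in> set ths \<Longrightarrow> bij (at th)" by (auto simp: isperm_iff)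
qed

lemmas search33_simps = s33_1_def s33_2_def s33_3_def s33_4_def s33_5_def s33_6_def s33_7_def every_def leaf_def any.simps inv7_def tab_def at.simps
  s7.distinct if_True if_False simp_thms(6)

lemma glue33_0: "list_all (\<lambda>(B, ths). glue L33 B ths) (take 7 (drop 0 G33))"
  by (simp only: G33_def chunk, (intro conjI)?; (rule search33,
    simp only: search33_simps at2[OF L1_def] at2[OF L2_def] at2[OF L3_def] at2[OF L28_def] at2[OF L29_def] at2[OF L30_def] at2[OF L31_def] cong: if_weak_cong))

lemma glue33_7: "list_all (\<lambda>(B, ths). glue L33 B ths) (take 7 (drop 7 G33))"
  by (simp only: G33_def chunk, (intro conjI)?; (rule search33,
    simp only: search33_simps at2[OF L32_def] at2[OF L33_def] at2[OF L34_def] at2[OF L35_def] at2[OF L36_def] at2[OF L37_def] cong: if_weak_cong))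

lemma glue33: "\<forall>(B, ths)\<in>set G33. glue L33 B ths"
proof -
  have eq: "G33 = take 7 (drop 0 G33) @ take 7 (drop 7 G33)"
    by (simp only: G33_def chunk append.simps)
  show ?thesis
    unfolding list_all_iff[symmetric] by (subst eq) (simp only: list_all_append glue33_0 glue33_7 simp_thms)
qed

section \<open>Excluding the nonlinear types\<close>

text \<open>The square of a crossing plane in the unlabelled coordinates \<open>z\<close>,
  \<open>f\<close>, \<open>g\<close>: labels along the line are removed, \<open>B\<close> is applied
  through \<open>th\<close>, and the label of \<open>g\<close> is put back. The inverse permutations
  are arguments in order to be computed once for the square and not once for each cell.\<close>

definition square :: "s7 v7 v7 \<Rightarrow> s7 v7 \<Rightarrow> s7 v7 \<Rightarrow> s7 v7 \<Rightarrow> s7 v7 \<Rightarrow> s7 v7 \<Rightarrow> s7 v7 v7" where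
  "square B th thi pi qi r = tab (\<lambda>z. tab (\<lambda>f. r $ (thi $ (B $ (th $ (pi $ z)) $ (th $ (qi $ f))))))"

text \<open>All Latin squares that the planes through line \<open>v\<close> of a plane \<open>T\<close> may cut out, given the
  candidates \<open>G\<close> for the class of that line.\<close>

definition cands :: "s7 v7 v7 \<times> s7 v7 v7 \<Rightarrow> s7 \<Rightarrow> s7 v7 \<Rightarrow> (s7 v7 v7 \<times> s7 v7 list) list \<Rightarrow> s7 v7 v7 set" where
  "cands T v p G = (\<Union>(B, ths)\<in>set G. (\<lambda>th. square B th (inv7 th) (inv7 p) (inv7 (line (fst T) v p)) (line (snd T) v p)) ` set ths)"

text \<open>Recursive form of the quantifier over \<open>cands\<close>, which rewriting unfolds into
  a conjunction with one explicit square per conjunct.\<close>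

fun all_squares1 :: "(s7 v7 v7 \<Rightarrow> bool) \<Rightarrow> s7 v7 v7 \<Rightarrow> s7 v7 \<Rightarrow> s7 v7 \<Rightarrow> s7 v7 \<Rightarrow> s7 v7 list \<Rightarrow> bool" where
  "all_squares1 P B pi qi r [] \<longleftrightarrow> True"
| "all_squares1 P B pi qi r (th # ths) \<longleftrightarrow> P (square B th (inv7 th) pi qi r) \<and> all_squares1 P B pi qi r ths"

fun all_squares :: "(s7 v7 v7 \<Rightarrow> bool) \<Rightarrow> s7 v7 \<Rightarrow> s7 v7 \<Rightarrow> s7 v7 \<Rightarrow> (s7 v7 v7 \<times> s7 v7 list) list \<Rightarrow> bool" where
  "all_squares P pi qi r [] \<longleftrightarrow> True"
| "all_squares P pi qi r ((B, ths) # G) \<longleftrightarrow> all_squares1 P B pi qi r ths \<and> all_squares P pi qi r G"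

lemma all_squares1: "all_squares1 P B pi qi r ths \<longleftrightarrow> (\<forall>th\<in>set ths. P (square B th (inv7 th) pi qi r))"
  by (induction ths) auto

lemma all_squares: "all_squares P pi qi r G \<longleftrightarrow> (\<forall>(B, ths)\<in>set G. \<forall>th\<in>set ths. P (square B th (inv7 th) pi qi r))"
  by (induction G) (auto simp: all_squares1)

lemma ball_cands: "(\<forall>K\<in>cands T v p G. P K) \<longleftrightarrow>
    all_squares P (inv7 p) (inv7 (line (fst T) v p)) (line (snd T) v p) G"
  by (auto simp: cands_def all_squares)

fun disj1 :: "s7 v7 \<Rightarrow> s7 v7 \<Rightarrow> bool" where
  "disj1 (V a b c d e f g) (V a' b' c' d' e' f' g') = (if a = a' then False else if b = b' then False
    else if c = c' then False else if d = d' then False else if e = e' then False else if f = f' then False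
    else if g = g' then False else True)"

fun disj :: "s7 v7 v7 \<Rightarrow> s7 v7 v7 \<Rightarrow> bool" where
  "disj (V a b c d e f g) (V a' b' c' d' e' f' g') = (if disj1 a a' then if disj1 b b' then
    if disj1 c c' then if disj1 d d' then if disj1 e e' then if disj1 f f' then disj1 g g'
    else False else False else False else False else False else False)"

lemma disj1: "disj1 p q \<longleftrightarrow> (\<forall>i. p $ i \<noteq> q $ i)"
  by (cases p; cases q) (simp add: all_s7)

lemma disj: "disj H K \<longleftrightarrow> (\<forall>i j. H $ i $ j \<noteq> K $ i $ j)"
  by (cases H; cases K) (simp add: all_s7[of "\<lambda>i. \<forall>j. H i j" for H] disj1)

lemma disj_row: "disj H (V a b c d e f g) = (if disj1 (H $ A0) a then if disj1 (H $ A1) b then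
    if disj1 (H $ A2) c then if disj1 (H $ A3) d then if disj1 (H $ A4) e then if disj1 (H $ A5) f then disj1 (H $ A6) g
    else False else False else False else False else False else False)"
  by (cases H) simp

definition pair_ok :: "s7 v7 v7 set \<Rightarrow> s7 v7 v7 \<Rightarrow> s7 v7 v7 \<Rightarrow> bool" where
  "pair_ok Ms H K = (if disj H K then \<forall>M\<in>Ms. if disj H M then if disj K M then False else True else True else True)"

definition row_ok :: "s7 v7 v7 set \<Rightarrow> s7 v7 v7 set \<Rightarrow> s7 v7 v7 \<Rightarrow> bool" where
  "row_ok Ks Ms H = (\<forall>K\<in>Ks. pair_ok Ms H K)"

text \<open>Since \<open>(z, f, g)\<close> determines a word, the planes at different values of the
  second coordinate have squares that differ in every cell. The contradiction sought is that no
  three candidates are pairwise disjoint in this sense.\<close>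

definition no_triple :: "s7 v7 v7 set \<Rightarrow> s7 v7 v7 set \<Rightarrow> s7 v7 v7 set \<Rightarrow> bool" where
  "no_triple Hs Ks Ms = (\<forall>H\<in>Hs. row_ok Ks Ms H)"

text \<open>The second and third family become set variables known only through their bounded
  quantifiers. Their expansions then enter as rewrite rules where a test needs them and are not
  traversed at every step.\<close>

lemma no_tripleI:
  assumes "\<And>xs ys. (\<And>P. (\<forall>K\<in>xs. P K) = (\<forall>K\<in>Ks. P K)) \<Longrightarrow>
    (\<And>P. (\<forall>M\<in>ys. P M) = (\<forall>M\<in>Ms. P M)) \<Longrightarrow> no_triple Hs xs ys"
  shows "no_triple Hs Ks Ms"
  using assms by blast

lemma row_okI:
  assumes "\<And>h. h $ A0 = a \<Longrightarrow> h $ A1 = b \<Longrightarrow> h $ A2 = c \<Longrightarrow> h $ A3 = d \<Longrightarrow> h $ A4 = e \<Longrightarrow>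
    h $ A5 = f \<Longrightarrow> h $ A6 = g \<Longrightarrow> row_ok Ks Ms h"
  shows "row_ok Ks Ms (V a b c d e f g)"
  using assms by simp

definition glues :: "s7 v7 v7 \<Rightarrow> s7 v7 v7 set \<Rightarrow> (s7 v7 v7 \<times> s7 v7 list) list \<Rightarrow> bool" where
  "glues A fs G \<longleftrightarrow> (\<forall>(B, ths)\<in>set G. glue A B ths \<and> (\<forall>th\<in>set ths. bij (at th))) \<and> fs \<subseteq> fst ` set G"

lemma glues0: "glues L0 (set forms_all) G0"
  unfolding glues_def using glue0 G0_forms G0_perm by blast

lemma glues11: "glues L11 (set forms_BEF) G11"
  unfolding glues_def using glue11 G11_forms G11_perm by blast

lemma glues30: "glues L30 (set forms_BF) G30"
  unfolding glues_def using glue30 G30_forms G30_perm by blast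

lemma glues33: "glues L33 (set forms_BF) G33"
  unfolding glues_def using glue33 G33_forms G33_perm by blast

text \<open>The plane \<open>R x0\<close> and the crossing plane at \<open>v\<close> share a line,
  and each labels it; \<open>s\<close> translates one labelling into the other. Words of the two
  planes with equal \<open>(z, f, g)\<close> coincide and so lie on the shared line. Hence the two
  squares meet on the diagonal only, and \<open>glue\<close> leaves just the listed squares for the
  crossing plane.\<close>

lemma glued:
  assumes R: "mds5 R" and T: "R x0 = tn T" and fs: "Full fs (\<lambda>x. R x v)"
    and m: "chkmark T v A p (line (fst T) v p) (line (snd T) v p)"
    and G: "glues A fs G"
  shows "\<exists>H\<in>cands T v p G. \<forall>z f. \<exists>x. R x v z f (H $ z $ f)"
proof -
  let ?q = "line (fst T) v p" and ?r = "line (snd T) v p"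
  note b = chkmarkD(1-3)[OF m] and 1 = chkmarkD(4)[OF m] and 2 = chkmarkD(5)[OF m]
  have R0: "R x0 y z (fst T $ y $ z) (snd T $ y $ z)" for y z unfolding T tn_def by simp
  have l0: "R x0 v (p $ i) (?q $ i) (?r $ i)" for i using R0[of v "p $ i"] 1 by simp
  have s0: "\<exists>y. R x0 y (p $ i) (?q $ j) (?r $ (A $ i $ j))" for i j using 2[of i j] R0 by metis
  from fs have "Mk fs (\<lambda>x. R x v)" unfolding Full_def by blast
  then obtain B where B: "B \<in> fs" "mk B (\<lambda>x. R x v) x0" unfolding Mk_def by blast
  then obtain p' q' r' where n: "bij p'" "bij q'" "bij r'" "\<And>i. R x0 v (p' i) (q' i) (r' i)"
    "\<And>i j. \<exists>x. R x v (p' i) (q' j) (r' (B $ i $ j))" unfolding mk_def by blast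
  obtain ths where ths: "(B, ths) \<in> set G" using B(1) G unfolding glues_def by auto
  have gl: "glue A B ths" and perm: "\<forall>th\<in>set ths. bij (at th)" using G ths unfolding glues_def by auto
  define s where "s = tab (\<lambda>i. inv7 p $ p' i)"
  have ps: "p $ (s $ i) = p' i" for i by (simp add: s_def at_inv7[OF b(1)])
  have qrs: "?q $ (s $ i) = q' i" "?r $ (s $ i) = r' i" for i
    using mds5_eq[OF R, OF l0[of "s $ i"] n(4)[of i]] ps by auto
  have bs: "bij (at s)"
  proof -
    have "at s = at (inv7 p) \<circ> p'" by (simp add: s_def fun_eq_iff)
    then show ?thesis by (simp add: bij_comp bij_inv7 b(1) n(1))
  qed
  have inj: "a = c" if "s $ a = s $ c" for a c using that bs by (metis bij_is_inj injD)
  have "A $ (s $ i) $ (s $ j) \<noteq> s $ (B $ i $ j)" if "i \<noteq> j" for i j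
  proof
    assume e: "A $ (s $ i) $ (s $ j) = s $ (B $ i $ j)"
    obtain y where y: "R x0 y (p' i) (q' j) (r' (B $ i $ j))"
      using s0[of "s $ i" "s $ j"] e ps qrs by auto
    obtain x where x: "R x v (p' i) (q' j) (r' (B $ i $ j))" using n(5) by blast
    \<comment> \<open>The two words agree in the last three coordinates, so they are one word of the
      shared line; there the labels of all three coordinates have the same index, against
      \<open>i \<noteq> j\<close>.\<close>
    from mds5_eq[OF R, OF y x] have "y = v" by simp
    with y have "R x0 v (p' i) (q' j) (r' (B $ i $ j))" by simp
    from mds5_eq[OF R, OF this n(4)[of i]] have "q' j = q' i" by simp
    with n(2) have "j = i" by (metis bij_is_inj injD)
    with that show False by simp
  qed
  with gl bs obtain th where th: "th \<in> set ths"
    "\<And>i j. B $ (th $ (s $ i)) $ (th $ (s $ j)) = th $ (s $ (B $ i $ j))" unfolding glue_def by blast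
  let ?H = "square B th (inv7 th) (inv7 p) (inv7 ?q) ?r"
  have "?H \<in> cands T v p G" unfolding cands_def using ths th(1) by blast
  moreover have "\<exists>x. R x v z f (?H $ z $ f)" for z f
  proof -
    obtain i where i: "z = p' i" using n(1) by (metis bij_pointE)
    obtain j where j: "f = q' j" using n(2) by (metis bij_pointE)
    have z: "inv7 p $ z = s $ i" using inv7_at[OF b(1)] ps[of i] i by metis
    have f: "inv7 ?q $ f = s $ j" using inv7_at[OF b(2)] qrs(1)[of j] j by metis
    have bth: "inv7 th $ (th $ k) = k" for k
      using perm th(1) by (blast intro: inv7_at)
    have "?H $ z $ f = ?r $ (s $ (B $ i $ j))" by (simp add: square_def z f th(2) bth)
    then show ?thesis using n(5)[of i j] qrs(2) i j by simp
  qed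
  ultimately show ?thesis by blast
qed

lemma no_plane:
  assumes R: "mds5 R" and T: "R x0 = tn T" and fs: "\<And>v. Full fs (\<lambda>x. R x v)"
    and G: "glues K1 fs G1" "glues K2 fs G2"
    and m: "chkmark T v1 K1 p1 (line (fst T) v1 p1) (line (snd T) v1 p1)"
      "chkmark T v2 K1 p2 (line (fst T) v2 p2) (line (snd T) v2 p2)"
      "chkmark T v3 K2 p3 (line (fst T) v3 p3) (line (snd T) v3 p3)"
    and ne: "v1 \<noteq> v2" "v1 \<noteq> v3" "v2 \<noteq> v3"
    and no: "no_triple (cands T v1 p1 G1) (cands T v2 p2 G1) (cands T v3 p3 G2)"
  shows False
proof -
  obtain H where H: "H \<in> cands T v1 p1 G1" "\<And>z f. \<exists>x. R x v1 z f (H $ z $ f)"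
    using glued[OF R T fs m(1) G(1)] by blast
  obtain K where K: "K \<in> cands T v2 p2 G1" "\<And>z f. \<exists>x. R x v2 z f (K $ z $ f)"
    using glued[OF R T fs m(2) G(1)] by blast
  obtain M where M: "M \<in> cands T v3 p3 G2" "\<And>z f. \<exists>x. R x v3 z f (M $ z $ f)"
    using glued[OF R T fs m(3) G(2)] by blast
  have d: "disj X Y" if X: "\<And>z f. \<exists>x. R x v z f (X $ z $ f)" and Y: "\<And>z f. \<exists>x. R x w z f (Y $ z $ f)" and "v \<noteq> w" for X Y v w
    unfolding disj
  proof (intro allI notI)
    fix z f assume e: "X $ z $ f = Y $ z $ f"
    obtain x where x: "R x v z f (X $ z $ f)" using X by blast
    obtain y where y: "R y w z f (X $ z $ f)" using Y e by metis
    from mds5_eq[OF R, OF x y] \<open>v \<noteq> w\<close> show False by simp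
  qed
  show False
    using no H(1) K(1) M(1) d[OF H(2) K(2) ne(1)] d[OF H(2) M(2) ne(2)] d[OF K(2) M(2) ne(3)]
    unfolding no_triple_def row_ok_def pair_ok_def by (auto split: if_splits)
qed

lemmas cands_simps = no_triple_def ball_cands all_squares.simps all_squares1.simps square_def line_def inv7_def tab_def at.simps
  fst_conv snd_conv simp_thms s7.distinct if_True if_False

lemmas triple_simps = row_ok_def pair_ok_def disj_row disj1.simps simp_thms at.simps s7.distinct if_True if_False

text \<open>These three labellings are the marks of \<open>Full_T0\<close> for lines
  \<open>A0\<close>, \<open>A1\<close> and \<open>A3\<close>, all of which have the square
  \<open>L0\<close>.\<close>

definition P00 :: "s7 v7" where "P00 = V A0 A1 A2 A3 A4 A5 A6"
definition P01 :: "s7 v7" where "P01 = V A0 A5 A1 A4 A6 A2 A3"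
definition P02 :: "s7 v7" where "P02 = V A2 A4 A1 A5 A3 A0 A6"

lemma lines0:
  "chkmark T0 A0 L0 P00 (line (fst T0) A0 P00) (line (snd T0) A0 P00)"
  "chkmark T0 A1 L0 P01 (line (fst T0) A1 P01) (line (snd T0) A1 P01)"
  "chkmark T0 A3 L0 P02 (line (fst T0) A3 P02) (line (snd T0) A3 P02)"
  by code_simp+

lemma no_triple0: "no_triple (cands T0 A0 P00 G0) (cands T0 A1 P01 G0) (cands T0 A3 P02 G0)"
proof (rule no_tripleI)
  fix xs ys
  assume Ks: "\<And>P. (\<forall>K\<in>xs. P K) = (\<forall>K\<in>cands T0 A1 P01 G0. P K)"
    and Ms: "\<And>P. (\<forall>M\<in>ys. P M) = (\<forall>M\<in>cands T0 A3 P02 G0. P M)"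
  note tabs = P00_def P01_def P02_def T0_def G0_def at2[OF L0_def] at2[OF L1_def] at2[OF L2_def] at2[OF L3_def] at2[OF L4_def] at2[OF L5_def] at2[OF L6_def] at2[OF L7_def] at2[OF L8_def] at2[OF L9_def] at2[OF L10_def] at2[OF L11_def] at2[OF L12_def] at2[OF L13_def] at2[OF L14_def] at2[OF L15_def] at2[OF L16_def] at2[OF L17_def] at2[OF L18_def] at2[OF L19_def] at2[OF L20_def] at2[OF L21_def] at2[OF L22_def] at2[OF L23_def] at2[OF L24_def] at2[OF L25_def] at2[OF L26_def] at2[OF L27_def] at2[OF L28_def] at2[OF L29_def] at2[OF L30_def] at2[OF L31_def] at2[OF L32_def] at2[OF L33_def] at2[OF L34_def] at2[OF L35_def] at2[OF L36_def] at2[OF L37_def] at2[OF L38_def] at2[OF L39_def] at2[OF L40_def] at2[OF L41_def] at2[OF L42_def] at2[OF L43_def] at2[OF L44_def] at2[OF L45_def] at2[OF L46_def] at2[OF L47_def] at2[OF L48_def] at2[OF L49_def] at2[OF L50_def] at2[OF L51_def] at2[OF L52_def] at2[OF L53_def] at2[OF L54_def] at2[OF L55_def] at2[OF L56_def] at2[OF L57_def] at2[OF L58_def] at2[OF L59_def] at2[OF L60_def] at2[OF L61_def] at2[OF L62_def] at2[OF L63_def] at2[OF L64_def] at2[OF L65_def] at2[OF L66_def] at2[OF L67_def]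
  note Kx = Ks[simplified cands_simps tabs] and Mx = Ms[simplified cands_simps tabs]
  show "no_triple (cands T0 A0 P00 G0) xs ys"
    by (simp only: cands_simps tabs cong: if_weak_cong, (intro conjI)?;
      (rule row_okI, simp only: triple_simps Kx Mx cong: if_weak_cong))
qed

lemma no_plane0:
  assumes "mds5 R" "R x0 = tn T0" "\<And>v. Full (set forms_all) (\<lambda>x. R x v)"
  shows False
  by (rule no_plane[OF assms glues0 glues0 lines0 _ _ _ no_triple0]) simp_all

definition P20 :: "s7 v7" where "P20 = V A0 A4 A5 A1 A2 A3 A6"
definition P21 :: "s7 v7" where "P21 = V A1 A2 A0 A5 A6 A3 A4"
definition P22 :: "s7 v7" where "P22 = V A1 A4 A6 A3 A0 A5 A2"

lemma lines2:
  "chkmark T2 A0 L0 P20 (line (fst T2) A0 P20) (line (snd T2) A0 P20)"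
  "chkmark T2 A1 L0 P21 (line (fst T2) A1 P21) (line (snd T2) A1 P21)"
  "chkmark T2 A2 L0 P22 (line (fst T2) A2 P22) (line (snd T2) A2 P22)"
  by code_simp+

lemma no_triple2: "no_triple (cands T2 A0 P20 G0) (cands T2 A1 P21 G0) (cands T2 A2 P22 G0)"
proof (rule no_tripleI)
  fix xs ys
  assume Ks: "\<And>P. (\<forall>K\<in>xs. P K) = (\<forall>K\<in>cands T2 A1 P21 G0. P K)"
    and Ms: "\<And>P. (\<forall>M\<in>ys. P M) = (\<forall>M\<in>cands T2 A2 P22 G0. P M)"
  note tabs = P20_def P21_def P22_def T2_def G0_def at2[OF L0_def] at2[OF L1_def] at2[OF L2_def] at2[OF L3_def] at2[OF L4_def] at2[OF L5_def] at2[OF L6_def] at2[OF L7_def] at2[OF L8_def] at2[OF L9_def] at2[OF L10_def] at2[OF L11_def] at2[OF L12_def] at2[OF L13_def] at2[OF L14_def] at2[OF L15_def] at2[OF L16_def] at2[OF L17_def] at2[OF L18_def] at2[OF L19_def] at2[OF L20_def] at2[OF L21_def] at2[OF L22_def] at2[OF L23_def] at2[OF L24_def] at2[OF L25_def] at2[OF L26_def] at2[OF L27_def] at2[OF L28_def] at2[OF L29_def] at2[OF L30_def] at2[OF L31_def] at2[OF L32_def] at2[OF L33_def] at2[OF L34_def] at2[OF L35_def] at2[OF L36_def] at2[OF L37_def] at2[OF L38_def] at2[OF L39_def] at2[OF L40_def] at2[OF L41_def] at2[OF L42_def] at2[OF L43_def] at2[OF L44_def] at2[OF L45_def] at2[OF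 L46_def] at2[OF L47_def] at2[OF L48_def] at2[OF L49_def] at2[OF L50_def] at2[OF L51_def] at2[OF L52_def] at2[OF L53_def] at2[OF L54_def] at2[OF L55_def] at2[OF L56_def] at2[OF L57_def] at2[OF L58_def] at2[OF L59_def] at2[OF L60_def] at2[OF L61_def] at2[OF L62_def] at2[OF L63_def] at2[OF L64_def] at2[OF L65_def] at2[OF L66_def] at2[OF L67_def]
  note Kx = Ks[simplified cands_simps tabs] and Mx = Ms[simplified cands_simps tabs]
  show "no_triple (cands T2 A0 P20 G0) xs ys"
    by (simp only: cands_simps tabs cong: if_weak_cong, (intro conjI)?;
      (rule row_okI, simp only: triple_simps Kx Mx cong: if_weak_cong))
qed

lemma no_plane2:
  assumes "mds5 R" "R x0 = tn T2" "\<And>v. Full (set forms_all) (\<lambda>x. R x v)"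
  shows False
  by (rule no_plane[OF assms glues0 glues0 lines2 _ _ _ no_triple2]) simp_all

definition P30 :: "s7 v7" where "P30 = V A0 A4 A5 A1 A2 A3 A6"
definition P31 :: "s7 v7" where "P31 = V A1 A2 A0 A5 A6 A3 A4"
definition P32 :: "s7 v7" where "P32 = V A1 A3 A2 A6 A4 A0 A5"

lemma lines3:
  "chkmark T3 A0 L0 P30 (line (fst T3) A0 P30) (line (snd T3) A0 P30)"
  "chkmark T3 A1 L0 P31 (line (fst T3) A1 P31) (line (snd T3) A1 P31)"
  "chkmark T3 A2 L0 P32 (line (fst T3) A2 P32) (line (snd T3) A2 P32)"
  by code_simp+

lemma no_triple3: "no_triple (cands T3 A0 P30 G0) (cands T3 A1 P31 G0) (cands T3 A2 P32 G0)"
proof (rule no_tripleI)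
  fix xs ys
  assume Ks: "\<And>P. (\<forall>K\<in>xs. P K) = (\<forall>K\<in>cands T3 A1 P31 G0. P K)"
    and Ms: "\<And>P. (\<forall>M\<in>ys. P M) = (\<forall>M\<in>cands T3 A2 P32 G0. P M)"
  note tabs = P30_def P31_def P32_def T3_def G0_def at2[OF L0_def] at2[OF L1_def] at2[OF L2_def] at2[OF L3_def] at2[OF L4_def] at2[OF L5_def] at2[OF L6_def] at2[OF L7_def] at2[OF L8_def] at2[OF L9_def] at2[OF L10_def] at2[OF L11_def] at2[OF L12_def] at2[OF L13_def] at2[OF L14_def] at2[OF L15_def] at2[OF L16_def] at2[OF L17_def] at2[OF L18_def] at2[OF L19_def] at2[OF L20_def] at2[OF L21_def] at2[OF L22_def] at2[OF L23_def] at2[OF L24_def] at2[OF L25_def] at2[OF L26_def] at2[OF L27_def] at2[OF L28_def] at2[OF L29_def] at2[OF L30_def] at2[OF L31_def] at2[OF L32_def] at2[OF L33_def] at2[OF L34_def] at2[OF L35_def] at2[OF L36_def] at2[OF L37_def] at2[OF L38_def] at2[OF L39_def] at2[OF L40_def] at2[OF L41_def] at2[OF L42_def] at2[OF L43_def] at2[OF L44_def] at2[OF L45_def] at2[OF L46_def] at2[OF L47_def] at2[OF L48_def] at2[OF L49_def] at2[OF L50_def] at2[OF L51_def] at2[OF L52_def] at2[OF L53_def] at2[OF L54_def] at2[OF L55_def] at2[OF L56_def] at2[OF L57_def] at2[OF L58_def] at2[OF L59_def] at2[OF L60_def] at2[OF L61_def] at2[OF L62_def] at2[OF L63_def] at2[OF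 L64_def] at2[OF L65_def] at2[OF L66_def] at2[OF L67_def]
  note Kx = Ks[simplified cands_simps tabs] and Mx = Ms[simplified cands_simps tabs]
  show "no_triple (cands T3 A0 P30 G0) xs ys"
    by (simp only: cands_simps tabs cong: if_weak_cong, (intro conjI)?;
      (rule row_okI, simp only: triple_simps Kx Mx cong: if_weak_cong))
qed

lemma no_plane3:
  assumes "mds5 R" "R x0 = tn T3" "\<And>v. Full (set forms_all) (\<lambda>x. R x v)"
  shows False
  by (rule no_plane[OF assms glues0 glues0 lines3 _ _ _ no_triple3]) simp_all

definition P40 :: "s7 v7" where "P40 = V A1 A3 A4 A0 A2 A5 A6"
definition P41 :: "s7 v7" where "P41 = V A6 A2 A3 A1 A4 A5 A0"
definition P42 :: "s7 v7" where "P42 = V A3 A6 A1 A4 A0 A5 A2"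

lemma lines4:
  "chkmark T4 A1 L11 P40 (line (fst T4) A1 P40) (line (snd T4) A1 P40)"
  "chkmark T4 A2 L11 P41 (line (fst T4) A2 P41) (line (snd T4) A2 P41)"
  "chkmark T4 A4 L11 P42 (line (fst T4) A4 P42) (line (snd T4) A4 P42)"
  by code_simp+

lemma no_triple4: "no_triple (cands T4 A1 P40 G11) (cands T4 A2 P41 G11) (cands T4 A4 P42 G11)"
proof (rule no_tripleI)
  fix xs ys
  assume Ks: "\<And>P. (\<forall>K\<in>xs. P K) = (\<forall>K\<in>cands T4 A2 P41 G11. P K)"
    and Ms: "\<And>P. (\<forall>M\<in>ys. P M) = (\<forall>M\<in>cands T4 A4 P42 G11. P M)"
  note tabs = P40_def P41_def P42_def T4_def G11_def at2[OF L1_def] at2[OF L2_def] at2[OF L3_def] at2[OF L10_def] at2[OF L11_def] at2[OF L12_def] at2[OF L28_def] at2[OF L29_def] at2[OF L30_def] at2[OF L31_def] at2[OF L32_def] at2[OF L33_def] at2[OF L34_def] at2[OF L35_def] at2[OF L36_def] at2[OF L37_def] at2[OF L65_def] at2[OF L66_def] at2[OF L67_def]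
  note Kx = Ks[simplified cands_simps tabs] and Mx = Ms[simplified cands_simps tabs]
  show "no_triple (cands T4 A1 P40 G11) xs ys"
    by (simp only: cands_simps tabs cong: if_weak_cong, (intro conjI)?;
      (rule row_okI, simp only: triple_simps Kx Mx cong: if_weak_cong))
qed

lemma no_plane4:
  assumes "mds5 R" "R x0 = tn T4" "\<And>v. Full (set forms_BEF) (\<lambda>x. R x v)"
  shows False
  by (rule no_plane[OF assms glues11 glues11 lines4 _ _ _ no_triple4]) simp_all

text \<open>In the marks of \<open>Full_T1\<close> no square occurs on three lines of the first
  direction. Two lines marked \<open>L30\<close> are therefore combined with one marked
  \<open>L33\<close>, and two lists of relabellings are needed.\<close>

definition P10 :: "s7 v7" where "P10 = V A0 A1 A2 A3 A4 A5 A6"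
definition P11 :: "s7 v7" where "P11 = V A2 A6 A0 A3 A5 A4 A1"
definition P12 :: "s7 v7" where "P12 = V A2 A4 A3 A5 A1 A0 A6"

lemma lines1:
  "chkmark T1 A1 L30 P10 (line (fst T1) A1 P10) (line (snd T1) A1 P10)"
  "chkmark T1 A3 L30 P11 (line (fst T1) A3 P11) (line (snd T1) A3 P11)"
  "chkmark T1 A2 L33 P12 (line (fst T1) A2 P12) (line (snd T1) A2 P12)"
  by code_simp+

lemma no_triple1: "no_triple (cands T1 A1 P10 G30) (cands T1 A3 P11 G30) (cands T1 A2 P12 G33)"
proof (rule no_tripleI)
  fix xs ys
  assume Ks: "\<And>P. (\<forall>K\<in>xs. P K) = (\<forall>K\<in>cands T1 A3 P11 G30. P K)"
    and Ms: "\<And>P. (\<forall>M\<in>ys. P M) = (\<forall>M\<in>cands T1 A2 P12 G33. P M)"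
  note tabs = P10_def P11_def P12_def T1_def G30_def G33_def at2[OF L1_def] at2[OF L2_def] at2[OF L3_def] at2[OF L28_def] at2[OF L29_def] at2[OF L30_def] at2[OF L31_def] at2[OF L32_def] at2[OF L33_def] at2[OF L34_def] at2[OF L35_def] at2[OF L36_def] at2[OF L37_def]
  note Kx = Ks[simplified cands_simps tabs] and Mx = Ms[simplified cands_simps tabs]
  show "no_triple (cands T1 A1 P10 G30) xs ys"
    by (simp only: cands_simps tabs cong: if_weak_cong, (intro conjI)?;
      (rule row_okI, simp only: triple_simps Kx Mx cong: if_weak_cong))
qed

lemma no_plane1:
  assumes "mds5 R" "R x0 = tn T1" "\<And>v. Full (set forms_BF) (\<lambda>x. R x v)"
  shows False
  by (rule no_plane[OF assms glues30 glues33 lines1 _ _ _ no_triple1]) simp_all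

lemma Full_types: "T \<in> set types \<Longrightarrow> Full (set forms_all) (tn T)"
  "T \<in> set [T1, T4, T5, T6] \<Longrightarrow> Full (set forms_BEF) (tn T)"
  "T \<in> set [T1, T5, T6] \<Longrightarrow> Full (set forms_BF) (tn T)"
proof -
  have BF: "set forms_BF \<subseteq> set forms_BEF" and BEF: "set forms_BEF \<subseteq> set forms_all"
    by (simp_all add: forms_BF_def forms_BEF_def forms_all_def)
  note T1 = Full_mono[OF Full_T1 BF] and T5 = Full_mono[OF Full_T5 BF] and T6 = Full_mono[OF Full_T6 BF]
  show "T \<in> set types \<Longrightarrow> Full (set forms_all) (tn T)"
    unfolding types_def using Full_T0 Full_T2 Full_T3 Full_mono[OF T1 BEF] Full_mono[OF Full_T4 BEF]
      Full_mono[OF T5 BEF] Full_mono[OF T6 BEF] by auto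
  show "T \<in> set [T1, T4, T5, T6] \<Longrightarrow> Full (set forms_BEF) (tn T)" using T1 T5 T6 Full_T4 by auto
  show "T \<in> set [T1, T5, T6] \<Longrightarrow> Full (set forms_BF) (tn T)" using Full_T1 Full_T5 Full_T6 by auto
qed

text \<open>A crossing plane is a plane of the code with its first two coordinates exchanged, so
  what is already known about the types of all planes bounds the squares it can carry. Excluding a
  type thereby strengthens the hypothesis for the next one.\<close>

lemma excluded:
  assumes R: "mds5 R" and e: "eqv (R x) (tn T)"
    and none: "\<And>R. mds5 R \<Longrightarrow> R x = tn T \<Longrightarrow> (\<And>v. Full (set fs) (\<lambda>y. R y v)) \<Longrightarrow> False"
    and types: "\<And>R x. mds5 R \<Longrightarrow> \<exists>T\<in>set ts. eqv (R x) (tn T)"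
    and full: "\<And>T. T \<in> set ts \<Longrightarrow> Full (set fs) (tn T)" and closed: "closed (set fs)"
  shows False
proof -
  from eqv_plane[OF e R] obtain R' where R': "mds5 R'" "R' x = tn T" by blast
  have "Full (set fs) (\<lambda>y. R' y v)" for v
  proof -
    obtain T where "T \<in> set ts" "eqv ((\<lambda>x y. R' y x) v) (tn T)" using types[OF mds5_swap0[OF R'(1)]] by blast
    then show ?thesis using Full_eqv[OF _ closed full] by simp
  qed
  from none[OF R' this] show False .
qed

lemma plane_types1: "mds5 R \<Longrightarrow> \<exists>T\<in>set types. eqv (R x) (tn T)"
  using net4_classified[OF mds5_plane] unfolding classified_def by blast

text \<open>In each of \<open>T0\<close>, \<open>T2\<close> and \<open>T3\<close> three lines of the
  first direction are marked \<open>L0\<close>, and \<open>G0\<close> lists the possible crossings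
  for every square of the seven types.\<close>

lemma plane_types2: assumes R: "mds5 R" shows "\<exists>T\<in>set [T1, T4, T5, T6]. eqv (R x) (tn T)"
proof -
  have "\<not> eqv (R x) (tn T0)"
    by (rule notI, rule excluded[of R x T0 forms_all "types"])
      (rule R, assumption, erule no_plane0, assumption, erule meta_spec, erule plane_types1, erule Full_types(1), rule closed_forms(1))
  moreover have "\<not> eqv (R x) (tn T2)"
    by (rule notI, rule excluded[of R x T2 forms_all "types"])
      (rule R, assumption, erule no_plane2, assumption, erule meta_spec, erule plane_types1, erule Full_types(1), rule closed_forms(1))
  moreover have "\<not> eqv (R x) (tn T3)"
    by (rule notI, rule excluded[of R x T3 forms_all "types"])
      (rule R, assumption, erule no_plane3, assumption, erule meta_spec, erule plane_types1, erule Full_types(1), rule closed_forms(1))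
  ultimately show ?thesis using plane_types1[OF R, of x] by (auto simp: types_def)
qed

text \<open>With three types gone, crossing planes carry squares of \<open>forms_BEF\<close> only;
  the shorter list \<open>G11\<close> now suffices against \<open>T4\<close>.\<close>

lemma plane_types3: assumes R: "mds5 R" shows "\<exists>T\<in>set [T1, T5, T6]. eqv (R x) (tn T)"
proof -
  have "\<not> eqv (R x) (tn T4)"
    by (rule notI, rule excluded[of R x T4 forms_BEF "[T1, T4, T5, T6]"])
      (rule R, assumption, erule no_plane4, assumption, erule meta_spec, erule plane_types2, erule Full_types(2), rule closed_forms(2))
  with plane_types2[OF R, of x] show ?thesis by auto
qed

theorem plane_linear: assumes R: "mds5 R" shows "eqv (R x) (tn T5) \<or> eqv (R x) (tn T6)"
proof -
  have "\<not> eqv (R x) (tn T1)"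
    by (rule notI, rule excluded[of R x T1 forms_BF "[T1, T5, T6]"])
      (rule R, assumption, erule no_plane1, assumption, erule meta_spec, erule plane_types3, erule Full_types(3), rule closed_forms(3))
  with plane_types3[OF R, of x] show ?thesis by auto
qed

section \<open>Linear planes, their cross ratio, and how they cross\<close>

definition lin :: "'a :: field \<Rightarrow> ('b \<Rightarrow> 'b \<Rightarrow> 'b \<Rightarrow> 'b \<Rightarrow> bool) \<Rightarrow> bool" where
  "lin k N \<longleftrightarrow> (\<exists>p q r s. bij p \<and> bij q \<and> bij r \<and> bij s \<and> (\<forall>u v. N (p u) (q v) (r (u + v)) (s (u + k * v))))"

definition lins :: "'a :: field set \<Rightarrow> ('b \<Rightarrow> 'b \<Rightarrow> 'b \<Rightarrow> 'b \<Rightarrow> bool) \<Rightarrow> bool" where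
  "lins K N \<longleftrightarrow> (\<exists>k\<in>K. lin k N)"

text \<open>The parameter \<open>k\<close> is a cross ratio: permuting the coordinates of a net moves it in its orbit
  under \<open>k \<mapsto> 1 / k\<close> and \<open>k \<mapsto> k / (k - 1)\<close>.\<close>

definition cross :: "'a :: field set \<Rightarrow> bool" where
  "cross K \<longleftrightarrow> (\<forall>k\<in>K. k \<noteq> 0 \<and> k \<noteq> 1 \<and> inverse k \<in> K \<and> k / (k - 1) \<in> K)"

lemma bij_mult: "k \<noteq> 0 \<Longrightarrow> bij (\<lambda>x. k * x :: 'a :: field)"
  by (rule bij_betw_byWitness[where f' = "\<lambda>x. inverse k * x"]) auto

lemma bij_shift: "bij (\<lambda>x. x + c :: 'a :: field)"
  by (rule bij_betw_byWitness[where f' = "\<lambda>x. x - c"]) auto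

lemma bij_neg: "bij (\<lambda>x. - x :: 'a :: field)"
  by (rule bij_betw_byWitness[where f' = "\<lambda>x. - x"]) auto

text \<open>With \<open>u\<close> and \<open>v\<close> exchanged, the fourth coordinate is
  \<open>v + k * u\<close>, which is \<open>k\<close> times \<open>u + inverse k * v\<close>; the
  factor is absorbed by the label.\<close>

lemma lin_swap1: assumes "lin k (\<lambda>y z. N z y)" "k \<noteq> 0" shows "lin (inverse k) N"
proof -
  obtain p q r s where b: "bij p" "bij q" "bij r" "bij s"
    and h: "\<And>u v. N (q v) (p u) (r (u + v)) (s (u + k * v))" using assms(1) unfolding lin_def by blast
  show ?thesis unfolding lin_def
  proof (rule exI[of _ q], rule exI[of _ p], rule exI[of _ r], rule exI[of _ "s \<circ> (\<lambda>x. k * x)"], intro conjI allI)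
    show "bij (s \<circ> (\<lambda>x. k * x))" by (rule bij_comp[OF bij_mult[OF assms(2)] b(4)])
    show "N (q u) (p v) (r (u + v)) ((s \<circ> (\<lambda>x. k * x)) (u + inverse k * v))" for u v
    proof -
      have "k * (u + inverse k * v) = v + k * u"
        using assms(2) by (simp add: distrib_left mult.assoc[symmetric] add.commute)
      with h[of u v] show ?thesis by (simp add: add.commute)
    qed
  qed (use b in auto)
qed

text \<open>The substitution of \<open>- u\<close> for \<open>u\<close> and \<open>u + v\<close> for
  \<open>v\<close> exchanges the second and third coordinates. The fourth becomes
  \<open>- u + k * (u + v)\<close>, which is \<open>k - 1\<close> times
  \<open>u + k / (k - 1) * v\<close>.\<close>

lemma lin_swap2: assumes "lin k (\<lambda>y z f. N y f z)" "k \<noteq> 0" "k \<noteq> 1" shows "lin (k / (k - 1)) N"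
proof -
  obtain p q r s where b: "bij p" "bij q" "bij r" "bij s"
    and h: "\<And>u v. N (p u) (r (u + v)) (q v) (s (u + k * v))" using assms(1) unfolding lin_def by blast
  have k: "k - 1 \<noteq> 0" using assms(3) by simp
  show ?thesis unfolding lin_def
  proof (rule exI[of _ "p \<circ> uminus"], rule exI[of _ r], rule exI[of _ q],
      rule exI[of _ "s \<circ> (\<lambda>x. (k - 1) * x)"], intro conjI allI)
    show "bij (p \<circ> uminus)" by (rule bij_comp[OF bij_neg b(1)])
    show "bij (s \<circ> (\<lambda>x. (k - 1) * x))" by (rule bij_comp[OF bij_mult[OF k] b(4)])
    have e: "(k - 1) * (u + k / (k - 1) * v) = - u + k * (u + v)" for u v
    proof -
      have "(k - 1) * (k / (k - 1) * v) = k * v" using k by simp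
      then show ?thesis by (simp add: distrib_left) (simp add: algebra_simps)
    qed
    show "N ((p \<circ> uminus) u) (r v) (q (u + v)) ((s \<circ> (\<lambda>x. (k - 1) * x)) (u + k / (k - 1) * v))" for u v
      using h[of "- u" "u + v"] by (simp only: comp_apply e) simp
  qed (use b in auto)
qed

lemma lin_swap3: assumes "lin k (\<lambda>y z f g. N y z g f)" "k \<noteq> 0" shows "lin (inverse k) N"
proof -
  obtain p q r s where b: "bij p" "bij q" "bij r" "bij s"
    and h: "\<And>u v. N (p u) (q v) (s (u + k * v)) (r (u + v))" using assms(1) unfolding lin_def by blast
  have k: "inverse k \<noteq> 0" using assms(2) by simp
  show ?thesis unfolding lin_def
  proof (rule exI[of _ p], rule exI[of _ "q \<circ> (\<lambda>x. inverse k * x)"], rule exI[of _ s], rule exI[of _ r], intro conjI allI)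
    show "bij (q \<circ> (\<lambda>x. inverse k * x))" by (rule bij_comp[OF bij_mult[OF k] b(2)])
    show "N (p u) ((q \<circ> (\<lambda>x. inverse k * x)) v) (s (u + v)) (r (u + inverse k * v))" for u v
      using h[of u "inverse k * v"] assms(2) by (simp add: mult.assoc[symmetric])
  qed (use b in auto)
qed

lemma lin_relabel:
  assumes "lin k (\<lambda>y z f g. N (a y) (b z) (c f) (d g))" "bij a" "bij b" "bij c" "bij d"
  shows "lin k N"
proof -
  obtain p q r s where p: "bij p" "bij q" "bij r" "bij s"
    and h: "\<And>u v. N (a (p u)) (b (q v)) (c (r (u + v))) (d (s (u + k * v)))" using assms(1) unfolding lin_def by blast
  show ?thesis unfolding lin_def
    by (rule exI[of _ "a \<circ> p"], rule exI[of _ "b \<circ> q"], rule exI[of _ "c \<circ> r"], rule exI[of _ "d \<circ> s"])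
      (use p assms(2-5) h in \<open>simp add: bij_comp\<close>)
qed

lemma lins_eqv: assumes "eqv N M" "cross K" shows "lins K M \<Longrightarrow> lins K N"
  using assms(1)
proof (induction rule: eqv.induct)
  case (eqv_relabel M a b c d)
  have "lins K M" using eqv_relabel.prems lin_relabel[OF _ eqv_relabel.hyps(2-5)] unfolding lins_def by blast
  then show ?case by (rule eqv_relabel.IH)
next
  case (eqv_swap1 M)
  then obtain k where "k \<in> K" "lin k (\<lambda>y z. M z y)" unfolding lins_def by blast
  with lin_swap1[OF this(2)] assms(2) have "lins K M" unfolding lins_def cross_def by blast
  then show ?case by (rule eqv_swap1.IH)
next
  case (eqv_swap2 M)
  then obtain k where "k \<in> K" "lin k (\<lambda>y z f. M y f z)" unfolding lins_def by blast
  with lin_swap2[OF this(2)] assms(2) have "lins K M" unfolding lins_def cross_def by blast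
  then show ?case by (rule eqv_swap2.IH)
next
  case (eqv_swap3 M)
  then obtain k where "k \<in> K" "lin k (\<lambda>y z f g. M y z g f)" unfolding lins_def by blast
  with lin_swap3[OF this(2)] assms(2) have "lins K M" unfolding lins_def cross_def by blast
  then show ?case by (rule eqv_swap3.IH)
qed

text \<open>The labels \<open>p\<close> along the common line of two linear planes for which the planes have no further
  common word.\<close>

definition star :: "'a :: field \<Rightarrow> 'a \<Rightarrow> ('a \<Rightarrow> 'a) \<Rightarrow> bool" where
  "star k l p \<longleftrightarrow> bij p \<and> p 0 = 0 \<and> p 1 = 1 \<and>
    (\<forall>u v. u \<noteq> 0 \<longrightarrow> k * (p (v + l * u) - p v) \<noteq> p (v + u) - p v)"

text \<open>The common labels are forced to be affine; after the normalisation at 0 and 1 this means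
  the identity.\<close>

definition rigid :: "'a :: field \<Rightarrow> bool" where
  "rigid k \<longleftrightarrow> (\<forall>l p. l \<noteq> 0 \<longrightarrow> l \<noteq> 1 \<longrightarrow> star k l p \<longrightarrow> p = id)"

text \<open>An affine change of parameter respects the linear form of the crossing plane and
  normalises its labels \<open>w\<close> along the shared line at 0 and 1. Comparing the shared line
  in both planes expresses the other two labels through \<open>w\<close>. A further common word
  would be a solution of the equation that \<open>star\<close> forbids.\<close>

lemma crossing_plane:
  fixes R :: "'a :: field \<Rightarrow> 'a \<Rightarrow> 'a \<Rightarrow> 'a \<Rightarrow> 'a \<Rightarrow> bool"
  assumes R: "mds5 R" and R0: "\<And>y z. R x0 y z (y + z) (y + k0 * z)" and k: "lin k (\<lambda>x. R x b)" "k \<noteq> 0"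
  obtains h p where "bij h" "star k0 (inverse k) p"
    "\<And>u v. R (h u) b (p v) (b + p (v + u)) (b + k0 * p (v + inverse k * u))"
proof -
  obtain px pz pf pg where p: "bij px" "bij pz" "bij pf" "bij pg"
    and n: "\<And>u v. R (px u) b (pz v) (pf (u + v)) (pg (u + k * v))" using k(1) unfolding lin_def by blast
  obtain u0 where u0: "px u0 = x0" using p(1) by (metis bij_pointE)
  obtain t where t: "pz t = 0" using p(2) by (metis bij_pointE)
  obtain t1 where t1: "pz t1 = 1" using p(2) by (metis bij_pointE)
  \<comment> \<open>Slope of the affine map that sends 0 and 1 to the parameters at which
    \<open>pz\<close> takes the values 0 and 1; \<open>t\<close> is its constant term.\<close>
  define s where "s = t1 - t"
  have s: "s \<noteq> 0" using t t1 by (auto simp: s_def)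
  define w where "w v = pz (s * v + t)" for v
  define h where "h u = px (s * u + u0)" for u
  have aff: "bij (\<lambda>x. s * x + c)" for c using bij_comp[OF bij_mult[OF s] bij_shift[of c]] by (simp add: comp_def)
  have bw: "bij w" "bij h" using bij_comp[OF aff[of t] p(2)] bij_comp[OF aff[of u0] p(1)]
    by (simp_all add: w_def[abs_def] h_def[abs_def] comp_def)
  have w01: "w 0 = 0" "w 1 = 1" using t t1 by (simp_all add: w_def s_def)
  have l: "pf (u0 + v) = b + pz v \<and> pg (u0 + k * v) = b + k0 * pz v" for v
    by (rule mds5_eq[OF R, OF n[of u0 v] R0[of b "pz v", folded u0], THEN conjunct2, THEN conjunct2, THEN conjunct2])
      (intro disjI1 conjI refl)
  have m: "R (h u) b (w v) (b + w (v + u)) (b + k0 * w (v + inverse k * u))" for u v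
  proof -
    have "R (h u) b (w v) (pf (u0 + (s * (v + u) + t))) (pg (u0 + k * (s * (v + inverse k * u) + t)))"
    proof -
      have "k * (s * (v + inverse k * u) + t) = k * (inverse k * (s * u)) + k * (s * v + t)"
        by (simp add: algebra_simps)
      moreover have "k * (inverse k * (s * u)) = s * u" using k(2) by (simp add: mult.assoc[symmetric])
      ultimately have "(s * u + u0) + k * (s * v + t) = u0 + k * (s * (v + inverse k * u) + t)"
        by (simp only: add.assoc) (simp only: add.left_commute)
      moreover have "(s * u + u0) + (s * v + t) = u0 + (s * (v + u) + t)" by (simp add: algebra_simps)
      ultimately show ?thesis using n[of "s * u + u0" "s * v + t"] by (simp only: h_def w_def)
    qed
    then show ?thesis using l[of "s * (v + u) + t"] l[of "s * (v + inverse k * u) + t"] by (simp add: w_def)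
  qed
  have "star k0 (inverse k) w" unfolding star_def
  proof (intro conjI allI impI notI)
    fix u v :: 'a
    assume u: "u \<noteq> 0" and e: "k0 * (w (v + inverse k * u) - w v) = w (v + u) - w v"
    \<comment> \<open>The second coordinate of the word of the base plane with the given
      \<open>z\<close> and \<open>f\<close>. By the equation \<open>e\<close> this word has the
      given \<open>g\<close> as well.\<close>
    let ?y = "b + w (v + u) - w v"
    have r: "R x0 ?y (w v) (b + w (v + u)) (b + k0 * w (v + inverse k * u))"
    proof -
      have "k0 * w (v + inverse k * u) = w (v + u) - w v + k0 * w v"
        using e by (simp only: right_diff_distrib diff_eq_eq)
      then have e2: "?y + k0 * w v = b + k0 * w (v + inverse k * u)" by simp
      have e1: "?y + w v = b + w (v + u)" by simp
      show ?thesis using R0[of ?y "w v"] by (simp only: e1 e2)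
    qed
    have "x0 = h u" by (rule mds5_eq[OF R, OF r m[of u v], THEN conjunct1]) (intro disjI2 conjI refl)
    moreover have "h 0 = x0" using u0 by (simp add: h_def)
    ultimately have "h 0 = h u" by simp
    then have "u = 0" using bij_eq[OF bw(2), of 0 u] by simp
    with u show False by simp
  qed (use bw(1) w01 in simp_all)
  from that[OF bw(2) this m] show thesis .
qed

text \<open>Exchanging \<open>y\<close> and \<open>z\<close> and rescaling \<open>g\<close> returns
  the base plane to the same form with parameter \<open>inverse k0\<close>. Planes with
  \<open>z\<close> fixed can then be treated like planes with \<open>y\<close> fixed.\<close>

lemma base_swap:
  fixes R :: "'a :: field \<Rightarrow> 'a \<Rightarrow> 'a \<Rightarrow> 'a \<Rightarrow> 'a \<Rightarrow> bool"
  assumes R: "mds5 R" and R0: "\<And>y z. R x0 y z (y + z) (y + k0 * z)" and k0: "k0 \<noteq> 0"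
  defines "S \<equiv> \<lambda>x z y f g. R x y z f (k0 * g)"
  shows "mds5 S" "\<And>y z. S x0 y z (y + z) (y + inverse k0 * z)"
    "lin k (\<lambda>x y. R x y c) \<Longrightarrow> lin k (\<lambda>x. S x c)"
proof -
  show "mds5 S" unfolding S_def
    using mds5_relabel[OF mds5_swap1[OF R] bij_id bij_id bij_id bij_id bij_mult[OF k0]] by simp
  show "S x0 y z (y + z) (y + inverse k0 * z)" for y z
  proof -
    have "k0 * (y + inverse k0 * z) = z + k0 * y"
      using k0 by (simp add: distrib_left mult.assoc[symmetric] add.commute)
    with R0[of z y] show ?thesis by (simp add: S_def add.commute)
  qed
  assume "lin k (\<lambda>x y. R x y c)"
  then obtain p q r s where p: "bij p" "bij q" "bij r" "bij s"
    and h: "\<And>u v. R (p u) (q v) c (r (u + v)) (s (u + k * v))" unfolding lin_def by blast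
  have k: "inverse k0 \<noteq> 0" using k0 by simp
  show "lin k (\<lambda>x. S x c)" unfolding lin_def S_def
    by (rule exI[of _ p], rule exI[of _ q], rule exI[of _ r], rule exI[of _ "(\<lambda>x. inverse k0 * x) \<circ> s"])
      (use p h k0 bij_comp[OF p(4) bij_mult[OF k]] in \<open>simp add: mult.assoc[symmetric]\<close>)
qed

text \<open>Scaling the labels of the first three coordinates turns the first check equation into a
  plain sum, so coefficients remain in the second one only.\<close>

definition linear5 :: "('a :: field \<Rightarrow> 'a \<Rightarrow> 'a \<Rightarrow> 'a \<Rightarrow> 'a \<Rightarrow> bool) \<Rightarrow> bool" where
  "linear5 R \<longleftrightarrow> (\<exists>a b c d e l m k. bij a \<and> bij b \<and> bij c \<and> bij d \<and> bij e \<and>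
    (\<forall>x y z :: 'a. R (a x) (b y) (c z) (d (x + y + z)) (e (l * x + m * y + k * z))))"

text \<open>By rigidity every plane with \<open>y\<close> fixed is explicit up to the naming of
  \<open>x\<close> and one coefficient, and likewise every plane with \<open>z\<close> fixed.
  Comparing the two descriptions on the lines where both are fixed shows that naming and coefficient
  depend on neither \<open>y\<close> nor \<open>z\<close>.\<close>

lemma lin_linear5:
  fixes R :: "'a :: field \<Rightarrow> 'a \<Rightarrow> 'a \<Rightarrow> 'a \<Rightarrow> 'a \<Rightarrow> bool" and k0 :: 'a and K :: "'a set"
  assumes R: "mds5 R" and K: "cross K" and k0: "lin k0 (R x0)" "k0 \<in> K" "rigid k0" "rigid (inverse k0)"
    and y: "\<And>b. lins K (\<lambda>x. R x b)" and z: "\<And>c. lins K (\<lambda>x y. R x y c)"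
  shows "linear5 R"
proof -
  obtain a b c d :: "'a \<Rightarrow> 'a" where p: "bij a" "bij b" "bij c" "bij d"
    and n: "\<And>u v. R x0 (a u) (b v) (c (u + v)) (d (u + k0 * v))" using k0(1) unfolding lin_def by blast
  define S where "S = (\<lambda>x y z f g. R x (a y) (b z) (c f) (d g))"
  have S: "mds5 S" unfolding S_def using mds5_relabel[OF R bij_id p] by simp
  have S0: "S x0 y z (y + z) (y + k0 * z)" for y z using n by (simp add: S_def)
  have k00: "k0 \<noteq> 0" using K k0(2) by (auto simp: cross_def)
  note i = bij_imp_bij_inv[OF p(1)] bij_imp_bij_inv[OF p(2)] bij_imp_bij_inv[OF p(3)] bij_imp_bij_inv[OF p(4)]
  have rig: "l \<noteq> 0 \<Longrightarrow> l \<noteq> 1 \<Longrightarrow> star k0 l w \<Longrightarrow> w = id" "l \<noteq> 0 \<Longrightarrow> l \<noteq> 1 \<Longrightarrow> star (inverse k0) l w \<Longrightarrow> w = id" for l w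
    using k0(3,4) unfolding rigid_def by blast+
  have "\<exists>h l. \<forall>u v. S (h u) y v (y + v + u) (y + k0 * v + k0 * l * u)" for y
  proof -
    obtain k where k: "k \<in> K" "lin k (\<lambda>x. R x (a y))" using y unfolding lins_def by blast
    have "lin k (\<lambda>x. S x y)"
      by (rule lin_relabel[of k "\<lambda>x. S x y" id "inv b" "inv c" "inv d"])
        (use k(2) i in \<open>simp_all add: S_def bij_is_surj[OF p(2)] bij_is_surj[OF p(3)] bij_is_surj[OF p(4)] surj_f_inv_f\<close>)
    moreover have "k \<noteq> 0" "k \<noteq> 1" using K k(1) by (auto simp: cross_def)
    ultimately obtain h w where w: "bij h" "star k0 (inverse k) w"
      "\<And>u v. S (h u) y (w v) (y + w (v + u)) (y + k0 * w (v + inverse k * u))"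
      using crossing_plane[OF S S0] by metis
    have "w = id" using rig(1)[OF _ _ w(2)] \<open>k \<noteq> 0\<close> \<open>k \<noteq> 1\<close> by simp
    then show ?thesis using w(3) by (intro exI[of _ h] exI[of _ "inverse k"]) (simp add: algebra_simps)
  qed
  then obtain h l where h: "\<And>y u v. S (h y u) y v (y + v + u) (y + k0 * v + k0 * l y * u)" by metis
  have "\<exists>h l. bij h \<and> (\<forall>u v. S (h u) v z (z + v + u) (k0 * z + v + l * u))" for z
  proof -
    obtain k where k: "k \<in> K" "lin k (\<lambda>x y. R x y (b z))" using z unfolding lins_def by blast
    have "lin k (\<lambda>x y. S x y z)"
      by (rule lin_relabel[of k "\<lambda>x y. S x y z" id "inv a" "inv c" "inv d"])
        (use k(2) i in \<open>simp_all add: S_def bij_is_surj[OF p(1)] bij_is_surj[OF p(3)] bij_is_surj[OF p(4)] surj_f_inv_f\<close>)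
    note T = base_swap(1,2)[OF S S0 k00] base_swap(3)[OF S S0 k00 this]
    have "k \<noteq> 0" "k \<noteq> 1" using K k(1) by (auto simp: cross_def)
    with crossing_plane[OF T] obtain h w where w: "bij h" "star (inverse k0) (inverse k) w"
      "\<And>u v. S (h u) (w v) z (z + w (v + u)) (k0 * (z + inverse k0 * w (v + inverse k * u)))" by metis
    have "w = id" using rig(2)[OF _ _ w(2)] \<open>k \<noteq> 0\<close> \<open>k \<noteq> 1\<close> by simp
    moreover have "k0 * (z + inverse k0 * (v + inverse k * u)) = k0 * z + v + inverse k * u" for u v
      using k00 by (simp add: distrib_left mult.assoc[symmetric])
    ultimately show ?thesis using w(1,3) by (intro exI[of _ h] exI[of _ "inverse k"]) (simp add: ac_simps)
  qed
  then obtain h' l' where h': "\<And>z. bij (h' z)" "\<And>z u v. S (h' z u) v z (z + v + u) (k0 * z + v + l' z * u)" by metis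
  \<comment> \<open>Both words have these \<open>y\<close> and \<open>z\<close> and the same fourth
    coordinate \<open>y + z + u\<close>, so they are equal.\<close>
  have eq: "h y u = h' z u \<and> k0 * l y * u = l' z * u" for y z u
    using mds5_eq[OF S, OF h[of y u z] h'(2)[of z u y]] by (auto simp: algebra_simps)
  have "S (h' 0 u) y z (u + y + z) (l' 0 * u + 1 * y + k0 * z)" for u y z
  proof -
    have e: "h y u = h' 0 u" "k0 * l y * u = l' 0 * u" using eq[of y u 0] by blast+
    show ?thesis using h[of y u z] unfolding e by (simp add: ac_simps)
  qed
  then show ?thesis unfolding linear5_def S_def using h'(1) p by blast
qed

section \<open>Transport between fields of the same size\<close>

text \<open>Translation by 1 permutes the field, so adding 1 to every element leaves the sum of all
  elements unchanged.\<close>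

lemma of_nat_card_UNIV: "of_nat (card (UNIV :: 'a :: {field,finite} set)) = (0 :: 'a)"
proof -
  have "(\<Sum>y\<in>UNIV. y + 1 :: 'a) = (\<Sum>y\<in>UNIV. y)"
    by (rule sum.reindex_bij_betw[OF bij_shift[of 1], of "\<lambda>x. x"])
  then show ?thesis by (simp add: sum.distrib)
qed

lemma field_hom_bij:
  fixes \<phi> :: "'b :: {field,finite} \<Rightarrow> 'a :: {field,finite}"
  assumes add: "\<And>x y. \<phi> (x + y) = \<phi> x + \<phi> y" and mult: "\<And>x y. \<phi> (x * y) = \<phi> x * \<phi> y" and one: "\<phi> 1 = 1"
    and card: "card (UNIV :: 'b set) = card (UNIV :: 'a set)"
  shows "bij \<phi>"
proof -
  have zero: "\<phi> 0 = 0" by (metis add add_0_right add_left_cancel)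
  have ker: "x = 0" if "\<phi> x = 0" for x
    using mult[of x "inverse x"] that one by (cases "x = 0") simp_all
  have "inj \<phi>"
  proof (rule injI)
    fix x y assume "\<phi> x = \<phi> y"
    with add[of "x - y" y] have "\<phi> (x - y) = 0" by simp
    from ker[OF this] show "x = y" by simp
  qed
  moreover have "range \<phi> = UNIV"
    using card_image[OF \<open>inj \<phi>\<close>] card by (intro card_subset_eq) simp_all
  ultimately show ?thesis by (simp add: bij_def)
qed

text \<open>The finite searches are done over a concrete datatype. A field isomorphism relabels the
  five coordinates and carries the linear form back with its coefficients.\<close>

lemma linear5_transport:
  fixes R :: "'a :: {field,finite} \<Rightarrow> 'a \<Rightarrow> 'a \<Rightarrow> 'a \<Rightarrow> 'a \<Rightarrow> bool" and \<phi> :: "'b :: {field,finite} \<Rightarrow> 'a"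
  assumes add: "\<And>x y. \<phi> (x + y) = \<phi> x + \<phi> y" and mult: "\<And>x y. \<phi> (x * y) = \<phi> x * \<phi> y" and one: "\<phi> 1 = 1"
    and card: "card (UNIV :: 'b set) = card (UNIV :: 'a set)"
    and all: "\<And>R :: 'b \<Rightarrow> 'b \<Rightarrow> 'b \<Rightarrow> 'b \<Rightarrow> 'b \<Rightarrow> bool. mds5 R \<Longrightarrow> linear5 R" and R: "mds5 R"
  shows "linear5 R"
proof -
  note b = field_hom_bij[of \<phi>, OF add mult one card]
  have "mds5 (\<lambda>x y z f g. R (\<phi> x) (\<phi> y) (\<phi> z) (\<phi> f) (\<phi> g))" by (rule mds5_relabel[OF R b b b b b])
  from all[OF this] obtain a1 a2 a3 a4 a5 l m k where conj: "bij a1 \<and> bij a2 \<and> bij a3 \<and> bij a4 \<and> bij a5 \<and>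
    (\<forall>x y z :: 'b. R (\<phi> (a1 x)) (\<phi> (a2 y)) (\<phi> (a3 z)) (\<phi> (a4 (x + y + z))) (\<phi> (a5 (l * x + m * y + k * z))))"
    unfolding linear5_def by (elim exE) (rule that)
  then have p: "bij a1" "bij a2" "bij a3" "bij a4" "bij a5" by simp_all
  have h: "R (\<phi> (a1 x)) (\<phi> (a2 y)) (\<phi> (a3 z)) (\<phi> (a4 (x + y + z))) (\<phi> (a5 (l * x + m * y + k * z)))" for x y z using conj by simp
  let ?i = "inv \<phi>"
  have i: "\<phi> (?i x) = x" "?i (\<phi> u) = u" for x u using b by (simp_all add: bij_is_surj surj_f_inv_f bij_is_inj)
  have e: "?i (x + y + z) = ?i x + ?i y + ?i z" "?i (\<phi> l * x + \<phi> m * y + \<phi> k * z) = l * ?i x + m * ?i y + k * ?i z" for x y z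
  proof -
    have "x + y + z = \<phi> (?i x + ?i y + ?i z)" by (simp add: add i)
    then show "?i (x + y + z) = ?i x + ?i y + ?i z" by (simp only: i)
    have "\<phi> l * x + \<phi> m * y + \<phi> k * z = \<phi> (l * ?i x + m * ?i y + k * ?i z)" by (simp add: add mult i)
    then show "?i (\<phi> l * x + \<phi> m * y + \<phi> k * z) = l * ?i x + m * ?i y + k * ?i z" by (simp only: i)
  qed
  let ?c = "\<lambda>a x. \<phi> (a (?i x))"
  have bc: "bij (?c a)" if "bij a" for a
    using bij_comp[OF bij_comp[OF bij_imp_bij_inv[OF b] that] b] by (simp add: comp_def)
  have "R (?c a1 x) (?c a2 y) (?c a3 z) (?c a4 (x + y + z)) (?c a5 (\<phi> l * x + \<phi> m * y + \<phi> k * z))" for x y z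
    by (subst e(2), subst e(1), rule h)
  then show ?thesis unfolding linear5_def
    by (intro exI[of _ "?c a1"] exI[of _ "?c a2"] exI[of _ "?c a3"] exI[of _ "?c a4"] exI[of _ "?c a5"]
        exI[of _ "\<phi> l"] exI[of _ "\<phi> m"] exI[of _ "\<phi> k"] conjI bc p allI)
qed

subsection \<open>Five symbols\<close>

datatype s5 = B0 | B1 | B2 | B3 | B4

lemma UNIV_s5: "(UNIV :: s5 set) = {B0, B1, B2, B3, B4}"
  using s5.exhaust by blast

instance s5 :: finite
  by standard (simp add: UNIV_s5)

lemma card_s5: "card (UNIV :: s5 set) = 5"
  by (simp add: UNIV_s5)

lemma all_s5: "(\<forall>x::s5. P x) \<longleftrightarrow> P B0 \<and> P B1 \<and> P B2 \<and> P B3 \<and> P B4"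
  by (metis s5.exhaust)

lemma ex_s5: "(\<exists>x::s5. P x) \<longleftrightarrow> P B0 \<or> P B1 \<or> P B2 \<or> P B3 \<or> P B4"
  by (metis s5.exhaust)

fun val5 :: "s5 \<Rightarrow> int" where
  "val5 B0 = 0" | "val5 B1 = 1" | "val5 B2 = 2" | "val5 B3 = 3" | "val5 B4 = 4"

definition of_val5 :: "int \<Rightarrow> s5" where
  "of_val5 k = (if k mod 5 = 0 then B0 else if k mod 5 = 1 then B1 else if k mod 5 = 2 then B2 else if k mod 5 = 3 then B3 else B4)"

lemma val5_of [simp]: "val5 (of_val5 k) = k mod 5"
proof -
  have "k mod 5 = 0 \<or> k mod 5 = 1 \<or> k mod 5 = 2 \<or> k mod 5 = 3 \<or> k mod 5 = 4" by presburger
  then show ?thesis by (auto simp: of_val5_def)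
qed

lemma of_val5 [simp]: "of_val5 (val5 x) = x"
  by (cases x) (simp_all add: of_val5_def)

lemma of_val5_cong: "j mod 5 = k mod 5 \<Longrightarrow> of_val5 j = of_val5 k"
  by (simp add: of_val5_def)

instantiation s5 :: field
begin

definition "0 = B0"
definition "1 = B1"
definition "x + y = of_val5 (val5 x + val5 y)" for x y :: s5
definition "x - y = of_val5 (val5 x - val5 y)" for x y :: s5
definition "- x = of_val5 (- val5 x)" for x :: s5
definition "x * y = of_val5 (val5 x * val5 y)" for x y :: s5
definition "inverse x = of_val5 (val5 x ^ 3)" for x :: s5
definition "x div y = x * inverse y" for x y :: s5

instance
proof
  fix x y z :: s5
  show "x + y + z = x + (y + z)" "x * y * z = x * (y * z)" "(x + y) * z = x * z + y * z"
    unfolding plus_s5_def times_s5_def val5_of by (rule of_val5_cong, simp add: mod_simps algebra_simps)+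
  show "x + y = y + x" "x * y = y * x" by (simp_all add: plus_s5_def times_s5_def ac_simps)
  show "0 + x = x" "1 * x = x" by (simp_all add: plus_s5_def times_s5_def zero_s5_def one_s5_def)
  show "- x + x = 0" by (cases x) (simp_all add: plus_s5_def uminus_s5_def zero_s5_def of_val5_def)
  show "x - y = x + - y" unfolding plus_s5_def minus_s5_def uminus_s5_def val5_of
    by (rule of_val5_cong) (simp add: mod_simps)
  show "x \<noteq> 0 \<Longrightarrow> inverse x * x = 1" by (cases x) (simp_all add: times_s5_def inverse_s5_def zero_s5_def one_s5_def of_val5_def)
  show "inverse (0 :: s5) = 0" by (simp add: inverse_s5_def zero_s5_def of_val5_def)
  show "x div y = x * inverse y" by (simp add: divide_s5_def)
  show "(0 :: s5) \<noteq> 1" by (simp add: zero_s5_def one_s5_def)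
qed

end

lemma arith5:
  "B0 + B0 = B0" "B0 + B1 = B1" "B0 + B2 = B2" "B0 + B3 = B3" "B0 + B4 = B4"
  "B1 + B0 = B1" "B1 + B1 = B2" "B1 + B2 = B3" "B1 + B3 = B4" "B1 + B4 = B0"
  "B2 + B0 = B2" "B2 + B1 = B3" "B2 + B2 = B4" "B2 + B3 = B0" "B2 + B4 = B1"
  "B3 + B0 = B3" "B3 + B1 = B4" "B3 + B2 = B0" "B3 + B3 = B1" "B3 + B4 = B2"
  "B4 + B0 = B4" "B4 + B1 = B0" "B4 + B2 = B1" "B4 + B3 = B2" "B4 + B4 = B3"
  "B0 - B0 = B0" "B0 - B1 = B4" "B0 - B2 = B3" "B0 - B3 = B2" "B0 - B4 = B1"
  "B1 - B0 = B1" "B1 - B1 = B0" "B1 - B2 = B4" "B1 - B3 = B3" "B1 - B4 = B2"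
  "B2 - B0 = B2" "B2 - B1 = B1" "B2 - B2 = B0" "B2 - B3 = B4" "B2 - B4 = B3"
  "B3 - B0 = B3" "B3 - B1 = B2" "B3 - B2 = B1" "B3 - B3 = B0" "B3 - B4 = B4"
  "B4 - B0 = B4" "B4 - B1 = B3" "B4 - B2 = B2" "B4 - B3 = B1" "B4 - B4 = B0"
  "B0 * B0 = B0" "B0 * B1 = B0" "B0 * B2 = B0" "B0 * B3 = B0" "B0 * B4 = B0"
  "B1 * B0 = B0" "B1 * B1 = B1" "B1 * B2 = B2" "B1 * B3 = B3" "B1 * B4 = B4"
  "B2 * B0 = B0" "B2 * B1 = B2" "B2 * B2 = B4" "B2 * B3 = B1" "B2 * B4 = B3"
  "B3 * B0 = B0" "B3 * B1 = B3" "B3 * B2 = B1" "B3 * B3 = B4" "B3 * B4 = B2"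
  "B4 * B0 = B0" "B4 * B1 = B4" "B4 * B2 = B3" "B4 * B3 = B2" "B4 * B4 = B1"
  "inverse B0 = B0" "inverse B1 = B1" "inverse B2 = B3" "inverse B3 = B2" "inverse B4 = B4"
  unfolding plus_s5_def minus_s5_def times_s5_def inverse_s5_def by (simp_all add: of_val5_def)

lemma hom5:
  assumes "card (UNIV :: 'a :: {field,finite} set) = 5"
  shows "of_int (val5 (x + y)) = (of_int (val5 x) + of_int (val5 y) :: 'a)"
    "of_int (val5 (x * y)) = (of_int (val5 x) * of_int (val5 y) :: 'a)" "of_int (val5 1) = (1 :: 'a)"
proof -
  have "of_nat 5 = (0 :: 'a)" using of_nat_card_UNIV[where 'a = 'a] assms(1) by simp
  then have z: "of_int 5 = (0 :: 'a)" by simp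
  have *: "of_int (k mod 5) = (of_int k :: 'a)" for k
  proof -
    have "of_int k = (of_int (k div 5) * of_int 5 + of_int (k mod 5) :: 'a)"
      by (simp only: of_int_mult[symmetric] of_int_add[symmetric] div_mult_mod_eq)
    then show ?thesis by (simp only: z mult_zero_right add_0_left)
  qed
  show "of_int (val5 (x + y)) = (of_int (val5 x) + of_int (val5 y) :: 'a)"
    by (simp only: plus_s5_def val5_of * of_int_add)
  show "of_int (val5 (x * y)) = (of_int (val5 x) * of_int (val5 y) :: 'a)"
    by (simp only: times_s5_def val5_of * of_int_mult)
  show "of_int (val5 1) = (1 :: 'a)" by (simp add: one_s5_def)
qed

text \<open>The field is prime. In longer codes this turns additive labels into multiplications by
  constants.\<close>

lemma of_nat5:
  assumes c: "card (UNIV :: 'a :: {field,finite} set) = 5"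
  shows "\<exists>m. (x :: 'a) = of_nat m"
proof -
  have "bij (\<lambda>x. of_int (val5 x) :: 'a)" by (rule field_hom_bij[OF hom5[OF c]]) (simp add: c card_s5)
  then obtain y where y: "x = of_int (val5 y)" by (metis bij_pointE)
  have "0 \<le> val5 y" by (cases y) simp_all
  then have "x = of_nat (nat (val5 y))" using y by simp
  then show ?thesis ..
qed

lemma field5:
  fixes R :: "'a :: {field,finite} \<Rightarrow> 'a \<Rightarrow> 'a \<Rightarrow> 'a \<Rightarrow> 'a \<Rightarrow> bool"
  assumes c: "card (UNIV :: 'a set) = 5" and R: "mds5 R"
    and all: "\<And>R :: s5 \<Rightarrow> s5 \<Rightarrow> s5 \<Rightarrow> s5 \<Rightarrow> s5 \<Rightarrow> bool. mds5 R \<Longrightarrow> linear5 R"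
  shows "linear5 R"
  by (rule linear5_transport[OF hom5[OF c] _ all R]) (simp_all add: c card_s5)

text \<open>These are 2, 1/2 and -1, the harmonic cross ratios; over five elements they exhaust the
  values other than 0 and 1.\<close>

lemma cross5: "cross {B2, B3, B4}"
  by (simp add: cross_def divide_s5_def arith5 zero_s5_def one_s5_def)

fun pm :: "s5 \<Rightarrow> s5 \<Rightarrow> s5 \<Rightarrow> s5 \<Rightarrow> s5" where
  "pm c d e B0 = B0" | "pm c d e B1 = B1" | "pm c d e B2 = c" | "pm c d e B3 = d" | "pm c d e B4 = e"

text \<open>The set consists of the five permutations that fix 0 and 1 other than the identity; for
  each of them the two planes have a further common word.\<close>

lemma star5_table: "\<forall>k\<in>{B2, B3, B4}. \<forall>l\<in>{B2, B3, B4}.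
    \<forall>p\<in>{pm B2 B4 B3, pm B3 B2 B4, pm B3 B4 B2, pm B4 B2 B3, pm B4 B3 B2}.
    \<exists>u v. u \<noteq> B0 \<and> k * (p (v + l * u) - p v) = p (v + u) - p v"
  by (simp only: ball_simps ex_s5 pm.simps arith5 s5.distinct simp_thms)

lemma rigid5: "rigid (k :: s5)" if k: "k \<in> {B2, B3, B4}"
  unfolding rigid_def
proof (intro allI impI)
  fix l :: s5 and p assume l: "l \<noteq> 0" "l \<noteq> 1" and s: "star k l p"
  have l': "l \<in> {B2, B3, B4}" using l by (cases l) (simp_all add: zero_s5_def one_s5_def)
  have p01: "p B0 = B0" "p B1 = B1" and b: "bij p" using s by (simp_all add: star_def zero_s5_def one_s5_def)
  have st: "k * (p (v + l * u) - p v) \<noteq> p (v + u) - p v" if "u \<noteq> B0" for u v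
    using s that unfolding star_def zero_s5_def by blast
  have ne: "p x \<noteq> p y" if "x \<noteq> y" for x y using b that by (simp add: bij_eq)
  note ne = ne[of B0 B2] ne[of B0 B3] ne[of B0 B4] ne[of B1 B2] ne[of B1 B3] ne[of B1 B4] ne[of B2 B3] ne[of B2 B4] ne[of B3 B4]
  let ?five = "{pm B2 B4 B3, pm B3 B2 B4, pm B3 B4 B2, pm B4 B2 B3, pm B4 B3 B2}"
  have "p = pm (p B2) (p B3) (p B4)" by (simp add: fun_eq_iff all_s5 p01)
  moreover have "pm (p B2) (p B3) (p B4) \<in> insert (pm B2 B3 B4) ?five"
    using ne p01 by (cases "p B2"; cases "p B3"; cases "p B4") simp_all
  moreover have "p \<notin> ?five" using star5_table[rule_format, OF k l'] st by blast
  ultimately have "p = pm B2 B3 B4" by auto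
  then show "p = id" by (simp add: fun_eq_iff all_s5)
qed

definition normal5 :: "(s5 \<Rightarrow> s5 \<Rightarrow> s5 \<Rightarrow> s5 \<Rightarrow> bool) \<Rightarrow> bool" where
  "normal5 N \<longleftrightarrow> net4 N \<and> (\<forall>i. N B0 i i i) \<and> (\<forall>i. \<exists>g. N i B0 i g)"

text \<open>Passing from line \<open>B0\<close> to line \<open>B1\<close> gives a derangement of the
  symbols that sends \<open>B0\<close> to \<open>B1\<close>, of cycle type 5 or 3+2. The first two
  claims exclude that \<open>B0\<close> lies in a 2-cycle or that the cycle is
  \<open>B0, B1, B2\<close>; up to relabelling only a 5-cycle remains. The third determines the
  plane when that cycle begins with \<open>B0, B1, B2, B3\<close>.\<close>

lemma normal5_cases:
  fixes N :: "s5 \<Rightarrow> s5 \<Rightarrow> s5 \<Rightarrow> s5 \<Rightarrow> bool"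
  assumes nN: "normal5 N"
  shows "\<not> N B1 B1 B0 g" and "N B1 B1 B2 g \<Longrightarrow> \<not> N B1 B2 B0 h"
    and "N B1 B1 B2 g \<Longrightarrow> N B1 B2 B3 h \<Longrightarrow> \<exists>k\<in>{B2, B3, B4}. \<forall>u v. N u v (u + v) (k * u + v)"
  supply [[argo_timeout = 300]]
proof -
  have N: "net4 N" and d0: "\<And>i. N B0 i i i" and c0: "\<And>i. \<exists>g. N i B0 i g"
    using nN by (simp_all add: normal5_def)
  define a where "a y z f \<longleftrightarrow> (\<exists>g. N y z f g)" for y z f
  define b where "b y z g \<longleftrightarrow> (\<exists>f. N y z f g)" for y z g
  define d where "d z f g \<longleftrightarrow> (\<exists>y. N y z f g)" for z f g
  note ex = net4_ex[OF N] and eq = net4_eq[OF N]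
  have "\<forall>y z. \<exists>f. a y z f" "\<forall>y f. \<exists>z. a y z f" "\<forall>z f. \<exists>y. a y z f"
    "\<forall>y z. \<exists>f. b y z f" "\<forall>y f. \<exists>z. b y z f" "\<forall>z f. \<exists>y. b y z f"
    "\<forall>y z. \<exists>f. d y z f" "\<forall>y f. \<exists>z. d y z f" "\<forall>z f. \<exists>y. d y z f"
    unfolding a_def b_def d_def using ex by metis+
  note e1 = this[unfolded all_s5 ex_s5]
  have "\<forall>y z f f'. f = f' \<or> \<not> a y z f \<or> \<not> a y z f'" "\<forall>y z f f'. f = f' \<or> \<not> a y f z \<or> \<not> a y f' z"
    "\<forall>y z f f'. f = f' \<or> \<not> a f y z \<or> \<not> a f' y z"
    "\<forall>y z f f'. f = f' \<or> \<not> b y z f \<or> \<not> b y z f'" "\<forall>y z f f'. f = f' \<or> \<not> b y f z \<or> \<not> b y f' z"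
    "\<forall>y z f f'. f = f' \<or> \<not> b f y z \<or> \<not> b f' y z"
    "\<forall>y z f f'. f = f' \<or> \<not> d y z f \<or> \<not> d y z f'" "\<forall>y z f f'. f = f' \<or> \<not> d y f z \<or> \<not> d y f' z"
    "\<forall>y z f f'. f = f' \<or> \<not> d f y z \<or> \<not> d f' y z"
    unfolding a_def b_def d_def using eq by blast+
  note u1 = this[unfolded all_s5, simplified s5.distinct simp_thms]
  have "\<forall>y z f g. (\<not> a y z f \<or> \<not> b y z g \<or> d z f g) \<and> (\<not> a y z f \<or> \<not> d z f g \<or> b y z g) \<and>
    (\<not> b y z g \<or> \<not> d z f g \<or> a y z f)"
    unfolding a_def b_def d_def using eq by blast
  note w1 = this[unfolded all_s5]
  \<comment> \<open>The entries decided by the diagonal line and the first column; substituting them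
    shortens the clauses before the propositional step.\<close>
  have units: "a B0 i j \<longleftrightarrow> i = j" "a i B0 j \<longleftrightarrow> i = j" "b B0 i j \<longleftrightarrow> i = j" "d i i j \<longleftrightarrow> i = j"
    "d i j i \<longleftrightarrow> i = j" "d j i i \<longleftrightarrow> i = j" for i j
    unfolding a_def b_def d_def using d0 c0 eq by blast+
  note facts = e1[simplified units s5.distinct simp_thms] u1[simplified units s5.distinct simp_thms] w1[simplified units s5.distinct simp_thms]
  have "\<not> a B1 B1 B0" by (insert facts, argo)
  then show "\<not> N B1 B1 B0 g" unfolding a_def by blast
  have "\<not> (a B1 B1 B2 \<and> a B1 B2 B0)" by (insert facts, argo)
  then show "N B1 B1 B2 g \<Longrightarrow> \<not> N B1 B2 B0 h" unfolding a_def by blast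
  assume "N B1 B1 B2 g" "N B1 B2 B3 h"
  then have h: "a B1 B1 B2" "a B1 B2 B3" unfolding a_def by blast+
  \<comment> \<open>Given the first square, the plane is determined by this single entry, which
    becomes the coefficient of \<open>u\<close>.\<close>
  obtain k where k: "b B1 B0 k" using ex(1)[of B1 B0] unfolding b_def by blast
  have "\<forall>u v. a u v (u + v) \<and> b u v (k * u + v)" if "k = B2"
    using k unfolding that by (simp only: all_s5 arith5 units simp_thms s5.distinct) (insert facts h, argo)
  moreover have "\<forall>u v. a u v (u + v) \<and> b u v (k * u + v)" if "k = B3"
    using k unfolding that by (simp only: all_s5 arith5 units simp_thms s5.distinct) (insert facts h, argo)
  moreover have "\<forall>u v. a u v (u + v) \<and> b u v (k * u + v)" if "k = B4"
    using k unfolding that by (simp only: all_s5 arith5 units simp_thms s5.distinct) (insert facts h, argo)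
  moreover have "k \<noteq> B0" using k units(3) unfolding b_def using d0 eq by blast
  moreover have "k \<noteq> B1" 
  proof
    assume "k = B1"
    then obtain f where f: "N B1 B0 f B1" using k unfolding b_def by blast
    obtain g where g: "N B1 B0 B1 g" using c0 by blast
    have "N B1 B0 B1 B1" using eq[OF f g] f by simp
    from eq[OF this d0[of B1]] show False by simp
  qed
  ultimately have "(\<forall>u v. a u v (u + v) \<and> b u v (k * u + v)) \<and> k \<in> {B2, B3, B4}" by (cases k) simp_all
  moreover have "N u v f g" if "a u v f" "b u v g" for u v f g
    using that eq unfolding a_def b_def by blast
  ultimately show "\<exists>k\<in>{B2, B3, B4}. \<forall>u v. N u v (u + v) (k * u + v)" by blast
qed

lemma normal5_relabel:
  assumes "normal5 N" "bij p" "p B0 = B0"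
  shows "normal5 (\<lambda>y z f g. N (p y) (p z) (p f) (p g))"
proof -
  have "\<exists>g. N (p i) B0 (p i) (p g)" for i
  proof -
    obtain g where "N (p i) B0 (p i) g" using assms(1) unfolding normal5_def by blast
    moreover obtain g' where "g = p g'" using assms(2) by (metis bij_pointE)
    ultimately show ?thesis by blast
  qed
  then show ?thesis using assms net4_relabel[of N p p p p] by (simp add: normal5_def)
qed

lemma bij_pm: assumes "distinct [B0, B1, c, d, e]" shows "bij (pm c d e)"
proof -
  have "inj (pm c d e)"
  proof (rule injI)
    fix x y assume "pm c d e x = pm c d e y"
    then show "x = y" using assms by (cases x; cases y) auto
  qed
  then show ?thesis by (simp add: bij_def finite_UNIV_inj_surj)
qed

lemma lins5_123:
  assumes N: "normal5 N" "N B1 B1 B2 g" "N B1 B2 B3 h"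
  shows "lins {B2, B3, B4} N"
proof -
  obtain k where k: "k \<in> {B2, B3, B4}" "\<And>u v. N u v (u + v) (k * u + v)" using normal5_cases(3)[OF N] by blast
  have k': "k \<noteq> 0" "inverse k \<in> {B2, B3, B4}" using k(1) by (auto simp: zero_s5_def arith5)
  have "lin (inverse k) N" unfolding lin_def
  proof (rule exI[of _ id], rule exI[of _ id], rule exI[of _ id], rule exI[of _ "\<lambda>x. k * x"], intro conjI allI)
    show "bij (\<lambda>x. k * x)" by (rule bij_mult[OF k'(1)])
    fix u v
    have "k * (u + inverse k * v) = k * u + v" using k'(1) by (simp add: distrib_left mult.assoc[symmetric])
    then show "N (id u) (id v) (id (u + v)) (k * (u + inverse k * v))" using k(2) by simp
  qed simp_all
  with k'(2) show ?thesis unfolding lins_def by blast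
qed

lemma lins_relabel5:
  assumes "lins K (\<lambda>y z f g. N (p y) (p z) (p f) (p g))" "bij p"
  shows "lins K N"
  using assms lin_relabel[of _ N p p p p] unfolding lins_def by blast

text \<open>The cycle continues after \<open>B2\<close> with \<open>B3\<close> or \<open>B4\<close>;
  exchanging these two symbols in all coordinates preserves the normal form and reduces the second
  case to the first.\<close>

lemma lins5_12:
  assumes N: "normal5 N" "N B1 B1 B2 g"
  shows "lins {B2, B3, B4} N"
proof -
  have n: "net4 N" and d0: "\<And>i. N B0 i i i" and c0: "\<And>i. \<exists>g. N i B0 i g" using N(1) by (simp_all add: normal5_def)
  obtain y h where y: "N B1 B2 y h" using net4_ex(1)[OF n] by blast
  obtain i where i: "N B1 B0 B1 i" using c0 by blast
  consider "y = B3" | "y = B4"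
    using y normal5_cases(2)[OF N, of h] net4_eq[OF n y i] net4_eq[OF n y N(2)] by (cases y) auto
  then show ?thesis
  proof cases
    case 1
    then show ?thesis using lins5_123[OF N] y by blast
  next
    case 2
    let ?p = "pm B2 B4 B3"
    have p: "bij ?p" by (rule bij_pm) simp
    obtain g' h' where g: "g = ?p g'" "h = ?p h'" using p by (metis bij_pointE)
    show ?thesis
      by (rule lins_relabel5[OF lins5_123[OF normal5_relabel[OF N(1) p], of g' h'] p])
        (use N(2) y 2 g in simp_all)
  qed
qed

text \<open>The symbol that follows \<open>B1\<close> in the cycle is renamed to \<open>B2\<close>
  by a permutation fixing \<open>B0\<close> and \<open>B1\<close>, which keeps the plane
  normal.\<close>

lemma lins5_normal:
  assumes N: "normal5 N"
  shows "lins {B2, B3, B4} N"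
proof -
  have n: "net4 N" and c0: "\<And>i. \<exists>g. N i B0 i g" using N by (simp_all add: normal5_def)
  obtain x h where x: "N B1 B1 x h" using net4_ex(1)[OF n] by blast
  obtain i where i: "N B1 B0 B1 i" using c0 by blast
  have "x \<noteq> B0" "x \<noteq> B1" using x normal5_cases(1)[OF N, of h] net4_eq[OF n x i] by auto
  then obtain d e where de: "distinct [B0, B1, x, d, e]"
    using that[of B3 B4] that[of B2 B4] that[of B2 B3] by (cases x) simp_all
  let ?p = "pm x d e"
  have p: "bij ?p" by (rule bij_pm[OF de])
  obtain h' where h: "h = ?p h'" using p by (metis bij_pointE)
  show ?thesis
    by (rule lins_relabel5[OF lins5_12[OF normal5_relabel[OF N p], of h'] p]) (use x h in simp_all)
qed

lemma lins5: assumes N: "net4 (N :: s5 \<Rightarrow> s5 \<Rightarrow> s5 \<Rightarrow> s5 \<Rightarrow> bool)" shows "lins {B2, B3, B4} N"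
proof -
  note eq = net4_eq[OF N]
  have "\<forall>z. \<exists>f g. N B0 z f g" using net4_ex(1)[OF N] by blast
  then obtain r s where rs: "\<And>z. N B0 z (r z) (s z)" by metis
  have "inj r" "inj s" using eq[OF rs rs] by (auto intro!: injI)
  then have b: "bij r" "bij s" by (simp_all add: bij_def finite_UNIV_inj_surj)
  have "\<forall>f. \<exists>y g. N y B0 (r f) g" using net4_ex(4)[OF N] by blast
  then obtain q G where q: "\<And>f. N (q f) B0 (r f) (G f)" by metis
  have "inj q"
  proof (rule injI)
    fix x y assume "q x = q y"
    with eq[OF q[of x] q[of y]] have "r x = r y" by simp
    with \<open>inj r\<close> show "x = y" by (simp add: inj_eq)
  qed
  then have bq: "bij q" by (simp add: bij_def finite_UNIV_inj_surj)
  have q0: "q B0 = B0" using eq[OF q[of B0] rs[of B0]] by simp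
  let ?M = "\<lambda>y z f g. N (q y) (id z) (r f) (s g)"
  have M: "net4 ?M" by (rule net4_relabel[OF N bq bij_id b])
  have "\<exists>g. ?M i B0 i g" for i
  proof -
    obtain g where "G i = s g" using b(2) by (metis bij_pointE)
    with q[of i] have "?M i B0 i g" by simp
    then show ?thesis ..
  qed
  with rs q0 M have "normal5 ?M" by (simp add: normal5_def)
  then have "lins {B2, B3, B4} ?M" by (rule lins5_normal)
  then show ?thesis unfolding lins_def using lin_relabel[OF _ bq bij_id b] by blast
qed

theorem linear5_five: assumes R: "mds5 (R :: s5 \<Rightarrow> s5 \<Rightarrow> s5 \<Rightarrow> s5 \<Rightarrow> s5 \<Rightarrow> bool)" shows "linear5 R"
proof -
  obtain k where k: "k \<in> {B2, B3, B4}" "lin k (R B0)" using lins5[OF mds5_plane[OF R]] unfolding lins_def by blast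
  have ik: "inverse k \<in> {B2, B3, B4}" using cross5 k(1) unfolding cross_def by blast
  show ?thesis
    using lin_linear5[OF R cross5 k(2,1) rigid5[OF k(1)] rigid5[OF ik] lins5[OF mds5_plane[OF mds5_swap0[OF R]]]
      lins5[OF mds5_plane[OF mds5_swap0[OF mds5_swap1[OF R]]]]] .
qed

subsection \<open>Seven symbols\<close>

fun val7 :: "s7 \<Rightarrow> int" where
  "val7 A0 = 0" | "val7 A1 = 1" | "val7 A2 = 2" | "val7 A3 = 3" | "val7 A4 = 4" | "val7 A5 = 5" | "val7 A6 = 6"

definition of_val7 :: "int \<Rightarrow> s7" where
  "of_val7 k = (if k mod 7 = 0 then A0 else if k mod 7 = 1 then A1 else if k mod 7 = 2 then A2 else if k mod 7 = 3 then A3 else if k mod 7 = 4 then A4 else if k mod 7 = 5 then A5 else A6)"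

lemma val7_of [simp]: "val7 (of_val7 k) = k mod 7"
proof -
  have "k mod 7 = 0 \<or> k mod 7 = 1 \<or> k mod 7 = 2 \<or> k mod 7 = 3 \<or> k mod 7 = 4 \<or> k mod 7 = 5 \<or> k mod 7 = 6" by presburger
  then show ?thesis by (auto simp: of_val7_def)
qed

lemma of_val7 [simp]: "of_val7 (val7 x) = x"
  by (cases x) (simp_all add: of_val7_def)

lemma of_val7_cong: "j mod 7 = k mod 7 \<Longrightarrow> of_val7 j = of_val7 k"
  by (simp add: of_val7_def)

instantiation s7 :: field
begin

definition "0 = A0"
definition "1 = A1"
definition "x + y = of_val7 (val7 x + val7 y)" for x y :: s7
definition "x - y = of_val7 (val7 x - val7 y)" for x y :: s7
definition "- x = of_val7 (- val7 x)" for x :: s7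
definition "x * y = of_val7 (val7 x * val7 y)" for x y :: s7
definition "inverse x = of_val7 (val7 x ^ 5)" for x :: s7
definition "x div y = x * inverse y" for x y :: s7

instance
proof
  fix x y z :: s7
  show "x + y + z = x + (y + z)" "x * y * z = x * (y * z)" "(x + y) * z = x * z + y * z"
    unfolding plus_s7_def times_s7_def val7_of by (rule of_val7_cong, simp add: mod_simps algebra_simps)+
  show "x + y = y + x" "x * y = y * x" by (simp_all add: plus_s7_def times_s7_def ac_simps)
  show "0 + x = x" "1 * x = x" by (simp_all add: plus_s7_def times_s7_def zero_s7_def one_s7_def)
  show "- x + x = 0" by (cases x) (simp_all add: plus_s7_def uminus_s7_def zero_s7_def of_val7_def)
  show "x - y = x + - y" unfolding plus_s7_def minus_s7_def uminus_s7_def val7_of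
    by (rule of_val7_cong) (simp add: mod_simps)
  show "x \<noteq> 0 \<Longrightarrow> inverse x * x = 1" by (cases x) (simp_all add: times_s7_def inverse_s7_def zero_s7_def one_s7_def of_val7_def)
  show "inverse (0 :: s7) = 0" by (simp add: inverse_s7_def zero_s7_def of_val7_def)
  show "x div y = x * inverse y" by (simp add: divide_s7_def)
  show "(0 :: s7) \<noteq> 1" by (simp add: zero_s7_def one_s7_def)
qed

end

lemma arith7:
  "A0 + A0 = A0" "A0 + A1 = A1" "A0 + A2 = A2" "A0 + A3 = A3" "A0 + A4 = A4" "A0 + A5 = A5" "A0 + A6 = A6"
  "A1 + A0 = A1" "A1 + A1 = A2" "A1 + A2 = A3" "A1 + A3 = A4" "A1 + A4 = A5" "A1 + A5 = A6" "A1 + A6 = A0"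
  "A2 + A0 = A2" "A2 + A1 = A3" "A2 + A2 = A4" "A2 + A3 = A5" "A2 + A4 = A6" "A2 + A5 = A0" "A2 + A6 = A1"
  "A3 + A0 = A3" "A3 + A1 = A4" "A3 + A2 = A5" "A3 + A3 = A6" "A3 + A4 = A0" "A3 + A5 = A1" "A3 + A6 = A2"
  "A4 + A0 = A4" "A4 + A1 = A5" "A4 + A2 = A6" "A4 + A3 = A0" "A4 + A4 = A1" "A4 + A5 = A2" "A4 + A6 = A3"
  "A5 + A0 = A5" "A5 + A1 = A6" "A5 + A2 = A0" "A5 + A3 = A1" "A5 + A4 = A2" "A5 + A5 = A3" "A5 + A6 = A4"
  "A6 + A0 = A6" "A6 + A1 = A0" "A6 + A2 = A1" "A6 + A3 = A2" "A6 + A4 = A3" "A6 + A5 = A4" "A6 + A6 = A5"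
  "A0 - A0 = A0" "A0 - A1 = A6" "A0 - A2 = A5" "A0 - A3 = A4" "A0 - A4 = A3" "A0 - A5 = A2" "A0 - A6 = A1"
  "A1 - A0 = A1" "A1 - A1 = A0" "A1 - A2 = A6" "A1 - A3 = A5" "A1 - A4 = A4" "A1 - A5 = A3" "A1 - A6 = A2"
  "A2 - A0 = A2" "A2 - A1 = A1" "A2 - A2 = A0" "A2 - A3 = A6" "A2 - A4 = A5" "A2 - A5 = A4" "A2 - A6 = A3"
  "A3 - A0 = A3" "A3 - A1 = A2" "A3 - A2 = A1" "A3 - A3 = A0" "A3 - A4 = A6" "A3 - A5 = A5" "A3 - A6 = A4"
  "A4 - A0 = A4" "A4 - A1 = A3" "A4 - A2 = A2" "A4 - A3 = A1" "A4 - A4 = A0" "A4 - A5 = A6" "A4 - A6 = A5"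
  "A5 - A0 = A5" "A5 - A1 = A4" "A5 - A2 = A3" "A5 - A3 = A2" "A5 - A4 = A1" "A5 - A5 = A0" "A5 - A6 = A6"
  "A6 - A0 = A6" "A6 - A1 = A5" "A6 - A2 = A4" "A6 - A3 = A3" "A6 - A4 = A2" "A6 - A5 = A1" "A6 - A6 = A0"
  "A0 * A0 = A0" "A0 * A1 = A0" "A0 * A2 = A0" "A0 * A3 = A0" "A0 * A4 = A0" "A0 * A5 = A0" "A0 * A6 = A0"
  "A1 * A0 = A0" "A1 * A1 = A1" "A1 * A2 = A2" "A1 * A3 = A3" "A1 * A4 = A4" "A1 * A5 = A5" "A1 * A6 = A6"
  "A2 * A0 = A0" "A2 * A1 = A2" "A2 * A2 = A4" "A2 * A3 = A6" "A2 * A4 = A1" "A2 * A5 = A3" "A2 * A6 = A5"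
  "A3 * A0 = A0" "A3 * A1 = A3" "A3 * A2 = A6" "A3 * A3 = A2" "A3 * A4 = A5" "A3 * A5 = A1" "A3 * A6 = A4"
  "A4 * A0 = A0" "A4 * A1 = A4" "A4 * A2 = A1" "A4 * A3 = A5" "A4 * A4 = A2" "A4 * A5 = A6" "A4 * A6 = A3"
  "A5 * A0 = A0" "A5 * A1 = A5" "A5 * A2 = A3" "A5 * A3 = A1" "A5 * A4 = A6" "A5 * A5 = A4" "A5 * A6 = A2"
  "A6 * A0 = A0" "A6 * A1 = A6" "A6 * A2 = A5" "A6 * A3 = A4" "A6 * A4 = A3" "A6 * A5 = A2" "A6 * A6 = A1"
  "inverse A0 = A0" "inverse A1 = A1" "inverse A2 = A4" "inverse A3 = A5" "inverse A4 = A2" "inverse A5 = A3" "inverse A6 = A6"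
  unfolding plus_s7_def minus_s7_def times_s7_def inverse_s7_def by (simp_all add: of_val7_def)

lemma hom7:
  assumes "card (UNIV :: 'a :: {field,finite} set) = 7"
  shows "of_int (val7 (x + y)) = (of_int (val7 x) + of_int (val7 y) :: 'a)"
    "of_int (val7 (x * y)) = (of_int (val7 x) * of_int (val7 y) :: 'a)" "of_int (val7 1) = (1 :: 'a)"
proof -
  have "of_nat 7 = (0 :: 'a)" using of_nat_card_UNIV[where 'a = 'a] assms(1) by simp
  then have z: "of_int 7 = (0 :: 'a)" by simp
  have *: "of_int (k mod 7) = (of_int k :: 'a)" for k
  proof -
    have "of_int k = (of_int (k div 7) * of_int 7 + of_int (k mod 7) :: 'a)"
      by (simp only: of_int_mult[symmetric] of_int_add[symmetric] div_mult_mod_eq)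
    then show ?thesis by (simp only: z mult_zero_right add_0_left)
  qed
  show "of_int (val7 (x + y)) = (of_int (val7 x) + of_int (val7 y) :: 'a)"
    by (simp only: plus_s7_def val7_of * of_int_add)
  show "of_int (val7 (x * y)) = (of_int (val7 x) * of_int (val7 y) :: 'a)"
    by (simp only: times_s7_def val7_of * of_int_mult)
  show "of_int (val7 1) = (1 :: 'a)" by (simp add: one_s7_def)
qed

lemma of_nat7:
  assumes c: "card (UNIV :: 'a :: {field,finite} set) = 7"
  shows "\<exists>m. (x :: 'a) = of_nat m"
proof -
  have "bij (\<lambda>x. of_int (val7 x) :: 'a)" by (rule field_hom_bij[OF hom7[OF c]]) (simp add: c card_s7)
  then obtain y where y: "x = of_int (val7 y)" by (metis bij_pointE)
  have "0 \<le> val7 y" by (cases y) simp_all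
  then have "x = of_nat (nat (val7 y))" using y by simp
  then show ?thesis ..
qed

lemma field7:
  fixes R :: "'a :: {field,finite} \<Rightarrow> 'a \<Rightarrow> 'a \<Rightarrow> 'a \<Rightarrow> 'a \<Rightarrow> bool"
  assumes c: "card (UNIV :: 'a set) = 7" and R: "mds5 R"
    and all: "\<And>R :: s7 \<Rightarrow> s7 \<Rightarrow> s7 \<Rightarrow> s7 \<Rightarrow> s7 \<Rightarrow> bool. mds5 R \<Longrightarrow> linear5 R"
  shows "linear5 R"
  by (rule linear5_transport[OF hom7[OF c] _ all R]) (simp_all add: c card_s7)

text \<open>The harmonic values 2, 1/2 and -1; the two roots of k^2 - k + 1, which are the primitive
  sixth roots of unity; and all values other than 0 and 1 together.\<close>

lemma cross7: "cross {A2, A4, A6}" "cross {A3, A5}" "cross {A2, A3, A4, A5, A6}"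
  by (simp_all add: cross_def divide_s7_def arith7 zero_s7_def one_s7_def)

lemma lin_T5: "lin A2 (tn T5)" unfolding lin_def
proof (rule exI[of _ id], rule exI[of _ id], rule exI[of _ id], rule exI[of _ id], intro conjI allI)
  show "tn T5 (id u) (id v) (id (u + v)) (id (u + A2 * v))" for u v
    by (cases u; cases v) (simp_all add: tn_def T5_def arith7)
qed simp_all

lemma lin_T6: "lin A3 (tn T6)" unfolding lin_def
proof (rule exI[of _ id], rule exI[of _ id], rule exI[of _ id], rule exI[of _ id], intro conjI allI)
  show "tn T6 (id u) (id v) (id (u + v)) (id (u + A3 * v))" for u v
    by (cases u; cases v) (simp_all add: tn_def T6_def arith7)
qed simp_all

lemma plane_lins: fixes R :: "s7 \<Rightarrow> s7 \<Rightarrow> s7 \<Rightarrow> s7 \<Rightarrow> s7 \<Rightarrow> bool" assumes "mds5 R" shows "lins {A2, A4, A6} (R x) \<or> lins {A3, A5} (R x)"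
proof -
  have "lins {A2, A4, A6} (tn T5)" "lins {A3, A5} (tn T6)" using lin_T5 lin_T6 by (auto simp: lins_def)
  then show ?thesis using plane_linear[OF assms, of x] lins_eqv[OF _ cross7(1)] lins_eqv[OF _ cross7(2)] by blast
qed

definition perm6 :: "(s7 v7 \<Rightarrow> bool) \<Rightarrow> s7 \<Rightarrow> s7 \<Rightarrow> s7 \<Rightarrow> s7 \<Rightarrow> s7 \<Rightarrow> bool" where
  "perm6 Q c d e f g = (if elem g [A0, A1, c, d, e, f] then True else Q (V A0 A1 c d e f g))"

definition perm5 :: "(s7 v7 \<Rightarrow> bool) \<Rightarrow> s7 \<Rightarrow> s7 \<Rightarrow> s7 \<Rightarrow> s7 \<Rightarrow> bool" where
  "perm5 Q c d e f = (if elem f [A0, A1, c, d, e] then True else every (perm6 Q c d e f))"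

definition perm4 :: "(s7 v7 \<Rightarrow> bool) \<Rightarrow> s7 \<Rightarrow> s7 \<Rightarrow> s7 \<Rightarrow> bool" where
  "perm4 Q c d e = (if elem e [A0, A1, c, d] then True else every (perm5 Q c d e))"

definition perm3 :: "(s7 v7 \<Rightarrow> bool) \<Rightarrow> s7 \<Rightarrow> s7 \<Rightarrow> bool" where
  "perm3 Q c d = (if elem d [A0, A1, c] then True else every (perm4 Q c d))"

definition perm2 :: "(s7 v7 \<Rightarrow> bool) \<Rightarrow> s7 \<Rightarrow> bool" where
  "perm2 Q c = (if elem c [A0, A1] then True else every (perm3 Q c))"

text \<open>Enumerates the permutations that fix \<open>A0\<close> and \<open>A1\<close>, the
  normalisation in \<open>star\<close>.\<close>

definition perms :: "(s7 v7 \<Rightarrow> bool) \<Rightarrow> bool" where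
  "perms Q = every (perm2 Q)"

lemma permsD:
  assumes Q: "perms Q" and b: "bij (at p)" and 01: "p $ A0 = A0" "p $ A1 = A1"
  shows "Q p"
proof -
  obtain c d e f g where V: "p = V A0 A1 c d e f g" using 01 by (cases p) simp
  have "p $ i \<noteq> p $ j" if "i \<noteq> j" for i j using b that by (simp add: bij_eq)
  then have "\<forall>i j. i \<noteq> j \<longrightarrow> p $ i \<noteq> p $ j" by blast
  note ne = this[unfolded all_s7 V, simplified at.simps s7.distinct simp_thms]
  note n = ne elem.simps if_False
  have "perm2 Q c" by (rule everyD[OF Q[unfolded perms_def]])
  then have h: "every (perm3 Q c)" by (simp only: perm2_def n)
  have "perm3 Q c d" by (rule everyD[OF h])
  then have h: "every (perm4 Q c d)" by (simp only: perm3_def n)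
  have "perm4 Q c d e" by (rule everyD[OF h])
  then have h: "every (perm5 Q c d e)" by (simp only: perm4_def n)
  have "perm5 Q c d e f" by (rule everyD[OF h])
  then have h: "every (perm6 Q c d e f)" by (simp only: perm5_def n)
  have "perm6 Q c d e f g" by (rule everyD[OF h])
  then show "Q p" by (simp only: perm6_def n V)
qed

definition star2 :: "s7 \<Rightarrow> s7 \<Rightarrow> s7 v7 \<Rightarrow> s7 \<Rightarrow> s7 \<Rightarrow> bool" where
  "star2 k l p v u = (if u = A0 then True else if k * (p $ (v + l * u) - p $ v) = p $ (v + u) - p $ v then False else True)"

definition star1 :: "s7 \<Rightarrow> s7 \<Rightarrow> s7 v7 \<Rightarrow> s7 \<Rightarrow> bool" where
  "star1 k l p v = every (star2 k l p v)"

definition starx :: "s7 \<Rightarrow> s7 \<Rightarrow> s7 v7 \<Rightarrow> bool" where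
  "starx k l p = every (star1 k l p)"

lemma starx: "star k l (at p) \<Longrightarrow> starx k l p"
  unfolding starx_def star1_def star2_def star_def every_iff by (simp add: zero_s7_def)

definition fix_pt :: "s7 v7 \<Rightarrow> s7 \<Rightarrow> bool" where
  "fix_pt p i = (if p $ i = i then True else False)"

definition rigid_at :: "s7 \<Rightarrow> s7 \<Rightarrow> s7 v7 \<Rightarrow> bool" where
  "rigid_at k l p = (if starx k l p then every (fix_pt p) else True)"

text \<open>Two crossing planes, with labels \<open>p\<close> and \<open>q\<close>, agree at
  parameter \<open>u\<close> of the line they share; \<open>skew_planes\<close> derives the
  equation.\<close>

definition fits :: "s7 \<Rightarrow> s7 \<Rightarrow> s7 \<Rightarrow> s7 v7 \<Rightarrow> s7 v7 \<Rightarrow> s7 \<Rightarrow> bool" where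
  "fits k l m p q u = (if k * (p $ (l * u)) = q $ (m * (inv7 q $ (p $ u))) then True else False)"

text \<open>The first test is the case \<open>u = A1\<close> of \<open>fits\<close>, used as a cheap
  filter before the conditions of \<open>starx\<close> are tried on \<open>q\<close>.\<close>

definition clash1 :: "s7 \<Rightarrow> s7 \<Rightarrow> s7 \<Rightarrow> s7 v7 \<Rightarrow> s7 v7 \<Rightarrow> bool" where
  "clash1 k l m p q = (if k * (p $ l) = q $ m then
    if starx (inverse k) m q then if every (fits k l m p q) then False else True else True else True)"

definition clash :: "s7 \<Rightarrow> s7 \<Rightarrow> s7 \<Rightarrow> s7 v7 \<Rightarrow> bool" where
  "clash k l m p = (if starx k l p then perms (clash1 k l m p) else True)"

lemmas perms_simps = perms_def perm2_def perm3_def perm4_def perm5_def perm6_def elem.simps every_def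
  star2_def star1_def starx_def fix_pt_def rigid_at_def fits_def clash1_def clash_def arith7 at.simps
  inv7_def tab_def s7.distinct simp_thms if_True if_False ball_simps

text \<open>A base plane with harmonic parameter forces identity labels on its crossing planes,
  whatever their parameter.\<close>

lemma rigid_table: "\<forall>k\<in>{A2, A4, A6}. \<forall>l\<in>{A2, A3, A4, A5, A6}. perms (rigid_at k l)"
  by (simp only: perms_simps cong: if_weak_cong)

text \<open>Identity labels show the obstruction: \<open>star\<close> then forces
  \<open>l = k\<close> and \<open>m = inverse k\<close>, and agreement on the common line requires
  k^3 = 1, whereas 3 and 5 have cube -1. The table rules out all other labels as well.\<close>

lemma clash_table: "\<forall>k\<in>{A3, A5}. \<forall>l\<in>{A3, A5}. \<forall>m\<in>{A3, A5}. perms (clash k l m)"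
  by (simp only: perms_simps cong: if_weak_cong)

lemma at_tab_eq: "at (tab p) = p"
  by (simp add: fun_eq_iff)

lemma rigid7: assumes k: "k \<in> {A2, A4, A6}" shows "rigid k"
  unfolding rigid_def
proof (intro allI impI)
  fix l p assume l: "l \<noteq> 0" "l \<noteq> 1" and s: "star k l p"
  have "l \<in> {A2, A3, A4, A5, A6}" using l by (cases l) (auto simp: zero_s7_def one_s7_def)
  with rigid_table k have "perms (rigid_at k l)" by blast
  moreover have "bij p" "p A0 = A0" "p A1 = A1" using s by (simp_all add: star_def zero_s7_def one_s7_def)
  ultimately have "rigid_at k l (tab p)"
    using permsD[of "rigid_at k l" "tab p"] by (simp only: at_tab_eq at_tab)
  then have "\<forall>i. fix_pt (tab p) i" using starx[of k l "tab p"] s by (simp add: rigid_at_def at_tab_eq)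
  then show "p = id" by (auto simp: fun_eq_iff fix_pt_def split: if_splits)
qed

text \<open>In labels that make the base plane at \<open>x0\<close> linear, the crossing planes at
  \<open>y = 0\<close> and \<open>z = 0\<close> share a line. Expressing \<open>g\<close> through
  \<open>f\<close> on it, once by the labels \<open>q\<close> and once by the labels
  \<open>r\<close>, gives an equation that no admissible labels satisfy.\<close>

lemma skew_planes:
  fixes R :: "s7 \<Rightarrow> s7 \<Rightarrow> s7 \<Rightarrow> s7 \<Rightarrow> s7 \<Rightarrow> bool"
  assumes R: "mds5 R" and x: "lins {A3, A5} (R x0)"
    and y: "\<And>b. lins {A3, A5} (\<lambda>x. R x b)" and z: "\<And>c. lins {A3, A5} (\<lambda>x y. R x y c)"
  shows False
proof -
  obtain k0 where k0: "k0 \<in> {A3, A5}" "lin k0 (R x0)" using x unfolding lins_def by blast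
  then obtain a b c d where p: "bij a" "bij b" "bij c" "bij d"
    and n: "\<And>u v. R x0 (a u) (b v) (c (u + v)) (d (u + k0 * v))" unfolding lin_def by blast
  define S where "S = (\<lambda>x y z f g. R x (a y) (b z) (c f) (d g))"
  have S: "mds5 S" unfolding S_def using mds5_relabel[OF R bij_id p] by simp
  have S0: "S x0 y z (y + z) (y + k0 * z)" for y z using n by (simp add: S_def)
  have k00: "k0 \<noteq> 0" using k0(1) by (auto simp: zero_s7_def)
  note i = bij_imp_bij_inv[OF p(1)] bij_imp_bij_inv[OF p(2)] bij_imp_bij_inv[OF p(3)] bij_imp_bij_inv[OF p(4)]
  have inv: "inverse k \<in> {A3, A5}" "k \<noteq> 0" if "k \<in> {A3, A5}" for k using that by (auto simp: arith7 zero_s7_def)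
  obtain k where k: "k \<in> {A3, A5}" "lin k (\<lambda>x. R x (a 0))" using y unfolding lins_def by blast
  have "lin k (\<lambda>x. S x 0)"
    by (rule lin_relabel[of k "\<lambda>x. S x 0" id "inv b" "inv c" "inv d"])
      (use k(2) i in \<open>simp_all add: S_def bij_is_surj[OF p(2)] bij_is_surj[OF p(3)] bij_is_surj[OF p(4)] surj_f_inv_f\<close>)
  from crossing_plane[OF S S0 this inv(2)[OF k(1)]] obtain h q where h: "star k0 (inverse k) q"
    "\<And>u v. S (h u) 0 (q v) (0 + q (v + u)) (0 + k0 * q (v + inverse k * u))" by metis
  obtain k' where k': "k' \<in> {A3, A5}" "lin k' (\<lambda>x y. R x y (b 0))" using z unfolding lins_def by blast
  have "lin k' (\<lambda>x y. S x y 0)"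
    by (rule lin_relabel[of k' "\<lambda>x y. S x y 0" id "inv a" "inv c" "inv d"])
      (use k'(2) i in \<open>simp_all add: S_def bij_is_surj[OF p(1)] bij_is_surj[OF p(3)] bij_is_surj[OF p(4)] surj_f_inv_f\<close>)
  note T = base_swap(1,2)[OF S S0 k00] base_swap(3)[OF S S0 k00 this]
  from crossing_plane[OF T inv(2)[OF k'(1)]] obtain h' r where h': "star (inverse k0) (inverse k') r"
    "\<And>u v. S (h' u) (r v) 0 (0 + r (v + u)) (k0 * (0 + inverse k0 * r (v + inverse k' * u)))" by metis
  have q0: "q 0 = 0" and r0: "r 0 = 0" and bq: "bij q" and br: "bij r" using h(1) h'(1) by (simp_all add: star_def)
  \<comment> \<open>The word of the common line with fourth coordinate \<open>q u\<close>; in the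
    second plane it has the parameter \<open>inv r (q u)\<close>.\<close>
  have f: "k0 * q (inverse k * u) = r (inverse k' * inv r (q u))" for u
  proof -
    let ?v = "inv r (q u)"
    have rv: "r ?v = q u" using br by (simp add: bij_is_surj surj_f_inv_f)
    have 1: "S (h u) 0 0 (q u) (k0 * q (inverse k * u))" using h(2)[of u 0] by (simp add: q0)
    have "k0 * (inverse k0 * w) = w" for w using k00 by (simp add: mult.assoc[symmetric])
    then have 2: "S (h' ?v) 0 0 (q u) (r (inverse k' * ?v))" using h'(2)[of ?v 0] by (simp only: add_0_left r0 rv)
    show ?thesis by (rule mds5_eq[OF S, OF 1 2, THEN conjunct2, THEN conjunct2, THEN conjunct2, THEN conjunct2])
      (intro disjI2 disjI1 conjI refl | simp)+
  qed
  have b01: "q A0 = A0" "q A1 = A1" "r A0 = A0" "r A1 = A1" using h(1) h'(1) by (simp_all add: star_def zero_s7_def one_s7_def)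
  have "perms (clash k0 (inverse k) (inverse k'))" using clash_table k0(1) inv(1)[OF k(1)] inv(1)[OF k'(1)] by blast
  then have "clash k0 (inverse k) (inverse k') (tab q)"
    using permsD[of "clash k0 (inverse k) (inverse k')" "tab q"] bq b01 by (simp only: at_tab_eq at_tab)
  then have "perms (clash1 k0 (inverse k) (inverse k') (tab q))"
    using starx[of k0 "inverse k" "tab q"] h(1) by (simp add: clash_def at_tab_eq)
  then have "clash1 k0 (inverse k) (inverse k') (tab q) (tab r)"
    using permsD[of "clash1 k0 (inverse k) (inverse k') (tab q)" "tab r"] br b01 by (simp only: at_tab_eq at_tab)
  moreover have "k0 * (tab q $ inverse k) = tab r $ inverse k'"
  proof -
    have "inv r (q A1) = A1" using b01 br by (metis bij_is_inj inv_f_f)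
    then show ?thesis using f[of A1] by (simp add: mult_1_right[where 'a = s7, unfolded one_s7_def])
  qed
  ultimately have "\<not> (\<forall>u. fits k0 (inverse k) (inverse k') (tab q) (tab r) u)"
    using starx[of "inverse k0" "inverse k'" "tab r"] h'(1) by (simp add: clash1_def at_tab_eq split: if_splits)
  moreover have "fits k0 (inverse k) (inverse k') (tab q) (tab r) u" for u
  proof -
    have "inv7 (tab r) $ x = inv r x" for x
      using inv7_at[of "tab r" "inv r x"] br by (simp add: at_tab_eq bij_is_surj surj_f_inv_f)
    then show ?thesis using f[of u] by (simp add: fits_def)
  qed
  ultimately show False by blast
qed

lemma linear5_swap0: fixes R :: "'a :: field \<Rightarrow> 'a \<Rightarrow> 'a \<Rightarrow> 'a \<Rightarrow> 'a \<Rightarrow> bool"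
  assumes "linear5 (\<lambda>x y. R y x)" shows "linear5 R"
proof -
  obtain a b c d e l m k where conj: "bij a \<and> bij b \<and> bij c \<and> bij d \<and> bij e \<and>
    (\<forall>x y z :: 'a. R (b y) (a x) (c z) (d (x + y + z)) (e (l * x + m * y + k * z)))"
    using assms unfolding linear5_def by (elim exE) (rule that)
  note c1 = conj[THEN conjunct2] and c2 = conj[THEN conjunct2, THEN conjunct2, THEN conjunct2]
  note p = conj[THEN conjunct1] c1[THEN conjunct1] c1[THEN conjunct2, THEN conjunct1] c2[THEN conjunct1]
    c2[THEN conjunct2, THEN conjunct1]
  note h = c2[THEN conjunct2, THEN conjunct2, rule_format]
  have r: "R (b x) (a y) (c z) (d (x + y + z)) (e (m * x + l * y + k * z))" for x y z
    using h[of x y z] by (simp add: ac_simps)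
  show ?thesis unfolding linear5_def
    by (rule exI[of _ b], rule exI[of _ a], rule exI[of _ c], rule exI[of _ d], rule exI[of _ e],
      rule exI[of _ m], rule exI[of _ l], rule exI[of _ k]) (intro conjI allI p r)
qed

lemma linear5_swap1: fixes R :: "'a :: field \<Rightarrow> 'a \<Rightarrow> 'a \<Rightarrow> 'a \<Rightarrow> 'a \<Rightarrow> bool"
  assumes "linear5 (\<lambda>x y z. R x z y)" shows "linear5 R"
proof -
  obtain a b c d e l m k where conj: "bij a \<and> bij b \<and> bij c \<and> bij d \<and> bij e \<and>
    (\<forall>x y z :: 'a. R (a x) (c z) (b y) (d (x + y + z)) (e (l * x + m * y + k * z)))"
    using assms unfolding linear5_def by (elim exE) (rule that)
  note c1 = conj[THEN conjunct2] and c2 = conj[THEN conjunct2, THEN conjunct2, THEN conjunct2]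
  note p = conj[THEN conjunct1] c1[THEN conjunct1] c1[THEN conjunct2, THEN conjunct1] c2[THEN conjunct1]
    c2[THEN conjunct2, THEN conjunct1]
  note h = c2[THEN conjunct2, THEN conjunct2, rule_format]
  have r: "R (a x) (c y) (b z) (d (x + y + z)) (e (l * x + k * y + m * z))" for x y z
    using h[of x y z] by (simp add: ac_simps)
  show ?thesis unfolding linear5_def
    by (rule exI[of _ a], rule exI[of _ c], rule exI[of _ b], rule exI[of _ d], rule exI[of _ e],
      rule exI[of _ l], rule exI[of _ k], rule exI[of _ m]) (intro conjI allI p r)
qed

text \<open>Rigidity concerns the base plane alone, so one harmonic plane in any of the first three
  directions suffices once its direction is moved to the front. Otherwise all planes of these
  directions have parameter 3 or 5, which \<open>skew_planes\<close> excludes.\<close>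

theorem linear5_seven: assumes R: "mds5 (R :: s7 \<Rightarrow> s7 \<Rightarrow> s7 \<Rightarrow> s7 \<Rightarrow> s7 \<Rightarrow> bool)" shows "linear5 R"
proof -
  let ?K = "{A2, A3, A4, A5, A6}"
  have K: "lins ?K (S x)" if "mds5 S" for S :: "s7 \<Rightarrow> s7 \<Rightarrow> s7 \<Rightarrow> s7 \<Rightarrow> s7 \<Rightarrow> bool" and x
    using plane_lins[OF that, of x] unfolding lins_def by blast
  have even: "linear5 S" if S: "mds5 S" and l: "lins {A2, A4, A6} (S x)" for S :: "s7 \<Rightarrow> s7 \<Rightarrow> s7 \<Rightarrow> s7 \<Rightarrow> s7 \<Rightarrow> bool" and x
  proof -
    obtain k where k: "k \<in> {A2, A4, A6}" "lin k (S x)" using l unfolding lins_def by blast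
    have ik: "inverse k \<in> {A2, A4, A6}" using cross7(1) k(1) unfolding cross_def by blast
    have kK: "k \<in> ?K" using k(1) by blast
    show ?thesis
      by (rule lin_linear5[OF S cross7(3) k(2) kK rigid7[OF k(1)] rigid7[OF ik] K[OF mds5_swap0[OF S]]
        K[OF mds5_swap0[OF mds5_swap1[OF S]]]])
  qed
  note R1 = mds5_swap0[OF R] and R2 = mds5_swap0[OF mds5_swap1[OF R]]
  show ?thesis
  proof (cases "\<exists>x. lins {A2, A4, A6} (R x) \<or> lins {A2, A4, A6} (\<lambda>y. R y x) \<or> lins {A2, A4, A6} (\<lambda>y z. R y z x)")
    case True
    then obtain x where "lins {A2, A4, A6} (R x) \<or> lins {A2, A4, A6} (\<lambda>y. R y x) \<or> lins {A2, A4, A6} (\<lambda>y z. R y z x)" ..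
    then show ?thesis
    proof (elim disjE)
      assume "lins {A2, A4, A6} (R x)" then show ?thesis by (rule even[OF R])
    next
      assume "lins {A2, A4, A6} (\<lambda>y. R y x)"
      from even[OF R1 this] show ?thesis by (rule linear5_swap0)
    next
      assume "lins {A2, A4, A6} (\<lambda>y z. R y z x)"
      from even[OF R2 this] have "linear5 (\<lambda>x y z. R x z y)" by (rule linear5_swap0)
      then show ?thesis by (rule linear5_swap1)
    qed
  next
    case False
    have "lins {A3, A5} (R x)" "lins {A3, A5} (\<lambda>y. R y x)" "lins {A3, A5} (\<lambda>y z. R y z x)" for x
      using plane_lins[OF R, of x] plane_lins[OF R1, of x] plane_lins[OF R2, of x] False by blast+
    from skew_planes[OF R this] show ?thesis by blast
  qed
qed

subsection \<open>Longer codes\<close>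

text \<open>A systematic encoder: symbol \<open>i\<close> of the word with information symbols \<open>x 0, \<dots>, x (k - 1)\<close>
  is \<open>F i x\<close>; \<open>n > k + 1\<close> and any \<open>k\<close> symbols determine the word.\<close>

definition encoder :: "nat \<Rightarrow> nat \<Rightarrow> (nat \<Rightarrow> (nat \<Rightarrow> 'a) \<Rightarrow> 'a) \<Rightarrow> bool" where
  "encoder k n F \<longleftrightarrow> 3 \<le> k \<and> k + 2 \<le> n \<and> (\<forall>i<k. \<forall>x. F i x = x i) \<and>
    (\<forall>x y. (\<forall>i<k. x i = y i) \<longrightarrow> (\<forall>i<n. F i x = F i y)) \<and>
    (\<forall>x y P. P \<subseteq> {..<n} \<longrightarrow> card P = k \<longrightarrow> (\<forall>i\<in>P. F i x = F i y) \<longrightarrow> (\<forall>i<k. x i = y i))"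

lemma encoderD:
  assumes "encoder k n F"
  shows "3 \<le> k" "k + 2 \<le> n" "i < k \<Longrightarrow> F i x = x i" "(\<And>i. i < k \<Longrightarrow> x i = y i) \<Longrightarrow> i < n \<Longrightarrow> F i x = F i y"
    "P \<subseteq> {..<n} \<Longrightarrow> card P = k \<Longrightarrow> (\<And>i. i \<in> P \<Longrightarrow> F i x = F i y) \<Longrightarrow> i < k \<Longrightarrow> x i = y i"
  using assms unfolding encoder_def by (blast, blast, blast, blast, blast)

definition section5 :: "(nat \<Rightarrow> (nat \<Rightarrow> 'a) \<Rightarrow> 'a) \<Rightarrow> (nat \<Rightarrow> 'a) \<Rightarrow> nat \<Rightarrow> nat \<Rightarrow> nat \<Rightarrow> nat \<Rightarrow> nat \<Rightarrow>
    'a \<Rightarrow> 'a \<Rightarrow> 'a \<Rightarrow> 'a \<Rightarrow> 'a \<Rightarrow> bool" where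
  "section5 F w a b c i j u v t f g \<longleftrightarrow> f = F i (w(a := u, b := v, c := t)) \<and> g = F j (w(a := u, b := v, c := t))"

lemma section5_agree:
  assumes F: "encoder k n F" and abc: "a < k" "b < k" "c < k" "distinct [a, b, c]"
    and ij: "k \<le> i" "i < n" "k \<le> j" "j < n" "i \<noteq> j"
    and P: "P \<subseteq> {a, b, c, i, j}" "card P = 3"
    and eq: "\<And>l. l \<in> P \<Longrightarrow> F l (w(a := u, b := v, c := t)) = F l (w(a := u', b := v', c := t'))"
  shows "u = u' \<and> v = v' \<and> t = t'"
proof -
  let ?Q = "P \<union> ({..<k} - {a, b, c})"
  have "finite P" using P(1) finite_subset by blast
  moreover have "P \<inter> ({..<k} - {a, b, c}) = {}" using P(1) ij by auto
  moreover have "card ({..<k} - {a, b, c}) = k - 3" using abc by (subst card_Diff_subset) auto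
  ultimately have "card ?Q = k" using P(2) encoderD(1)[OF F] by (simp add: card_Un_disjoint)
  moreover have "?Q \<subseteq> {..<n}" using P(1) abc ij encoderD(2)[OF F] by auto
  moreover have "F l (w(a := u, b := v, c := t)) = F l (w(a := u', b := v', c := t'))" if "l \<in> ?Q" for l
    using that eq[of l] by (auto simp: encoderD(3)[OF F])
  ultimately have "(w(a := u, b := v, c := t)) l = (w(a := u', b := v', c := t')) l" if "l < k" for l
    using encoderD(5)[OF F, of ?Q] that by blast
  from this[OF abc(1)] this[OF abc(2)] this[OF abc(3)] abc(4) show ?thesis by auto
qed

lemma section5_mds5:
  fixes F :: "nat \<Rightarrow> (nat \<Rightarrow> 'a :: finite) \<Rightarrow> 'a"
  assumes F: "encoder k n F" and abc: "a < k" "b < k" "c < k" "distinct [a, b, c]"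
    and ij: "k \<le> i" "i < n" "k \<le> j" "j < n" "i \<noteq> j"
  shows "mds5 (section5 F w a b c i j)"
proof -
  define W where "W p = w(a := fst p, b := fst (snd p), c := snd (snd p))" for p
  have W: "F a (W p) = fst p" "F b (W p) = fst (snd p)" "F c (W p) = snd (snd p)" for p
    using abc by (auto simp: W_def encoderD(3)[OF F])
  have ne: "a \<noteq> b" "a \<noteq> c" "b \<noteq> c" "a \<noteq> i" "b \<noteq> i" "c \<noteq> i" "a \<noteq> j" "b \<noteq> j" "c \<noteq> j" using abc ij by auto
  have inj: "p = q" if "card {l1, l2, l3} = 3" "{l1, l2, l3} \<subseteq> {a, b, c, i, j}"
    "F l1 (W p) = F l1 (W q)" "F l2 (W p) = F l2 (W q)" "F l3 (W p) = F l3 (W q)" for p q l1 l2 l3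
  proof -
    have "F l (W p) = F l (W q)" if "l \<in> {l1, l2, l3}" for l
      using that \<open>F l1 (W p) = F l1 (W q)\<close> \<open>F l2 (W p) = F l2 (W q)\<close> \<open>F l3 (W p) = F l3 (W q)\<close> by auto
    from section5_agree[OF F abc ij that(2,1) this[unfolded W_def]] show ?thesis by (simp add: prod_eq_iff)
  qed
  \<comment> \<open>An injective map from triples to triples over a finite alphabet is onto.\<close>
  have sur: "\<exists>p. F l1 (W p) = x \<and> F l2 (W p) = y \<and> F l3 (W p) = z"
    if "card {l1, l2, l3} = 3" "{l1, l2, l3} \<subseteq> {a, b, c, i, j}" for l1 l2 l3 x y z
  proof -
    have "inj (\<lambda>p. (F l1 (W p), F l2 (W p), F l3 (W p)))"
    proof (rule injI)
      fix p q assume "(F l1 (W p), F l2 (W p), F l3 (W p)) = (F l1 (W q), F l2 (W q), F l3 (W q))"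
      then have "F l1 (W p) = F l1 (W q)" "F l2 (W p) = F l2 (W q)" "F l3 (W p) = F l3 (W q)" by simp_all
      then show "p = q" by (rule inj[OF that])
    qed
    then have "surj (\<lambda>p. (F l1 (W p), F l2 (W p), F l3 (W p)))" by (rule finite_UNIV_inj_surj[OF finite])
    then obtain p where p: "(x, y, z) = (F l1 (W p), F l2 (W p), F l3 (W p))" by (rule surjE)
    show ?thesis using p by (intro exI[of _ p]) simp
  qed
  have S: "section5 F w a b c i j u v t f g \<longleftrightarrow> (\<exists>p. u = F a (W p) \<and> v = F b (W p) \<and> t = F c (W p) \<and> f = F i (W p) \<and> g = F j (W p))"
    for u v t f g unfolding W by (auto simp: section5_def W_def)
  have c0: "card {a, b, c} = 3" "{a, b, c} \<subseteq> {a, b, c, i, j}" using ne ij(5) by auto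
  have c1: "card {a, b, i} = 3" "{a, b, i} \<subseteq> {a, b, c, i, j}" using ne ij(5) by auto
  have c2: "card {a, b, j} = 3" "{a, b, j} \<subseteq> {a, b, c, i, j}" using ne ij(5) by auto
  have c3: "card {a, c, i} = 3" "{a, c, i} \<subseteq> {a, b, c, i, j}" using ne ij(5) by auto
  have c4: "card {a, c, j} = 3" "{a, c, j} \<subseteq> {a, b, c, i, j}" using ne ij(5) by auto
  have c5: "card {a, i, j} = 3" "{a, i, j} \<subseteq> {a, b, c, i, j}" using ne ij(5) by auto
  have c6: "card {b, c, i} = 3" "{b, c, i} \<subseteq> {a, b, c, i, j}" using ne ij(5) by auto
  have c7: "card {b, c, j} = 3" "{b, c, j} \<subseteq> {a, b, c, i, j}" using ne ij(5) by auto
  have c8: "card {b, i, j} = 3" "{b, i, j} \<subseteq> {a, b, c, i, j}" using ne ij(5) by auto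
  have c9: "card {c, i, j} = 3" "{c, i, j} \<subseteq> {a, b, c, i, j}" using ne ij(5) by auto
  have e0: "\<exists>u v. \<exists>p. x = F a (W p) \<and> y = F b (W p) \<and> z = F c (W p) \<and> u = F i (W p) \<and> v = F j (W p)" for x y z using sur[OF c0, of x y z] by blast
  have e1: "\<exists>u v. \<exists>p. x = F a (W p) \<and> y = F b (W p) \<and> u = F c (W p) \<and> z = F i (W p) \<and> v = F j (W p)" for x y z using sur[OF c1, of x y z] by blast
  have e2: "\<exists>u v. \<exists>p. x = F a (W p) \<and> y = F b (W p) \<and> u = F c (W p) \<and> v = F i (W p) \<and> z = F j (W p)" for x y z using sur[OF c2, of x y z] by blast
  have e3: "\<exists>u v. \<exists>p. x = F a (W p) \<and> u = F b (W p) \<and> y = F c (W p) \<and> z = F i (W p) \<and> v = F j (W p)" for x y z using sur[OF c3, of x y z] by blast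
  have e4: "\<exists>u v. \<exists>p. x = F a (W p) \<and> u = F b (W p) \<and> y = F c (W p) \<and> v = F i (W p) \<and> z = F j (W p)" for x y z using sur[OF c4, of x y z] by blast
  have e5: "\<exists>u v. \<exists>p. x = F a (W p) \<and> u = F b (W p) \<and> v = F c (W p) \<and> y = F i (W p) \<and> z = F j (W p)" for x y z using sur[OF c5, of x y z] by blast
  have e6: "\<exists>u v. \<exists>p. u = F a (W p) \<and> x = F b (W p) \<and> y = F c (W p) \<and> z = F i (W p) \<and> v = F j (W p)" for x y z using sur[OF c6, of x y z] by blast
  have e7: "\<exists>u v. \<exists>p. u = F a (W p) \<and> x = F b (W p) \<and> y = F c (W p) \<and> v = F i (W p) \<and> z = F j (W p)" for x y z using sur[OF c7, of x y z] by blast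
  have e8: "\<exists>u v. \<exists>p. u = F a (W p) \<and> x = F b (W p) \<and> v = F c (W p) \<and> y = F i (W p) \<and> z = F j (W p)" for x y z using sur[OF c8, of x y z] by blast
  have e9: "\<exists>u v. \<exists>p. u = F a (W p) \<and> v = F b (W p) \<and> x = F c (W p) \<and> y = F i (W p) \<and> z = F j (W p)" for x y z using sur[OF c9, of x y z] by blast
  have "mds5_ex (section5 F w a b c i j)" unfolding mds5_ex_def S
    by (intro conjI allI) (rule e0, rule e1, rule e2, rule e3, rule e4, rule e5, rule e6, rule e7, rule e8, rule e9)
  moreover have "mds5_eq (section5 F w a b c i j)" unfolding mds5_eq_def S
  proof (intro allI impI)
    fix u v t f g u' v' t' f' g'
    assume p: "\<exists>p. u = F a (W p) \<and> v = F b (W p) \<and> t = F c (W p) \<and> f = F i (W p) \<and> g = F j (W p)"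
      and q: "\<exists>p. u' = F a (W p) \<and> v' = F b (W p) \<and> t' = F c (W p) \<and> f' = F i (W p) \<and> g' = F j (W p)"
      and D: "u = u' \<and> v = v' \<and> t = t' \<or> u = u' \<and> v = v' \<and> f = f' \<or> u = u' \<and> v = v' \<and> g = g' \<or> u = u' \<and> t = t' \<and> f = f' \<or> u = u' \<and> t = t' \<and> g = g' \<or> u = u' \<and> f = f' \<and> g = g' \<or> v = v' \<and> t = t' \<and> f = f' \<or> v = v' \<and> t = t' \<and> g = g' \<or> v = v' \<and> f = f' \<and> g = g' \<or> t = t' \<and> f = f' \<and> g = g'"
    from p obtain p where p: "u = F a (W p)" "v = F b (W p)" "t = F c (W p)" "f = F i (W p)" "g = F j (W p)" by blast
    from q obtain q where q: "u' = F a (W q)" "v' = F b (W q)" "t' = F c (W q)" "f' = F i (W q)" "g' = F j (W q)" by blast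
    have "p = q" using D unfolding p q
      by (elim disjE conjE) (erule (2) inj[OF c0], erule (2) inj[OF c1], erule (2) inj[OF c2], erule (2) inj[OF c3], erule (2) inj[OF c4], erule (2) inj[OF c5], erule (2) inj[OF c6], erule (2) inj[OF c7], erule (2) inj[OF c8], erule (2) inj[OF c9])
    then show "u = u' \<and> v = v' \<and> t = t' \<and> f = f' \<and> g = g'" unfolding p q by simp
  qed
  ultimately show ?thesis by (simp add: mds5_def)
qed

definition all_linear5 :: "'a :: field itself \<Rightarrow> bool" where
  "all_linear5 TYPE('a) \<longleftrightarrow> (\<forall>R :: 'a \<Rightarrow> 'a \<Rightarrow> 'a \<Rightarrow> 'a \<Rightarrow> 'a \<Rightarrow> bool. mds5 R \<longrightarrow> linear5 R)"

text \<open>The arguments are translated so that the word \<open>w\<close> sits at the origin; the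
  resulting constants are absorbed by the labels \<open>s\<close> and \<open>t\<close> of the check
  symbols.\<close>

lemma section5_linear:
  fixes F :: "nat \<Rightarrow> (nat \<Rightarrow> 'a :: {field,finite}) \<Rightarrow> 'a"
  assumes F: "encoder k n F" and lin: "all_linear5 TYPE('a)" and abc: "a < k" "b < k" "c < k" "distinct [a, b, c]"
    and ij: "k \<le> i" "i < n" "k \<le> j" "j < n" "i \<noteq> j"
  obtains p q r s t :: "'a \<Rightarrow> 'a" and l m e :: 'a where "bij p" "bij q" "bij r" "bij s" "bij t" "p 0 = w a" "q 0 = w b" "r 0 = w c"
    "\<And>x y z. F i (w(a := p x, b := q y, c := r z)) = s (x + y + z)"
    "\<And>x y z. F j (w(a := p x, b := q y, c := r z)) = t (l * x + m * y + e * z)"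
proof -
  have "linear5 (section5 F w a b c i j)" using lin section5_mds5[OF F abc ij] unfolding all_linear5_def by blast
  then obtain p q r s t l m e where conj: "bij p \<and> bij q \<and> bij r \<and> bij s \<and> bij t \<and>
    (\<forall>x y z :: 'a. section5 F w a b c i j (p x) (q y) (r z) (s (x + y + z)) (t (l * x + m * y + e * z)))"
    unfolding linear5_def by (elim exE) (rule that)
  then have b: "bij p" "bij q" "bij r" "bij s" "bij t" by simp_all
  have h: "section5 F w a b c i j (p x) (q y) (r z) (s (x + y + z)) (t (l * x + m * y + e * z))" for x y z using conj by simp
  obtain x0 y0 z0 where 0: "p x0 = w a" "q y0 = w b" "r z0 = w c" using b(1-3) by (metis bij_pointE)
  have sh: "bij (\<lambda>x. f (x + d))" if "bij f" for f :: "'a \<Rightarrow> 'a" and d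
    using bij_comp[OF bij_shift that] by (simp add: comp_def)
  show thesis
  proof (rule that[OF sh[OF b(1), of x0] sh[OF b(2), of y0] sh[OF b(3), of z0] sh[OF b(4), of "x0 + y0 + z0"]
        sh[OF b(5), of "l * x0 + m * y0 + e * z0"]])
    fix x y z
    have n: "section5 F w a b c i j (p (x + x0)) (q (y + y0)) (r (z + z0)) (s ((x + x0) + (y + y0) + (z + z0)))
      (t (l * (x + x0) + m * (y + y0) + e * (z + z0)))" by (rule h)
    show "F i (w(a := p (x + x0), b := q (y + y0), c := r (z + z0))) = s (x + y + z + (x0 + y0 + z0))"
      using n by (simp add: section5_def ac_simps)
    show "F j (w(a := p (x + x0), b := q (y + y0), c := r (z + z0))) = t (l * x + m * y + e * z + (l * x0 + m * y0 + e * z0))"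
      using n by (simp add: section5_def distrib_left ac_simps)
  qed (use 0 in simp_all)
qed

text \<open>In linear form the symbol at \<open>i\<close> is a bijective image of a sum with one
  summand for each of \<open>u\<close>, \<open>v\<close>, \<open>t\<close>. Whether two pairs
  \<open>(v, t)\<close> produce the same symbol is therefore independent of
  \<open>u\<close>.\<close>

lemma quad:
  fixes F :: "nat \<Rightarrow> (nat \<Rightarrow> 'a :: {field,finite}) \<Rightarrow> 'a"
  assumes F: "encoder k n F" and lin: "all_linear5 TYPE('a)" and abc: "a < k" "b < k" "c < k" "distinct [a, b, c]"
    and i: "k \<le> i" "i < n"
    and e: "F i (w(a := u, b := v, c := t)) = F i (w(a := u, b := v', c := t'))"
  shows "F i (w(a := u', b := v, c := t)) = F i (w(a := u', b := v', c := t'))"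
proof -
  \<comment> \<open>Any second check position, to complete a section; it exists because
    \<open>k + 2 \<le> n\<close>.\<close>
  define j where "j = (if i = k then k + 1 else k)"
  have j: "k \<le> j" "j < n" "i \<noteq> j" using encoderD(2)[OF F] by (auto simp: j_def)
  obtain p q r s :: "'a \<Rightarrow> 'a" where b: "bij p" "bij q" "bij r" "bij s"
    and h: "\<And>x y z. F i (w(a := p x, b := q y, c := r z)) = s (x + y + z)"
    using section5_linear[OF F lin abc i j, of w] by metis
  obtain x x' y y' z z' where x: "u = p x" "u' = p x'" "v = q y" "v' = q y'" "t = r z" "t' = r z'"
    using b(1-3) by (metis bij_pointE)
  from e have "s (x + y + z) = s (x + y' + z')" unfolding x h .
  then have "y + z = y' + z'" using b(4) by (simp add: bij_eq add.assoc)
  then show ?thesis unfolding x h by (simp add: add.assoc)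
qed

lemma check_surj:
  fixes F :: "nat \<Rightarrow> (nat \<Rightarrow> 'a :: {field,finite}) \<Rightarrow> 'a"
  assumes F: "encoder k n F" and a: "a < k" and i: "k \<le> i" "i < n"
  shows "bij (\<lambda>u. F i (w(a := u)))"
proof -
  have "inj (\<lambda>u. F i (w(a := u)))"
  proof (rule injI)
    fix u u' assume e: "F i (w(a := u)) = F i (w(a := u'))"
    have "F l (w(a := u)) = F l (w(a := u'))" if "l \<in> insert i ({..<k} - {a})" for l
      using that e by (auto simp: encoderD(3)[OF F])
    moreover have "card (insert i ({..<k} - {a})) = k" using a i by simp
    moreover have "insert i ({..<k} - {a}) \<subseteq> {..<n}" using i encoderD(2)[OF F] by auto
    ultimately have "(w(a := u)) a = (w(a := u')) a" using encoderD(5)[OF F _ _ _ a] by blast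
    then show "u = u'" by simp
  qed
  then show ?thesis by (simp add: bij_def finite_UNIV_inj_surj)
qed

text \<open>Induction on the number \<open>m\<close> of information positions that may be nonzero.
  To find the effect of a position \<open>a < m\<close> while position \<open>m\<close> is occupied,
  position \<open>m\<close> is cleared and compensated at another position \<open>b\<close> so that
  symbol \<open>i\<close> is unchanged; by \<open>quad\<close> the compensation remains valid after
  \<open>a\<close> is cleared, and the induction hypothesis applies to both words.\<close>

lemma affine_extend:
  fixes F :: "nat \<Rightarrow> (nat \<Rightarrow> 'a :: {field,finite}) \<Rightarrow> 'a"
  assumes F: "encoder k n F" and lin: "all_linear5 TYPE('a)" and i: "k \<le> i" "i < n"
    and one: "\<And>l z. l < k \<Longrightarrow> F i ((\<lambda>_. 0)(l := z)) = \<alpha> l * z"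
    and two: "\<And>y z. F i ((\<lambda>_. 0)(0 := y, 1 := z)) = \<alpha> 0 * y + \<alpha> 1 * z"
  shows "F i x = (\<Sum>l<k. \<alpha> l * x l)"
proof -
  note k = encoderD(1)[OF F]
  have "(\<forall>l\<ge>m. x l = 0) \<longrightarrow> F i x = (\<Sum>l<m. \<alpha> l * x l)" if "2 \<le> m" "m \<le> k" for m x
    using that
  proof (induction m arbitrary: x rule: nat_induct_at_least)
    case base
    have "F i x = \<alpha> 0 * x 0 + \<alpha> 1 * x 1" if "\<forall>l\<ge>2. x l = 0"
    proof -
      have "x = (\<lambda>_. 0)(0 := x 0, 1 := x 1)"
      proof
        fix l show "x l = ((\<lambda>_. 0)(0 := x 0, 1 := x 1)) l" using that by (cases "l \<ge> 2") (auto simp: less_2_cases_iff not_le)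
      qed
      then show ?thesis using two[of "x 0" "x 1"] by simp
    qed
    then show ?case by (simp add: numeral_2_eq_2)
  next
    case (Suc m)
    have IH: "F i x = (\<Sum>l<m. \<alpha> l * x l)" if "\<forall>l\<ge>m. x l = 0" for x using Suc that by simp
    have step: "F i x - F i (x(a := 0)) = \<alpha> a * x a" if x: "\<forall>l\<ge>Suc m. x l = 0" and a: "a < m" for x a
    proof -
      \<comment> \<open>Any position below \<open>m\<close> other than \<open>a\<close>; its
        existence is the reason why the induction begins at two.\<close>
      define b where "b = (if a = 0 then 1 else 0 :: nat)"
      have b: "b < m" "b \<noteq> a" using Suc.hyps by (auto simp: b_def)
      have "surj (\<lambda>v. F i ((x(m := 0))(b := v)))" using check_surj[OF F, of b i "x(m := 0)"] b Suc.prems i by (simp add: bij_is_surj)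
      then obtain v where v: "F i x = F i (x(m := 0, b := v))" by (metis surjD)
      have d: "distinct [a, b, m]" "a < k" "b < k" "m < k" using a b Suc.prems by auto
      have e1: "x(a := x a, b := x b, m := x m) = x" by simp
      have e2: "x(a := u, b := v, m := 0) = x(m := 0, a := u, b := v)" for u v using d by (auto simp: fun_eq_iff)
      have e4: "x(m := 0, a := x a, b := v) = x(m := 0, b := v)" using d by (auto simp: fun_eq_iff)
      have e3: "x(a := 0, b := x b, m := x m) = x(a := 0)" using d by (auto simp: fun_eq_iff)
      have "F i (x(a := x a, b := x b, m := x m)) = F i (x(a := x a, b := v, m := 0))"
        by (simp only: e1 e2 e4) (rule v)
      from quad[OF F lin d(2-4,1) i this, of 0]
      have q: "F i (x(a := 0)) = F i (x(m := 0, a := 0, b := v))" unfolding e2 e3 .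
      let ?y = "x(m := 0, b := v)" and ?z = "x(m := 0, a := 0, b := v)"
      have yz: "\<forall>l\<ge>m. ?y l = 0" "\<forall>l\<ge>m. ?z l = 0" using x a b by (auto simp: Suc_le_eq le_neq_implies_less)
      have z: "?z = ?y(a := 0)" using b by (auto simp: fun_eq_iff)
      have "F i x - F i (x(a := 0)) = (\<Sum>l<m. \<alpha> l * ?y l) - (\<Sum>l<m. \<alpha> l * ?z l)"
        unfolding v q IH[OF yz(1)] IH[OF yz(2)] ..
      also have "\<dots> = \<alpha> a * ?y a"
        using a by (simp add: z sum.remove[of "{..<m}" a] del: fun_upd_apply) (simp add: fun_upd_apply)
      also have "\<dots> = \<alpha> a * x a" using a b by simp
      finally show ?thesis .
    qed
    show ?case
    proof
      assume x: "\<forall>l\<ge>Suc m. x l = 0"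
      \<comment> \<open>The positions below \<open>m\<close> are cleared one by one, each
        contributing its linear term; a word supported at \<open>m\<close> alone remains, and
        \<open>one\<close> covers it.\<close>
      have "F i x = (\<Sum>l<j. \<alpha> l * x l) + F i (\<lambda>l. if l < j then 0 else x l)" if "j \<le> m" for j
        using that
      proof (induction j)
        case (Suc j)
        let ?x = "\<lambda>l. if l < j then 0 else x l"
        have "?x(j := 0) = (\<lambda>l. if l < Suc j then 0 else x l)" by (auto simp: fun_eq_iff less_Suc_eq)
        with step[of ?x j] x Suc.prems have "F i ?x = \<alpha> j * x j + F i (\<lambda>l. if l < Suc j then 0 else x l)"
          by (simp add: diff_eq_eq)
        with Suc show ?case by simp
      qed simp
      from this[of m] have "F i x = (\<Sum>l<m. \<alpha> l * x l) + F i (\<lambda>l. if l < m then 0 else x l)" by simp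
      moreover have "(\<lambda>l. if l < m then 0 else x l) = (\<lambda>_. 0)(m := x m)" using x by (auto simp: fun_eq_iff Suc_le_eq)
      moreover have "m < k" using Suc.prems by simp
      ultimately show "F i x = (\<Sum>l<Suc m. \<alpha> l * x l)" by (simp add: one)
    qed
  qed
  from this[of k "\<lambda>l. if l < k then x l else 0"] k
  have "F i (\<lambda>l. if l < k then x l else 0) = (\<Sum>l<k. \<alpha> l * x l)" by simp
  moreover have "F i (\<lambda>l. if l < k then x l else 0) = F i x" using i by (intro encoderD(4)[OF F]) auto
  ultimately show ?thesis by simp
qed

lemma encoder_relabel:
  assumes F: "encoder k n F" and b: "\<And>i. bij (\<pi> i)"
  shows "encoder k n (\<lambda>i x. \<pi> i (F i (\<lambda>l. inv (\<pi> l) (x l))))"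
  unfolding encoder_def
proof (intro conjI allI impI)
  show "3 \<le> k" "k + 2 \<le> n" using encoderD(1,2)[OF F] by auto
  show "\<pi> i (F i (\<lambda>l. inv (\<pi> l) (x l))) = x i" if "i < k" for i x
    using that b by (simp add: encoderD(3)[OF F] bij_is_surj surj_f_inv_f)
  show "\<pi> i (F i (\<lambda>l. inv (\<pi> l) (x l))) = \<pi> i (F i (\<lambda>l. inv (\<pi> l) (y l)))" if "\<forall>i<k. x i = y i" "i < n" for x y i
    using encoderD(4)[OF F, of "\<lambda>l. inv (\<pi> l) (x l)" "\<lambda>l. inv (\<pi> l) (y l)" i] that by simp
  fix x y P i
  assume P: "P \<subseteq> {..<n}" "card P = k" "\<forall>i\<in>P. \<pi> i (F i (\<lambda>l. inv (\<pi> l) (x l))) = \<pi> i (F i (\<lambda>l. inv (\<pi> l) (y l)))" "i < k"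
  have "F l (\<lambda>l. inv (\<pi> l) (x l)) = F l (\<lambda>l. inv (\<pi> l) (y l))" if "l \<in> P" for l
    using P(3) that bij_eq[OF b] by blast
  from encoderD(5)[OF F P(1,2) this P(4)] have "inv (\<pi> i) (x i) = inv (\<pi> i) (y i)" .
  then show "x i = y i" using bij_eq[OF bij_imp_bij_inv[OF b]] by blast
qed

text \<open>The labels are chosen so that check symbol \<open>k\<close> simply copies a lone nonzero
  information symbol and adds those at positions 0 and 1. In a section through 0, 1,
  \<open>i\<close> and the check positions \<open>k\<close> and \<open>j\<close>, this forces the
  labels of the information symbols and of symbol \<open>k\<close> to be one and the same additive
  map, which is a multiplication since the field is prime; symbol \<open>j\<close> is then linear on
  the section.\<close>

lemma linear_encoder:
  fixes F :: "nat \<Rightarrow> (nat \<Rightarrow> 'a :: {field,finite}) \<Rightarrow> 'a"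
  assumes F: "encoder k n F" and lin: "all_linear5 TYPE('a)" and gen: "\<And>x :: 'a. \<exists>m. x = of_nat m"
  obtains \<pi> :: "nat \<Rightarrow> 'a \<Rightarrow> 'a" and \<alpha> where "\<And>i. bij (\<pi> i)"
    "\<And>i x. k \<le> i \<Longrightarrow> i < n \<Longrightarrow> \<pi> i (F i (\<lambda>l. inv (\<pi> l) (x l))) = (\<Sum>l<k. \<alpha> i l * x l)"
proof -
  let ?o = "(\<lambda>_. 0) :: nat \<Rightarrow> 'a"
  note k = encoderD(1,2)[OF F]
  have additive: "d x = d 1 * x" if d: "\<And>x y. d (x + y) = d x + d y" for d :: "'a \<Rightarrow> 'a" and x
  proof -
    have d0: "d 0 = 0" by (metis d add_0_right add_left_cancel)
    have "d (of_nat m) = d 1 * of_nat m" for m by (induction m) (simp_all add: d0 d distrib_left)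
    then show ?thesis using gen[of x] by blast
  qed
  have idx: "0 < k" "1 < k" "2 < k" "distinct [0, 1, 2 :: nat]" "k \<le> k" "k < n" "k \<le> k + 1" "k + 1 < n" "k \<noteq> k + 1"
    using k by auto
  obtain p q r s :: "'a \<Rightarrow> 'a" where b: "bij p" "bij q" "bij s" and z: "p 0 = 0" "q 0 = 0" "r 0 = 0"
    and s: "\<And>x y z. F k (?o(0 := p x, 1 := q y, 2 := r z)) = s (x + y + z)"
    using section5_linear[OF F lin idx, of ?o] by metis
  define g where "g i u = F k (?o(i := u))" for i u
  have bg: "bij (g i)" if "i < k" for i unfolding g_def by (rule check_surj[OF F that]) (use idx in auto)
  have g0: "g i 0 = s 0" for i using s[of 0 0 0] by (simp add: g_def z fun_upd_idem)
  define c where "c j v = F j (?o(1 := q v))" for j v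
  have bc: "bij (c j)" if "k \<le> j" "j < n" for j
    using bij_comp[OF b(2) check_surj[OF F idx(2) that, of ?o]] by (simp add: c_def[abs_def] comp_def)
  \<comment> \<open>An information symbol is renamed to what it produces alone at check position
    \<open>k\<close>, read through \<open>s\<close>; a check symbol is renamed to the information
    symbol at position 1 that produces it alone.\<close>
  define \<pi> where "\<pi> i = (if i < k then inv s \<circ> g i else if i < n then inv (c i) else id)" for i
  have b\<pi>: "bij (\<pi> i)" for i
    using bij_comp[OF bg bij_imp_bij_inv[OF b(3)]] bij_imp_bij_inv[OF bc] by (auto simp: \<pi>_def)
  have invs: "inv s (s x) = x" "s (inv s x) = x" for x using b(3) by (simp_all add: bij_is_inj bij_is_surj surj_f_inv_f)
  have inv\<pi>: "\<pi> i (inv (\<pi> i) x) = x" "inv (\<pi> i) (\<pi> i x) = x" for i x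
    using b\<pi>[of i] by (simp_all add: bij_is_inj bij_is_surj surj_f_inv_f)
  have \<pi>0: "inv (\<pi> i) 0 = 0" if "i < k" for i
  proof -
    have "\<pi> i 0 = 0" using that by (simp add: \<pi>_def g0 invs)
    then show ?thesis using inv\<pi>(2)[of i 0] by simp
  qed
  have ip: "inv (\<pi> 0) x = p x" for x
  proof -
    have "\<pi> 0 (p x) = x" using s[of x 0 0] idx by (simp add: \<pi>_def g_def z fun_upd_idem fun_upd_twist invs)
    then show ?thesis using inv\<pi>(2)[of 0 "p x"] by simp
  qed
  have iq: "inv (\<pi> 1) x = q x" for x
  proof -
    have "g 1 (q x) = s x" using s[of 0 x 0] by (simp add: g_def z fun_upd_idem)
    then have "\<pi> 1 (q x) = x" using idx by (simp add: \<pi>_def invs)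
    then show ?thesis using inv\<pi>(2)[of 1 "q x"] by simp
  qed
  have ck: "c k v = s v" for v using s[of 0 v 0] by (simp add: c_def z fun_upd_idem)
  have \<pi>k: "\<pi> k x = inv s x" for x
  proof -
    have "c k = s" using ck by (simp add: fun_eq_iff)
    then show ?thesis using idx by (simp add: \<pi>_def)
  qed
  define G where "G i x = \<pi> i (F i (\<lambda>l. inv (\<pi> l) (x l)))" for i x
  have G: "encoder k n G" unfolding G_def[abs_def] by (rule encoder_relabel[OF F b\<pi>])
  have loc: "F i (\<lambda>l. inv (\<pi> l) ((?o(a := u, b := v)) l)) = F i (?o(a := inv (\<pi> a) u, b := inv (\<pi> b) v))"
    if "i < n" for i a b u v
    by (rule encoderD(4)[OF F _ that]) (simp add: \<pi>0)
  have G1: "G k (?o(i := x)) = x" if "i < k" for i x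
  proof -
    have "F k (?o(i := inv (\<pi> i) x)) = s x"
      using inv\<pi>(1)[of i x] that invs(2)[of "g i (inv (\<pi> i) x)"] by (simp add: \<pi>_def g_def)
    then show ?thesis using loc[of k i x i x] idx by (simp add: G_def \<pi>k invs)
  qed
  have G2: "G k (?o(0 := x, 1 := y)) = x + y" for x y
    using loc[of k 0 x 1 y] s[of x y 0] idx by (simp add: G_def \<pi>k invs ip iq[simplified] z fun_upd_idem)
  have G3: "G j (?o(1 := y)) = y" if "k \<le> j" "j < n" for j y
  proof -
    have "F j (?o(1 := inv (\<pi> 1) y)) = c j y" by (simp only: c_def iq)
    moreover have "\<pi> j (c j y) = y" using bc[OF that] that by (simp add: \<pi>_def bij_is_inj)
    ultimately show ?thesis using loc[of j 1 y 1 y] that by (simp add: G_def)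
  qed
  have G4: "\<exists>A B. \<forall>x y z. G j (?o(0 := x, 1 := y, i := z)) = A * x + y + B * z" if j: "k < j" "j < n" and i: "2 \<le> i" "i < k" for i j
  proof -
    have d: "distinct [0, 1, i]" and j': "k \<le> j" "k \<noteq> j" using i j by auto
    obtain p q r s t :: "'a \<Rightarrow> 'a" and l m e where b: "bij s" and z: "p 0 = 0" "q 0 = 0" "r 0 = 0"
      and s: "\<And>x y z. G k (?o(0 := p x, 1 := q y, i := r z)) = s (x + y + z)"
      and t: "\<And>x y z. G j (?o(0 := p x, 1 := q y, i := r z)) = t (l * x + m * y + e * z)"
      using section5_linear[OF G lin idx(1,2) i(2) d idx(5,6) j'(1) j(2) j'(2), of ?o] by metis
    have i0: "i \<noteq> 0" "i \<noteq> 1" "i \<noteq> Suc 0" using i by auto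
    have u1: "?o(0 := x, 1 := y, i := 0) = ?o(0 := x, 1 := y)" for x y using i0 by (auto simp: fun_eq_iff)
    have u2: "?o(0 := 0, 1 := 0, i := x) = ?o(i := x)" for x by (auto simp: fun_eq_iff)
    have u3: "?o(0 := 0, 1 := x, i := 0) = ?o(1 := x)" for x using i0 by (auto simp: fun_eq_iff)
    \<comment> \<open>Symbol \<open>k\<close> is already the sum on positions 0 and 1. Setting one
      argument to zero identifies \<open>p\<close> and \<open>q\<close> with \<open>s\<close>, and
      additivity of \<open>s\<close> follows.\<close>
    have pq: "p x + q y = s (x + y)" for x y using s[of x y 0] unfolding z u1 G2 by simp
    have ps: "p x = s x" "q x = s x" for x using pq[of x 0] pq[of 0 x] by (simp_all add: z)
    have rs: "r x = s x" for x using s[of 0 0 x] unfolding z u2 G1[OF i(2)] by simp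
    define \<sigma> where "\<sigma> = s 1"
    have sx: "s x = \<sigma> * x" for x unfolding \<sigma>_def by (rule additive[of s x]) (use pq in \<open>simp add: ps\<close>)
    have \<sigma>: "\<sigma> \<noteq> 0" using sx[of 0] sx[of 1] bij_eq[OF b, of 0 1] by auto
    have tm: "t (m * y) = \<sigma> * y" for y using t[of 0 y 0] unfolding z u3 G3[OF j'(1) j(2)] by (simp add: ps sx)
    have m: "m \<noteq> 0" using tm[of 0] tm[of 1] \<sigma> by auto
    have tu: "t u = \<sigma> * (u / m)" for u using tm[of "u / m"] m by simp
    have "G j (?o(0 := x, 1 := y, i := z)) = (l / m) * x + y + (e / m) * z" for x y z
    proof -
      have "G j (?o(0 := x, 1 := y, i := z)) = \<sigma> * ((l * (x / \<sigma>) + m * (y / \<sigma>) + e * (z / \<sigma>)) / m)"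
        using t[of "x / \<sigma>" "y / \<sigma>" "z / \<sigma>"] \<sigma> unfolding tu by (simp add: ps rs sx)
      also have "\<dots> = (l / m) * x + y + (e / m) * z" using \<sigma> m
        by (simp add: add_divide_distrib distrib_left; fail | simp add: field_simps; fail)
      finally show ?thesis .
    qed
    then show ?thesis by blast
  qed
  define \<alpha> where "\<alpha> j i = G j (?o(i := 1))" for i j
  have fin: "G j x = (\<Sum>l<k. \<alpha> j l * x l)" if j: "k \<le> j" "j < n" for j x
  proof (cases "j = k")
    case True
    show ?thesis
      by (rule affine_extend[OF G lin j]) (use True G1 G1[of 0] G1[of 1] G2 idx in \<open>simp_all add: \<alpha>_def\<close>)
  next
    case False
    then have kj: "k < j" using j by simp
    have z: "?o(0 := x, 1 := y, i := 0) = ?o(0 := x, 1 := y)" "?o(0 := 0, 1 := 0, i := x) = ?o(i := x)"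
      "?o(0 := x, 1 := 0) = ?o(0 := x)" if "2 \<le> i" for x y i using that by (auto simp: fun_eq_iff)
    obtain L E where LE: "\<And>x y z. G j (?o(0 := x, 1 := y, 2 := z)) = L * x + y + E * z"
      using G4[OF kj j(2) order_refl idx(3)] by blast
    have two: "G j (?o(0 := x, 1 := y)) = L * x + y" for x y using LE[of x y 0] unfolding z(1)[OF order_refl] by simp
    have zero: "G j (?o(0 := x)) = L * x" for x using two[of x 0] unfolding z(3)[OF order_refl] by simp
    have one: "G j (?o(i := x)) = \<alpha> j i * x" if ik: "i < k" for i x
    proof -
      consider "i = 0" | "i = 1" | "2 \<le> i" by linarith
      then show ?thesis
      proof cases
        case 1 then show ?thesis using zero[of x] zero[of 1] by (simp add: \<alpha>_def)
      next
        case 2 then show ?thesis using G3[OF j, of x] G3[OF j, of 1] by (simp add: \<alpha>_def)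
      next
        case 3
        then obtain L' E' where e: "\<forall>x y z. G j (?o(0 := x, 1 := y, i := z)) = L' * x + y + E' * z"
          using G4[OF kj j(2) 3 ik] by (elim exE) (rule that)
        have "G j (?o(i := x)) = E' * x" for x using e[rule_format, of 0 0 x] unfolding z(2)[OF 3] by simp
        then show ?thesis by (simp add: \<alpha>_def)
      qed
    qed
    have \<alpha>01: "\<alpha> j 0 = L" "\<alpha> j 1 = 1" unfolding \<alpha>_def using zero[of 1] G3[OF j, of 1] by simp_all
    show ?thesis by (rule affine_extend[OF G lin j one]) (simp_all only: two \<alpha>01 mult_1_left)
  qed
  show thesis by (rule that[of \<pi> \<alpha>, OF b\<pi>]) (rule fin[unfolded G_def])
qed

section \<open>From codes to encoders and back\<close>

text \<open>Two distinct words that agree on \<open>P\<close> differ in at most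
  \<open>n - card P\<close> places, fewer than the minimum distance.\<close>

lemma code_agree:
  assumes C: "is_code n M d C" "M \<noteq> 0" and xy: "x \<in> C" "y \<in> C" and P: "P \<subseteq> {..<n}" "n < card P + d"
    and e: "\<And>i. i \<in> P \<Longrightarrow> x ! i = y ! i"
  shows "x = y"
proof (rule ccontr)
  assume ne: "x \<noteq> y"
  have fin: "finite C" using C card.infinite[of C] unfolding is_code_def by metis
  have len: "length x = n" using C(1) xy(1) unfolding is_code_def by blast
  have "{hamming x y | x y. x \<in> C \<and> y \<in> C \<and> x \<noteq> y} \<subseteq> (\<lambda>(x, y). hamming x y) ` (C \<times> C)" by auto
  then have "finite {hamming x y | x y. x \<in> C \<and> y \<in> C \<and> x \<noteq> y}" using fin finite_subset by blast
  then have "Min {hamming x y | x y. x \<in> C \<and> y \<in> C \<and> x \<noteq> y} \<le> hamming x y" by (rule Min_le) (use xy ne in blast)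
  then have "d \<le> hamming x y" using C(1) unfolding is_code_def min_dist_def by simp
  also have "hamming x y \<le> card ({..<n} - P)"
    unfolding hamming_def by (rule card_mono) (use e len in auto)
  also have "\<dots> = n - card P" using P(1) finite_subset[OF P(1)] by (simp add: card_Diff_subset)
  finally have "d \<le> n - card P" .
  moreover have "card P \<le> n" using card_mono[OF _ P(1)] by simp
  moreover have "d \<noteq> 0"
  proof
    assume "d = 0"
    with P(2) \<open>card P \<le> n\<close> show False by simp
  qed
  ultimately show False using P(2) by linarith
qed

text \<open>Any \<open>k\<close> positions determine a word, so restriction to the first
  \<open>k\<close> positions is injective; by the number of words it is also onto, and the first
  \<open>k\<close> symbols can serve as information symbols.\<close>

lemma code_encoder:
  fixes C :: "'a :: finite list set"
  assumes C: "is_code (k + d - 1) (card (UNIV :: 'a set) ^ k) d C" and k: "3 \<le> k" and d: "3 \<le> d"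
  obtains F where "encoder k (k + d - 1) F" "C = range (\<lambda>x. map (\<lambda>i. F i x) [0..<k + d - 1])"
proof -
  let ?n = "k + d - 1"
  have q: "card (UNIV :: 'a set) ^ k \<noteq> 0" by simp
  have len: "length w = ?n" if "w \<in> C" for w using C that unfolding is_code_def by blast
  have fin: "finite C" using C card.infinite[of C] q unfolding is_code_def by metis
  have agree: "x = y" if "x \<in> C" "y \<in> C" "P \<subseteq> {..<?n}" "card P = k" "\<And>i. i \<in> P \<Longrightarrow> x ! i = y ! i" for x y P
    by (rule code_agree[OF C q that(1,2,3)]) (use that k d in auto)
  have inj: "inj_on (take k) C"
  proof (rule inj_onI)
    fix x y assume xy: "x \<in> C" "y \<in> C" "take k x = take k y"
    show "x = y"
    proof (rule agree[OF xy(1,2), of "{..<k}"])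
      show "x ! i = y ! i" if "i \<in> {..<k}" for i using that nth_take[of i k x] nth_take[of i k y] xy(3) by simp
    qed (use d in auto)
  qed
  have sub: "take k ` C \<subseteq> {xs. set xs \<subseteq> (UNIV :: 'a set) \<and> length xs = k}" using len d by auto
  have "card (take k ` C) = card {xs. set xs \<subseteq> (UNIV :: 'a set) \<and> length xs = k}"
    using C card_image[OF inj] card_lists_length_eq[of "UNIV :: 'a set" k] unfolding is_code_def by simp
  then have eq: "take k ` C = {xs. set xs \<subseteq> (UNIV :: 'a set) \<and> length xs = k}"
    by (intro card_subset_eq[OF finite_lists_length_eq sub]) simp_all
  have "\<exists>w. w \<in> C \<and> (\<forall>i<k. w ! i = x i)" for x
  proof -
    have "map x [0..<k] \<in> take k ` C" unfolding eq by simp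
    then obtain w where w: "w \<in> C" "take k w = map x [0..<k]" by auto
    have "w ! i = x i" if "i < k" for i using that nth_take[of i k w] w(2) by simp
    with w(1) show ?thesis by blast
  qed
  then obtain E where E: "\<And>x. E x \<in> C" "\<And>x i. i < k \<Longrightarrow> E x ! i = x i" by metis
  have kn: "{..<k} \<subseteq> {..<?n}" using d by auto
  have "encoder k ?n (\<lambda>i x. E x ! i)" unfolding encoder_def
  proof (intro conjI allI impI)
    show "3 \<le> k" "k + 2 \<le> ?n" using k d by auto
    show "E x ! i = x i" if "i < k" for i x using that by (rule E(2))
    show "E x ! i = E y ! i" if xy: "\<forall>i<k. x i = y i" and "i < ?n" for x y i
    proof -
      have "E x = E y" by (rule agree[OF E(1) E(1) kn]) (use xy E(2) in auto)
      then show ?thesis by simp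
    qed
    fix x y P i assume P: "P \<subseteq> {..<?n}" "card P = k" "\<forall>i\<in>P. E x ! i = E y ! i" "i < k"
    have "E x = E y" by (rule agree[OF E(1) E(1) P(1,2)]) (use P(3) in blast)
    then show "x i = y i" using E(2)[OF P(4), of x] E(2)[OF P(4), of y] by simp
  qed
  moreover have "C = range (\<lambda>x. map (\<lambda>i. E x ! i) [0..<?n])"
  proof -
    have m: "map (\<lambda>i. E x ! i) [0..<?n] = E x" for x using len[OF E(1), of x] map_nth[of "E x"] by simp
    have "w = E (\<lambda>i. w ! i)" if "w \<in> C" for w by (rule agree[OF that E(1) kn]) (use E(2) in auto)
    then show ?thesis unfolding m using E(1) by blast
  qed
  ultimately show thesis by (rule that)
qed

text \<open>The order of the coordinates is kept and only symbols are renamed. The image of the code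
  is the solution set of the check equations, from which closure under the linear operations is
  immediate.\<close>

lemma linear_equiv:
  fixes C :: "'a :: {field,finite} list set"
  assumes C: "is_code (k + d - 1) (card (UNIV :: 'a set) ^ k) d C" and k: "3 \<le> k" and d: "3 \<le> d"
    and lin: "all_linear5 TYPE('a)" and gen: "\<And>x :: 'a. \<exists>m. x = of_nat m"
  shows "\<exists>L. linear_code (k + d - 1) L \<and> code_equiv (k + d - 1) C L"
proof -
  define n where "n = k + d - 1"
  obtain F where F: "encoder k n F" and CF: "C = range (\<lambda>x. map (\<lambda>i. F i x) [0..<n])"
    unfolding n_def by (rule code_encoder[OF C k d])
  obtain \<pi> :: "nat \<Rightarrow> 'a \<Rightarrow> 'a" and \<alpha> where b: "\<And>i. bij (\<pi> i)"
    and \<alpha>: "\<And>i x. k \<le> i \<Longrightarrow> i < n \<Longrightarrow> \<pi> i (F i (\<lambda>l. inv (\<pi> l) (x l))) = (\<Sum>l<k. \<alpha> i l * x l)"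
    using linear_encoder[OF F lin gen] by metis
  let ?f = "\<lambda>w. map (\<lambda>i. \<pi> i (w ! i)) [0..<n]"
  let ?L = "{v. length v = n \<and> (\<forall>i. k \<le> i \<longrightarrow> i < n \<longrightarrow> v ! i = (\<Sum>l<k. \<alpha> i l * v ! l))}"
  have kn: "k < n" using encoderD(2)[OF F] by simp
  have fE: "?f (map (\<lambda>i. F i (\<lambda>l. inv (\<pi> l) (x l))) [0..<n]) = map (\<lambda>i. if i < k then x i else \<Sum>l<k. \<alpha> i l * x l) [0..<n]" for x
    using \<alpha> b by (auto simp: encoderD(3)[OF F] bij_is_surj surj_f_inv_f)
  have "?f ` C = ?L"
  proof
    show "?f ` C \<subseteq> ?L"
    proof
      fix v assume "v \<in> ?f ` C"
      then obtain y where y: "v = ?f (map (\<lambda>i. F i y) [0..<n])" unfolding CF by blast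
      have "y = (\<lambda>l. inv (\<pi> l) (\<pi> l (y l)))" using b by (simp add: bij_is_inj)
      with y have v: "v = map (\<lambda>i. if i < k then \<pi> i (y i) else \<Sum>l<k. \<alpha> i l * \<pi> l (y l)) [0..<n]"
        using fE[of "\<lambda>l. \<pi> l (y l)"] by simp
      show "v \<in> ?L" using kn by (simp add: v)
    qed
    show "?L \<subseteq> ?f ` C"
    proof
      fix v assume v: "v \<in> ?L"
      have "v = map (\<lambda>i. if i < k then v ! i else \<Sum>l<k. \<alpha> i l * v ! l) [0..<n]"
        using v by (intro nth_equalityI) auto
      then have "v = ?f (map (\<lambda>i. F i (\<lambda>l. inv (\<pi> l) (v ! l))) [0..<n])" unfolding fE .
      moreover have "map (\<lambda>i. F i (\<lambda>l. inv (\<pi> l) (v ! l))) [0..<n] \<in> C" unfolding CF by blast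
      ultimately show "v \<in> ?f ` C" by blast
    qed
  qed
  then have "code_equiv n C ?L" unfolding code_equiv_def
    by (intro exI[of _ id] exI[of _ \<pi>] conjI allI impI) (simp_all add: b)
  moreover have "linear_code n ?L" unfolding linear_code_def
  proof (intro conjI ballI allI)
    show "?L \<subseteq> {w. length w = n}" by blast
    show "replicate n 0 \<in> ?L" using kn by simp
  next
    fix x y assume xy: "x \<in> ?L" "y \<in> ?L"
    have "map2 (+) x y ! i = (\<Sum>l<k. \<alpha> i l * map2 (+) x y ! l)" if i: "k \<le> i" "i < n" for i
    proof -
      have "(\<Sum>l<k. \<alpha> i l * map2 (+) x y ! l) = (\<Sum>l<k. \<alpha> i l * x ! l + \<alpha> i l * y ! l)"
        by (rule sum.cong) (use xy kn in \<open>simp_all add: distrib_left\<close>)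
      also have "\<dots> = x ! i + y ! i" using xy i by (simp add: sum.distrib)
      finally show ?thesis using xy i by simp
    qed
    then show "map2 (+) x y \<in> ?L" using xy by simp
  next
    fix c x assume x: "x \<in> ?L"
    have "map ((*) c) x ! i = (\<Sum>l<k. \<alpha> i l * map ((*) c) x ! l)" if i: "k \<le> i" "i < n" for i
    proof -
      have "(\<Sum>l<k. \<alpha> i l * map ((*) c) x ! l) = (\<Sum>l<k. c * (\<alpha> i l * x ! l))"
        by (rule sum.cong) (use x kn in \<open>simp_all add: mult.left_commute\<close>)
      also have "\<dots> = c * x ! i" using x i by (simp add: sum_distrib_left)
      finally show ?thesis using x i by simp
    qed
    then show "map ((*) c) x \<in> ?L" using x by simp
  qed
  ultimately show ?thesis unfolding n_def by blast
qed

theorem theorem4: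
  fixes C :: "'a::{field,finite} list set" and k d :: nat
  assumes "card (UNIV :: 'a set) = 7 \<or> card (UNIV :: 'a set) = 5"
    and "k \<ge> 3" and "d \<ge> 3"
    and "is_code (k + d - 1) (card (UNIV :: 'a set) ^ k) d C"
  shows "\<exists>L. linear_code (k + d - 1) L \<and> code_equiv (k + d - 1) C L"
proof -
  have l: "all_linear5 TYPE('a)" using assms(1)
  proof
    assume c: "card (UNIV :: 'a set) = 7"
    show ?thesis unfolding all_linear5_def by (intro allI impI) (rule field7[OF c _ linear5_seven])
  next
    assume c: "card (UNIV :: 'a set) = 5"
    show ?thesis unfolding all_linear5_def by (intro allI impI) (rule field5[OF c _ linear5_five])
  qed
  have g: "\<exists>m. x = of_nat m" for x :: 'a
    using assms(1) by (elim disjE) (rule of_nat7, assumption, rule of_nat5, assumption)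
  show ?thesis by (rule linear_equiv[OF assms(4,2,3) l g])
qed

end
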